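(* Let the Godunov values $u^n_j$, $v^n_j$ (depending on the large integer parameter $T$ and on the function $g$) and the $1$-periodic function $\Pi$ (depending on $g$) be as in the context, and put $V(j):=v^{1}_{j+1}$ and $z_j:=2q\sqrt{|j|/\beta}$. Assume (A) the smooth function $g$ has compact support and is such that the $1$-periodic function $\Pi$ does not vanish identically. Then there are constants $C>0$ and $C_0<\infty$, independent of $T$, such that for $T$ large $$\underset{-T\le j\le-\sqrt T}{\mathrm{Tot.Var.}}\ V(j)\ \ge\ \sum_{\sqrt T\le j\le T}\frac{C\,|\Pi(z_j)|}{j}\,-\,C_0 ,$$ and, with a (possibly different) constant $C>0$ independent of $T$, $$\sum_{\sqrt T\le j\le T}\frac{|\Pi(z_j)|}{j}\ \ge\ C\ln T .$$ Consequently the total variation of $V$ on $[-T,-\sqrt T]$ grows at least like a positive constant times $\ln T$ as $T\to\infty$, although $v^{-2T}_j=0$ for all $j$: there is no a priori bound on the total variation of an approximate solution computed using the upwind scheme. Condition (A) is satisfied for a large class of functions $g$ (for example, functions $g$ whose derivative approximates a Dirac delta concentrated at a point $u^*$ close to the value $a_0$ defined in the context).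
   Context: Fix $\mu\in(1/2,1)$, $f(u)=\ln\big((1-\mu)+\mu e^u\big)$, and a rational number $\lambda_0=p/q\in(\mu,1)$ (in lowest terms). Put $\beta:=\lambda_0-\tfrac12>0$. The system under consideration is $$u_t+f(u)_x=0,\qquad v_t+\tfrac12 v_x+g(u)_x=0,$$ with mesh sizes $\Delta t=\Delta x=1$; its Godunov (upwind) scheme is $$u^{n+1}_j=u^n_j-\big[f(u^n_j)-f(u^n_{j-1})\big],\qquad v^{n+1}_j=\tfrac12 v^n_{j-1}+\tfrac12 v^n_j-\big[g(u^n_j)-g(u^n_{j-1})\big].$$ For $\sigma\in(\mu,1)$ let $\varphi(\sigma)>0$ be the unique positive solution $u$ of $f(u)/u=\sigma$ ($\varphi$ is smooth), and let $\kappa_0:=\varphi(\lambda_0)$. For a large positive integer $T$ let $\gamma$ be a curve, required to be smooth on $[-2T,0]$, with $\gamma(t)=\lambda_0t-2\sqrt{-t}$ for $t\in[-2T,-\sqrt T)$ and $\dot\gamma(t)\equiv\lambda_0+T^{-1/4}$ for $t\in[-\sqrt T,0]$. Put $u_-(\tau):=\varphi(\dot\gamma(\tau))$ and, for $(t,x)\in\mathbb R^2$, $$z(t,x):=1+\int_{-2T}^0\exp\Big\{-u_-(\tau)\big[x-\gamma(\tau)-\dot\gamma(\tau)(t-\tau)\big]\Big\}(-\tau)^{-3/4}\,d\tau,\qquad u(t,x):=\ln\frac{z(t,x-1)}{z(t,x)} .$$ The values $u^n_j:=u(n,j)$ ($n,j\in\mathbb Z$) are a solution of the first equation of the scheme.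 Let $v^n_j$, $n\ge-2T$, be the solution of the second equation of the scheme with this $u^n_j$ and with $v^{-2T}_j=0$ for all $j\in\mathbb Z$. Let $c_0:=2\sqrt{\pi/\kappa_0}$ and $a_0:=\ln\frac{1+c_0e^{\kappa_0}}{1+c_0}$. For $a$ sufficiently close to $a_0$ let $x(t;a)$ be the $a$-level curve of $u$, i.e. $u(t,x(t;a))\equiv a$. There is a smooth function $c(a)$, defined on an interval about $a_0$, such that $x(t;a)=c(a)+\gamma(t)+O(1)(-t)^{-1/2+\varepsilon}$ for $t\in[-2T,0]$ ($\varepsilon>0$ small). For a real number $r$ let $((r)):=r-\lfloor r\rfloor$ be its fractional part. With this function $c$, define $$\pi(\sigma;z):=\int_0^\infty g'(\xi)\left(\!\!\left(q\,c(\xi)+z+\frac{q(\sigma-\sqrt8)}{\sqrt2\,\beta}\right)\!\!\right)d\xi,\qquad \Pi(z):=\int_{-\infty}^\infty(2\sigma^2-1)e^{-\sigma^2}\,\pi(\sigma;z)\,d\sigma .$$ The total variation of $V$ over a set of consecutive integers is the sum of $|V(j)-V(j-1)|$ over that set. *)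

theory Defs
  imports "HOL-Analysis.Analysis"
begin

text \<open>
  Throughout, \<open>\<mu>\<close> is the parameter of the flux, \<open>lam0\<close> the limiting shock speed, \<open>T\<close> the large
  integer, and \<open>q\<close> the denominator of \<open>lam0\<close> in lowest terms.
\<close>

definition flux :: "real \<Rightarrow> real \<Rightarrow> real" where
  "flux \<mu> u = ln ((1 - \<mu>) + \<mu> * exp u)"

definition phi :: "real \<Rightarrow> real \<Rightarrow> real" where
  "phi \<mu> \<sigma> = (THE u. u > 0 \<and> flux \<mu> u / u = \<sigma>)"

definition kappa0 :: "real \<Rightarrow> real \<Rightarrow> real" where
  "kappa0 \<mu> lam0 = phi \<mu> lam0"

definition beta :: "real \<Rightarrow> real" where
  "beta lam0 = lam0 - 1 / 2"

text \<open>
  The curve is \<open>lam0 * t - 2 * sqrt (-t)\<close> to the left of \<open>- sqrt T\<close> and has constant slope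
  \<open>lam0 + T powr (-1/4)\<close> to the right of it.  Its slope from the left at \<open>- sqrt T\<close> is also
  \<open>lam0 + T powr (-1/4)\<close>, and continuity fixes the additive constant, so the curve below is the
  only continuously differentiable one with these properties; its second derivative necessarily
  jumps at \<open>- sqrt T\<close>.  Only the values on \<open>{-2T..0}\<close> matter; both formulas are used beyond this
  interval so that \<^const>\<open>deriv\<close> gives the slope also at the end points.
\<close>

definition shock_curve :: "real \<Rightarrow> nat \<Rightarrow> real \<Rightarrow> real" where
  "shock_curve lam0 T t =
     (if t < - sqrt (real T) then lam0 * t - 2 * sqrt (- t)
      else (lam0 + real T powr (- 1 / 4)) * (t + sqrt (real T))
             - lam0 * sqrt (real T) - 2 * sqrt (sqrt (real T)))"

lemma powr_minus_quarter:
  assumes "T > 0"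
  shows "real T powr (- 1 / 4) = 1 / sqrt (sqrt (real T))"
proof -
  have "sqrt (sqrt (real T)) = real T powr (1 / 4)"
    using assms by (simp add: powr_half_sqrt [symmetric] powr_powr)
  then show ?thesis
    by (simp add: powr_minus_divide)
qed

lemma shock_curve_has_derivative:
  assumes "T > 0"
  shows "(shock_curve lam0 T has_real_derivative
           (if t < - sqrt (real T) then lam0 + 1 / sqrt (- t) else lam0 + real T powr (- 1 / 4))) (at t)"
proof -
  let ?s = "- sqrt (real T)"
  let ?f = "\<lambda>t. lam0 * t - 2 * sqrt (- t)"
  let ?h = "\<lambda>t. (lam0 + real T powr (- 1 / 4)) * (t + sqrt (real T))
             - lam0 * sqrt (real T) - 2 * sqrt (sqrt (real T))"
  have s: "?s < 0" using assms by simp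
  have df: "(?f has_real_derivative lam0 + 1 / sqrt (- t)) (at t within A)" if "t < 0" for t A
    using that by (auto intro!: derivative_eq_intros simp: field_simps)
  have dh: "(?h has_real_derivative lam0 + real T powr (- 1 / 4)) (at t within A)" for t A
    by (auto intro!: derivative_eq_intros)
  consider "t < ?s" | "t = ?s" | "t > ?s" by linarith
  then show ?thesis
  proof cases
    case 1
    have "(shock_curve lam0 T has_real_derivative lam0 + 1 / sqrt (- t)) (at t)"
      by (rule has_field_derivative_transform_within_open [OF df, where S = "{..<?s}"])
        (use 1 s order.strict_trans [OF 1 s] in \<open>auto simp: shock_curve_def\<close>)
    with 1 show ?thesis by simp
  next
    case 3
    have "(shock_curve lam0 T has_real_derivative lam0 + real T powr (- 1 / 4)) (at t)"
      by (rule has_field_derivative_transform_within_open [OF dh, where S = "{?s<..}"])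
        (use 3 s in \<open>auto simp: shock_curve_def\<close>)
    with 3 show ?thesis by simp
  next
    case 2
    have l: "(shock_curve lam0 T has_real_derivative lam0 + real T powr (- 1 / 4)) (at ?s within {..?s})"
    proof (rule has_field_derivative_transform_within [where d = 1])
      show "(?f has_real_derivative lam0 + real T powr (- 1 / 4)) (at ?s within {..?s})"
        using df [of ?s "{..?s}"] s powr_minus_quarter [OF assms] by simp
    qed (auto simp: shock_curve_def)
    have r: "(shock_curve lam0 T has_real_derivative lam0 + real T powr (- 1 / 4)) (at ?s within {?s..})"
      by (rule has_field_derivative_transform_within [OF dh, where d = 1])
        (auto simp: shock_curve_def)
    have "{..?s} \<union> {?s..} = UNIV" by auto
    with Lim_Un [OF l [unfolded has_field_derivative_iff] r [unfolded has_field_derivative_iff]]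
    have "(shock_curve lam0 T has_real_derivative lam0 + real T powr (- 1 / 4)) (at ?s)"
      by (simp only: has_field_derivative_iff)
    with 2 show ?thesis by simp
  qed
qed

lemma continuous_on_deriv_shock_curve:
  assumes "T > 0"
  shows "continuous_on UNIV (deriv (shock_curve lam0 T))"
proof -
  let ?s = "- sqrt (real T)"
  have s: "?s < 0" using assms by simp
  have eq: "deriv (shock_curve lam0 T) =
      (\<lambda>t. if t \<le> ?s then lam0 + 1 / sqrt (- t) else lam0 + real T powr (- 1 / 4))"
  proof
    fix t
    show "deriv (shock_curve lam0 T) t =
        (if t \<le> ?s then lam0 + 1 / sqrt (- t) else lam0 + real T powr (- 1 / 4))"
      using DERIV_imp_deriv [OF shock_curve_has_derivative [OF assms, of lam0 t]]
        powr_minus_quarter [OF assms]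
      by (cases "t = ?s") simp_all
  qed
  have "continuous_on ({..?s} \<union> {?s..})
      (\<lambda>t. if t \<le> ?s then lam0 + 1 / sqrt (- t) else lam0 + real T powr (- 1 / 4))"
    by (rule continuous_on_cases)
      (use s powr_minus_quarter [OF assms] in \<open>auto intro!: continuous_intros\<close>)
  moreover have "{..?s} \<union> {?s..} = UNIV" by auto
  ultimately show ?thesis unfolding eq by simp
qed

definition u_minus :: "real \<Rightarrow> real \<Rightarrow> nat \<Rightarrow> real \<Rightarrow> real" where
  "u_minus \<mu> lam0 T \<tau> = phi \<mu> (deriv (shock_curve lam0 T) \<tau>)"

definition z_sol :: "real \<Rightarrow> real \<Rightarrow> nat \<Rightarrow> real \<Rightarrow> real \<Rightarrow> real" where
  "z_sol \<mu> lam0 T t x = 1 + (LBINT \<tau>:{- 2 * real T..0}.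
     exp (- u_minus \<mu> lam0 T \<tau> *
            (x - shock_curve lam0 T \<tau> - deriv (shock_curve lam0 T) \<tau> * (t - \<tau>)))
       * (- \<tau>) powr (- 3 / 4))"

definition u_sol :: "real \<Rightarrow> real \<Rightarrow> nat \<Rightarrow> real \<Rightarrow> real \<Rightarrow> real" where
  "u_sol \<mu> lam0 T t x = ln (z_sol \<mu> lam0 T t (x - 1) / z_sol \<mu> lam0 T t x)"

text \<open>
  The upwind scheme for the second equation with zero data, driven by the values \<open>U k j\<close>, where
  \<open>k\<close> counts the time steps from the initial time.
\<close>

primrec upwind_v :: "(real \<Rightarrow> real) \<Rightarrow> (nat \<Rightarrow> int \<Rightarrow> real) \<Rightarrow> nat \<Rightarrow> int \<Rightarrow> real" where
  "upwind_v g U 0 j = 0"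
| "upwind_v g U (Suc k) j =
     1 / 2 * upwind_v g U k (j - 1) + 1 / 2 * upwind_v g U k j - (g (U k j) - g (U k (j - 1)))"

definition v_sol :: "real \<Rightarrow> real \<Rightarrow> nat \<Rightarrow> (real \<Rightarrow> real) \<Rightarrow> int \<Rightarrow> int \<Rightarrow> real" where
  "v_sol \<mu> lam0 T g n j =
     upwind_v g (\<lambda>k i. u_sol \<mu> lam0 T (real k - 2 * real T) (of_int i)) (nat (n + 2 * int T)) j"

definition V_profile :: "real \<Rightarrow> real \<Rightarrow> nat \<Rightarrow> (real \<Rightarrow> real) \<Rightarrow> int \<Rightarrow> real" where
  "V_profile \<mu> lam0 T g j = v_sol \<mu> lam0 T g 1 (j + 1)"

definition tot_var :: "int set \<Rightarrow> (int \<Rightarrow> real) \<Rightarrow> real" where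
  "tot_var S W = (\<Sum>j\<in>S. \<bar>W j - W (j - 1)\<bar>)"

definition left_range :: "nat \<Rightarrow> int set" where
  "left_range T = {j. - real T \<le> of_int j \<and> of_int j \<le> - sqrt (real T)}"

definition right_range :: "nat \<Rightarrow> int set" where
  "right_range T = {j. sqrt (real T) \<le> of_int j \<and> of_int j \<le> real T}"

definition c0 :: "real \<Rightarrow> real \<Rightarrow> real" where
  "c0 \<mu> lam0 = 2 * sqrt (pi / kappa0 \<mu> lam0)"

definition a0 :: "real \<Rightarrow> real \<Rightarrow> real" where
  "a0 \<mu> lam0 = ln ((1 + c0 \<mu> lam0 * exp (kappa0 \<mu> lam0)) / (1 + c0 \<mu> lam0))"

definition level_curve :: "real \<Rightarrow> real \<Rightarrow> nat \<Rightarrow> real \<Rightarrow> real \<Rightarrow> real" where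
  "level_curve \<mu> lam0 T t a = (THE x. u_sol \<mu> lam0 T t x = a)"

text \<open>
  The expansion of the level curves that determines the function \<open>c\<close> on \<open>I\<close>; the bound is uniform
  in \<open>T\<close>, \<open>a\<close> and \<open>t\<close>.  It is required for \<open>t\<close> in \<open>{-(2-\<delta>)T..-(1+\<delta>) sqrt T}\<close> for every small
  \<open>\<delta>\<close>, and not up to the ends of \<open>{-2T..0}\<close>: a fixed \<open>c\<close> cannot satisfy it at
  \<open>t = -2T\<close>, where only half of the Gaussian-like integrand lies in the domain of integration, or
  for \<open>t\<close> in \<open>{-sqrt T..0}\<close>, where the curve is straight and level curves are shifted by a
  multiple of \<open>ln T\<close>.  An expansion on all of \<open>{-2T..0}\<close> would imply the one below.
\<close>

definition level_expansion :: "real \<Rightarrow> real \<Rightarrow> real set \<Rightarrow> (real \<Rightarrow> real) \<Rightarrow> bool" where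
  "level_expansion \<mu> lam0 I c \<longleftrightarrow>
     (\<forall>\<delta> \<epsilon>. 0 < \<delta> \<and> \<delta> < 1 \<and> 0 < \<epsilon> \<and> \<epsilon> < 1 / 2 \<longrightarrow>
       (\<exists>K T0. \<forall>T\<ge>T0. \<forall>a\<in>I. \<forall>t. - (2 - \<delta>) * real T \<le> t \<and> t \<le> - (1 + \<delta>) * sqrt (real T) \<longrightarrow>
          \<bar>level_curve \<mu> lam0 T t a - (c a + shock_curve lam0 T t)\<bar> \<le> K * (- t) powr (- 1 / 2 + \<epsilon>)))"

text \<open>Infinite differentiability; meant for open sets \<open>S\<close> only.\<close>

definition smooth_on :: "real set \<Rightarrow> (real \<Rightarrow> real) \<Rightarrow> bool" where
  "smooth_on S h \<longleftrightarrow> (\<forall>n. (deriv ^^ n) h differentiable_on S)"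

definition pi_fun :: "real \<Rightarrow> nat \<Rightarrow> (real \<Rightarrow> real) \<Rightarrow> (real \<Rightarrow> real) \<Rightarrow> real \<Rightarrow> real \<Rightarrow> real" where
  "pi_fun lam0 q c g \<sigma> z = (LBINT \<xi>:{0..}. deriv g \<xi> *
     frac (real q * c \<xi> + z + real q * (\<sigma> - sqrt 8) / (sqrt 2 * beta lam0)))"

definition Pi_fun :: "real \<Rightarrow> nat \<Rightarrow> (real \<Rightarrow> real) \<Rightarrow> (real \<Rightarrow> real) \<Rightarrow> real \<Rightarrow> real" where
  "Pi_fun lam0 q c g z =
     (LBINT \<sigma>. (2 * \<sigma>\<^sup>2 - 1) * exp (- \<sigma>\<^sup>2) * pi_fun lam0 q c g \<sigma> z)"

definition z_pt :: "real \<Rightarrow> nat \<Rightarrow> int \<Rightarrow> real" where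
  "z_pt lam0 q j = 2 * real q * sqrt (\<bar>of_int j\<bar> / beta lam0)"

text \<open>
  Since \<open>c\<close> is only defined on \<open>I\<close>, the integral over \<open>{0..}\<close> in \<^const>\<open>pi_fun\<close> is meaningful only
  if the derivative of \<open>g\<close> on \<open>{0..}\<close> is supported in \<open>I\<close>.  The behaviour of \<open>g\<close> on the negative
  axis is irrelevant, since the values of \<^const>\<open>u_sol\<close> are positive.
\<close>

definition deriv_supported_in :: "real set \<Rightarrow> (real \<Rightarrow> real) \<Rightarrow> bool" where
  "deriv_supported_in I g \<longleftrightarrow> closure {\<xi>. 0 \<le> \<xi> \<and> deriv g \<xi> \<noteq> 0} \<subseteq> I"

definition smooth_compact_support :: "(real \<Rightarrow> real) \<Rightarrow> bool" where
  "smooth_compact_support g \<longleftrightarrow> smooth_on UNIV g \<and> compact (closure {x. g x \<noteq> 0})"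

definition condition_A :: "real \<Rightarrow> nat \<Rightarrow> (real \<Rightarrow> real) \<Rightarrow> (real \<Rightarrow> real) \<Rightarrow> bool" where
  "condition_A lam0 q c g \<longleftrightarrow> smooth_compact_support g \<and> (\<exists>z. Pi_fun lam0 q c g z \<noteq> 0)"

text \<open>
  On \<open>{0..}\<close> the derivative of \<open>g\<close> is a mollified unit Dirac mass at \<open>u0\<close> of radius \<open>\<delta>\<close>.
  (A compactly supported \<open>g\<close> has to return to zero somewhere on the negative axis.)
\<close>

definition deriv_approx_delta :: "real \<Rightarrow> real \<Rightarrow> (real \<Rightarrow> real) \<Rightarrow> bool" where
  "deriv_approx_delta u0 \<delta> g \<longleftrightarrow>
     (\<forall>\<xi>\<ge>0. deriv g \<xi> \<ge> 0) \<and> (\<forall>\<xi>\<ge>0. \<bar>\<xi> - u0\<bar> \<ge> \<delta> \<longrightarrow> deriv g \<xi> = 0)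
       \<and> (LBINT \<xi>:{0..}. deriv g \<xi>) = 1"

end

theory Submission
  imports Defs "HOL-Probability.Probability" "HOL-Real_Asymp.Real_Asymp"
begin

text \<open>
  The increments of \<open>V\<close> are tested against oscillating functions
  \<open>\<rho> (b / L) * cos (\<alpha> * sqrt b + \<theta>)\<close>, supported in a dyadic block \<open>{L..2 * L}\<close>.  The adjoint of the scheme
  averages a test function over a random walk with drift \<open>1/2\<close>, and the source contributes only where a
  level curve of \<open>u\<close> steps from one lattice point to the next.  Since \<open>lam0\<close> is rational, the sawtooth of
  these steps resonates with the test function if \<open>\<alpha>\<close> is chosen according to a frequency \<open>k * q\<close>, and the
  contribution of a block is, up to a small error, a multiple bounded away from zero of
  \<open>\<integral> g' \<xi> * sin (2 * pi * k * q * c \<xi> + \<theta>') d\<xi>\<close>, with \<open>\<theta>'\<close> a shift of \<open>\<theta>\<close>.  If these integrals vanished for all \<open>k\<close> and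
  \<open>\<theta>\<close>, then so would \<^const>\<open>Pi_fun\<close>.  Hence each of the about \<open>ln T\<close> dyadic blocks between \<open>sqrt T\<close> and
  \<open>T\<close> carries a variation bounded below.
\<close>

subsection \<open>Expectations over the symmetric random walk with steps 1/2\<close>

text \<open>At time - m a level curve sits near - (lam0 * m + 2 * sqrt m - c). With \<beta> = lam0 -
  1 / 2, the dual walk started there ends, after its drift m / 2 is removed, around b = \<beta> * m
  + 2 * sqrt m - c with spread sqrt m / 2. For \<alpha> = 4 * pi * k * q / sqrt \<beta> the phase
  \<alpha> * sqrt b is, up to a constant, 4 * pi * k * q * sqrt m, and modulo 2 * pi this equals 2 *
  pi * k * q times the lattice position p / q * m + 2 * sqrt m. Over the spread of the walk the
  phase varies only by O(1), so averaging costs the fixed factor exp (- \<alpha>^2 / (32 *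
  \<beta>)). The obstacle is one of size: a lattice step sees the first derivative of the averaged
  test function, O(1 / sqrt L), and O(L) such terms could swamp everything. They telescope along the
  level curve; what remains are second-order terms of size 1 / L weighted by the sawtooth, and these
  add up to order one. The expansion of the level curves covers intermediate times only; at other
  times their speed of at least lam0 > 1 / 2 and a fourth-moment bound keep the walk away from the
  support of the test function.\<close>

primrec walk_mean :: "nat \<Rightarrow> (real \<Rightarrow> real) \<Rightarrow> real \<Rightarrow> real" where
  "walk_mean 0 f x = f x"
| "walk_mean (Suc m) f x = (walk_mean m f (x + 1 / 2) + walk_mean m f (x - 1 / 2)) / 2"

lemma walk_mean_add: "walk_mean m (\<lambda>y. f y + g y) x = walk_mean m f x + walk_mean m g x"
  by (induction m arbitrary: x) (simp_all add: field_simps)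

lemma walk_mean_cmult: "walk_mean m (\<lambda>y. k * f y) x = k * walk_mean m f x"
  by (induction m arbitrary: x) (simp_all add: field_simps)

lemma walk_mean_const: "walk_mean m (\<lambda>y. k) x = k"
  by (induction m arbitrary: x) simp_all

lemma walk_mean_mono:
  assumes "\<And>y. f y \<le> g y"
  shows "walk_mean m f x \<le> walk_mean m g x"
  by (induction m arbitrary: x) (simp_all add: assms add_mono divide_right_mono)

lemma abs_walk_mean_le:
  assumes "\<And>y. \<bar>f y\<bar> \<le> g y"
  shows "\<bar>walk_mean m f x\<bar> \<le> walk_mean m g x"
proof -
  have "walk_mean m f x \<le> walk_mean m g x"
    by (rule walk_mean_mono) (use assms abs_le_D1 in blast)
  moreover have "walk_mean m (\<lambda>y. - 1 * f y) x \<le> walk_mean m g x"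
    by (rule walk_mean_mono) (use assms abs_le_D2 in force)
  ultimately show ?thesis unfolding walk_mean_cmult by linarith
qed

lemma abs_walk_mean_bound:
  assumes "\<And>y. \<bar>f y\<bar> \<le> B"
  shows "\<bar>walk_mean m f x\<bar> \<le> B"
  using abs_walk_mean_le [of f "\<lambda>_. B", OF assms] by (simp add: walk_mean_const)

text \<open>Cosines are eigenfunctions of the symmetric averaging step, since the sine parts of the
  two shifts cancel. The factor cos (\<omega> / 2) ^ m is the characteristic function of the
  walk.\<close>

lemma walk_mean_cos:
  "walk_mean m (\<lambda>y. cos (\<omega> * y + \<phi>)) x = cos (\<omega> / 2) ^ m * cos (\<omega> * x + \<phi>)"
proof (induction m arbitrary: x)
  case (Suc m)
  have "cos (\<omega> * (x + 1 / 2) + \<phi>) + cos (\<omega> * (x - 1 / 2) + \<phi>) = 2 * cos (\<omega> / 2) * cos (\<omega> * x + \<phi>)"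
    using cos_add [of "\<omega> * x + \<phi>" "\<omega> / 2"] cos_diff [of "\<omega> * x + \<phi>" "\<omega> / 2"]
    by (simp add: algebra_simps)
  then have "cos (\<omega> / 2) ^ m * (cos (\<omega> * (x + 1 / 2) + \<phi>) + cos (\<omega> * (x - 1 / 2) + \<phi>))
      = cos (\<omega> / 2) ^ m * (2 * cos (\<omega> / 2) * cos (\<omega> * x + \<phi>))" by simp
  then show ?case unfolding walk_mean.simps Suc.IH by (simp add: algebra_simps)
qed simp

lemma walk_mean_square: "walk_mean m (\<lambda>y. (y - a)\<^sup>2) x = (x - a)\<^sup>2 + real m / 4"
proof (induction m arbitrary: x)
  case (Suc m)
  show ?case unfolding walk_mean.simps Suc.IH by (simp add: field_simps power2_eq_square)
qed simp

lemma walk_mean_power4: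
  "walk_mean m (\<lambda>y. (y - a) ^ 4) x
     = (x - a) ^ 4 + 3 / 2 * real m * (x - a)\<^sup>2 + (3 * (real m)\<^sup>2 - 2 * real m) / 16"
proof (induction m arbitrary: x)
  case (Suc m)
  show ?case unfolding walk_mean.simps Suc.IH by (simp add: field_simps power2_eq_square power4_eq_xxxx)
qed simp

text \<open>Markov's inequality for the fourth moment. The second moment would only give a bound of
  order m / d^2, which is not summable over the times m when d grows like m.\<close>

lemma walk_mean_tail:
  assumes B: "\<And>y. \<bar>f y\<bar> \<le> B" and z: "\<And>y. \<bar>y - x\<bar> < d \<Longrightarrow> f y = 0" and d: "d > 0"
  shows "\<bar>walk_mean m f x\<bar> \<le> B * (real m)\<^sup>2 / d ^ 4"
proof -
  have B0: "B \<ge> 0" using B [of 0] by linarith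
  have "\<bar>f y\<bar> \<le> B / d ^ 4 * (y - x) ^ 4" for y
  proof (cases "\<bar>y - x\<bar> < d")
    case True
    then show ?thesis using z [OF True] B0 d by simp
  next
    case False
    then have "d ^ 4 \<le> \<bar>y - x\<bar> ^ 4" using d by (intro power_mono) auto
    then have "d ^ 4 \<le> (y - x) ^ 4" by simp
    then have "B * 1 \<le> B * ((y - x) ^ 4 / d ^ 4)" using B0 d by (intro mult_left_mono) simp_all
    with B [of y] show ?thesis by simp
  qed
  then have "\<bar>walk_mean m f x\<bar> \<le> B / d ^ 4 * walk_mean m (\<lambda>y. (y - x) ^ 4) x"
    unfolding walk_mean_cmult [symmetric] by (rule abs_walk_mean_le)
  also have "\<dots> = B / d ^ 4 * ((3 * (real m)\<^sup>2 - 2 * real m) / 16)" by (simp add: walk_mean_power4)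
  also have "\<dots> \<le> B / d ^ 4 * (real m)\<^sup>2"
    using B0 d by (intro mult_left_mono) (auto simp: field_simps)
  finally show ?thesis by simp
qed

lemma DERIV_walk_mean:
  assumes "\<And>y. (f has_real_derivative f' y) (at y)"
  shows "(walk_mean m f has_real_derivative walk_mean m f' x) (at x)"
proof (induction m arbitrary: x)
  case 0
  have "walk_mean 0 f = f" "walk_mean 0 f' = f'" by auto
  with assms show ?case by simp
next
  case (Suc m)
  have e: "walk_mean (Suc m) f = (\<lambda>x. walk_mean m f (x + 1 / 2) / 2 + walk_mean m f (x + - (1 / 2)) / 2)" by (auto simp: field_simps)
  show ?case unfolding e
    using DERIV_shift [of "walk_mean m f" _ x "1 / 2"] DERIV_shift [of "walk_mean m f" _ x "- (1 / 2)"] Suc.IH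
    by (auto intro!: derivative_eq_intros)
qed

text \<open>Transposing the scheme averages over the points y and y - 1 in each step. Centring this
  walk with drift 1 / 2 leaves the symmetric walk, started at y - m / 2.\<close>

definition adj_mean :: "nat \<Rightarrow> (real \<Rightarrow> real) \<Rightarrow> real \<Rightarrow> real" where
  "adj_mean m f y = walk_mean m f (y - real m / 2)"

lemma adj_mean_0 [simp]: "adj_mean 0 f y = f y"
  by (simp add: adj_mean_def)

lemma adj_mean_Suc: "adj_mean (Suc m) f y = (adj_mean m f y + adj_mean m f (y - 1)) / 2"
proof -
  have "y - real (Suc m) / 2 + 1 / 2 = y - real m / 2" "y - real (Suc m) / 2 - 1 / 2 = y - 1 - real m / 2"
    by (simp_all add: field_simps)
  then show ?thesis by (simp only: adj_mean_def walk_mean.simps)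
qed

lemma DERIV_adj_mean:
  assumes "\<And>y. (f has_real_derivative f' y) (at y)"
  shows "(adj_mean m f has_real_derivative adj_mean m f' x) (at x)"
proof -
  have e: "adj_mean m f = (\<lambda>x. walk_mean m f (x - real m / 2))" by (auto simp: adj_mean_def)
  show ?thesis unfolding e adj_mean_def
    using DERIV_shift [of "walk_mean m f" _ x "- (real m / 2)"] DERIV_walk_mean [of f f' m "x - real m / 2", OF assms]
    by (simp only: diff_conv_add_uminus)
qed

lemma abs_adj_mean_bound:
  assumes "\<And>y. \<bar>f y\<bar> \<le> B"
  shows "\<bar>adj_mean m f x\<bar> \<le> B"
  unfolding adj_mean_def by (rule abs_walk_mean_bound [OF assms])

subsection \<open>Averages along slowly varying phases\<close>

lemma summation_by_parts:
  fixes w A :: "nat \<Rightarrow> real"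
  assumes "M1 \<le> M2"
  shows "(\<Sum>m = M1..<M2. w m * (A (Suc m) - A m))
      = w M2 * A M2 - w M1 * A M1 - (\<Sum>m = M1..<M2. A (Suc m) * (w (Suc m) - w m))"
  using assms by (induction M2 rule: dec_induct) (simp_all add: algebra_simps)

lemma sqrt_diff_eq:
  assumes "0 < x" "0 \<le> r"
  shows "sqrt (x + r) - sqrt x = r / (sqrt (x + r) + sqrt x)"
proof -
  have p: "sqrt (x + r) + sqrt x > 0" using assms by (simp add: add_nonneg_pos)
  have "(sqrt (x + r) - sqrt x) * (sqrt (x + r) + sqrt x) = r"
    using assms by (simp add: algebra_simps)
  with p show ?thesis by (simp add: eq_divide_eq)
qed

lemma sqrt_diff_le:
  assumes "0 < x" "0 \<le> r"
  shows "sqrt (x + r) - sqrt x \<le> r / (2 * sqrt x)"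
  unfolding sqrt_diff_eq [OF assms] using assms
  by (intro divide_left_mono mult_pos_pos) (auto simp: add_pos_pos add_nonneg_pos)

lemma Lipschitz_abs:
  fixes F :: "real \<Rightarrow> real"
  assumes "M-lipschitz_on UNIV F"
  shows "\<bar>F x - F y\<bar> \<le> M * \<bar>x - y\<bar>"
  using lipschitz_onD [OF assms, of x y] by (simp add: dist_real_def)

lemma antiderivative_exists:
  fixes F :: "real \<Rightarrow> real"
  assumes cont: "continuous_on UNIV F"
  obtains G where "\<And>x. (G has_real_derivative F x) (at x)"
proof -
  define H where "H x = (if x \<ge> 0 then integral {0..x} F else - integral {x..0} F)" for x
  \<comment> \<open>Relative to a base point below both 0 and x the two cases of \<open>H\<close>
    have one formula, to which the fundamental theorem applies.\<close>
  have H: "H x = integral {-n..x} F - integral {-n..0} F" if "-n \<le> x" "0 \<le> n" for x n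
  proof (cases "x \<ge> 0")
    case True
    have "integral {-n..0} F + integral {0..x} F = integral {-n..x} F"
      using that True by (intro Henstock_Kurzweil_Integration.integral_combine integrable_continuous_real continuous_on_subset [OF cont]) auto
    with True show ?thesis by (simp add: H_def)
  next
    case False
    have "integral {-n..x} F + integral {x..0} F = integral {-n..0} F"
      using that False by (intro Henstock_Kurzweil_Integration.integral_combine integrable_continuous_real continuous_on_subset [OF cont]) auto
    with False show ?thesis by (simp add: H_def)
  qed
  have "(H has_real_derivative F x) (at x)" for x
  proof -
    define n where "n = \<bar>x\<bar> + 1"
    have x: "x \<in> {-n<..<n}" and n: "n > 0" by (auto simp: n_def)
    have "((\<lambda>x. integral {-n..x} F) has_real_derivative F x) (at x within {-n..n})"
      by (rule integral_has_real_derivative) (use x continuous_on_subset [OF cont] in auto)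
    then have "((\<lambda>x. integral {-n..x} F) has_real_derivative F x) (at x)"
      using x by (simp add: at_within_Icc_at)
    then have "((\<lambda>x. integral {-n..x} F - integral {-n..0} F) has_real_derivative F x) (at x)"
      by (auto intro!: derivative_eq_intros)
    then show ?thesis
      by (rule has_field_derivative_transform_within_open [where S = "{-n<..<n}"])
        (use x n H [where n = n] in auto)
  qed
  then show ?thesis by (rule that)
qed

text \<open>Zero mean is what makes a primitive periodic. Normalised to vanish at 0, it is bounded
  by \<open>B\<close> because it only has to be followed over a period of length one.\<close>

lemma periodic_primitive:
  fixes F :: "real \<Rightarrow> real"
  assumes lip: "M-lipschitz_on UNIV F" and per: "\<And>x. F (x + 1) = F x"
    and mean: "integral {0..1} F = 0" and B: "\<And>x. \<bar>F x\<bar> \<le> B"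
  obtains G where "\<And>x. (G has_real_derivative F x) (at x)" "\<And>x. G (x + 1) = G x"
    "\<And>x. \<bar>G x\<bar> \<le> B"
proof -
  have cont: "continuous_on UNIV F" using lip by (rule lipschitz_on_continuous_on)
  obtain G0 where G0: "\<And>x. (G0 has_real_derivative F x) (at x)"
    using antiderivative_exists [OF cont] by blast
  define G where "G x = G0 x - G0 0" for x
  have G: "(G has_real_derivative F x) (at x)" for x
    unfolding G_def by (auto intro!: derivative_eq_intros G0)
  have G1: "((\<lambda>x. G (x + 1)) has_real_derivative F x) (at x)" for x
    using G [of "x + 1"] DERIV_shift [of G "F (x + 1)" x 1] by (simp add: per)
  have d: "\<forall>x. ((\<lambda>x. G (x + 1) - G x) has_real_derivative 0) (at x)"
    by (auto intro!: derivative_eq_intros G1 G)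
  have "G (x + 1) - G x = G (0 + 1) - G 0" for x
    by (rule DERIV_isconst_all [OF d])
  moreover have "G 1 - G 0 = integral {0..1} F"
  proof -
    have "(F has_integral (G 1 - G 0)) {0..1}"
      by (rule fundamental_theorem_of_calculus)
        (auto simp: has_real_derivative_iff_has_vector_derivative [symmetric] intro!: has_field_derivative_at_within G)
    then show ?thesis by (simp add: integral_unique)
  qed
  ultimately have Gp: "G (x + 1) = G x" for x using mean by (metis add_0 eq_iff_diff_eq_0)
  have Gint: "G (x + of_int k) = G x" for x k
  proof (induction k rule: int_induct [where k = 0])
    case (step1 i)
    then show ?case using Gp [of "x + of_int i"] by (simp add: add.assoc)
  next
    case (step2 i)
    then show ?case using Gp [of "x + of_int (i - 1)"] by (simp add: add.assoc)
  qed simp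
  have B0: "B \<ge> 0" using B [of 0] by linarith
  have "\<bar>G x\<bar> \<le> B" for x
  proof -
    have e: "G x = G (frac x)" using Gint [of x "- \<lfloor>x\<rfloor>"] by (simp add: frac_def)
    have "\<bar>G x\<bar> = norm (G (frac x) - G 0)" unfolding e by (simp add: G_def)
    also have "\<dots> \<le> B * norm (frac x - 0)"
      by (rule field_differentiable_bound [where S = UNIV and f' = F])
        (use B in \<open>auto intro!: has_field_derivative_at_within G\<close>)
    also have "\<dots> \<le> B * 1" using B0 frac_lt_1 [of x] by (intro mult_left_mono) (auto simp: less_imp_le)
    finally show ?thesis by simp
  qed
  with G Gp show ?thesis by (rule that)
qed

lemma periodic_add_int:
  fixes F :: "real \<Rightarrow> real"
  assumes per: "\<And>x. F (x + 1) = F x"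
  shows "F (x + of_int k) = F x"
proof (induction k rule: int_induct [where k = 0])
  case (step1 i)
  then show ?case using per [of "x + of_int i"] by (simp add: add.assoc)
next
  case (step2 i)
  then show ?case using per [of "x + of_int (i - 1)"] by (simp add: add.assoc)
qed simp

text \<open>Along residue classes modulo \<open>q\<close> the phase advances by \<open>O(1 / sqrt m)\<close> modulo 1, so each
  value of \<open>F\<close> is nearly a difference quotient of its periodic primitive.\<close>

lemma slow_phase_average:
  fixes F :: "real \<Rightarrow> real" and h :: "nat \<Rightarrow> real" and p :: int and q :: nat
  assumes lip: "M-lipschitz_on UNIV F" and per: "\<And>x. F (x + 1) = F x"
    and mean: "integral {0..1} F = 0" and B: "\<And>x. \<bar>F x\<bar> \<le> B"
    and q: "q > 0" and a: "a > 0" and R: "R \<ge> 1" "R \<le> real M1" "M1 \<le> M2" "real M2 + real q + 1 \<le> \<kappa> * R"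
    and h: "\<And>m. M1 \<le> m \<Longrightarrow> m \<le> M2 \<Longrightarrow> \<bar>h m\<bar> \<le> H / R"
      "\<And>m. M1 \<le> m \<Longrightarrow> m < M2 \<Longrightarrow> \<bar>h (Suc m) - h m\<bar> \<le> H / R\<^sup>2"
  shows "\<bar>\<Sum>m = M1..<M2. h m * F (of_int p / real q * real m + a * sqrt (real m) - c)\<bar>
     \<le> (B * H / a * (4 * sqrt \<kappa> + 2 * \<kappa> * sqrt \<kappa> + \<kappa>) + \<kappa> * H * M * a * real q / 2) / sqrt R"
proof -
  obtain G where G: "\<And>x. (G has_real_derivative F x) (at x)" "\<And>x. G (x + 1) = G x"
    "\<And>x. \<bar>G x\<bar> \<le> B" using periodic_primitive [OF lip per mean B] by blast
  have M0: "M \<ge> 0" using lip by (rule lipschitz_on_nonneg)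
  have B0: "B \<ge> 0" using B [of 0] by linarith
  have "0 \<le> H / R" using h(1) [of M1] R by (metis abs_ge_zero order_refl order_trans)
  then have H0: "H \<ge> 0" using R by (simp add: zero_le_divide_iff)
  have k0: "\<kappa> > 0" using R by (smt (verit) mult_nonpos_nonneg of_nat_0_le_iff)
  define s where "s m = sqrt (real m)" for m
  define x where "x m = of_int p / real q * real m + a * s m - c" for m
  define \<delta> where "\<delta> m = a * (s (m + q) - s m)" for m
  define D where "D m = s (m + q) + s m" for m
  \<comment> \<open>Since \<delta> m * D m = a * q, the weight \<open>w m\<close> is h m / \<delta>
    m, the factor needed to write h m * F (x m) as a multiple of an increment of the primitive.
    Below, \<Gamma> collects q consecutive values of the primitive, so that its one-step increment
    is the q-step increment of \<open>G\<close> along the phase.\<close>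
  define w where "w m = h m * D m / (a * real q)" for m
  define \<Gamma> where "\<Gamma> m = (\<Sum>i<q. G (x (m + i)))" for m
  have sR: "sqrt R > 0" using R by simp
  have smR: "sqrt R \<le> s m" if "M1 \<le> m" for m unfolding s_def using R that by simp
  have spos: "s m > 0" if "M1 \<le> m" for m using smR [OF that] sR by linarith
  have sle: "s m \<le> sqrt \<kappa> * sqrt R" if "m \<le> M2 + q + 1" for m
    unfolding s_def real_sqrt_mult [symmetric] using R that by (intro real_sqrt_le_mono) linarith
  have Dpos: "D m > 0" if "M1 \<le> m" for m unfolding D_def using spos [of m] spos [of "m + q"] that by simp
  have sd: "s (m + r) - s m = real r / (s (m + r) + s m)" if "M1 \<le> m" for m r
    using sqrt_diff_eq [of "real m" "real r"] that R unfolding s_def by simp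
  have \<delta>D: "\<delta> m * D m = a * real q" if "M1 \<le> m" for m
    using sd [OF that, of q] Dpos [OF that] by (simp add: \<delta>_def D_def)
  have sdle: "s (m + r) - s m \<le> real r / (2 * sqrt R)" if "M1 \<le> m" for m r
  proof -
    have "s (m + r) - s m \<le> real r / (2 * s m)"
      using sqrt_diff_le [of "real m" "real r"] that R unfolding s_def by simp
    also have "\<dots> \<le> real r / (2 * sqrt R)"
      using smR [OF that] spos [OF that] sR by (intro divide_left_mono) (auto simp del: real_sqrt_gt_0_iff)
    finally show ?thesis .
  qed
  have \<delta>0: "0 \<le> \<delta> m" for m unfolding \<delta>_def s_def using a by simp
  have \<delta>le: "\<delta> m \<le> a * real q / (2 * sqrt R)" if "M1 \<le> m" for m
    using mult_left_mono [OF sdle [OF that, of q], of a] a by (simp add: \<delta>_def)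
  have key: "\<bar>G (x (m + q)) - G (x m) - \<delta> m * F (x m)\<bar> \<le> M * (\<delta> m)\<^sup>2" for m
  proof -
    \<comment> \<open>In q steps the rational part of the phase advances by the integer p, which the
      period of \<open>G\<close> absorbs; only the small advance \<delta> m is left.\<close>
    have xe: "x (m + q) = x m + \<delta> m + of_int p" using q by (simp add: x_def \<delta>_def field_simps)
    have g: "G (x (m + q)) = G (x m + \<delta> m)" unfolding xe by (rule periodic_add_int [of G, OF G(2)])
    have d: "((\<lambda>y. G y - F (x m) * y) has_real_derivative (F y - F (x m))) (at y)" for y
      by (auto intro!: derivative_eq_intros G(1))
    have "norm ((G (x m + \<delta> m) - F (x m) * (x m + \<delta> m)) - (G (x m) - F (x m) * x m))
        \<le> (M * \<delta> m) * norm ((x m + \<delta> m) - x m)"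
    proof (rule field_differentiable_bound [where S = "{x m..x m + \<delta> m}" and f' = "\<lambda>y. F y - F (x m)"])
      fix y assume y: "y \<in> {x m..x m + \<delta> m}"
      show "((\<lambda>y. G y - F (x m) * y) has_field_derivative F y - F (x m)) (at y within {x m..x m + \<delta> m})"
        by (rule has_field_derivative_at_within [OF d])
      have "\<bar>F y - F (x m)\<bar> \<le> M * \<bar>y - x m\<bar>" by (rule Lipschitz_abs [OF lip])
      also have "\<dots> \<le> M * \<delta> m" using y M0 by (intro mult_left_mono) auto
      finally show "norm (F y - F (x m)) \<le> M * \<delta> m" by simp
    qed (use \<delta>0 [of m] in auto)
    then show ?thesis unfolding g using \<delta>0 [of m] by (simp add: algebra_simps power2_eq_square)
  qed
  \<comment> \<open>The quadratic error M * (\<delta> m)^2 is divided by \<delta> m, so each term is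
    off by O(R^(-3/2)); over at most \<kappa> * R terms this gives O(R^(-1/2)).\<close>
  have hF: "\<bar>h m * F (x m) - w m * (\<Gamma> (Suc m) - \<Gamma> m)\<bar> \<le> H * M * a * real q / (2 * R * sqrt R)"
    if m: "M1 \<le> m" "m < M2" for m
  proof -
    have \<delta>p: "\<delta> m > 0" using \<delta>D [OF m(1)] Dpos [OF m(1)] a q by (metis mult_pos_pos of_nat_0_less_iff zero_less_mult_pos2)
    have G': "\<Gamma> (Suc m) - \<Gamma> m = G (x (m + q)) - G (x m)"
    proof -
      have "(\<Sum>i<q. G (x (Suc m + i)) - G (x (m + i))) = G (x (m + q)) - G (x m)"
        using sum_lessThan_telescope [of "\<lambda>i. G (x (m + i))" q] by simp
      then show ?thesis by (simp add: \<Gamma>_def sum_subtractf)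
    qed
    have we: "w m = h m / \<delta> m" using \<delta>D [OF m(1)] \<delta>p a q by (simp add: w_def field_simps)
    have "h m * F (x m) - w m * (\<Gamma> (Suc m) - \<Gamma> m)
       = - (h m / \<delta> m) * (G (x (m + q)) - G (x m) - \<delta> m * F (x m))"
      unfolding we G' using \<delta>p by (simp add: field_simps)
    also have "\<bar>\<dots>\<bar> = \<bar>h m\<bar> / \<delta> m * \<bar>G (x (m + q)) - G (x m) - \<delta> m * F (x m)\<bar>"
      using \<delta>p by (simp add: abs_mult)
    also have "\<dots> \<le> \<bar>h m\<bar> / \<delta> m * (M * (\<delta> m)\<^sup>2)" using key \<delta>p by (intro mult_left_mono) auto
    also have "\<dots> = \<bar>h m\<bar> * (M * \<delta> m)" using \<delta>p by (simp add: power2_eq_square)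
    also have "\<dots> \<le> H / R * (M * (a * real q / (2 * sqrt R)))"
      using h(1) [of m] m M0 \<delta>le [OF m(1)] \<delta>0 by (intro mult_mono) (auto intro: mult_left_mono order_trans [OF abs_ge_zero])
    finally show ?thesis by (simp add: field_simps)
  qed
  have N: "real (M2 - M1) \<le> \<kappa> * R" using R by (simp add: of_nat_diff)
  have s1: "\<bar>(\<Sum>m = M1..<M2. h m * F (x m)) - (\<Sum>m = M1..<M2. w m * (\<Gamma> (Suc m) - \<Gamma> m))\<bar>
      \<le> \<kappa> * H * M * a * real q / 2 / sqrt R"
  proof -
    have "\<bar>(\<Sum>m = M1..<M2. h m * F (x m)) - (\<Sum>m = M1..<M2. w m * (\<Gamma> (Suc m) - \<Gamma> m))\<bar>
       \<le> (\<Sum>m = M1..<M2. H * M * a * real q / (2 * R * sqrt R))"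
      unfolding sum_subtractf [symmetric] by (rule order_trans [OF sum_abs]) (rule sum_mono, use hF in auto)
    also have "\<dots> = real (M2 - M1) * (H * M * a * real q / (2 * R * sqrt R))" by simp
    also have "\<dots> \<le> \<kappa> * R * (H * M * a * real q / (2 * R * sqrt R))"
      using N H0 M0 a sR R by (intro mult_right_mono) auto
    also have "\<dots> = \<kappa> * H * M * a * real q / 2 / sqrt R" using R by (simp add: field_simps)
    finally show ?thesis .
  qed
  have \<Gamma>b: "\<bar>\<Gamma> m\<bar> \<le> real q * B" for m
  proof -
    have "\<bar>\<Gamma> m\<bar> \<le> (\<Sum>i<q. B)" unfolding \<Gamma>_def
      by (rule order_trans [OF sum_abs]) (rule sum_mono, use G(3) in auto)
    then show ?thesis by simp
  qed
  have Dle: "D m \<le> 2 * (sqrt \<kappa> * sqrt R)" if "m \<le> Suc M2" for m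
    unfolding D_def using sle [of "m + q"] sle [of m] that by simp
  have wb: "\<bar>w m\<bar> \<le> 2 * H * sqrt \<kappa> / (a * real q) / sqrt R" if m: "M1 \<le> m" "m \<le> M2" for m
  proof -
    have "\<bar>w m\<bar> = \<bar>h m\<bar> * D m / (a * real q)" using Dpos [OF m(1)] a q by (simp add: w_def abs_mult)
    also have "\<dots> \<le> H / R * (2 * (sqrt \<kappa> * sqrt R)) / (a * real q)"
      using h(1) [OF m] Dle [of m] Dpos [of m] m a q H0 R by (intro divide_right_mono mult_mono) auto
    also have "\<dots> = 2 * H * sqrt \<kappa> / (a * real q) / sqrt R"
      using R real_sqrt_pow2 [of R] a q by (simp add: field_simps power2_eq_square)
    finally show ?thesis .
  qed
  have wd: "\<bar>w (Suc m) - w m\<bar> \<le> H * (2 * sqrt \<kappa> + 1) / (a * real q) / (R * sqrt R)" if m: "M1 \<le> m" "m < M2" for m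
  proof -
    have D0: "0 \<le> D (Suc m) - D m" unfolding D_def s_def
      using real_sqrt_le_mono [of "real (m + q)" "real (Suc m + q)"] real_sqrt_le_mono [of "real m" "real (Suc m)"] by linarith
    have D1: "D (Suc m) - D m \<le> 1 / sqrt R"
      unfolding D_def using sdle [of m 1] sdle [of "m + q" 1] m by (simp add: field_simps)
    have "w (Suc m) - w m = ((h (Suc m) - h m) * D (Suc m) + h m * (D (Suc m) - D m)) / (a * real q)"
      by (simp only: w_def diff_divide_distrib [symmetric]) (simp add: algebra_simps)
    also have "\<bar>\<dots>\<bar> = \<bar>(h (Suc m) - h m) * D (Suc m) + h m * (D (Suc m) - D m)\<bar> / (a * real q)"
      using a q by simp
    also have "\<dots> \<le> (H / R\<^sup>2 * (2 * (sqrt \<kappa> * sqrt R)) + H / R * (1 / sqrt R)) / (a * real q)"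
    proof (rule divide_right_mono)
      have "\<bar>(h (Suc m) - h m) * D (Suc m)\<bar> \<le> H / R\<^sup>2 * (2 * (sqrt \<kappa> * sqrt R))"
        unfolding abs_mult using h(2) [OF m] Dle [of "Suc m"] Dpos [of "Suc m"] m H0 R
        by (intro mult_mono) auto
      moreover have "\<bar>h m * (D (Suc m) - D m)\<bar> \<le> H / R * (1 / sqrt R)"
        unfolding abs_mult using h(1) [of m] D0 D1 m H0 R by (intro mult_mono) auto
      ultimately show "\<bar>(h (Suc m) - h m) * D (Suc m) + h m * (D (Suc m) - D m)\<bar>
          \<le> H / R\<^sup>2 * (2 * (sqrt \<kappa> * sqrt R)) + H / R * (1 / sqrt R)" by linarith
    qed (use a q in simp)
    also have "H / R\<^sup>2 * (2 * (sqrt \<kappa> * sqrt R)) = 2 * H * sqrt \<kappa> / (R * sqrt R)"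
      using R real_sqrt_pow2 [of R] by (simp add: field_simps power2_eq_square)
    also have "(2 * H * sqrt \<kappa> / (R * sqrt R) + H / R * (1 / sqrt R)) / (a * real q)
       = H * (2 * sqrt \<kappa> + 1) / (a * real q) / (R * sqrt R)"
      using R a q by (simp add: field_simps)
    finally show ?thesis .
  qed
  define Q where "Q = H / (a * real q)"
  have Q0: "Q \<ge> 0" using H0 a q by (simp add: Q_def)
  \<comment> \<open>Summation by parts moves the difference from \<Gamma>, which is merely bounded,
    to \<open>w\<close>, which is O(R^(-1/2)) with increments O(R^(-3/2)).\<close>
  have s2: "\<bar>\<Sum>m = M1..<M2. w m * (\<Gamma> (Suc m) - \<Gamma> m)\<bar> \<le> B * H / a * (4 * sqrt \<kappa> + 2 * \<kappa> * sqrt \<kappa> + \<kappa>) / sqrt R"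
  proof -
    have e1: "\<bar>w M2 * \<Gamma> M2\<bar> \<le> 2 * Q * sqrt \<kappa> / sqrt R * (real q * B)"
      unfolding abs_mult using wb [of M2] \<Gamma>b [of M2] R k0 Q0 by (intro mult_mono) (auto simp: Q_def)
    have e2: "\<bar>w M1 * \<Gamma> M1\<bar> \<le> 2 * Q * sqrt \<kappa> / sqrt R * (real q * B)"
      unfolding abs_mult using wb [of M1] \<Gamma>b [of M1] R k0 Q0 by (intro mult_mono) (auto simp: Q_def)
    have "\<bar>\<Sum>m = M1..<M2. \<Gamma> (Suc m) * (w (Suc m) - w m)\<bar>
        \<le> (\<Sum>m = M1..<M2. (real q * B) * (Q * (2 * sqrt \<kappa> + 1) / (R * sqrt R)))"
    proof (rule order_trans [OF sum_abs], rule sum_mono)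
      fix m assume "m \<in> {M1..<M2}"
      then show "\<bar>\<Gamma> (Suc m) * (w (Suc m) - w m)\<bar> \<le> (real q * B) * (Q * (2 * sqrt \<kappa> + 1) / (R * sqrt R))"
        unfolding abs_mult using wd [of m] \<Gamma>b [of "Suc m"] B0 by (intro mult_mono) (auto simp: Q_def)
    qed
    also have "\<dots> = real (M2 - M1) * ((real q * B) * (Q * (2 * sqrt \<kappa> + 1) / (R * sqrt R)))" by simp
    also have "\<dots> \<le> \<kappa> * R * ((real q * B) * (Q * (2 * sqrt \<kappa> + 1) / (R * sqrt R)))"
      using N B0 Q0 k0 sR R by (intro mult_right_mono) auto
    also have "\<dots> = \<kappa> * (real q * B) * Q * (2 * sqrt \<kappa> + 1) / sqrt R" using R by (simp add: field_simps)
    finally have e3: "\<bar>\<Sum>m = M1..<M2. \<Gamma> (Suc m) * (w (Suc m) - w m)\<bar> \<le> \<kappa> * (real q * B) * Q * (2 * sqrt \<kappa> + 1) / sqrt R" .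
    have "\<bar>\<Sum>m = M1..<M2. w m * (\<Gamma> (Suc m) - \<Gamma> m)\<bar>
        \<le> 2 * (2 * Q * sqrt \<kappa> / sqrt R * (real q * B)) + \<kappa> * (real q * B) * Q * (2 * sqrt \<kappa> + 1) / sqrt R"
      unfolding summation_by_parts [OF R(3)] using e1 e2 e3 by linarith
    also have "\<dots> = B * H / a * (4 * sqrt \<kappa> + 2 * \<kappa> * sqrt \<kappa> + \<kappa>) / sqrt R"
      using a q sR by (simp add: Q_def field_simps)
    finally show ?thesis .
  qed
  have "\<bar>\<Sum>m = M1..<M2. h m * F (x m)\<bar> \<le> B * H / a * (4 * sqrt \<kappa> + 2 * \<kappa> * sqrt \<kappa> + \<kappa>) / sqrt R
      + \<kappa> * H * M * a * real q / 2 / sqrt R" using s1 s2 by linarith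
  then show ?thesis unfolding x_def s_def by (simp add: add_divide_distrib)
qed

section \<open>Periodic tents and the regularised sawtooth\<close>

definition dist_int :: "real \<Rightarrow> real" where
  "dist_int y = min (frac y) (1 - frac y)"

lemma dist_int_le: "dist_int y \<le> \<bar>y - of_int n\<bar>"
proof (cases "n \<le> \<lfloor>y\<rfloor>")
  case True
  then have "real_of_int n \<le> \<lfloor>y\<rfloor>" by simp
  then show ?thesis by (simp add: dist_int_def frac_def min_def) linarith
next
  case False
  then have "\<lfloor>y\<rfloor> + 1 \<le> n" by simp
  then have "real_of_int \<lfloor>y\<rfloor> + 1 \<le> n" by linarith
  then show ?thesis by (simp add: dist_int_def frac_def min_def) linarith
qed

lemma dist_int_attained: "\<exists>n. dist_int y = \<bar>y - of_int n\<bar>"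
proof (cases "frac y \<le> 1 - frac y")
  case True
  then have "dist_int y = \<bar>y - of_int \<lfloor>y\<rfloor>\<bar>" using frac_ge_0 [of y] by (simp add: dist_int_def frac_def)
  then show ?thesis by blast
next
  case False
  then have "dist_int y = \<bar>y - of_int (\<lfloor>y\<rfloor> + 1)\<bar>" using frac_lt_1 [of y] by (simp add: dist_int_def frac_def)
  then show ?thesis by blast
qed

lemma dist_int_bounds: "0 \<le> dist_int y" "dist_int y \<le> 1 / 2"
  using frac_ge_0 [of y] frac_lt_1 [of y] by (auto simp: dist_int_def min_def)

lemma dist_int_Lipschitz: "\<bar>dist_int x - dist_int y\<bar> \<le> \<bar>x - y\<bar>"
proof -
  have "dist_int x \<le> \<bar>x - y\<bar> + dist_int y" for x y
  proof -
    obtain n where n: "dist_int y = \<bar>y - of_int n\<bar>" using dist_int_attained by blast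
    show ?thesis using dist_int_le [of x n] unfolding n by linarith
  qed
  from this [of x y] this [of y x] show ?thesis by linarith
qed

lemma frac_add_one: "frac (y + 1) = frac (y::real)"
  by (simp add: frac_def)

lemma dist_int_periodic: "dist_int (y + 1) = dist_int y"
  by (simp add: dist_int_def frac_add_one)

text \<open>A Lipschitz substitute for the indicator of a neighbourhood of the integers, so that the
  times at which a phase comes close to a jump of the sawtooth can be counted by
  \<open>slow_phase_average\<close>.\<close>

definition tent :: "real \<Rightarrow> real \<Rightarrow> real" where
  "tent r y = max 0 (1 - dist_int y / r)"

lemma tent_bounds: "r > 0 \<Longrightarrow> 0 \<le> tent r y" "r > 0 \<Longrightarrow> tent r y \<le> 1"
  using dist_int_bounds [of y] by (auto simp: tent_def)

lemma tent_periodic: "tent r (y + 1) = tent r y"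
  by (simp add: tent_def dist_int_periodic)

lemma tent_Lipschitz:
  assumes "r > 0"
  shows "(1 / r)-lipschitz_on UNIV (tent r)"
proof (rule lipschitz_onI)
  fix x y
  have "\<bar>tent r x - tent r y\<bar> \<le> \<bar>dist_int x / r - dist_int y / r\<bar>"
    unfolding tent_def by linarith
  also have "\<dots> = \<bar>dist_int x - dist_int y\<bar> / r" using assms by (simp add: diff_divide_distrib [symmetric])
  also have "\<dots> \<le> \<bar>x - y\<bar> / r" using dist_int_Lipschitz [of x y] assms by (intro divide_right_mono) auto
  finally show "dist (tent r x) (tent r y) \<le> 1 / r * dist x y" by (simp add: dist_real_def)
qed (use assms in simp)

lemma integrable_Lipschitz:
  fixes F :: "real \<Rightarrow> real"
  assumes "M-lipschitz_on UNIV F"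
  shows "F integrable_on {a..b}"
  by (intro integrable_continuous_real continuous_on_subset [OF lipschitz_on_continuous_on [OF assms]]) auto

lemma integral_tent_le:
  assumes r: "0 < r" "r \<le> 1 / 2"
  shows "integral {0..1} (tent r) \<le> 2 * r"
proof -
  note i = integrable_Lipschitz [OF tent_Lipschitz [OF r(1)]]
  have "integral {0..1} (tent r) = integral {0..r} (tent r) + integral {r..1} (tent r)"
    using r by (intro Henstock_Kurzweil_Integration.integral_combine [symmetric] i) auto
  also have "integral {r..1} (tent r) = integral {r..1 - r} (tent r) + integral {1 - r..1} (tent r)"
    using r by (intro Henstock_Kurzweil_Integration.integral_combine [symmetric] i) auto
  also have "integral {r..1 - r} (tent r) \<le> integral {r..1 - r} (\<lambda>_. 0)"
  proof (rule integral_le [OF i])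
    fix x assume x: "x \<in> {r..1 - r}"
    then have "frac x = x" using r by (simp add: frac_eq)
    then have "r \<le> dist_int x" using x by (simp add: dist_int_def)
    then show "tent r x \<le> 0" using r by (simp add: tent_def)
  qed auto
  also have "integral {0..r} (tent r) \<le> integral {0..r} (\<lambda>_. 1)"
    by (rule integral_le [OF i]) (use r tent_bounds in auto)
  also have "integral {1 - r..1} (tent r) \<le> integral {1 - r..1} (\<lambda>_. 1)"
    by (rule integral_le [OF i]) (use r tent_bounds in auto)
  finally show ?thesis using r by simp
qed

text \<open>A primitive of the sawtooth; its difference quotients regularise the sawtooth.\<close>

definition saw_prim :: "real \<Rightarrow> real" where
  "saw_prim y = dist_int y * (1 - dist_int y) / 2"

definition saw_reg :: "real \<Rightarrow> real \<Rightarrow> real" where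
  "saw_reg \<delta> y = (saw_prim (y + \<delta>) - saw_prim y) / \<delta>"

text \<open>The product x * (1 - x) does not change when the distances to the two neighbouring
  integers are exchanged. The definition through the Lipschitz function \<open>dist_int\<close>
  therefore yields the usual primitive of 1 / 2 - frac.\<close>

lemma saw_prim_frac: "saw_prim y = frac y * (1 - frac y) / 2"
  by (simp add: saw_prim_def dist_int_def min_def)

lemma saw_prim_Lipschitz: "\<bar>saw_prim x - saw_prim y\<bar> \<le> \<bar>x - y\<bar> / 2"
proof -
  have "saw_prim x - saw_prim y = (dist_int x - dist_int y) * (1 - dist_int x - dist_int y) / 2"
    by (simp add: saw_prim_def field_simps)
  also have "\<bar>\<dots>\<bar> = \<bar>dist_int x - dist_int y\<bar> * \<bar>1 - dist_int x - dist_int y\<bar> / 2" by (simp add: abs_mult)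
  also have "\<dots> \<le> \<bar>x - y\<bar> * 1 / 2"
    using dist_int_Lipschitz [of x y] dist_int_bounds [of x] dist_int_bounds [of y]
    by (intro divide_right_mono mult_mono) auto
  finally show ?thesis by simp
qed

lemma saw_reg_bound: "\<delta> > 0 \<Longrightarrow> \<bar>saw_reg \<delta> y\<bar> \<le> 1 / 2"
  using saw_prim_Lipschitz [of "y + \<delta>" y] by (simp add: saw_reg_def divide_le_eq)

lemma saw_reg_Lipschitz:
  assumes "\<delta> > 0"
  shows "\<bar>saw_reg \<delta> x - saw_reg \<delta> y\<bar> \<le> \<bar>x - y\<bar> / \<delta>"
proof -
  have "saw_reg \<delta> x - saw_reg \<delta> y
      = ((saw_prim (x + \<delta>) - saw_prim (y + \<delta>)) - (saw_prim x - saw_prim y)) / \<delta>"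
    by (simp add: saw_reg_def diff_divide_distrib [symmetric])
  then have "\<bar>saw_reg \<delta> x - saw_reg \<delta> y\<bar>
      = \<bar>(saw_prim (x + \<delta>) - saw_prim (y + \<delta>)) - (saw_prim x - saw_prim y)\<bar> / \<delta>" using assms by simp
  also have "\<dots> \<le> \<bar>x - y\<bar> / \<delta>"
  proof (rule divide_right_mono)
    have "\<bar>(saw_prim (x + \<delta>) - saw_prim (y + \<delta>)) - (saw_prim x - saw_prim y)\<bar> \<le> \<bar>x - y\<bar> / 2 + \<bar>x - y\<bar> / 2"
      by (rule order_trans [OF abs_triangle_ineq4
            add_mono [OF saw_prim_Lipschitz [of "x + \<delta>" "y + \<delta>", unfolded add_diff_cancel_right] saw_prim_Lipschitz]])
    then show "\<bar>(saw_prim (x + \<delta>) - saw_prim (y + \<delta>)) - (saw_prim x - saw_prim y)\<bar> \<le> \<bar>x - y\<bar>" by simp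
  qed (use assms in simp)
  finally show ?thesis .
qed

lemma saw_reg_periodic: "saw_reg \<delta> (y + 1) = saw_reg \<delta> y"
proof -
  have "y + 1 + \<delta> = (y + \<delta>) + 1" by simp
  then show ?thesis by (simp only: saw_reg_def saw_prim_def dist_int_periodic)
qed

text \<open>If x is within \<delta> of an integer, the trivial bound 1 is covered because
  \<open>tent\<close> is at least 1 / 2 there. Otherwise no integer separates x from Y or from x +
  \<delta>, and everything is linear. One estimate thus handles both the regularisation and the
  perturbation of the phase.\<close>

lemma saw_reg_approx:
  assumes \<delta>: "0 < \<delta>" and Y: "\<bar>Y - x\<bar> \<le> \<delta>"
  shows "\<bar>(1 / 2 - frac Y) - saw_reg \<delta> x\<bar> \<le> 2 * \<delta> + 3 * tent (2 * \<delta>) x"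
proof (cases "dist_int x \<le> \<delta>")
  case True
  then have "tent (2 * \<delta>) x \<ge> 1 / 2" using \<delta> by (simp add: tent_def field_simps)
  moreover have "\<bar>1 / 2 - frac Y\<bar> \<le> 1 / 2" using frac_ge_0 [of Y] frac_lt_1 [of Y] by linarith
  ultimately show ?thesis using saw_reg_bound [OF \<delta>, of x] \<delta> by linarith
next
  case False
  then have f: "\<delta> < frac x" "frac x < 1 - \<delta>" by (auto simp: dist_int_def)
  have fr: "frac (x + e) = frac x + e" if "\<bar>e\<bar> \<le> \<delta>" for e
  proof -
    have "\<lfloor>x + e\<rfloor> = \<lfloor>x\<rfloor>" using f that by (intro floor_unique) (auto simp: frac_def)
    then show ?thesis by (simp add: frac_def)
  qed
  have Y': "frac Y = frac x + (Y - x)" using fr [of "Y - x"] Y by simp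
  have d': "frac (x + \<delta>) = frac x + \<delta>" using fr [of \<delta>] \<delta> by simp
  have "saw_reg \<delta> x = 1 / 2 - frac x - \<delta> / 2"
    using \<delta> by (simp add: saw_reg_def saw_prim_frac d' [unfolded add.commute [of x]] d' field_simps)
  then have "\<bar>(1 / 2 - frac Y) - saw_reg \<delta> x\<bar> \<le> 2 * \<delta>" using Y \<delta> Y' by linarith
  with tent_bounds(1) [of "2 * \<delta>" x] \<delta> show ?thesis by linarith
qed

text \<open>The n-th Fourier coefficient of the sawtooth, in every phase. It is of exact order 1 /
  n, and it is all that survives when sawtooth times cosine is averaged over an equidistributed
  phase.\<close>

lemma integral_sawtooth_cos:
  assumes n: "n > 0"
  shows "((\<lambda>y. (1 / 2 - y) * cos (2 * pi * real n * (y + c) + \<theta>)) has_integral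
     (- sin (2 * pi * real n * c + \<theta>) / (2 * pi * real n))) {0..1}"
proof -
  define w where "w = 2 * pi * real n"
  have w: "w > 0" using n by (simp add: w_def)
  define P where "P y = (1 / 2 - y) * sin (w * (y + c) + \<theta>) / w - cos (w * (y + c) + \<theta>) / w\<^sup>2" for y
  have "((\<lambda>y. (1 / 2 - y) * cos (w * (y + c) + \<theta>)) has_integral (P 1 - P 0)) {0..1}"
  proof (rule fundamental_theorem_of_calculus)
    fix y :: real
    have "(P has_real_derivative (1 / 2 - y) * cos (w * (y + c) + \<theta>)) (at y within {0..1})"
      unfolding P_def using w by (auto intro!: derivative_eq_intros simp: field_simps power2_eq_square)
    then show "(P has_vector_derivative (1 / 2 - y) * cos (w * (y + c) + \<theta>)) (at y within {0..1})"
      by (simp add: has_real_derivative_iff_has_vector_derivative)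
  qed simp
  moreover have "w * (1 + c) + \<theta> = (w * c + \<theta>) + 2 * pi * real n" by (simp add: w_def algebra_simps)
  then have "P 1 - P 0 = - sin (w * c + \<theta>) / w"
    using sin.plus_of_nat [of "w * c + \<theta>" n] cos.plus_of_nat [of "w * c + \<theta>" n] w
    by (simp add: P_def field_simps)
  ultimately show ?thesis by (simp add: w_def)
qed

lemma cos_add_2pi_nat: "cos (x + real n * (2 * pi)) = cos x"
  using cos.plus_of_nat [of x n] by (simp add: mult.commute mult.left_commute)

text \<open>The bounds of \<open>slow_phase_average\<close> for the regularised sawtooth times a
  cosine, with Lipschitz constant 1 / \<delta> + 2 * pi * n, and three times for the tent of radius
  2 * \<delta>. The constant blows up as \<delta> tends to 0, which is harmless because it gets
  divided by sqrt R with \<delta> fixed.\<close>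

definition sawtooth_const :: "real \<Rightarrow> real \<Rightarrow> real \<Rightarrow> nat \<Rightarrow> nat \<Rightarrow> real \<Rightarrow> real" where
  "sawtooth_const \<kappa> H a q n \<delta> =
     (H / a * (4 * sqrt \<kappa> + 2 * \<kappa> * sqrt \<kappa> + \<kappa>) + \<kappa> * H * (1 / \<delta> + 2 * pi * real n) * a * real q / 2)
      + 3 * (H / a * (4 * sqrt \<kappa> + 2 * \<kappa> * sqrt \<kappa> + \<kappa>) + \<kappa> * H * (1 / (2 * \<delta>)) * a * real q / 2)"

text \<open>The sawtooth of the perturbed phase is exchanged for \<open>saw_reg\<close> at the cost
  of tents, whose average is O(\<delta>). The Lipschitz product that remains averages to its mean,
  and this is O(\<delta>)-close to the Fourier coefficient. The error splits into a part small with
  \<delta>, uniformly in R, and a part small with R for fixed \<delta>.\<close>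

lemma sawtooth_average:
  fixes p :: int and q n :: nat and h Y :: "nat \<Rightarrow> real"
  assumes q: "q > 0" and n: "n > 0" and a: "a > 0" and \<delta>: "0 < \<delta>" "\<delta> \<le> 1 / 4" and k0: "\<kappa> > 0" and H0: "H \<ge> 0"
    and R: "R \<ge> 1" "R \<le> real M1" "M1 \<le> M2" "real M2 + real q + 1 \<le> \<kappa> * R"
    and h: "\<And>m. M1 \<le> m \<Longrightarrow> m \<le> M2 \<Longrightarrow> \<bar>h m\<bar> \<le> H / R"
      "\<And>m. M1 \<le> m \<Longrightarrow> m < M2 \<Longrightarrow> \<bar>h (Suc m) - h m\<bar> \<le> H / R\<^sup>2"
    and Y: "\<And>m. M1 \<le> m \<Longrightarrow> m < M2 \<Longrightarrow>
      \<bar>Y m - (of_int p / real q * real m + a * sqrt (real m) - c)\<bar> \<le> \<delta>"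
  shows "\<bar>(\<Sum>m = M1..<M2. h m * ((1 / 2 - frac (Y m)) *
          cos (2 * pi * real n * (of_int p / real q * real m + a * sqrt (real m) - c + c) + \<theta>)))
       + (\<Sum>m = M1..<M2. h m) * sin (2 * pi * real n * c + \<theta>) / (2 * pi * real n)\<bar>
     \<le> 40 * \<kappa> * H * \<delta> + sawtooth_const \<kappa> H a q n \<delta> / sqrt R"
proof -
  let ?S = "\<lambda>y. 1 / 2 - frac (y::real)"
  define M where "M = 1 / \<delta> + 2 * pi * real n"
  define K where "K = 4 * sqrt \<kappa> + 2 * \<kappa> * sqrt \<kappa> + \<kappa>"
  define C where "C = (1 * H / a * K + \<kappa> * H * M * a * real q / 2)
      + 3 * (1 * H / a * K + \<kappa> * H * (1 / (2 * \<delta>)) * a * real q / 2)"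
  have C: "C = sawtooth_const \<kappa> H a q n \<delta>" by (simp add: C_def sawtooth_const_def K_def M_def)
  define It where "It = integral {0..1} (tent (2 * \<delta>))"
  have It: "0 \<le> It" "It \<le> 4 * \<delta>"
    using integral_tent_le [of "2 * \<delta>"] \<delta> integrable_Lipschitz [OF tent_Lipschitz, of "2 * \<delta>"] tent_bounds(1) [of "2 * \<delta>"]
    by (auto simp: It_def intro!: Henstock_Kurzweil_Integration.integral_nonneg)
    define x where "x m = of_int p / real q * real m + a * sqrt (real m) - c" for m :: nat
    define cs where "cs y = cos (2 * pi * real n * (y + c) + \<theta>)" for y
    define F where "F y = saw_reg \<delta> y * cs y" for y
    define I0 where "I0 = integral {0..1} F"
    define s where "s = - sin (2 * pi * real n * c + \<theta>) / (2 * pi * real n)"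
    have csb: "\<bar>cs y\<bar> \<le> 1" for y by (simp add: cs_def)
    have csL: "\<bar>cs x - cs y\<bar> \<le> 2 * pi * real n * \<bar>x - y\<bar>" for x y
    proof -
      have "norm (cs x - cs y) \<le> 2 * pi * real n * norm (x - y)"
      proof (rule field_differentiable_bound [where S = UNIV and f' = "\<lambda>y. - sin (2 * pi * real n * (y + c) + \<theta>) * (2 * pi * real n)"])
        show "norm (- sin (2 * pi * real n * (y + c) + \<theta>) * (2 * pi * real n)) \<le> 2 * pi * real n" for y
          using mult_right_mono [of "\<bar>sin (2 * pi * real n * (y + c) + \<theta>)\<bar>" 1 "2 * pi * real n"] by (simp add: abs_mult)
      qed (auto simp: cs_def intro!: derivative_eq_intros)
      then show ?thesis by simp
    qed
    have csper: "cs (y + 1) = cs y" for y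
    proof -
      have e: "2 * pi * real n * (y + 1 + c) + \<theta> = (2 * pi * real n * (y + c) + \<theta>) + real n * (2 * pi)"
        by (simp add: algebra_simps)
      show ?thesis unfolding cs_def e by (rule cos_add_2pi_nat)
    qed
    have Flip: "M-lipschitz_on UNIV F"
    proof (rule lipschitz_onI)
      fix x y
      have "F x - F y = (saw_reg \<delta> x - saw_reg \<delta> y) * cs x + saw_reg \<delta> y * (cs x - cs y)"
        by (simp add: F_def algebra_simps)
      also have "\<bar>\<dots>\<bar> \<le> \<bar>x - y\<bar> / \<delta> * 1 + 1 * (2 * pi * real n * \<bar>x - y\<bar>)"
        unfolding abs_mult [symmetric]
        by (rule order_trans [OF abs_triangle_ineq], unfold abs_mult, intro add_mono mult_mono)
          (use saw_reg_Lipschitz [OF \<delta>(1)] csb csL order_trans [OF saw_reg_bound [OF \<delta>(1)]] \<delta> in auto)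
      finally show "dist (F x) (F y) \<le> M * dist x y" by (simp add: dist_real_def M_def algebra_simps)
    qed (use \<delta> in \<open>simp add: M_def\<close>)
    have Fb: "\<bar>F y\<bar> \<le> 1 / 2" for y
    proof -
      have "\<bar>saw_reg \<delta> y\<bar> * \<bar>cs y\<bar> \<le> 1 / 2 * 1"
        by (intro mult_mono) (use saw_reg_bound [OF \<delta>(1)] csb in auto)
      then show ?thesis by (simp add: F_def abs_mult)
    qed
    note Fi = integrable_Lipschitz [OF Flip]
    have I0b: "\<bar>I0\<bar> \<le> 1 / 2"
      using integral_bound [of 0 1 F "1 / 2"] Fb lipschitz_on_continuous_on [OF Flip]
      by (simp add: I0_def continuous_on_subset)
    have tl: "(1 / (2 * \<delta>))-lipschitz_on UNIV (tent (2 * \<delta>))" using tent_Lipschitz [of "2 * \<delta>"] \<delta> by simp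
    note ti = integrable_Lipschitz [OF tl]
    have I0s: "\<bar>I0 - s\<bar> \<le> 14 * \<delta>"
    proof -
      have e: "((\<lambda>y. (1 / 2 - y) * cs y) has_integral s) {0..1}"
        unfolding cs_def s_def by (rule integral_sawtooth_cos [OF n])
      have "\<bar>s - I0\<bar> = norm (integral {0..1} (\<lambda>y. (1 / 2 - y) * cs y - F y))"
        unfolding I0_def using e Fi by (subst Henstock_Kurzweil_Integration.integral_diff) (auto simp: integral_unique)
      also have "\<dots> \<le> integral {0..1} (\<lambda>y. 2 * \<delta> + 3 * tent (2 * \<delta>) y)"
      proof (rule integral_norm_bound_integral)
        show "(\<lambda>y. (1 / 2 - y) * cs y - F y) integrable_on {0..1}"
          using e Fi by (intro integrable_diff) auto
        show "(\<lambda>y. 2 * \<delta> + 3 * tent (2 * \<delta>) y) integrable_on {0..1}"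
          by (intro integrable_add integrable_const_ivl integrable_on_mult_right ti)
        fix y :: real assume y: "y \<in> {0..1}"
        have "\<bar>(1 / 2 - y) - saw_reg \<delta> y\<bar> \<le> 2 * \<delta> + 3 * tent (2 * \<delta>) y"
        \<comment> \<open>At the right end point \<open>frac\<close> is 0 and not 1; there the tent
          equals 1 and makes the bound trivial.\<close>
        proof (cases "y = 1")
          case True
          have "dist_int 1 = 0" by (simp add: dist_int_def frac_def)
          with True saw_reg_bound [OF \<delta>(1), of 1] \<delta> show ?thesis by (simp add: tent_def)
        next
          case False
          then have "frac y = y" using y by (simp add: frac_eq)
          with saw_reg_approx [OF \<delta>(1), of y y] \<delta> show ?thesis by simp
        qed
        then have "\<bar>(1 / 2 - y) - saw_reg \<delta> y\<bar> * \<bar>cs y\<bar> \<le> (2 * \<delta> + 3 * tent (2 * \<delta>) y) * 1"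
          using csb by (intro mult_mono) auto
        then show "norm ((1 / 2 - y) * cs y - F y) \<le> 2 * \<delta> + 3 * tent (2 * \<delta>) y"
          by (simp add: F_def abs_mult [symmetric] algebra_simps)
      qed
      also have "\<dots> = 2 * \<delta> + 3 * It"
        unfolding It_def
        by (subst Henstock_Kurzweil_Integration.integral_add) (use ti in \<open>auto intro!: integrable_on_mult_right\<close>)
      finally show ?thesis using It by linarith
    qed
    have N: "real (M2 - M1) \<le> \<kappa> * R" using R by (simp add: of_nat_diff)
    have HR: "real (M2 - M1) * (H / R) \<le> \<kappa> * H"
    proof -
      have "real (M2 - M1) * (H / R) \<le> \<kappa> * R * (H / R)" using N H0 R by (intro mult_right_mono) auto
      then show ?thesis using R by simp
    qed
    have A1: "\<bar>\<Sum>m = M1..<M2. h m * (F (x m) - I0)\<bar> \<le> (1 * H / a * K + \<kappa> * H * M * a * real q / 2) / sqrt R"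
      unfolding x_def K_def
    proof (rule slow_phase_average [where F = "\<lambda>x. F x - I0" and h = h, OF _ _ _ _ q a R h])
      show "M-lipschitz_on UNIV (\<lambda>x. F x - I0)"
        using Flip by (simp add: lipschitz_on_def dist_real_def)
      show "F (y + 1) - I0 = F y - I0" for y
        by (simp add: F_def saw_reg_periodic csper)
      show "integral {0..1} (\<lambda>x. F x - I0) = 0"
        by (subst Henstock_Kurzweil_Integration.integral_diff) (use Fi in \<open>auto simp: I0_def\<close>)
      show "\<bar>F y - I0\<bar> \<le> 1" for y using Fb [of y] I0b by linarith
    qed
    \<comment> \<open>The tents are averaged with the constant weight H / R, an upper bound for all
      weights, because they only enter as an error.\<close>
    have A2: "\<bar>\<Sum>m = M1..<M2. H / R * (tent (2 * \<delta>) (x m) - It)\<bar>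
        \<le> (1 * H / a * K + \<kappa> * H * (1 / (2 * \<delta>)) * a * real q / 2) / sqrt R"
      unfolding x_def K_def
    proof (rule slow_phase_average [where F = "\<lambda>x. tent (2 * \<delta>) x - It" and h = "\<lambda>_. H / R", OF _ _ _ _ q a R])
      show "(1 / (2 * \<delta>))-lipschitz_on UNIV (\<lambda>x. tent (2 * \<delta>) x - It)"
        using tl by (simp add: lipschitz_on_def dist_real_def)
      show "tent (2 * \<delta>) (y + 1) - It = tent (2 * \<delta>) y - It" for y by (simp add: tent_periodic)
      show "integral {0..1} (\<lambda>x. tent (2 * \<delta>) x - It) = 0"
        by (subst Henstock_Kurzweil_Integration.integral_diff) (use ti in \<open>auto simp: It_def\<close>)
      show "\<bar>tent (2 * \<delta>) y - It\<bar> \<le> 1" for y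
        using tent_bounds [of "2 * \<delta>" y] It \<delta> by auto
    qed (use H0 R in auto)
    have A2': "(\<Sum>m = M1..<M2. H / R * tent (2 * \<delta>) (x m))
        \<le> 4 * \<kappa> * H * \<delta> + (1 * H / a * K + \<kappa> * H * (1 / (2 * \<delta>)) * a * real q / 2) / sqrt R"
    proof -
      have "(\<Sum>m = M1..<M2. H / R * (tent (2 * \<delta>) (x m) - It))
         = (\<Sum>m = M1..<M2. H / R * tent (2 * \<delta>) (x m)) - real (M2 - M1) * (H / R) * It"
        by (simp add: right_diff_distrib sum_subtractf)
      moreover have "real (M2 - M1) * (H / R) * It \<le> (\<kappa> * H) * (4 * \<delta>)"
        by (rule mult_mono [OF HR]) (use It k0 H0 in auto)
      ultimately show ?thesis using A2 by (simp add: abs_le_iff)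
    qed
    have A3: "\<bar>(\<Sum>m = M1..<M2. h m * (?S (Y m) * cs (x m))) - (\<Sum>m = M1..<M2. h m * F (x m))\<bar>
        \<le> (\<Sum>m = M1..<M2. H / R * (2 * \<delta> + 3 * tent (2 * \<delta>) (x m)))"
      unfolding sum_subtractf [symmetric]
    proof (rule order_trans [OF sum_abs], rule sum_mono)
      fix m assume m: "m \<in> {M1..<M2}"
      have "\<bar>h m * (?S (Y m) * cs (x m)) - h m * F (x m)\<bar> = \<bar>h m\<bar> * (\<bar>?S (Y m) - saw_reg \<delta> (x m)\<bar> * \<bar>cs (x m)\<bar>)"
        unfolding abs_mult [symmetric] by (simp add: F_def algebra_simps)
      also have "\<dots> \<le> H / R * ((2 * \<delta> + 3 * tent (2 * \<delta>) (x m)) * 1)"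
        using h(1) [of m] m Y [of m] H0 R csb [of "x m"] saw_reg_approx [OF \<delta>(1), of "Y m" "x m"] tent_bounds(1) [of "2 * \<delta>" "x m"] \<delta>
        by (intro mult_mono) (auto simp: x_def)
      finally show "\<bar>h m * (?S (Y m) * cs (x m)) - h m * F (x m)\<bar> \<le> H / R * (2 * \<delta> + 3 * tent (2 * \<delta>) (x m))" by simp
    qed
    also have "(\<Sum>m = M1..<M2. H / R * (2 * \<delta> + 3 * tent (2 * \<delta>) (x m)))
        = 2 * \<delta> * (real (M2 - M1) * (H / R)) + 3 * (\<Sum>m = M1..<M2. H / R * tent (2 * \<delta>) (x m))"
      by (simp add: sum.distrib sum_distrib_left algebra_simps)
    also have "\<dots> \<le> 2 * \<delta> * (\<kappa> * H)
        + 3 * (4 * \<kappa> * H * \<delta> + (1 * H / a * K + \<kappa> * H * (1 / (2 * \<delta>)) * a * real q / 2) / sqrt R)"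
      using HR A2' \<delta> by (intro add_mono mult_left_mono) auto
    finally have A3: "\<bar>(\<Sum>m = M1..<M2. h m * (?S (Y m) * cs (x m))) - (\<Sum>m = M1..<M2. h m * F (x m))\<bar>
       \<le> 14 * \<kappa> * H * \<delta> + 3 * ((1 * H / a * K + \<kappa> * H * (1 / (2 * \<delta>)) * a * real q / 2) / sqrt R)"
      by (simp add: algebra_simps)
    have A4: "\<bar>(\<Sum>m = M1..<M2. h m) * (I0 - s)\<bar> \<le> 14 * \<kappa> * H * \<delta>"
    proof -
      have "\<bar>\<Sum>m = M1..<M2. h m\<bar> \<le> (\<Sum>m = M1..<M2. H / R)"
        by (rule order_trans [OF sum_abs]) (rule sum_mono, use h(1) in auto)
      then have "\<bar>\<Sum>m = M1..<M2. h m\<bar> \<le> \<kappa> * H" using HR by simp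
      then have "\<bar>\<Sum>m = M1..<M2. h m\<bar> * \<bar>I0 - s\<bar> \<le> (\<kappa> * H) * (14 * \<delta>)"
        using I0s k0 H0 by (intro mult_mono) auto
      then show ?thesis unfolding abs_mult by (simp add: mult_ac)
    qed
    have A1': "(\<Sum>m = M1..<M2. h m * (F (x m) - I0)) = (\<Sum>m = M1..<M2. h m * F (x m)) - (\<Sum>m = M1..<M2. h m) * I0"
      by (simp add: right_diff_distrib sum_subtractf sum_distrib_right)
    have "\<bar>(\<Sum>m = M1..<M2. h m * (?S (Y m) * cs (x m))) - (\<Sum>m = M1..<M2. h m) * s\<bar>
       \<le> 28 * \<kappa> * H * \<delta> + C / sqrt R"
      using A1 [unfolded A1'] A3 A4 unfolding C_def
      by (simp add: add_divide_distrib right_diff_distrib abs_le_iff)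
    also have "28 * \<kappa> * H * \<delta> \<le> 40 * \<kappa> * H * \<delta>" using k0 H0 \<delta> by simp
    finally show ?thesis unfolding C [symmetric]
      by (simp add: x_def cs_def s_def)
qed

subsection \<open>Telescoping along the level curves\<close>

lemma taylor_first:
  fixes A :: "real \<Rightarrow> real"
  assumes A: "\<And>x. (A has_real_derivative A1 x) (at x)" "\<And>x. (A1 has_real_derivative A2 x) (at x)"
    and S2: "\<And>x. \<bar>A2 x\<bar> \<le> S2"
  shows "\<bar>A (y + h) - A y - h * A1 y\<bar> \<le> S2 * h\<^sup>2"
proof -
  have S0: "S2 \<ge> 0" using S2 [of 0] by linarith
  have l: "\<bar>A1 (y + t) - A1 y\<bar> \<le> S2 * \<bar>t\<bar>" for t
  proof -
    have "norm (A1 (y + t) - A1 y) \<le> S2 * norm (y + t - y)"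
      by (rule field_differentiable_bound [where S = UNIV and f' = A2]) (use A(2) S2 in auto)
    then show ?thesis by simp
  qed
  have "norm ((A (y + h) - h * A1 y) - (A (y + 0) - 0 * A1 y)) \<le> (S2 * \<bar>h\<bar>) * norm (h - 0)"
  proof (rule field_differentiable_bound [where S = "closed_segment 0 h" and f' = "\<lambda>t. A1 (y + t) - A1 y"])
    fix t assume t: "t \<in> closed_segment 0 h"
    have "((\<lambda>t. A (y + t)) has_real_derivative A1 (y + t)) (at t)"
      using A(1) [of "t + y"] DERIV_shift [of A "A1 (t + y)" t y] by (simp add: add.commute)
    then have "((\<lambda>t. A (y + t) - t * A1 y) has_field_derivative (A1 (y + t) - A1 y)) (at t)"
      by (auto intro!: derivative_eq_intros)
    then show "((\<lambda>t. A (y + t) - t * A1 y) has_field_derivative (A1 (y + t) - A1 y)) (at t within closed_segment 0 h)"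
      by (rule has_field_derivative_at_within)
    have "\<bar>t\<bar> \<le> \<bar>h\<bar>" using t by (auto simp: closed_segment_eq_real_ivl split: if_splits)
    then show "norm (A1 (y + t) - A1 y) \<le> S2 * \<bar>h\<bar>" using l [of t] S0 mult_left_mono [of "\<bar>t\<bar>" "\<bar>h\<bar>" S2] by simp
  qed auto
  then show ?thesis by (simp add: power2_eq_square algebra_simps)
qed

lemma taylor_second:
  fixes A :: "real \<Rightarrow> real"
  assumes A: "\<And>x. (A has_real_derivative A1 x) (at x)" "\<And>x. (A1 has_real_derivative A2 x) (at x)"
    "\<And>x. (A2 has_real_derivative A3 x) (at x)"
    and S3: "\<And>x. \<bar>A3 x\<bar> \<le> S3"
  shows "\<bar>A (y + h) - A y - h * A1 y - h\<^sup>2 / 2 * A2 y\<bar> \<le> S3 * \<bar>h\<bar> ^ 3"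
proof -
  have S0: "S3 \<ge> 0" using S3 [of 0] by linarith
  have "norm ((A (y + h) - h * A1 y - h\<^sup>2 / 2 * A2 y) - (A (y + 0) - 0 * A1 y - 0\<^sup>2 / 2 * A2 y)) \<le> (S3 * h\<^sup>2) * norm (h - 0)"
  proof (rule field_differentiable_bound [where S = "closed_segment 0 h" and f' = "\<lambda>t. A1 (y + t) - A1 y - t * A2 y"])
    fix t assume t: "t \<in> closed_segment 0 h"
    have "((\<lambda>t. A (y + t)) has_real_derivative A1 (y + t)) (at t)"
      using A(1) [of "t + y"] DERIV_shift [of A "A1 (t + y)" t y] by (simp add: add.commute)
    then have "((\<lambda>t. A (y + t) - t * A1 y - t\<^sup>2 / 2 * A2 y) has_field_derivative (A1 (y + t) - A1 y - t * A2 y)) (at t)"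
      by (auto intro!: derivative_eq_intros)
    then show "((\<lambda>t. A (y + t) - t * A1 y - t\<^sup>2 / 2 * A2 y) has_field_derivative (A1 (y + t) - A1 y - t * A2 y)) (at t within closed_segment 0 h)"
      by (rule has_field_derivative_at_within)
    have "\<bar>t\<bar> \<le> \<bar>h\<bar>" using t by (auto simp: closed_segment_eq_real_ivl split: if_splits)
    then have "t\<^sup>2 \<le> h\<^sup>2" by (simp add: abs_le_square_iff)
    then show "norm (A1 (y + t) - A1 y - t * A2 y) \<le> S3 * h\<^sup>2"
      using taylor_first [OF A(2,3) S3, of y t] S0 mult_left_mono [of "t\<^sup>2" "h\<^sup>2" S3] by simp
  qed auto
  then show ?thesis by (simp add: power3_eq_cube power2_eq_square algebra_simps)
qed

text \<open>One time step along a path with increment \<open>d\<close>: the drift relative to the walk is \<open>d - 1/2\<close>.\<close>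

lemma adj_mean_step1:
  assumes f: "\<And>x. (f has_real_derivative f1 x) (at x)" "\<And>x. (f1 has_real_derivative f2 x) (at x)"
    and S2: "\<And>x. \<bar>f2 x\<bar> \<le> S2" and d: "0 \<le> d" "d \<le> 2"
  shows "\<bar>adj_mean (Suc m) f (y + d) - adj_mean m f y - (d - 1 / 2) * adj_mean m f1 y\<bar> \<le> 5 * S2"
proof -
  have S0: "S2 \<ge> 0" using S2 [of 0] by linarith
  note t = taylor_first [OF DERIV_adj_mean [OF f(1)] DERIV_adj_mean [OF f(2)] abs_adj_mean_bound [OF S2], of m y]
  have "d * d \<le> 2 * 2" using d by (intro mult_mono) auto
  then have d2: "d\<^sup>2 \<le> 4" by (simp add: power2_eq_square)
  have "\<bar>d - 1\<bar> * \<bar>d - 1\<bar> \<le> 1 * 1" using d by (intro mult_mono) auto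
  then have d1: "(d - 1)\<^sup>2 \<le> 1" by (simp add: power2_eq_square)
  have e: "y + d - 1 = y + (d - 1)" by simp
  have "\<bar>adj_mean m f (y + d) - adj_mean m f y - d * adj_mean m f1 y\<bar> \<le> S2 * 4"
    using t [of d] mult_left_mono [OF d2 S0] by linarith
  moreover have "\<bar>adj_mean m f (y + (d - 1)) - adj_mean m f y - (d - 1) * adj_mean m f1 y\<bar> \<le> S2 * 1"
    using t [of "d - 1"] mult_left_mono [OF d1 S0] by linarith
  ultimately show ?thesis unfolding adj_mean_Suc e using S0 by (simp add: abs_le_iff field_simps)
qed

text \<open>The second-order coefficient is half the mean of the squares of d and d - 1, the
  displacements of the path relative to the two branches of the averaging. The branches have
  third-order errors 8 * S3 and S3, whose mean is below 5 * S3.\<close>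

lemma adj_mean_step2:
  assumes f: "\<And>x. (f has_real_derivative f1 x) (at x)" "\<And>x. (f1 has_real_derivative f2 x) (at x)"
    "\<And>x. (f2 has_real_derivative f3 x) (at x)"
    and S3: "\<And>x. \<bar>f3 x\<bar> \<le> S3" and d: "0 \<le> d" "d \<le> 2"
  shows "\<bar>adj_mean (Suc m) f (y + d) - adj_mean m f y - (d - 1 / 2) * adj_mean m f1 y
     - (d\<^sup>2 + (d - 1)\<^sup>2) / 4 * adj_mean m f2 y\<bar> \<le> 5 * S3"
proof -
  have S0: "S3 \<ge> 0" using S3 [of 0] by linarith
  note t = taylor_second [OF DERIV_adj_mean [OF f(1)] DERIV_adj_mean [OF f(2)] DERIV_adj_mean [OF f(3)]
      abs_adj_mean_bound [OF S3], of m y]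
  have "\<bar>d\<bar> ^ 3 \<le> 2 ^ 3" using d by (intro power_mono) auto
  then have d2: "\<bar>d\<bar> ^ 3 \<le> 8" by simp
  have d1: "\<bar>d - 1\<bar> ^ 3 \<le> 1" using d by (intro power_le_one) auto
  have e: "y + d - 1 = y + (d - 1)" by simp
  have 1: "\<bar>adj_mean m f (y + d) - adj_mean m f y - d * adj_mean m f1 y - d\<^sup>2 / 2 * adj_mean m f2 y\<bar> \<le> S3 * 8"
    using t [of d] mult_left_mono [OF d2 S0] by linarith
  have 2: "\<bar>adj_mean m f (y + (d - 1)) - adj_mean m f y - (d - 1) * adj_mean m f1 y - (d - 1)\<^sup>2 / 2 * adj_mean m f2 y\<bar> \<le> S3 * 1"
    using t [of "d - 1"] mult_left_mono [OF d1 S0] by linarith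
  have "adj_mean (Suc m) f (y + d) - adj_mean m f y - (d - 1 / 2) * adj_mean m f1 y
     - (d\<^sup>2 + (d - 1)\<^sup>2) / 4 * adj_mean m f2 y =
     ((adj_mean m f (y + d) - adj_mean m f y - d * adj_mean m f1 y - d\<^sup>2 / 2 * adj_mean m f2 y) +
      (adj_mean m f (y + (d - 1)) - adj_mean m f y - (d - 1) * adj_mean m f1 y - (d - 1)\<^sup>2 / 2 * adj_mean m f2 y)) / 2"
    unfolding adj_mean_Suc e by (simp add: field_simps)
  moreover have "\<bar>(a + b) / 2\<bar> \<le> 5 * S3" if "\<bar>a\<bar> \<le> S3 * 8" "\<bar>b\<bar> \<le> S3 * 1" for a b
    using abs_le_D1 [OF that(1)] abs_le_D2 [OF that(1)] abs_le_D1 [OF that(2)] abs_le_D2 [OF that(2)] S0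
    by (intro abs_leI) (simp_all add: field_simps)
  ultimately show ?thesis using 1 2 by presburger
qed

text \<open>A monotone weight has total variation v M2 - v M1. So the full weight meets only the end
  values of \<open>Z\<close>, and the uniform bound \<open>S\<close> is multiplied by the small
  variation alone.\<close>

lemma increasing_weight_telescope:
  fixes v Z :: "nat \<Rightarrow> real"
  assumes M: "M1 \<le> M2" and v: "\<And>m. M1 \<le> m \<Longrightarrow> m < M2 \<Longrightarrow> v m \<le> v (Suc m)" "0 \<le> v M1"
    and Z: "\<And>m. \<bar>Z m\<bar> \<le> S"
  shows "\<bar>\<Sum>m = M1..<M2. v m * (Z (Suc m) - Z m)\<bar> \<le> v M2 * (\<bar>Z M2\<bar> + \<bar>Z M1\<bar>) + S * (v M2 - v M1)"
proof -
  have vm: "v M1 \<le> v M2" using M v(1) by (induction M2 rule: dec_induct) (force intro: order_trans)+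
  have "\<bar>\<Sum>m = M1..<M2. Z (Suc m) * (v (Suc m) - v m)\<bar> \<le> (\<Sum>m = M1..<M2. S * (v (Suc m) - v m))"
  proof (rule order_trans [OF sum_abs], rule sum_mono)
    fix m assume "m \<in> {M1..<M2}"
    then show "\<bar>Z (Suc m) * (v (Suc m) - v m)\<bar> \<le> S * (v (Suc m) - v m)"
      unfolding abs_mult using v(1) [of m] Z [of "Suc m"] by (intro mult_mono) auto
  qed
  also have "\<dots> = S * (v M2 - v M1)"
    using sum_Suc_diff' [OF M, of v] by (simp add: sum_distrib_left [symmetric])
  finally have 1: "\<bar>\<Sum>m = M1..<M2. Z (Suc m) * (v (Suc m) - v m)\<bar> \<le> S * (v M2 - v M1)" .
  have 2: "\<bar>v M1 * Z M1\<bar> \<le> v M2 * \<bar>Z M1\<bar>" using vm v(2) by (simp add: abs_mult mult_right_mono)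
  have 3: "\<bar>v M2 * Z M2\<bar> = v M2 * \<bar>Z M2\<bar>" using vm v(2) by (simp add: abs_mult)
  show ?thesis unfolding summation_by_parts [OF M] using 1 2 3 by (simp only: distrib_left)
qed

text \<open>One step along the path changes the averaged f by (d - 1 / 2) times the averaged f1,
  plus a multiple of the averaged f2, up to third order. Dividing by d - 1 / 2 expresses f1 by a
  telescoping difference and an f2 term. The sum of the latter need not be small, but the
  first-order step applied to f1 turns it into a telescoping difference as well, so that only third
  derivatives are summed in absolute value.\<close>

lemma adj_mean_derivative_sum:
  fixes d y :: "nat \<Rightarrow> real"
  assumes f: "\<And>x. (f has_real_derivative f1 x) (at x)" "\<And>x. (f1 has_real_derivative f2 x) (at x)"
    "\<And>x. (f2 has_real_derivative f3 x) (at x)"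
    and S: "\<And>x. \<bar>f x\<bar> \<le> S0" "\<And>x. \<bar>f1 x\<bar> \<le> S1" "\<And>x. \<bar>f3 x\<bar> \<le> S3"
    and y: "\<And>m. y (Suc m) = y m + d m" and M: "M1 \<le> M2" and \<beta>: "\<beta> > 0"
    and d: "\<And>m. M1 \<le> m \<Longrightarrow> m \<le> M2 \<Longrightarrow> 1 / 2 + \<beta> \<le> d m \<and> d m \<le> 2"
      "\<And>m. M1 \<le> m \<Longrightarrow> m < M2 \<Longrightarrow> d (Suc m) \<le> d m"
  shows "\<bar>\<Sum>m = M1..<M2. adj_mean m f1 (y m)\<bar> \<le>
     (\<bar>adj_mean M2 f (y M2)\<bar> + \<bar>adj_mean M1 f (y M1)\<bar>) / \<beta>
     + S0 * (1 / (d M2 - 1 / 2) - 1 / (d M1 - 1 / 2))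
     + 3 * (1 + 1 / \<beta>\<^sup>2) * S1 + real (M2 - M1) * (5 / \<beta> + 5 * (1 + 1 / \<beta>\<^sup>2)) * S3"
proof -
  define v where "v m = 1 / (d m - 1 / 2)" for m
  \<comment> \<open>This is \<open>(v m)\<close> squared times \<open>K m\<close>, written so that
    monotonicity is visible; it is the weight for which w * (d - 1 / 2) = v * K.\<close>
  define w where "w m = 1 / 2 + (v m)\<^sup>2 / 8" for m
  define Z where "Z m = adj_mean m f (y m)" for m
  define Z1 where "Z1 m = adj_mean m f1 (y m)" for m
  define Z2 where "Z2 m = adj_mean m f2 (y m)" for m
  define K where "K m = ((d m)\<^sup>2 + (d m - 1)\<^sup>2) / 4" for m
  have S10: "S1 \<ge> 0" using S(2) [of 0] by linarith
  have S30: "S3 \<ge> 0" using S(3) [of 0] by linarith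
  have vpos: "0 < v m" "v m \<le> 1 / \<beta>" "v m * (d m - 1 / 2) = 1" if "M1 \<le> m" "m \<le> M2" for m
    using d(1) [OF that] \<beta> by (auto simp: v_def frac_le)
  have vinc: "v m \<le> v (Suc m)" if "M1 \<le> m" "m < M2" for m
    unfolding v_def using d(1) [of m] d(1) [of "Suc m"] d(2) [OF that] that \<beta> by (intro divide_left_mono) auto
  have wb: "0 < w m" "w m \<le> 1 + 1 / \<beta>\<^sup>2" if "M1 \<le> m" "m \<le> M2" for m
  proof -
    have "(v m)\<^sup>2 \<le> (1 / \<beta>)\<^sup>2" using vpos [OF that] by (intro power_mono) auto
    then have "(v m)\<^sup>2 \<le> 1 / \<beta>\<^sup>2" by (simp add: power_divide)
    with zero_le_power2 [of "v m"] show "w m \<le> 1 + 1 / \<beta>\<^sup>2" unfolding w_def by linarith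
    show "0 < w m" unfolding w_def by (simp add: add_pos_nonneg)
  qed
  have winc: "w m \<le> w (Suc m)" if "M1 \<le> m" "m < M2" for m
    unfolding w_def using vinc [OF that] vpos(1) [of m] that by (simp add: power_mono)
  have vK: "(v m)\<^sup>2 * K m = w m" if "M1 \<le> m" "m \<le> M2" for m
  proof -
    have "K m = (d m - 1 / 2)\<^sup>2 / 2 + 1 / 8" by (simp add: K_def power2_eq_square field_simps)
    then have "(v m)\<^sup>2 * K m = (v m * (d m - 1 / 2))\<^sup>2 / 2 + (v m)\<^sup>2 / 8"
      by (simp add: power_mult_distrib distrib_left)
    then show ?thesis using vpos(3) [OF that] by (simp add: w_def)
  qed
  have d02: "0 \<le> d m" "d m \<le> 2" if "M1 \<le> m" "m \<le> M2" for m using d(1) [OF that] \<beta> by auto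
  have st2: "\<bar>v m * (Z (Suc m) - Z m) - Z1 m - v m * K m * Z2 m\<bar> \<le> 5 / \<beta> * S3" if m: "M1 \<le> m" "m < M2" for m
  proof -
    have m': "m \<le> M2" using m by simp
    have "v m * (Z (Suc m) - Z m) - Z1 m - v m * K m * Z2 m
       = v m * (Z (Suc m) - Z m) - (v m * (d m - 1 / 2)) * Z1 m - v m * K m * Z2 m" using vpos(3) [OF m(1) m'] by simp
    also have "\<dots> = v m * (Z (Suc m) - Z m - (d m - 1 / 2) * Z1 m - K m * Z2 m)" by (simp add: algebra_simps)
    also have "\<bar>\<dots>\<bar> = v m * \<bar>Z (Suc m) - Z m - (d m - 1 / 2) * Z1 m - K m * Z2 m\<bar>"
      using vpos(1) [OF m(1) m'] by (simp add: abs_mult)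
    also have "\<dots> \<le> 1 / \<beta> * (5 * S3)"
      using adj_mean_step2 [OF f S(3) d02 [OF m(1) m'], of m "y m"] vpos [OF m(1) m']
\<beta>
      by (intro mult_mono) (auto simp: Z_def Z1_def Z2_def K_def y)
    finally show ?thesis by simp
  qed
  have st1: "\<bar>w m * (Z1 (Suc m) - Z1 m) - v m * K m * Z2 m\<bar> \<le> 5 * (1 + 1 / \<beta>\<^sup>2) * S3" if m: "M1 \<le> m" "m < M2" for m
  proof -
    have m': "m \<le> M2" using m by simp
    have "w m * (d m - 1 / 2) = v m * K m * (v m * (d m - 1 / 2))"
      unfolding vK [OF m(1) m', symmetric] by (simp add: power2_eq_square)
    then have wd: "w m * (d m - 1 / 2) = v m * K m" using vpos(3) [OF m(1) m'] by simp
    have "w m * (Z1 (Suc m) - Z1 m) - v m * K m * Z2 m = w m * (Z1 (Suc m) - Z1 m - (d m - 1 / 2) * Z2 m)"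
      unfolding wd [symmetric] by (simp add: algebra_simps)
    also have "\<bar>\<dots>\<bar> = w m * \<bar>Z1 (Suc m) - Z1 m - (d m - 1 / 2) * Z2 m\<bar>"
      using wb(1) [OF m(1) m'] by (simp add: abs_mult)
    also have "\<dots> \<le> (1 + 1 / \<beta>\<^sup>2) * (5 * S3)"
      using adj_mean_step1 [OF f(2,3) S(3) d02 [OF m(1) m'], of m "y m"] wb [OF m(1) m']
      by (intro mult_mono) (auto simp: Z1_def Z2_def y)
    finally show ?thesis by (simp add: algebra_simps)
  qed
  have E1: "\<bar>(\<Sum>m = M1..<M2. v m * (Z (Suc m) - Z m) - Z1 m - v m * K m * Z2 m)\<bar> \<le> real (M2 - M1) * (5 / \<beta> * S3)"
  proof -
    have "\<bar>(\<Sum>m = M1..<M2. v m * (Z (Suc m) - Z m) - Z1 m - v m * K m * Z2 m)\<bar> \<le> (\<Sum>m = M1..<M2. 5 / \<beta> * S3)"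
      by (rule order_trans [OF sum_abs], rule sum_mono, rule st2) auto
    then show ?thesis by simp
  qed
  have E2: "\<bar>(\<Sum>m = M1..<M2. w m * (Z1 (Suc m) - Z1 m) - v m * K m * Z2 m)\<bar> \<le> real (M2 - M1) * (5 * (1 + 1 / \<beta>\<^sup>2) * S3)"
  proof -
    have "\<bar>(\<Sum>m = M1..<M2. w m * (Z1 (Suc m) - Z1 m) - v m * K m * Z2 m)\<bar> \<le> (\<Sum>m = M1..<M2. 5 * (1 + 1 / \<beta>\<^sup>2) * S3)"
      by (rule order_trans [OF sum_abs], rule sum_mono, rule st1) auto
    then show ?thesis by simp
  qed
  have E3: "\<bar>\<Sum>m = M1..<M2. v m * (Z (Suc m) - Z m)\<bar> \<le> (\<bar>Z M2\<bar> + \<bar>Z M1\<bar>) / \<beta> + S0 * (v M2 - v M1)"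
  proof -
    have "\<bar>\<Sum>m = M1..<M2. v m * (Z (Suc m) - Z m)\<bar> \<le> v M2 * (\<bar>Z M2\<bar> + \<bar>Z M1\<bar>) + S0 * (v M2 - v M1)"
      by (rule increasing_weight_telescope [OF M]) (use vinc vpos(1) [of M1] M abs_adj_mean_bound [OF S(1)] in \<open>auto simp: Z_def\<close>)
    also have "v M2 * (\<bar>Z M2\<bar> + \<bar>Z M1\<bar>) \<le> 1 / \<beta> * (\<bar>Z M2\<bar> + \<bar>Z M1\<bar>)"
      using vpos(2) [of M2] M by (intro mult_right_mono) auto
    finally show ?thesis by simp
  qed
  have E4: "\<bar>\<Sum>m = M1..<M2. w m * (Z1 (Suc m) - Z1 m)\<bar> \<le> 3 * (1 + 1 / \<beta>\<^sup>2) * S1"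
  proof -
    have Zb: "\<bar>Z1 m\<bar> \<le> S1" for m unfolding Z1_def by (rule abs_adj_mean_bound [OF S(2)])
    have "\<bar>\<Sum>m = M1..<M2. w m * (Z1 (Suc m) - Z1 m)\<bar> \<le> w M2 * (\<bar>Z1 M2\<bar> + \<bar>Z1 M1\<bar>) + S1 * (w M2 - w M1)"
      by (rule increasing_weight_telescope [OF M]) (use winc wb(1) [of M1] M Zb in auto)
    also have "w M2 * (\<bar>Z1 M2\<bar> + \<bar>Z1 M1\<bar>) \<le> (1 + 1 / \<beta>\<^sup>2) * (S1 + S1)"
      using wb [of M2] M Zb by (intro mult_mono add_mono) auto
    also have "S1 * (w M2 - w M1) \<le> S1 * (1 + 1 / \<beta>\<^sup>2)"
      using wb [of M2] wb [of M1] M S10 by (intro mult_left_mono) auto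
    finally show ?thesis by (simp add: algebra_simps)
  qed
  \<comment> \<open>An exact identity: the terms v * K * Z2 cancel between the second-order step for
    \<open>Z\<close> and the first-order step for \<open>Z1\<close>.\<close>
  have "(\<Sum>m = M1..<M2. Z1 m) = (\<Sum>m = M1..<M2. v m * (Z (Suc m) - Z m))
      - (\<Sum>m = M1..<M2. v m * (Z (Suc m) - Z m) - Z1 m - v m * K m * Z2 m)
      + (\<Sum>m = M1..<M2. w m * (Z1 (Suc m) - Z1 m) - v m * K m * Z2 m)
      - (\<Sum>m = M1..<M2. w m * (Z1 (Suc m) - Z1 m))"
    unfolding sum_subtractf [symmetric] sum.distrib [symmetric] by (rule sum.cong) auto
  also have "\<bar>\<dots>\<bar> \<le> ((\<bar>Z M2\<bar> + \<bar>Z M1\<bar>) / \<beta> + S0 * (v M2 - v M1)) + real (M2 - M1) * (5 / \<beta> * S3)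
      + real (M2 - M1) * (5 * (1 + 1 / \<beta>\<^sup>2) * S3) + 3 * (1 + 1 / \<beta>\<^sup>2) * S1"
    using E1 E2 E3 E4 by linarith
  finally have r: "\<bar>\<Sum>m = M1..<M2. Z1 m\<bar> \<le> ((\<bar>Z M2\<bar> + \<bar>Z M1\<bar>) / \<beta> + S0 * (v M2 - v M1)) + real (M2 - M1) * (5 / \<beta> * S3)
      + real (M2 - M1) * (5 * (1 + 1 / \<beta>\<^sup>2) * S3) + 3 * (1 + 1 / \<beta>\<^sup>2) * S1" .
  have e: "real (M2 - M1) * (5 / \<beta> + 5 * (1 + 1 / \<beta>\<^sup>2)) * S3
    = real (M2 - M1) * (5 / \<beta> * S3) + real (M2 - M1) * (5 * (1 + 1 / \<beta>\<^sup>2) * S3)"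
    by (simp only: distrib_left distrib_right mult.assoc)
  show ?thesis unfolding e using r unfolding Z_def Z1_def v_def by linarith
qed

subsection \<open>Oscillating test functions\<close>

definition hat :: "real \<Rightarrow> real" where
  "hat s = max 0 ((s - 1) * (2 - s))"

lemma DERIV_max_power:
  fixes x :: real
  shows "((\<lambda>x. max 0 x ^ Suc (Suc n)) has_real_derivative real (Suc (Suc n)) * max 0 x ^ Suc n) (at x)"
proof -
  consider "x > 0" | "x < 0" | "x = 0" by linarith
  then show ?thesis
  proof cases
    case 1
    have "((\<lambda>x. x ^ Suc (Suc n)) has_real_derivative real (Suc (Suc n)) * x ^ Suc n) (at x)"
      using DERIV_pow [of "Suc (Suc n)" x] by simp
    then have "((\<lambda>x. max 0 x ^ Suc (Suc n)) has_real_derivative real (Suc (Suc n)) * x ^ Suc n) (at x)"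
      by (rule has_field_derivative_transform_within_open [where S = "{0<..}"]) (use 1 in auto)
    with 1 show ?thesis by simp
  next
    case 2
    have "((\<lambda>x. max 0 x ^ Suc (Suc n)) has_real_derivative 0) (at x)"
      by (rule has_field_derivative_transform_within_open [where S = "{..<0}" and f = "\<lambda>_. 0"]) (use 2 in auto)
    with 2 show ?thesis by simp
  next
    case 3
    have "((\<lambda>h. max 0 (h::real) ^ Suc n) \<longlongrightarrow> max 0 0 ^ Suc n) (at 0)"
      by (intro tendsto_intros)
    then have "((\<lambda>h. max 0 (h::real) ^ Suc n) \<longlongrightarrow> 0) (at 0)" by simp
    moreover have "\<forall>\<^sub>F h in at 0. max 0 (h::real) ^ Suc n = (max 0 (0 + h) ^ Suc (Suc n) - max 0 0 ^ Suc (Suc n)) / h"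
      by (rule eventually_at_filter [THEN iffD2]) (auto simp: max_def)
    ultimately have "((\<lambda>h. (max 0 (0 + h) ^ Suc (Suc n) - max 0 0 ^ Suc (Suc n)) / h) \<longlongrightarrow> 0) (at (0::real))"
      by (rule Lim_transform_eventually)
    then show ?thesis unfolding 3 DERIV_def by simp
  qed
qed

lemma DERIV_hat_power:
  "((\<lambda>s. hat s ^ Suc (Suc n)) has_real_derivative real (Suc (Suc n)) * hat s ^ Suc n * (3 - 2 * s)) (at s)"
proof -
  have "((\<lambda>s. (s - 1) * (2 - s)) has_real_derivative (3 - 2 * s)) (at s)"
    by (auto intro!: derivative_eq_intros)
  from DERIV_chain2 [OF DERIV_max_power [of n "(s - 1) * (2 - s)"] this] show ?thesis
    by (simp only: hat_def)
qed

text \<open>The fourth power is the lowest power of \<open>hat\<close> that is three times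
  differentiable at the ends of the support, as the Taylor estimates require.\<close>

definition rho0 :: "real \<Rightarrow> real" where "rho0 s = hat s ^ 4"
definition rho1 :: "real \<Rightarrow> real" where "rho1 s = 4 * hat s ^ 3 * (3 - 2 * s)"
definition rho2 :: "real \<Rightarrow> real" where "rho2 s = 12 * hat s ^ 2 * (3 - 2 * s)\<^sup>2 - 8 * hat s ^ 3"
definition rho3 :: "real \<Rightarrow> real" where
  "rho3 s = 24 * hat s * (3 - 2 * s) ^ 3 - 72 * hat s ^ 2 * (3 - 2 * s)"

lemma DERIV_hat:
  "((\<lambda>s. hat s ^ 2) has_real_derivative 2 * hat s * (3 - 2 * s)) (at s)"
  "((\<lambda>s. hat s ^ 3) has_real_derivative 3 * hat s ^ 2 * (3 - 2 * s)) (at s)"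
  "((\<lambda>s. hat s ^ 4) has_real_derivative 4 * hat s ^ 3 * (3 - 2 * s)) (at s)"
  using DERIV_hat_power [of 0 s] DERIV_hat_power [of 1 s] DERIV_hat_power [of 2 s]
  by (simp_all add: numeral_eq_Suc)

lemma DERIV_rho:
  "(rho0 has_real_derivative rho1 s) (at s)"
  "(rho1 has_real_derivative rho2 s) (at s)"
  "(rho2 has_real_derivative rho3 s) (at s)"
proof -
  have e: "rho0 = (\<lambda>s. hat s ^ 4)" "rho1 = (\<lambda>s. 4 * hat s ^ 3 * (3 - 2 * s))"
    "rho2 = (\<lambda>s. 12 * hat s ^ 2 * (3 - 2 * s)\<^sup>2 - 8 * hat s ^ 3)"
    by (auto simp: rho0_def rho1_def rho2_def)
  show "(rho0 has_real_derivative rho1 s) (at s)" unfolding e(1) rho1_def by (rule DERIV_hat)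
  have 1: "((\<lambda>s. 4 * h s * (3 - 2 * s)) has_real_derivative 4 * h' * (3 - 2 * s) - 8 * h s) (at s)"
    if "(h has_real_derivative h') (at s)" for h h'
    by (auto intro!: derivative_eq_intros that)
  show "(rho1 has_real_derivative rho2 s) (at s)" unfolding e(2) rho2_def
    by (rule DERIV_cong [OF 1 [OF DERIV_hat(2)]]) (simp add: power2_eq_square algebra_simps)
  have 2: "((\<lambda>s. 12 * h s * (3 - 2 * s)\<^sup>2 - 8 * k s) has_real_derivative
      12 * h' * (3 - 2 * s)\<^sup>2 - 48 * h s * (3 - 2 * s) - 8 * k') (at s)"
    if "(h has_real_derivative h') (at s)" "(k has_real_derivative k') (at s)" for h h' k k'
    by (auto intro!: derivative_eq_intros that simp: algebra_simps)
  show "(rho2 has_real_derivative rho3 s) (at s)" unfolding e(3) rho3_def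
    by (rule DERIV_cong [OF 2 [OF DERIV_hat(1,2)]]) (simp add: power3_eq_cube power2_eq_square algebra_simps)
qed

lemma hat_eq_0: "s \<le> 1 \<or> 2 \<le> s \<Longrightarrow> hat s = 0"
  by (auto simp: hat_def max_def mult_nonneg_nonpos mult_nonpos_nonneg zero_le_mult_iff)

lemma rho_eq_0:
  assumes "s \<le> 1 \<or> 2 \<le> s"
  shows "rho0 s = 0" "rho1 s = 0" "rho2 s = 0" "rho3 s = 0"
  using hat_eq_0 [OF assms] by (simp_all add: rho0_def rho1_def rho2_def rho3_def)

lemma hat_bounds: "0 \<le> hat s" "hat s \<le> 1 / 4"
proof -
  have "(s - 1) * (2 - s) = 1 / 4 - (s - 3 / 2)\<^sup>2" by (simp add: power2_eq_square field_simps)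
  then have "(s - 1) * (2 - s) \<le> 1 / 4" using zero_le_power2 [of "s - 3 / 2"] by linarith
  then show "hat s \<le> 1 / 4" by (simp add: hat_def)
qed (simp add: hat_def)

lemma rho_bounds: "0 \<le> rho0 s" "rho0 s \<le> 1" "\<bar>rho0 s\<bar> \<le> 100" "\<bar>rho1 s\<bar> \<le> 100" "\<bar>rho2 s\<bar> \<le> 100" "\<bar>rho3 s\<bar> \<le> 100"
proof -
  have h: "0 \<le> hat s" "hat s \<le> 1" using hat_bounds [of s] by auto
  have hk: "\<bar>hat s ^ k\<bar> \<le> 1" for k using h by (simp add: power_le_one)
  show "0 \<le> rho0 s" "rho0 s \<le> 1" using h hk [of 4] by (auto simp: rho0_def)
  have "\<bar>rho0 s\<bar> \<le> 100 \<and> \<bar>rho1 s\<bar> \<le> 100 \<and> \<bar>rho2 s\<bar> \<le> 100 \<and> \<bar>rho3 s\<bar> \<le> 100"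
  proof (cases "s \<le> 1 \<or> 2 \<le> s")
    case True
    with rho_eq_0 show ?thesis by simp
  next
    case False
    then have t: "\<bar>3 - 2 * s\<bar> \<le> 1" by auto
    have tk: "\<bar>(3 - 2 * s) ^ j\<bar> \<le> 1" for j using t by (simp add: power_abs power_le_one)
    have p: "\<bar>hat s ^ k * (3 - 2 * s) ^ j\<bar> \<le> 1" for k j
      unfolding abs_mult using mult_mono [OF hk tk] by simp
    have e: "rho1 s = 4 * (hat s ^ 3 * (3 - 2 * s) ^ 1)"
      "rho2 s = 12 * (hat s ^ 2 * (3 - 2 * s) ^ 2) - 8 * hat s ^ 3"
      "rho3 s = 24 * (hat s ^ 1 * (3 - 2 * s) ^ 3) - 72 * (hat s ^ 2 * (3 - 2 * s) ^ 1)"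
      by (simp_all add: rho1_def rho2_def rho3_def)
    have l: "\<bar>4 * x\<bar> \<le> 100" "\<bar>12 * x - 8 * y\<bar> \<le> 100" "\<bar>24 * x - 72 * y\<bar> \<le> 100"
      if "\<bar>x\<bar> \<le> 1" "\<bar>y\<bar> \<le> 1" for x y :: real
      using that by linarith+
    have "\<bar>rho0 s\<bar> \<le> 100" using hk [of 4] by (simp add: rho0_def)
    moreover have "\<bar>rho1 s\<bar> \<le> 100" unfolding e by (rule l(1) [OF p p])
    moreover have "\<bar>rho2 s\<bar> \<le> 100" unfolding e by (rule l(2) [OF p hk])
    moreover have "\<bar>rho3 s\<bar> \<le> 100" unfolding e by (rule l(3) [OF p p])
    ultimately show ?thesis by blast
  qed
  then show "\<bar>rho0 s\<bar> \<le> 100" "\<bar>rho1 s\<bar> \<le> 100" "\<bar>rho2 s\<bar> \<le> 100" "\<bar>rho3 s\<bar> \<le> 100" by auto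
qed

text \<open>A family closed under differentiation up to linear combinations: a derivative falls on
  the cut-off (factor 1 / L), on the power (two more factors 1 / sqrt b) or on the cosine (one more
  factor 1 / sqrt b and a phase shift by pi / 2). For b <= 0 the remaining factors are meaningless,
  but the cut-offs in use vanish there.\<close>

definition wave :: "real \<Rightarrow> real \<Rightarrow> (real \<Rightarrow> real) \<Rightarrow> nat \<Rightarrow> real \<Rightarrow> real \<Rightarrow> real" where
  "wave L \<alpha> r k \<phi> b = r (b / L) * (1 / sqrt b) ^ k * cos (\<alpha> * sqrt b + \<phi>)"

definition dwave :: "real \<Rightarrow> real \<Rightarrow> (real \<Rightarrow> real) \<Rightarrow> (real \<Rightarrow> real) \<Rightarrow> nat \<Rightarrow> real \<Rightarrow> real \<Rightarrow> real" where
  "dwave L \<alpha> r r' k \<phi> b = wave L \<alpha> r' k \<phi> b / L - real k / 2 * wave L \<alpha> r (k + 2) \<phi> b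
     + \<alpha> / 2 * wave L \<alpha> r (k + 1) (\<phi> + pi / 2) b"

lemma DERIV_wave:
  assumes L: "L > 0" and r: "\<And>s. (r has_real_derivative r' s) (at s)"
    and z: "\<And>s. s \<le> 1 \<Longrightarrow> r s = 0" "\<And>s. s \<le> 1 \<Longrightarrow> r' s = 0"
  shows "(wave L \<alpha> r k \<phi> has_real_derivative dwave L \<alpha> r r' k \<phi> b) (at b)"
proof (cases "b > 0")
  case True
  have e: "wave L \<alpha> r k \<phi> = (\<lambda>b. r (b / L) * ((1 / sqrt b) ^ k * cos (\<alpha> * sqrt b + \<phi>)))"
    by (auto simp: wave_def)
  have sq: "sqrt b > 0" using True by simp
  have dr: "((\<lambda>b. r (b / L)) has_real_derivative r' (b / L) * (1 / L)) (at b)"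
    by (rule DERIV_chain2 [OF r]) (use L in \<open>auto intro!: derivative_eq_intros\<close>)
  have ds: "(sqrt has_real_derivative 1 / sqrt b / 2) (at b)"
    using DERIV_real_sqrt [OF True] by (simp add: field_simps)
  have di: "((\<lambda>b. (1 / sqrt b) ^ k) has_real_derivative (- (real k / 2) * (1 / sqrt b) ^ (k + 2))) (at b)"
  proof (cases k)
    case (Suc j)
    have "((\<lambda>b. 1 / sqrt b) has_real_derivative (- ((1 / sqrt b) ^ 3 / 2))) (at b)"
      by (rule derivative_eq_intros ds refl | use sq in \<open>simp add: field_simps power3_eq_cube\<close>)+
    from DERIV_power [OF this, of k] show ?thesis
      by (rule DERIV_cong) (simp add: Suc power_add power3_eq_cube power2_eq_square)
  qed simp
  have dc: "((\<lambda>b. cos (\<alpha> * sqrt b + \<phi>)) has_real_derivative \<alpha> / 2 * (1 / sqrt b) * cos (\<alpha> * sqrt b + (\<phi> + pi / 2))) (at b)"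
  proof -
    have "cos (\<alpha> * sqrt b + (\<phi> + pi / 2)) = - sin (\<alpha> * sqrt b + \<phi>)"
      by (simp add: add.assoc [symmetric] cos_add)
    moreover have "((\<lambda>b. \<alpha> * sqrt b + \<phi>) has_real_derivative \<alpha> * (1 / sqrt b / 2) + 0) (at b)"
      by (intro DERIV_add DERIV_cmult ds DERIV_const)
    ultimately show ?thesis
      by (intro DERIV_cong [OF DERIV_chain2 [OF DERIV_cos]]) (auto simp: mult.commute)
  qed
  show ?thesis unfolding e
    by (rule DERIV_cong [OF DERIV_mult [OF dr DERIV_mult [OF di dc]]])
      (simp add: dwave_def wave_def power_add algebra_simps power2_eq_square)
next
  case False
  have w0: "wave L \<alpha> r k \<phi> b = 0" if "b < L" for b k \<phi>
    using z(1) [of "b / L"] that L by (simp add: wave_def)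
  have w1: "wave L \<alpha> r' k \<phi> b = 0" if "b < L" for b k \<phi>
    using z(2) [of "b / L"] that L by (simp add: wave_def)
  have "(wave L \<alpha> r k \<phi> has_real_derivative 0) (at b)"
    by (rule has_field_derivative_transform_within_open [where S = "{..<L}" and f = "\<lambda>_. 0"])
      (use False L w0 in auto)
  moreover have "dwave L \<alpha> r r' k \<phi> b = 0" using False L w0 w1 by (simp add: dwave_def)
  ultimately show ?thesis by simp
qed

lemma abs_wave_le:
  assumes L: "L > 0" and r: "\<And>s. \<bar>r s\<bar> \<le> K" "\<And>s. s \<le> 1 \<Longrightarrow> r s = 0"
  shows "\<bar>wave L \<alpha> r k \<phi> b\<bar> \<le> K * (1 / sqrt L) ^ k"
proof (cases "b \<le> L")
  case True
  have "K \<ge> 0" using r(1) [of 0] by linarith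
  moreover have "r (b / L) = 0" using True L by (intro r) simp
  ultimately show ?thesis using L by (simp add: wave_def)
next
  case False
  have "(1 / sqrt b) ^ k \<le> (1 / sqrt L) ^ k" using False L by (intro power_mono) (auto simp: frac_le)
  then have "\<bar>r (b / L)\<bar> * (1 / sqrt b) ^ k * \<bar>cos (\<alpha> * sqrt b + \<phi>)\<bar> \<le> K * (1 / sqrt L) ^ k * 1"
    using r(1) [of "b / L"] False L by (intro mult_mono) auto
  moreover have "\<bar>(1 / sqrt b) ^ k\<bar> = (1 / sqrt b) ^ k" using False L by simp
  ultimately show ?thesis by (simp only: wave_def abs_mult mult_1_right)
qed

lemma abs_dwave_le:
  assumes L: "L \<ge> 1" and r: "\<And>s. \<bar>r s\<bar> \<le> 100" "\<And>s. s \<le> 1 \<Longrightarrow> r s = 0"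
    and r': "\<And>s. \<bar>r' s\<bar> \<le> 100" "\<And>s. s \<le> 1 \<Longrightarrow> r' s = 0" and \<alpha>: "\<alpha> \<ge> 0" and k: "k \<le> 4"
  shows "\<bar>dwave L \<alpha> r r' k \<phi> b\<bar> \<le> 100 * (5 + \<alpha>) * (1 / sqrt L) ^ (k + 1)"
proof -
  define s where "s = 1 / sqrt L"
  have L0: "L > 0" using L by simp
  have s: "0 < s" "s \<le> 1" using L by (auto simp: s_def)
  have s2: "s ^ 2 = 1 / L" using L by (simp add: s_def power_divide power2_eq_square)
  have sk: "s ^ (k + 2) \<le> s ^ (k + 1)" using s by (intro power_decreasing) auto
  have "\<bar>wave L \<alpha> r' k \<phi> b / L\<bar> = \<bar>wave L \<alpha> r' k \<phi> b\<bar> * s ^ 2" using L by (simp add: s2)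
  also have "\<dots> \<le> 100 * s ^ k * s ^ 2"
    unfolding s_def by (intro mult_right_mono abs_wave_le [OF L0 r']) auto
  also have "\<dots> = 100 * s ^ (k + 2)" by (simp add: power_add power2_eq_square)
  finally have 1: "\<bar>wave L \<alpha> r' k \<phi> b / L\<bar> \<le> 100 * s ^ (k + 1)" using sk by linarith
  have "\<bar>real k / 2 * wave L \<alpha> r (k + 2) \<phi> b\<bar> = real k / 2 * \<bar>wave L \<alpha> r (k + 2) \<phi> b\<bar>" by (simp add: abs_mult)
  also have "\<dots> \<le> 2 * (100 * s ^ (k + 2))"
    unfolding s_def by (intro mult_mono abs_wave_le [OF L0 r]) (use k in auto)
  finally have 2: "\<bar>real k / 2 * wave L \<alpha> r (k + 2) \<phi> b\<bar> \<le> 200 * s ^ (k + 1)" using sk by linarith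
  have "\<bar>\<alpha> / 2 * wave L \<alpha> r (k + 1) (\<phi> + pi / 2) b\<bar> = \<alpha> / 2 * \<bar>wave L \<alpha> r (k + 1) (\<phi> + pi / 2) b\<bar>"
    using \<alpha> by (simp add: abs_mult)
  also have "\<dots> \<le> \<alpha> / 2 * (100 * s ^ (k + 1))"
    unfolding s_def by (intro mult_left_mono abs_wave_le [OF L0 r]) (use \<alpha> in auto)
  finally have 3: "\<bar>\<alpha> / 2 * wave L \<alpha> r (k + 1) (\<phi> + pi / 2) b\<bar> \<le> \<alpha> / 2 * (100 * s ^ (k + 1))" .
  have "\<bar>dwave L \<alpha> r r' k \<phi> b\<bar> \<le> 100 * s ^ (k + 1) + 200 * s ^ (k + 1) + \<alpha> / 2 * (100 * s ^ (k + 1))"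
    unfolding dwave_def using 1 2 3 by linarith
  also have "\<dots> = (300 + 50 * \<alpha>) * s ^ (k + 1)" by (simp add: algebra_simps)
  also have "\<dots> \<le> 100 * (5 + \<alpha>) * s ^ (k + 1)" using s \<alpha> by (intro mult_right_mono) auto
  finally show ?thesis by (simp add: s_def)
qed

text \<open>The test function and its first three derivatives. Each derivative gains a factor 1 /
  sqrt L, the rate of change of the phase on the block; the cut-off itself varies at the slower rate
  1 / L.\<close>

definition test0 :: "real \<Rightarrow> real \<Rightarrow> real \<Rightarrow> real \<Rightarrow> real" where
  "test0 L \<alpha> \<theta> b = wave L \<alpha> rho0 0 \<theta> b"
definition test1 :: "real \<Rightarrow> real \<Rightarrow> real \<Rightarrow> real \<Rightarrow> real" where
  "test1 L \<alpha> \<theta> b = dwave L \<alpha> rho0 rho1 0 \<theta> b"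
definition test2 :: "real \<Rightarrow> real \<Rightarrow> real \<Rightarrow> real \<Rightarrow> real" where
  "test2 L \<alpha> \<theta> b = dwave L \<alpha> rho1 rho2 0 \<theta> b / L + \<alpha> / 2 * dwave L \<alpha> rho0 rho1 1 (\<theta> + pi / 2) b"
definition test3 :: "real \<Rightarrow> real \<Rightarrow> real \<Rightarrow> real \<Rightarrow> real" where
  "test3 L \<alpha> \<theta> b =
     (dwave L \<alpha> rho2 rho3 0 \<theta> b / L + \<alpha> / 2 * dwave L \<alpha> rho1 rho2 1 (\<theta> + pi / 2) b) / L
     + \<alpha> / 2 * (dwave L \<alpha> rho1 rho2 1 (\<theta> + pi / 2) b / L - 1 / 2 * dwave L \<alpha> rho0 rho1 3 (\<theta> + pi / 2) b
         + \<alpha> / 2 * dwave L \<alpha> rho0 rho1 2 (\<theta> + pi / 2 + pi / 2) b)"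

lemma DERIV_test:
  assumes L: "L > 0"
  shows "(test0 L \<alpha> \<theta> has_real_derivative test1 L \<alpha> \<theta> b) (at b)"
    "(test1 L \<alpha> \<theta> has_real_derivative test2 L \<alpha> \<theta> b) (at b)"
    "(test2 L \<alpha> \<theta> has_real_derivative test3 L \<alpha> \<theta> b) (at b)"
proof -
  have d: "(wave L \<alpha> rho0 k \<phi> has_real_derivative dwave L \<alpha> rho0 rho1 k \<phi> b) (at b)"
    "(wave L \<alpha> rho1 k \<phi> has_real_derivative dwave L \<alpha> rho1 rho2 k \<phi> b) (at b)"
    "(wave L \<alpha> rho2 k \<phi> has_real_derivative dwave L \<alpha> rho2 rho3 k \<phi> b) (at b)" for k \<phi> b
    by (rule DERIV_wave [OF L] DERIV_rho | simp add: rho_eq_0)+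
  have e0: "test0 L \<alpha> \<theta> = wave L \<alpha> rho0 0 \<theta>" by (auto simp: test0_def)
  have e1: "test1 L \<alpha> \<theta> = (\<lambda>b. wave L \<alpha> rho1 0 \<theta> b / L + \<alpha> / 2 * wave L \<alpha> rho0 1 (\<theta> + pi / 2) b)"
    by (auto simp: test1_def dwave_def)
  have e2: "test2 L \<alpha> \<theta> = (\<lambda>b. (wave L \<alpha> rho2 0 \<theta> b / L + \<alpha> / 2 * wave L \<alpha> rho1 1 (\<theta> + pi / 2) b) / L
     + \<alpha> / 2 * (wave L \<alpha> rho1 1 (\<theta> + pi / 2) b / L - 1 / 2 * wave L \<alpha> rho0 3 (\<theta> + pi / 2) b
         + \<alpha> / 2 * wave L \<alpha> rho0 2 (\<theta> + pi / 2 + pi / 2) b))"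
    by (auto simp: test2_def dwave_def numeral_eq_Suc)
  show "(test0 L \<alpha> \<theta> has_real_derivative test1 L \<alpha> \<theta> b) (at b)"
    unfolding e0 test1_def by (rule d)
  show "(test1 L \<alpha> \<theta> has_real_derivative test2 L \<alpha> \<theta> b) (at b)"
    unfolding e1 test2_def using L by (auto intro!: derivative_eq_intros d)
  show "(test2 L \<alpha> \<theta> has_real_derivative test3 L \<alpha> \<theta> b) (at b)"
    unfolding e2 test3_def using L by (auto intro!: derivative_eq_intros d)
qed

lemma test_eq_0:
  assumes "L > 0" "b \<le> L \<or> 2 * L \<le> b"
  shows "test0 L \<alpha> \<theta> b = 0" "test1 L \<alpha> \<theta> b = 0"
proof -
  have "b / L \<le> 1 \<or> 2 \<le> b / L" using assms by (auto simp: field_simps)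
  from rho_eq_0 [OF this] show "test0 L \<alpha> \<theta> b = 0" "test1 L \<alpha> \<theta> b = 0"
    by (simp_all add: test0_def test1_def dwave_def wave_def)
qed

text \<open>One factor 100 * (5 + \<alpha>), as in \<open>abs_dwave_le\<close>, for each of three
  derivatives; the cube serves all orders at once.\<close>

definition test_bound :: "real \<Rightarrow> real" where
  "test_bound \<alpha> = (100 * (5 + \<alpha>)) ^ 3"

text \<open>The last bound isolates the only part of the second derivative of order 1 / L, in which
  both derivatives hit the phase. All other parts differentiate the cut-off or the power and lose at
  least another factor 1 / sqrt L.\<close>

lemma test_bounds:
  assumes L: "L \<ge> 1" and \<alpha>: "\<alpha> \<ge> 0"
  defines "s \<equiv> 1 / sqrt L"
  shows "\<bar>test0 L \<alpha> \<theta> b\<bar> \<le> 1" "\<bar>test1 L \<alpha> \<theta> b\<bar> \<le> test_bound \<alpha> * s"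
    "\<bar>test2 L \<alpha> \<theta> b\<bar> \<le> test_bound \<alpha> * s\<^sup>2" "\<bar>test3 L \<alpha> \<theta> b\<bar> \<le> test_bound \<alpha> * s ^ 3"
    "\<bar>test2 L \<alpha> \<theta> b + \<alpha>\<^sup>2 / 4 * (wave L 0 rho0 2 0 b * cos (\<alpha> * sqrt b + \<theta>))\<bar> \<le> test_bound \<alpha> * s ^ 3"
proof -
  define E where "E = 100 * (5 + \<alpha>)"
  have L0: "L > 0" using L by simp
  have s: "0 < s" "s \<le> 1" using L by (auto simp: s_def)
  have s2: "1 / L = s ^ 2" using L by (simp add: s_def power_divide)
  have E: "E \<ge> 1" "1 + \<alpha> \<le> E" "100 \<le> E" using \<alpha> by (auto simp: E_def)
  have T: "test_bound \<alpha> = E ^ 3" by (simp add: test_bound_def E_def)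
  have E2: "(1 + \<alpha>) * (1 + \<alpha>) \<le> E * E" using E \<alpha> by (intro mult_mono) auto
  have E13: "E \<le> E ^ 3" "E * E \<le> E ^ 3" using E power_increasing [of 1 3 E] power_increasing [of 2 3 E] by (auto simp: power2_eq_square)
  note rb = rho_bounds rho_eq_0
  show "\<bar>test0 L \<alpha> \<theta> b\<bar> \<le> 1"
  proof -
    have "\<bar>rho0 s\<bar> \<le> 1" for s using rho_bounds(1,2) [of s] by simp
    from abs_wave_le [OF L0, of rho0 1 \<alpha> 0 \<theta> b, OF this rho_eq_0(1)] show ?thesis by (simp add: test0_def)
  qed
  have D: "\<bar>dwave L \<alpha> rho0 rho1 k \<phi> b\<bar> \<le> E * s ^ (k + 1)" "\<bar>dwave L \<alpha> rho1 rho2 k \<phi> b\<bar> \<le> E * s ^ (k + 1)"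
    "\<bar>dwave L \<alpha> rho2 rho3 k \<phi> b\<bar> \<le> E * s ^ (k + 1)" if "k \<le> 4" for k \<phi>
    unfolding E_def s_def by (intro abs_dwave_le L \<alpha> that rho_bounds; simp add: rho_eq_0)+
  have W: "\<bar>wave L \<alpha> rho0 k \<phi> b\<bar> \<le> E * s ^ k" "\<bar>wave L \<alpha> rho1 k \<phi> b\<bar> \<le> E * s ^ k" for k \<phi>
  proof -
    have "\<bar>wave L \<alpha> rho0 k \<phi> b\<bar> \<le> 100 * s ^ k" "\<bar>wave L \<alpha> rho1 k \<phi> b\<bar> \<le> 100 * s ^ k"
      unfolding s_def by (intro abs_wave_le [OF L0] rho_bounds; simp add: rho_eq_0)+
    moreover have "100 * s ^ k \<le> E * s ^ k" using E s by (intro mult_right_mono) auto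
    ultimately show "\<bar>wave L \<alpha> rho0 k \<phi> b\<bar> \<le> E * s ^ k" "\<bar>wave L \<alpha> rho1 k \<phi> b\<bar> \<le> E * s ^ k" by linarith+
  qed
  have sk: "s ^ k \<le> s ^ j" if "j \<le> k" for j k using s that by (intro power_decreasing) auto
  have absL: "\<bar>x / L\<bar> \<le> s\<^sup>2 * B" if "\<bar>x\<bar> \<le> B" for x B
  proof -
    have "\<bar>x / L\<bar> = s\<^sup>2 * \<bar>x\<bar>" using L by (simp add: s2 [symmetric])
    also have "\<dots> \<le> s\<^sup>2 * B" using that by (intro mult_left_mono) auto
    finally show ?thesis .
  qed
  have absA: "\<bar>\<alpha> / 2 * x\<bar> \<le> \<alpha> / 2 * B" if "\<bar>x\<bar> \<le> B" for x B
    using that \<alpha> mult_left_mono [OF that, of "\<alpha> / 2"] by (simp add: abs_mult)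
  have "E * s \<le> E ^ 3 * s" using E13 s by (intro mult_right_mono) auto
  with D(1) [of 0 \<theta>] show "\<bar>test1 L \<alpha> \<theta> b\<bar> \<le> test_bound \<alpha> * s" unfolding T test1_def by simp
  have "\<bar>test2 L \<alpha> \<theta> b\<bar> \<le> s\<^sup>2 * (E * s ^ 1) + \<alpha> / 2 * (E * s ^ 2)"
  proof -
    have a: "\<bar>dwave L \<alpha> rho1 rho2 0 \<theta> b / L\<bar> \<le> s\<^sup>2 * (E * s ^ 1)"
      using absL [OF D(2) [of 0 \<theta>]] by simp
    have "\<bar>dwave L \<alpha> rho0 rho1 1 (\<theta> + pi / 2) b\<bar> \<le> E * s ^ 2"
      using D(1) [of 1 "\<theta> + pi / 2"] by (simp add: numeral_eq_Suc)
    from absA [OF this] a show ?thesis unfolding test2_def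
      by (intro order_trans [OF abs_triangle_ineq add_mono])
  qed
  also have "\<dots> \<le> s\<^sup>2 * (E * 1) + \<alpha> / 2 * (E * s ^ 2)" using s E \<alpha> by (intro add_mono mult_left_mono) auto
  also have "\<dots> = E * (1 + \<alpha> / 2) * s\<^sup>2" by (simp add: algebra_simps)
  also have "\<dots> \<le> E ^ 3 * s\<^sup>2"
  proof (rule mult_right_mono)
    have "E * (1 + \<alpha> / 2) \<le> E * E" using E \<alpha> by (intro mult_left_mono) auto
    with E13 show "E * (1 + \<alpha> / 2) \<le> E ^ 3" by linarith
  qed simp
  finally show "\<bar>test2 L \<alpha> \<theta> b\<bar> \<le> test_bound \<alpha> * s\<^sup>2" unfolding T .
  have p: "s\<^sup>2 * (E * s) = E * s ^ 3" "s\<^sup>2 * (E * s\<^sup>2) = E * s ^ 4" "s\<^sup>2 * (E * s ^ 3) = E * s ^ 5"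
    by (simp_all add: numeral_eq_Suc)
  have q: "E * s ^ 4 \<le> E * s ^ 3" "E * s ^ 5 \<le> E * s ^ 3" using sk [of 3 4] sk [of 3 5] E by (auto intro!: mult_left_mono)
  show "\<bar>test2 L \<alpha> \<theta> b + \<alpha>\<^sup>2 / 4 * (wave L 0 rho0 2 0 b * cos (\<alpha> * sqrt b + \<theta>))\<bar> \<le> test_bound \<alpha> * s ^ 3"
  proof -
    have "cos (\<alpha> * sqrt b + (\<theta> + pi / 2 + pi / 2)) = - cos (\<alpha> * sqrt b + \<theta>)"
      using cos_periodic_pi [of "\<alpha> * sqrt b + \<theta>"] by (simp add: add.assoc)
    then have w: "wave L \<alpha> rho0 2 (\<theta> + pi / 2 + pi / 2) b = - (wave L 0 rho0 2 0 b * cos (\<alpha> * sqrt b + \<theta>))"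
      unfolding wave_def by simp
    have "test2 L \<alpha> \<theta> b + \<alpha>\<^sup>2 / 4 * (wave L 0 rho0 2 0 b * cos (\<alpha> * sqrt b + \<theta>))
      = dwave L \<alpha> rho1 rho2 0 \<theta> b / L
        + \<alpha> / 2 * (wave L \<alpha> rho1 1 (\<theta> + pi / 2) b / L - 1 / 2 * wave L \<alpha> rho0 3 (\<theta> + pi / 2) b)"
      unfolding test2_def dwave_def [of L \<alpha> rho0 rho1 1]
      using w by (simp add: numeral_eq_Suc algebra_simps)
    also have "\<bar>\<dots>\<bar> \<le> s\<^sup>2 * (E * s ^ 1) + \<alpha> / 2 * (s\<^sup>2 * (E * s ^ 1) + E * s ^ 3)"
    proof (rule order_trans [OF abs_triangle_ineq], rule add_mono)
      show "\<bar>dwave L \<alpha> rho1 rho2 0 \<theta> b / L\<bar> \<le> s\<^sup>2 * (E * s ^ 1)" using absL [OF D(2) [of 0 \<theta>]] by simp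
      have "\<bar>wave L \<alpha> rho1 1 (\<theta> + pi / 2) b / L - 1 / 2 * wave L \<alpha> rho0 3 (\<theta> + pi / 2) b\<bar> \<le> s\<^sup>2 * (E * s ^ 1) + E * s ^ 3"
        using absL [OF W(2) [of 1 "\<theta> + pi / 2"]] W(1) [of 3 "\<theta> + pi / 2"] by linarith
      then show "\<bar>\<alpha> / 2 * (wave L \<alpha> rho1 1 (\<theta> + pi / 2) b / L - 1 / 2 * wave L \<alpha> rho0 3 (\<theta> + pi / 2) b)\<bar>
          \<le> \<alpha> / 2 * (s\<^sup>2 * (E * s ^ 1) + E * s ^ 3)" by (rule absA)
    qed
    also have "\<dots> = E * (1 + \<alpha>) * s ^ 3" by (simp add: power2_eq_square power3_eq_cube algebra_simps)
    also have "\<dots> \<le> E ^ 3 * s ^ 3"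
    proof (rule mult_right_mono)
      have "E * (1 + \<alpha>) \<le> E * E" using E \<alpha> by (intro mult_left_mono) auto
      with E13 show "E * (1 + \<alpha>) \<le> E ^ 3" by linarith
    qed (use s in simp)
    finally show ?thesis unfolding T .
  qed
  show "\<bar>test3 L \<alpha> \<theta> b\<bar> \<le> test_bound \<alpha> * s ^ 3"
  proof -
    have d: "\<bar>dwave L \<alpha> rho2 rho3 0 \<theta> b\<bar> \<le> E * s" "\<bar>dwave L \<alpha> rho1 rho2 1 (\<theta> + pi / 2) b\<bar> \<le> E * s\<^sup>2"
      "\<bar>dwave L \<alpha> rho0 rho1 3 (\<theta> + pi / 2) b\<bar> \<le> E * s ^ 4"
      "\<bar>dwave L \<alpha> rho0 rho1 2 (\<theta> + pi / 2 + pi / 2) b\<bar> \<le> E * s ^ 3"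
      using D(3) [of 0 \<theta>] D(2) [of 1 "\<theta> + pi / 2"] D(1) [of 3 "\<theta> + pi / 2"] D(1) [of 2 "\<theta> + pi / 2 + pi / 2"]
      by (simp_all add: numeral_eq_Suc)
    have sE: "E * s ^ 3 \<le> E * s\<^sup>2" using sk [of 2 3] E by (auto intro!: mult_left_mono)
    have a1: "\<bar>dwave L \<alpha> rho2 rho3 0 \<theta> b / L + \<alpha> / 2 * dwave L \<alpha> rho1 rho2 1 (\<theta> + pi / 2) b\<bar> \<le> E * s ^ 3 + \<alpha> / 2 * (E * s\<^sup>2)"
      using absL [OF d(1)] absA [OF d(2)] p by linarith
    have a2: "\<bar>(dwave L \<alpha> rho2 rho3 0 \<theta> b / L + \<alpha> / 2 * dwave L \<alpha> rho1 rho2 1 (\<theta> + pi / 2) b) / L\<bar>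
        \<le> E * s ^ 5 + \<alpha> / 2 * (E * s ^ 4)"
      using absL [OF a1] by (simp add: numeral_eq_Suc algebra_simps)
    have a3: "\<bar>dwave L \<alpha> rho1 rho2 1 (\<theta> + pi / 2) b / L - 1 / 2 * dwave L \<alpha> rho0 rho1 3 (\<theta> + pi / 2) b
         + \<alpha> / 2 * dwave L \<alpha> rho0 rho1 2 (\<theta> + pi / 2 + pi / 2) b\<bar> \<le> 2 * (E * s ^ 3) + \<alpha> / 2 * (E * s ^ 3)"
      using absL [OF d(2)] d(3) absA [OF d(4)] p q by linarith
    have a4: "\<alpha> / 2 * (E * s ^ 4) \<le> \<alpha> / 2 * (E * s ^ 3)" by (rule mult_left_mono [OF q(1)]) (use \<alpha> in simp)
    have "\<bar>test3 L \<alpha> \<theta> b\<bar> \<le> E * s ^ 3 + \<alpha> / 2 * (E * s ^ 3) + \<alpha> / 2 * (2 * (E * s ^ 3) + \<alpha> / 2 * (E * s ^ 3))"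
      unfolding test3_def using a2 absA [OF a3] a4 q by linarith
    also have "\<dots> = E * s ^ 3 * (1 + 3 / 2 * \<alpha> + \<alpha> * \<alpha> / 4)" by (simp add: algebra_simps)
    also have "\<dots> \<le> E * s ^ 3 * (E * E)"
    proof (rule mult_left_mono)
      have "(1 + \<alpha>) * (1 + \<alpha>) = 1 + 2 * \<alpha> + \<alpha> * \<alpha>" by (simp add: algebra_simps)
      then have "1 + 3 / 2 * \<alpha> + \<alpha> * \<alpha> / 4 \<le> (1 + \<alpha>) * (1 + \<alpha>)"
        using \<alpha> mult_nonneg_nonneg [OF \<alpha> \<alpha>] by linarith
      with E2 show "1 + 3 / 2 * \<alpha> + \<alpha> * \<alpha> / 4 \<le> E * E" by linarith
    qed (use E s in simp)
    finally show ?thesis unfolding T by (simp add: power3_eq_cube mult_ac)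
  qed
qed

section \<open>Gaussian asymptotics of the averaged second derivative\<close>

lemma exp_minus_approx:
  fixes u :: real
  assumes "0 \<le> u"
  shows "\<bar>exp (- u) - (1 - u)\<bar> \<le> u\<^sup>2"
proof -
  have "1 - u \<le> exp (- u)" using exp_ge_add_one_self [of "- u"] by simp
  moreover have "exp (- u) \<le> 1 - u + u\<^sup>2"
  proof -
    have "exp (- u) = 1 / exp u" by (simp add: exp_minus field_simps)
    also have "\<dots> \<le> 1 / (1 + u)" using assms exp_ge_add_one_self [of u] by (intro divide_left_mono) auto
    also have "\<dots> \<le> 1 - u + u\<^sup>2"
    proof -
      have "1 \<le> (1 - u + u\<^sup>2) * (1 + u)" using assms by (simp add: power2_eq_square algebra_simps)
      then show ?thesis using assms by (simp add: divide_le_eq)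
    qed
    finally show ?thesis .
  qed
  ultimately show ?thesis by simp
qed

lemma cos_quadratic_approx: "\<bar>cos x - (1 - x\<^sup>2 / 2)\<bar> \<le> x ^ 4" for x :: real
proof -
  obtain t where t: "cos x = (\<Sum>m<4. cos_coeff m * x ^ m) + (cos (t + 1 / 2 * real 4 * pi) / fact 4) * x ^ 4"
    using Maclaurin_cos_expansion [of x 4] by blast
  have "(\<Sum>m<4. f m) = f 0 + f 1 + f 2 + f 3" for f :: "nat \<Rightarrow> real"
    by (simp add: eval_nat_numeral)
  then have s: "(\<Sum>m<4. cos_coeff m * x ^ m) = 1 - x\<^sup>2 / 2"
    by (simp add: cos_coeff_def)
  have e: "cos x - (1 - x\<^sup>2 / 2) = cos (t + 1 / 2 * real 4 * pi) / 24 * x ^ 4"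
    using t unfolding s by (simp add: fact_numeral)
  have "\<bar>cos x - (1 - x\<^sup>2 / 2)\<bar> = \<bar>cos (t + 1 / 2 * real 4 * pi)\<bar> / 24 * x ^ 4"
    unfolding e by (simp add: abs_mult)
  also have "\<dots> \<le> 1 / 24 * x ^ 4" by (intro mult_right_mono divide_right_mono abs_cos_le_one) auto
  also have "\<dots> \<le> x ^ 4" by simp
  finally show ?thesis .
qed

text \<open>A central limit estimate at the level of characteristic functions: the single factors
  differ by O(a^4), and taking m-th powers of numbers of modulus at most one multiplies the
  difference by at most m.\<close>

lemma cos_power_gauss: "\<bar>cos a ^ m - exp (- (real m * a\<^sup>2 / 2))\<bar> \<le> 2 * real m * a ^ 4" for a :: real
proof -
  have u: "\<bar>exp (- (a\<^sup>2 / 2)) - (1 - a\<^sup>2 / 2)\<bar> \<le> (a\<^sup>2 / 2)\<^sup>2" by (rule exp_minus_approx) simp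
  have e: "(a\<^sup>2 / 2)\<^sup>2 = a ^ 4 / 4" by (simp add: power2_eq_square power4_eq_xxxx)
  have "0 \<le> a ^ 4" by simp
  then have d: "\<bar>cos a - exp (- (a\<^sup>2 / 2))\<bar> \<le> 2 * a ^ 4"
    using u cos_quadratic_approx [of a] unfolding e by linarith
  have "exp (- (real m * a\<^sup>2 / 2)) = exp (- (a\<^sup>2 / 2)) ^ m"
    by (simp add: exp_of_nat_mult [symmetric])
  then have "\<bar>cos a ^ m - exp (- (real m * a\<^sup>2 / 2))\<bar> = norm (cos a ^ m - exp (- (a\<^sup>2 / 2)) ^ m)" by simp
  also have "\<dots> \<le> real m * norm (cos a - exp (- (a\<^sup>2 / 2)))"
    by (rule norm_power_diff) auto
  also have "\<dots> \<le> real m * (2 * a ^ 4)" using d by (intro mult_left_mono) auto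
  finally show ?thesis by simp
qed

lemma cos_Lipschitz: "\<bar>cos x - cos y\<bar> \<le> \<bar>x - y\<bar>" for x y :: real
proof -
  have "norm (cos x - cos y) \<le> 1 * norm (x - y)"
    by (rule field_differentiable_bound [where S = UNIV and f' = "\<lambda>x. - sin x"])
      (auto intro!: derivative_eq_intros)
  then show ?thesis by simp
qed

lemma sqrt_linear_approx:
  assumes "B > 0" "b \<ge> 0"
  shows "\<bar>sqrt b - (sqrt B + (b - B) / (2 * sqrt B))\<bar> \<le> (b - B)\<^sup>2 / (2 * B * sqrt B)"
proof -
  define x y where "x = sqrt b" and "y = sqrt B"
  have xy: "x \<ge> 0" "y > 0" "b = x\<^sup>2" "B = y\<^sup>2" using assms by (auto simp: x_def y_def)
  have "x - (y + (b - B) / (2 * y)) = - ((x - y)\<^sup>2 / (2 * y))"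
    using xy by (simp add: field_simps power2_eq_square)
  then have "\<bar>x - (y + (b - B) / (2 * y))\<bar> = (x - y)\<^sup>2 / (2 * y)" using xy by simp
  also have "\<dots> \<le> (b - B)\<^sup>2 / y\<^sup>2 / (2 * y)"
  proof (rule divide_right_mono)
    have "y\<^sup>2 \<le> (x + y)\<^sup>2" using xy by (intro power_mono) auto
    then have "(x - y)\<^sup>2 * y\<^sup>2 \<le> (x - y)\<^sup>2 * (x + y)\<^sup>2" by (intro mult_left_mono) auto
    also have "\<dots> = (b - B)\<^sup>2" unfolding xy by (simp add: power_mult_distrib [symmetric] square_diff_square_factored power2_eq_square mult.commute)
    finally show "(x - y)\<^sup>2 \<le> (b - B)\<^sup>2 / y\<^sup>2" using xy by (simp add: pos_le_divide_eq)
  qed (use xy in simp)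
  also have "\<dots> = (b - B)\<^sup>2 / (2 * B * y)" using xy by (simp add: field_simps)
  finally show ?thesis by (simp add: x_def y_def)
qed

text \<open>With frequency and phase 0 the cosine is 1, so on its support this is rho0 (b / L) / b,
  the amplitude of the main part of the second derivative.\<close>

abbreviation envelope :: "real \<Rightarrow> real \<Rightarrow> real" where
  "envelope L \<equiv> wave L 0 rho0 2 0"

lemma envelope_bounds:
  assumes L: "L \<ge> 1"
  shows "\<bar>envelope L b\<bar> \<le> (1 / sqrt L)\<^sup>2" "\<bar>envelope L b - envelope L b'\<bar> \<le> 200 * (1 / sqrt L) ^ 4 * \<bar>b - b'\<bar>"
    "0 \<le> envelope L b"
proof -
  define s where "s = 1 / sqrt L"
  have L0: "L > 0" using L by simp
  have s2: "1 / L = s\<^sup>2" using L by (simp add: s_def power_divide)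
  have r1: "\<bar>rho0 s\<bar> \<le> 1" for s using rho_bounds(1,2) [of s] by simp
  show "\<bar>envelope L b\<bar> \<le> (1 / sqrt L)\<^sup>2" using abs_wave_le [OF L0, of rho0 1 0 2 0 b] r1 rho_eq_0 by simp
  show "0 \<le> envelope L b" using rho_bounds(1) by (simp add: wave_def)
  have "norm (envelope L b - envelope L b') \<le> 200 * s ^ 4 * norm (b - b')"
  proof (rule field_differentiable_bound [where S = UNIV and f' = "dwave L 0 rho0 rho1 2 0"])
    fix x
    show "(envelope L has_field_derivative dwave L 0 rho0 rho1 2 0 x) (at x within UNIV)"
      by (rule DERIV_wave [OF L0 DERIV_rho(1)]) (simp_all add: rho_eq_0)
    have 1: "\<bar>wave L 0 rho1 2 0 x\<bar> \<le> 100 * s ^ 2" unfolding s_def by (rule abs_wave_le [OF L0 rho_bounds(4)]) (simp add: rho_eq_0)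
    have 2: "\<bar>wave L 0 rho0 4 0 x\<bar> \<le> 100 * s ^ 4" unfolding s_def by (rule abs_wave_le [OF L0 rho_bounds(3)]) (simp add: rho_eq_0)
    have "\<bar>wave L 0 rho1 2 0 x / L\<bar> = s\<^sup>2 * \<bar>wave L 0 rho1 2 0 x\<bar>" using L by (simp add: s2 [symmetric])
    also have "\<dots> \<le> s\<^sup>2 * (100 * s\<^sup>2)" using 1 by (intro mult_left_mono) auto
    also have "\<dots> = 100 * s ^ 4" by (simp add: power2_eq_square power4_eq_xxxx)
    finally have "\<bar>wave L 0 rho1 2 0 x / L\<bar> + \<bar>wave L 0 rho0 4 0 x\<bar> \<le> 200 * s ^ 4" using 2 by simp
    moreover have "dwave L 0 rho0 rho1 2 0 x = wave L 0 rho1 2 0 x / L - wave L 0 rho0 4 0 x" by (simp add: dwave_def)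
    ultimately show "norm (dwave L 0 rho0 rho1 2 0 x) \<le> 200 * s ^ 4" by (simp add: order_trans [OF abs_triangle_ineq4])
  qed auto
  then show "\<bar>envelope L b - envelope L b'\<bar> \<le> 200 * (1 / sqrt L) ^ 4 * \<bar>b - b'\<bar>" by (simp add: s_def)
qed

text \<open>On the scale sqrt m of the walk, sqrt b may be replaced by its tangent at B = \<beta> *
  m and the envelope by its value at B. What remains is a genuine cosine in b, which the walk
  averages exactly. The replacement errors are quadratic in b - B, so the second moment of the walk
  controls them.\<close>

lemma test2_mean_asymptotics:
  assumes \<alpha>: "\<alpha> \<ge> 0" and \<beta>: "\<beta> > 0" and c12: "0 < c1" "c1 \<le> c2" and Cc: "Cc \<ge> 0"
  obtains C where "C \<ge> 0" "\<And>L m c \<theta>. \<lbrakk>L \<ge> 1; c1 * L \<le> real m; real m \<le> c2 * L; \<bar>c\<bar> \<le> Cc\<rbrakk> \<Longrightarrow>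
    \<bar>walk_mean m (test2 L \<alpha> \<theta>) (\<beta> * real m + 2 * sqrt (real m) - c)
     + \<alpha>\<^sup>2 / 4 * exp (- (\<alpha>\<^sup>2 / (32 * \<beta>))) * envelope L (\<beta> * real m)
       * cos (\<alpha> * sqrt (\<beta> * real m) + \<alpha> / sqrt \<beta> + \<theta>)\<bar> \<le> C * (1 / sqrt L) ^ 3"
proof -
  define b1 where "b1 = \<beta> * c1"
  define Q where "Q = 9 * c2 + 2 * Cc\<^sup>2"
  define D1 where "D1 = test_bound \<alpha> + 50 * \<alpha>\<^sup>2 + \<alpha>\<^sup>2 / 4 * (\<alpha> / (2 * b1 * sqrt b1) + 200) * Q"
  define D2 where "D2 = \<alpha>\<^sup>2 / 4 * (\<alpha> ^ 4 / (128 * \<beta>\<^sup>2 * c1) + \<alpha> * Cc / (2 * sqrt b1))"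
  have b1: "b1 > 0" using \<beta> c12 by (simp add: b1_def)
  have Q0: "Q \<ge> 0" using c12 by (simp add: Q_def)
  have TB: "test_bound \<alpha> \<ge> 0" using \<alpha> by (simp add: test_bound_def)
  have D1: "D1 \<ge> 0" unfolding D1_def using TB \<alpha> b1 Q0 by (intro add_nonneg_nonneg mult_nonneg_nonneg) auto
  have D2: "D2 \<ge> 0" unfolding D2_def using \<alpha> b1 c12 Cc by (intro add_nonneg_nonneg mult_nonneg_nonneg divide_nonneg_nonneg) auto
  show thesis
  proof (rule that [of "D1 + D2"])
    show "D1 + D2 \<ge> 0" using D1 D2 by simp
    fix L :: real and m :: nat and c \<theta> :: real
    assume L: "L \<ge> 1" and m: "c1 * L \<le> real m" "real m \<le> c2 * L" and c: "\<bar>c\<bar> \<le> Cc"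
    define s where "s = 1 / sqrt L"
    define B where "B = \<beta> * real m"
    \<comment> \<open>The frequency of the tangent to \<alpha> * sqrt b at \<open>B\<close>; the
      phase defined next makes the linearised argument exact at b = B.\<close>
    define \<omega> where "\<omega> = \<alpha> / (2 * sqrt B)"
    define \<phi> where "\<phi> = \<alpha> * sqrt B - \<omega> * B + \<theta>"
    define x where "x = B + 2 * sqrt (real m) - c"
    define G where "G = \<alpha>\<^sup>2 / 4 * envelope L B"
    have s: "0 < s" "s \<le> 1" using L by (auto simp: s_def)
    have sL: "s\<^sup>2 * L = 1" "s\<^sup>2 = 1 / L" using L by (auto simp: s_def power_divide)
    have m0: "real m > 0" using m c12 L by (smt (verit) mult_pos_pos)
    have B0: "B > 0" using m0 \<beta> by (simp add: B_def)
    have BL: "b1 * L \<le> B" using mult_left_mono [OF m(1), of \<beta>] \<beta> by (simp add: B_def b1_def mult.assoc)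
    have sB: "sqrt b1 * sqrt L \<le> sqrt B" using BL by (simp add: real_sqrt_mult [symmetric])
    have isB: "1 / sqrt B \<le> s / sqrt b1"
    proof -
      have "1 / sqrt B \<le> 1 / (sqrt b1 * sqrt L)" using sB b1 L B0 by (intro divide_left_mono mult_pos_pos) auto
      then show ?thesis by (simp add: s_def field_simps)
    qed
    have iB: "1 / B \<le> s\<^sup>2 / b1"
    proof -
      have "1 / B \<le> 1 / (b1 * L)" using BL b1 L B0 by (intro divide_left_mono mult_pos_pos) auto
      then show ?thesis by (simp add: sL field_simps)
    qed
    note env = envelope_bounds [OF L, folded s_def]
    define k1 where "k1 = \<alpha>\<^sup>2 / 4 * (s\<^sup>2 * \<alpha> / (2 * B * sqrt B) + 200 * s ^ 5)"
    define k0 where "k0 = (test_bound \<alpha> + 50 * \<alpha>\<^sup>2) * s ^ 3"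
    have k10: "k1 \<ge> 0" unfolding k1_def using \<alpha> B0 s by simp
    have pt: "\<bar>test2 L \<alpha> \<theta> b + G * cos (\<omega> * b + \<phi>)\<bar> \<le> k0 + k1 * (b - B)\<^sup>2" for b
    proof -
      have a1: "\<bar>envelope L b * cos (\<alpha> * sqrt b + \<theta>) - envelope L b * cos (\<omega> * b + \<phi>)\<bar>
          \<le> s\<^sup>2 * \<alpha> / (2 * B * sqrt B) * (b - B)\<^sup>2"
      proof (cases "b \<le> L")
        case True
        then have "b / L \<le> 1" using L by simp
        then have "envelope L b = 0" by (simp add: wave_def rho_eq_0)
        then show ?thesis using B0 \<alpha> by simp
      next
        case False
        then have b: "b \<ge> 0" using L by simp
        have "\<omega> * b + \<phi> - (\<alpha> * sqrt b + \<theta>) = - (\<alpha> * (sqrt b - (sqrt B + (b - B) / (2 * sqrt B))))"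
          by (simp add: \<omega>_def \<phi>_def right_diff_distrib distrib_left diff_divide_distrib)
        then have "\<bar>\<omega> * b + \<phi> - (\<alpha> * sqrt b + \<theta>)\<bar> = \<alpha> * \<bar>sqrt b - (sqrt B + (b - B) / (2 * sqrt B))\<bar>"
          using \<alpha> by (simp add: abs_mult)
        also have "\<dots> \<le> \<alpha> * ((b - B)\<^sup>2 / (2 * B * sqrt B))"
          by (intro mult_left_mono sqrt_linear_approx B0 b \<alpha>)
        finally have l: "\<bar>\<alpha> * sqrt b + \<theta> - (\<omega> * b + \<phi>)\<bar> \<le> \<alpha> * ((b - B)\<^sup>2 / (2 * B * sqrt B))"
          by (simp add: abs_minus_commute)
        have "\<bar>envelope L b * cos (\<alpha> * sqrt b + \<theta>) - envelope L b * cos (\<omega> * b + \<phi>)\<bar>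
           = \<bar>envelope L b\<bar> * \<bar>cos (\<alpha> * sqrt b + \<theta>) - cos (\<omega> * b + \<phi>)\<bar>"
          by (simp add: abs_mult [symmetric] right_diff_distrib)
        also have "\<dots> \<le> s\<^sup>2 * (\<alpha> * ((b - B)\<^sup>2 / (2 * B * sqrt B)))"
          using env(1) order_trans [OF cos_Lipschitz l] by (intro mult_mono) auto
        finally show ?thesis by simp
      qed
      \<comment> \<open>The envelope is Lipschitz, which gives an error linear in the distance. The
        arithmetic-geometric mean inequality trades it for a quadratic one with the balance
        \<open>s\<close> of the spread, leaving only second moments to average.\<close>
      have am: "\<bar>b - B\<bar> \<le> s * (b - B)\<^sup>2 + 1 / s"
      proof -
        define t where "t = \<bar>b - B\<bar>"
        have "0 \<le> (s * t - 1)\<^sup>2" by simp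
        then have "2 * (s * t) \<le> s * (s * t\<^sup>2) + 1" by (simp add: power2_eq_square algebra_simps)
        moreover have "0 \<le> s * t" using s by (simp add: t_def)
        ultimately have "s * t \<le> s * (s * t\<^sup>2 + 1 / s)" using s by (simp add: distrib_left)
        then have "t \<le> s * t\<^sup>2 + 1 / s" using s by simp
        then show ?thesis by (simp add: t_def)
      qed
      have a2: "\<bar>envelope L b * cos (\<omega> * b + \<phi>) - envelope L B * cos (\<omega> * b + \<phi>)\<bar> \<le> 200 * s ^ 5 * (b - B)\<^sup>2 + 200 * s ^ 3"
      proof -
        have "\<bar>envelope L b * cos (\<omega> * b + \<phi>) - envelope L B * cos (\<omega> * b + \<phi>)\<bar>
            = \<bar>envelope L b - envelope L B\<bar> * \<bar>cos (\<omega> * b + \<phi>)\<bar>"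
          by (simp add: abs_mult [symmetric] left_diff_distrib)
        also have "\<dots> \<le> (200 * s ^ 4 * (s * (b - B)\<^sup>2 + 1 / s)) * 1"
          using order_trans [OF env(2) [of b B] mult_left_mono [OF am]] s by (intro mult_mono) auto
        also have "\<dots> = 200 * s ^ 5 * (b - B)\<^sup>2 + 200 * s ^ 3" using s by (simp add: distrib_left numeral_eq_Suc)
        finally show ?thesis .
      qed
      define q where "q = envelope L b * cos (\<alpha> * sqrt b + \<theta>) - envelope L B * cos (\<omega> * b + \<phi>)"
      have q: "\<bar>q\<bar> \<le> s\<^sup>2 * \<alpha> / (2 * B * sqrt B) * (b - B)\<^sup>2 + (200 * s ^ 5 * (b - B)\<^sup>2 + 200 * s ^ 3)"
        unfolding q_def using a1 a2 by linarith
      have "test2 L \<alpha> \<theta> b + G * cos (\<omega> * b + \<phi>) =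
         (test2 L \<alpha> \<theta> b + \<alpha>\<^sup>2 / 4 * (envelope L b * cos (\<alpha> * sqrt b + \<theta>))) - \<alpha>\<^sup>2 / 4 * q"
        by (simp add: q_def G_def algebra_simps)
      also have "\<bar>\<dots>\<bar> \<le> test_bound \<alpha> * s ^ 3 + \<alpha>\<^sup>2 / 4 * (s\<^sup>2 * \<alpha> / (2 * B * sqrt B) * (b - B)\<^sup>2 + (200 * s ^ 5 * (b - B)\<^sup>2 + 200 * s ^ 3))"
      proof (rule order_trans [OF abs_triangle_ineq4], rule add_mono)
        show "\<bar>test2 L \<alpha> \<theta> b + \<alpha>\<^sup>2 / 4 * (envelope L b * cos (\<alpha> * sqrt b + \<theta>))\<bar> \<le> test_bound \<alpha> * s ^ 3"
          using test_bounds(5) [OF L \<alpha>] by (simp add: s_def)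
        show "\<bar>\<alpha>\<^sup>2 / 4 * q\<bar> \<le> \<alpha>\<^sup>2 / 4 * (s\<^sup>2 * \<alpha> / (2 * B * sqrt B) * (b - B)\<^sup>2 + (200 * s ^ 5 * (b - B)\<^sup>2 + 200 * s ^ 3))"
          using mult_left_mono [OF q, of "\<alpha>\<^sup>2 / 4"] by (simp add: abs_mult)
      qed
      also have "\<dots> = k0 + k1 * (b - B)\<^sup>2" by (simp add: k0_def k1_def algebra_simps)
      finally show ?thesis .
    qed
    have "\<bar>walk_mean m (\<lambda>b. test2 L \<alpha> \<theta> b + G * cos (\<omega> * b + \<phi>)) x\<bar> \<le> walk_mean m (\<lambda>b. k0 + k1 * (b - B)\<^sup>2) x"
      by (rule abs_walk_mean_le [OF pt])
    also have "\<dots> = k0 + k1 * ((x - B)\<^sup>2 + real m / 4)"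
      by (simp only: walk_mean_add walk_mean_cmult walk_mean_const walk_mean_square)
    also have "\<dots> \<le> D1 * s ^ 3"
    proof -
      have "(x - B)\<^sup>2 \<le> 8 * real m + 2 * c\<^sup>2"
      proof -
        have "(2 * r - c)\<^sup>2 = 8 * (r * r) + 2 * c\<^sup>2 - (2 * r + c)\<^sup>2" for r
          by (simp add: power2_eq_square algebra_simps)
        from this [of "sqrt (real m)"] zero_le_power2 [of "2 * sqrt (real m) + c"] show ?thesis
          by (simp add: x_def)
      qed
      moreover have "c\<^sup>2 \<le> Cc\<^sup>2" using c Cc abs_le_square_iff [of c Cc] by simp
      moreover have "Cc\<^sup>2 * 1 \<le> Cc\<^sup>2 * L" using L by (intro mult_left_mono) auto
      ultimately have "(x - B)\<^sup>2 + real m / 4 \<le> 9 * (c2 * L) + 2 * (Cc\<^sup>2 * L)" using m(2) m0 by linarith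
      then have xQ: "(x - B)\<^sup>2 + real m / 4 \<le> Q * L" by (simp add: Q_def algebra_simps)
      have "1 / (B * sqrt B) = (1 / B) * (1 / sqrt B)" by simp
      also have "\<dots> \<le> (s\<^sup>2 / b1) * (s / sqrt b1)" using iB isB B0 b1 s by (intro mult_mono) auto
      finally have i3: "1 / (B * sqrt B) \<le> s ^ 3 / (b1 * sqrt b1)" by (simp add: power3_eq_cube power2_eq_square mult.assoc)
      have "s\<^sup>2 * \<alpha> / (2 * B * sqrt B) = (s\<^sup>2 * \<alpha> / 2) * (1 / (B * sqrt B))" by simp
      also have "\<dots> \<le> (s\<^sup>2 * \<alpha> / 2) * (s ^ 3 / (b1 * sqrt b1))" using i3 \<alpha> by (intro mult_left_mono) auto
      also have "\<dots> = \<alpha> / (2 * b1 * sqrt b1) * s ^ 5" by (simp add: numeral_eq_Suc mult_ac)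
      finally have "k1 \<le> \<alpha>\<^sup>2 / 4 * (\<alpha> / (2 * b1 * sqrt b1) * s ^ 5 + 200 * s ^ 5)"
        unfolding k1_def by (intro mult_left_mono add_right_mono) auto
      then have "k1 * ((x - B)\<^sup>2 + real m / 4) \<le> \<alpha>\<^sup>2 / 4 * (\<alpha> / (2 * b1 * sqrt b1) * s ^ 5 + 200 * s ^ 5) * (Q * L)"
        using xQ k10 by (intro mult_mono) auto
      also have "\<dots> = \<alpha>\<^sup>2 / 4 * (\<alpha> / (2 * b1 * sqrt b1) + 200) * Q * (s\<^sup>2 * L * s ^ 3)"
        by (simp add: algebra_simps numeral_eq_Suc)
      finally show ?thesis unfolding D1_def k0_def sL(1) by (simp add: algebra_simps)
    qed
    finally have r1: "\<bar>walk_mean m (test2 L \<alpha> \<theta>) x + G * (cos (\<omega> / 2) ^ m * cos (\<omega> * x + \<phi>))\<bar> \<le> D1 * s ^ 3"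
      by (simp only: walk_mean_add walk_mean_cmult walk_mean_cos)
    define K where "K = exp (- (\<alpha>\<^sup>2 / (32 * \<beta>)))"
    define \<Theta> where "\<Theta> = \<alpha> * sqrt B + \<alpha> / sqrt \<beta> + \<theta>"
    have r2: "\<bar>cos (\<omega> / 2) ^ m * cos (\<omega> * x + \<phi>) - K * cos \<Theta>\<bar>
        \<le> (\<alpha> ^ 4 / (128 * \<beta>\<^sup>2 * c1) + \<alpha> * Cc / (2 * sqrt b1)) * s"
    proof -
      have o2: "\<omega>\<^sup>2 = \<alpha>\<^sup>2 / (4 * B)" using B0 by (simp add: \<omega>_def power_divide power_mult_distrib)
      \<comment> \<open>The damping exponent does not depend on m: the squared frequency is
        proportional to 1 / m and the variance to m.\<close>
      have "real m * (\<omega> / 2)\<^sup>2 / 2 = \<alpha>\<^sup>2 / (32 * \<beta>)"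
        using m0 \<beta> by (simp add: power_divide o2 B_def)
      then have p1: "\<bar>cos (\<omega> / 2) ^ m - K\<bar> \<le> 2 * real m * (\<omega> / 2) ^ 4"
        using cos_power_gauss [of "\<omega> / 2" m] by (simp add: K_def)
      have o4: "(\<omega> / 2) ^ 4 = \<alpha> ^ 4 / (256 * B\<^sup>2)"
      proof -
        have "(\<omega> / 2) ^ 4 = (\<omega>\<^sup>2)\<^sup>2 / 16" by (simp add: power_divide power_mult [symmetric])
        also have "\<dots> = \<alpha> ^ 4 / (256 * B\<^sup>2)" unfolding o2 by (simp add: power_divide power_mult_distrib power_mult [symmetric])
        finally show ?thesis .
      qed
      have "2 * real m * (\<omega> / 2) ^ 4 = \<alpha> ^ 4 / (128 * \<beta>\<^sup>2) * (1 / real m)"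
        unfolding o4 using m0 \<beta> by (simp add: B_def field_simps power2_eq_square)
      also have "\<dots> \<le> \<alpha> ^ 4 / (128 * \<beta>\<^sup>2) * (s / c1)"
      proof (rule mult_left_mono)
        have "1 / real m \<le> 1 / (c1 * L)" using m m0 c12 L by (intro divide_left_mono mult_pos_pos) auto
        also have "\<dots> = s\<^sup>2 / c1" by (simp add: sL)
        also have "\<dots> \<le> s / c1" using s c12 by (intro divide_right_mono) (auto simp: power2_eq_square mult_left_le)
        finally show "1 / real m \<le> s / c1" .
      qed simp
      finally have p2: "\<bar>cos (\<omega> / 2) ^ m - K\<bar> \<le> \<alpha> ^ 4 / (128 * \<beta>\<^sup>2 * c1) * s" using p1 by (simp add: mult.assoc)
      \<comment> \<open>The displacement 2 * sqrt m of the level curve shifts the phase by a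
        constant, while the offset c shifts it by O(1 / sqrt L) only.\<close>
      have "\<omega> * (2 * sqrt (real m)) = \<alpha> / sqrt \<beta>"
        unfolding \<omega>_def B_def using m0 \<beta> by (simp add: real_sqrt_mult)
      then have "\<omega> * x + \<phi> = \<Theta> - \<omega> * c"
        by (simp add: x_def \<phi>_def \<Theta>_def algebra_simps)
      then have "\<bar>cos (\<omega> * x + \<phi>) - cos \<Theta>\<bar> \<le> \<bar>\<omega> * c\<bar>" using cos_Lipschitz [of "\<omega> * x + \<phi>" \<Theta>] by simp
      also have "\<bar>\<omega> * c\<bar> = \<alpha> / 2 * (1 / sqrt B) * \<bar>c\<bar>" using \<alpha> B0 by (simp add: \<omega>_def abs_mult)
      also have "\<dots> \<le> \<alpha> / 2 * (s / sqrt b1) * Cc"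
        using isB c \<alpha> B0 b1 s by (intro mult_mono) auto
      finally have p3: "\<bar>cos (\<omega> * x + \<phi>) - cos \<Theta>\<bar> \<le> \<alpha> * Cc / (2 * sqrt b1) * s" by (simp add: mult_ac)
      have K: "0 < K" "K \<le> 1" using \<beta> by (auto simp: K_def)
      have "cos (\<omega> / 2) ^ m * cos (\<omega> * x + \<phi>) - K * cos \<Theta>
         = (cos (\<omega> / 2) ^ m - K) * cos (\<omega> * x + \<phi>) + K * (cos (\<omega> * x + \<phi>) - cos \<Theta>)" by (simp add: algebra_simps)
      also have "\<bar>\<dots>\<bar> \<le> \<alpha> ^ 4 / (128 * \<beta>\<^sup>2 * c1) * s * 1 + 1 * (\<alpha> * Cc / (2 * sqrt b1) * s)"
      proof (rule order_trans [OF abs_triangle_ineq], rule add_mono)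
        show "\<bar>(cos (\<omega> / 2) ^ m - K) * cos (\<omega> * x + \<phi>)\<bar> \<le> \<alpha> ^ 4 / (128 * \<beta>\<^sup>2 * c1) * s * 1"
          unfolding abs_mult by (rule mult_mono [OF p2 abs_cos_le_one]) (use s c12 in auto)
        show "\<bar>K * (cos (\<omega> * x + \<phi>) - cos \<Theta>)\<bar> \<le> 1 * (\<alpha> * Cc / (2 * sqrt b1) * s)"
          unfolding abs_mult by (rule mult_mono [OF _ p3]) (use K in auto)
      qed
      finally show ?thesis by (simp add: algebra_simps)
    qed
    have G: "\<bar>G\<bar> \<le> \<alpha>\<^sup>2 / 4 * s\<^sup>2"
      unfolding G_def using mult_left_mono [OF env(1) [of B], of "\<alpha>\<^sup>2 / 4"] by (simp add: abs_mult)
    have r3: "\<bar>G * (cos (\<omega> / 2) ^ m * cos (\<omega> * x + \<phi>)) - G * (K * cos \<Theta>)\<bar> \<le> D2 * s ^ 3"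
    proof -
      have "\<bar>G * (cos (\<omega> / 2) ^ m * cos (\<omega> * x + \<phi>)) - G * (K * cos \<Theta>)\<bar>
         = \<bar>G\<bar> * \<bar>cos (\<omega> / 2) ^ m * cos (\<omega> * x + \<phi>) - K * cos \<Theta>\<bar>"
        by (simp add: abs_mult [symmetric] right_diff_distrib)
      also have "\<dots> \<le> (\<alpha>\<^sup>2 / 4 * s\<^sup>2) * ((\<alpha> ^ 4 / (128 * \<beta>\<^sup>2 * c1) + \<alpha> * Cc / (2 * sqrt b1)) * s)"
        using G r2 by (intro mult_mono) auto
      also have "\<dots> = D2 * s ^ 3" by (simp add: D2_def power3_eq_cube power2_eq_square)
      finally show ?thesis .
    qed
    have "\<bar>walk_mean m (test2 L \<alpha> \<theta>) x + G * (K * cos \<Theta>)\<bar> \<le> (D1 + D2) * s ^ 3"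
      using r1 r3 by (simp only: distrib_right)
    moreover have "G * (K * cos \<Theta>) = \<alpha>\<^sup>2 / 4 * K * envelope L B * cos \<Theta>" by (simp add: G_def)
    ultimately show "\<bar>walk_mean m (test2 L \<alpha> \<theta>) (\<beta> * real m + 2 * sqrt (real m) - c)
     + \<alpha>\<^sup>2 / 4 * exp (- (\<alpha>\<^sup>2 / (32 * \<beta>))) * envelope L (\<beta> * real m)
       * cos (\<alpha> * sqrt (\<beta> * real m) + \<alpha> / sqrt \<beta> + \<theta>)\<bar> \<le> (D1 + D2) * (1 / sqrt L) ^ 3"
      by (simp only: x_def B_def K_def \<Theta>_def s_def)
  qed
qed

lemma adj_mean_tail_low:
  assumes B: "\<And>b. \<bar>f b\<bar> \<le> B" and z: "\<And>b. b \<le> L \<Longrightarrow> f b = 0" and L: "L > 0" and x: "y - real m / 2 \<le> 7 / 8 * L"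
  shows "\<bar>adj_mean m f y\<bar> \<le> B * (real m)\<^sup>2 / (L / 8) ^ 4"
  unfolding adj_mean_def
proof (rule walk_mean_tail [OF B])
  fix b assume "\<bar>b - (y - real m / 2)\<bar> < L / 8"
  then show "f b = 0" using x by (intro z) linarith
qed (use L in simp)

lemma adj_mean_tail_high:
  assumes B: "\<And>b. \<bar>f b\<bar> \<le> B" and z: "\<And>b. 2 * L \<le> b \<Longrightarrow> f b = 0" and D: "D > 0" and x: "2 * L + D \<le> y - real m / 2"
  shows "\<bar>adj_mean m f y\<bar> \<le> B * (real m)\<^sup>2 / D ^ 4"
  unfolding adj_mean_def
proof (rule walk_mean_tail [OF B _ D])
  fix b assume "\<bar>b - (y - real m / 2)\<bar> < D"
  then show "f b = 0" using x by (intro z) linarith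
qed

lemma sum_inverse_squares_le:
  assumes "1 \<le> a"
  shows "(\<Sum>m = a..N. 1 / (real m)\<^sup>2) \<le> 2"
proof -
  have *: "(\<Sum>m = 1..Suc N. 1 / (real m)\<^sup>2) \<le> 2 - 1 / (real N + 1)" for N
  proof (induction N)
    case (Suc N)
    have "1 / (real (Suc (Suc N)))\<^sup>2 \<le> 1 / ((real N + 1) * (real N + 2))"
      by (intro divide_left_mono) (auto simp: power2_eq_square intro!: mult_mono)
    also have "\<dots> = 1 / (real N + 1) - 1 / (real (Suc N) + 1)" by (simp add: field_simps)
    finally show ?case using Suc by simp
  qed simp
  have "(\<Sum>m = a..N. 1 / (real m)\<^sup>2) \<le> (\<Sum>m = 1..Suc N. 1 / (real m)\<^sup>2)"
    by (rule sum_mono2) (use assms in auto)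
  also have "\<dots> \<le> 2 - 1 / (real N + 1)" by (rule *)
  also have "\<dots> \<le> 2" by simp
  finally show ?thesis .
qed

section \<open>The contribution of one dyadic block along a model level curve\<close>

locale block_setup =
  fixes lam0 :: real and p :: int and q k :: nat and Cc :: real
  assumes q: "q > 0" and k: "k > 0" and lam: "lam0 = of_int p / real q" "1 / 2 < lam0" "lam0 < 1"
    and Cc: "Cc \<ge> 0"
begin

definition "bt = lam0 - 1 / 2"
text \<open>Chosen to make al * sqrt (bt * m) equal to 4 * pi * k * q * sqrt m, which is the phase
  at frequency k * q of the term 2 * sqrt m in \<open>lpath\<close>.\<close>

definition "al = 4 * pi * real (k * q) / sqrt bt"
text \<open>Minus the position at time - m of the level curve with offset c, without the error of
  the expansion; positions and times are reflected to make both positive.\<close>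

definition "lpath c m = lam0 * real m + 2 * sqrt (real m) - c"
text \<open>The end point bt * m of the centred walk is about 3 / 4 * L at \<open>M1\<close> and 3 *
  L at \<open>M2\<close>. Between these times it crosses the support {L..2 * L} of the test
  function; outside them it stays away by a multiple of L.\<close>

definition "M1 L = nat \<lceil>3 * L / (4 * bt)\<rceil>"
definition "M2 L = nat \<lfloor>3 * L / bt\<rfloor>"
text \<open>The square of the phase derivative, the damping by the walk and the envelope: the
  amplitude found in \<open>test2_mean_asymptotics\<close>, with the sign dropped.\<close>

definition "amp L m = al\<^sup>2 / 4 * exp (- (al\<^sup>2 / (32 * bt))) * envelope L (bt * real m)"
text \<open>From here on L / 16 dominates the lower-order terms in the position of the walk.\<close>

definition "L1 = 16 * (32 / bt + Cc + 5)"

lemma bt: "0 < bt" "bt < 1 / 2"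
  using lam(2,3) by (auto simp: bt_def)

lemma al: "al > 0"
  using bt q k by (simp add: al_def)

lemma L1: "L1 \<le> L \<Longrightarrow> 1 \<le> L" "L1 \<le> L \<Longrightarrow> L / 16 \<ge> 32 / bt + Cc + 5" "L1 \<le> L \<Longrightarrow> L \<ge> 80"
proof -
  assume "L1 \<le> L"
  define x where "x = 32 / bt"
  have 2: "16 * (x + Cc + 5) \<le> L" using \<open>L1 \<le> L\<close> by (simp only: L1_def x_def)
  have 1: "0 \<le> x" using bt by (simp add: x_def)
  show "1 \<le> L" using 1 2 Cc by argo
  show "L / 16 \<ge> 32 / bt + Cc + 5" unfolding x_def [symmetric] using 1 2 Cc by argo
  show "L \<ge> 80" using 1 2 Cc by argo
qed

lemma M_bounds:
  assumes "1 \<le> L"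
  shows "3 * L / (4 * bt) \<le> real (M1 L)" "real (M1 L) \<le> 3 * L / (4 * bt) + 1" "real (M1 L) \<le> 2 * L / bt" "L \<le> real (M1 L)"
    "3 * L / bt - 1 \<le> real (M2 L)" "real (M2 L) \<le> 3 * L / bt" "M1 L \<le> M2 L" "3 * L - 1 \<le> bt * real (M2 L)"
proof -
  have x: "0 \<le> 3 * L / (4 * bt)" "0 \<le> 3 * L / bt" using assms bt by auto
  have iL: "2 * L \<le> L / bt" using assms bt by (simp add: field_simps)
  have e: "3 * L / (4 * bt) = 3 / 4 * (L / bt)" "3 * L / bt = 3 * (L / bt)" "2 * L / bt = 2 * (L / bt)" by simp_all
  show a: "3 * L / (4 * bt) \<le> real (M1 L)" unfolding M1_def using x real_nat_ceiling_ge by blast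
  have "real (M1 L) = of_int \<lceil>3 * L / (4 * bt)\<rceil>" unfolding M1_def using x by simp
  then show b: "real (M1 L) \<le> 3 * L / (4 * bt) + 1" by linarith
  then show "real (M1 L) \<le> 2 * L / bt" using iL assms unfolding e by linarith
  show "L \<le> real (M1 L)" using a iL assms unfolding e by linarith
  have f: "real (M2 L) = of_int \<lfloor>3 * L / bt\<rfloor>" unfolding M2_def using x by simp
  then show c: "3 * L / bt - 1 \<le> real (M2 L)" by linarith
  show "real (M2 L) \<le> 3 * L / bt" using f by linarith
  have "real (M1 L) \<le> real (M2 L)" using b c iL assms unfolding e by linarith
  then show "M1 L \<le> M2 L" by simp
  have "bt * (3 * L / bt - 1) \<le> bt * real (M2 L)" using c bt by (intro mult_left_mono) auto
  then show "3 * L - 1 \<le> bt * real (M2 L)" using bt by (simp add: right_diff_distrib)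
qed

lemma drift_M1:
  assumes "L1 \<le> L"
  shows "bt * real (M1 L) + 2 * sqrt (real (M1 L)) + Cc + 3 \<le> 7 / 8 * L"
proof -
  have L: "1 \<le> L" using L1 [OF assms] by simp
  note M = M_bounds [OF L]
  have "bt * real (M1 L) \<le> bt * (3 * L / (4 * bt) + 1)" using M(2) bt by (intro mult_left_mono) auto
  also have "\<dots> = 3 / 4 * L + bt" using bt by (simp add: distrib_left)
  finally have 1: "bt * real (M1 L) \<le> 3 / 4 * L + 1" using bt by linarith
  \<comment> \<open>Young's inequality with the share bt / 32: as M1 L <= 2 * L / bt, it costs L /
    16. Together with 3 / 4 * L and the L / 16 reserved by \<open>L1\<close> this makes 7 / 8 *
    L.\<close>
  have "2 * sqrt (real (M1 L)) \<le> bt / 32 * real (M1 L) + 32 / bt"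
  proof -
    define t where "t = sqrt (real (M1 L))"
    have "0 \<le> (bt * t - 32)\<^sup>2" by simp
    then have "64 * (bt * t) \<le> bt\<^sup>2 * t\<^sup>2 + 1024" by (simp add: power2_eq_square algebra_simps)
    then have "2 * t \<le> bt / 32 * t\<^sup>2 + 32 / bt" using bt by (simp add: field_simps power2_eq_square)
    then show ?thesis by (simp add: t_def)
  qed
  also have "bt / 32 * real (M1 L) \<le> bt / 32 * (2 * L / bt)" using M(3) bt by (intro mult_left_mono) auto
  also have "\<dots> = L / 16" using bt by simp
  finally show ?thesis using 1 L1 [OF assms] by linarith
qed

text \<open>Every term of \<open>adj_mean_derivative_sum\<close> is O(1 / sqrt L). At both ends the
  walk is centred at least L / 8 off the support; by concavity of the square root the increments of
  the path decrease, and they exceed lam0 by O(1 / sqrt L), so the weight 1 / (d - 1 / 2) varies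
  that little; the first derivative is O(1 / sqrt L), and O(L) third derivatives are L^(-3/2)
  each.\<close>

lemma test1_sum_bound:
  "\<exists>C. \<forall>L\<ge>L1. \<forall>\<theta> c. \<bar>c\<bar> \<le> Cc \<longrightarrow>
     \<bar>\<Sum>m = M1 L..<M2 L. adj_mean m (test1 L al \<theta>) (lpath c m)\<bar> \<le> C / sqrt L"
proof -
  define E where "E = test_bound al"
  define G where "G = 3 * (1 + 1 / bt\<^sup>2)"
  define G' where "G' = 5 / bt + 5 * (1 + 1 / bt\<^sup>2)"
  define C where "C = 2 * (4096 * 9 / bt\<^sup>2) / bt + 1 / bt\<^sup>2 + G * E + 3 / bt * G' * E"
  have E0: "E \<ge> 0" using al by (simp add: E_def test_bound_def)
  have G0: "G' \<ge> 0" using bt by (simp add: G'_def)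
  show ?thesis
  proof (intro exI [of _ C] allI impI)
    fix L \<theta> c :: real
    assume LL: "L1 \<le> L" and c: "\<bar>c\<bar> \<le> Cc"
    note L = L1 [OF LL]
    note M = M_bounds [OF L(1)]
    define s where "s = 1 / sqrt L"
    have L0: "L > 0" using L by simp
    have s: "0 < s" "s \<le> 1" using L by (auto simp: s_def)
    have sL: "s\<^sup>2 * L = 1" using L by (simp add: s_def power_divide)
    define d where "d m = lam0 + 2 * (sqrt (real (Suc m)) - sqrt (real m))" for m
    note tb = test_bounds [OF L(1), of al, folded s_def E_def]
    have al0: "al \<ge> 0" using al by simp
    have M1p: "real (M1 L) > 0" "M1 L > 0" using M(4) L by auto
    have dm: "1 / 2 + bt \<le> d m \<and> d m \<le> lam0 + 1 / sqrt (real (M1 L))" if "M1 L \<le> m" for m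
    proof -
      have "sqrt (real m + 1) - sqrt (real m) \<le> 1 / (2 * sqrt (real m))"
        using sqrt_diff_le [of "real m" 1] that M1p by simp
      also have "\<dots> \<le> 1 / (2 * sqrt (real (M1 L)))" using that M1p by (intro divide_left_mono) auto
      finally have "2 * (sqrt (real (Suc m)) - sqrt (real m)) \<le> 1 / sqrt (real (M1 L))" by (simp add: add.commute)
      moreover have "sqrt (real m) \<le> sqrt (real (Suc m))" by simp
      ultimately show ?thesis by (simp add: d_def bt_def)
    qed
    have ddec: "d (Suc m) \<le> d m" if "M1 L \<le> m" for m
    proof -
      have m: "real m > 0" using that M1p by simp
      have "sqrt (real m + 1 + 1) - sqrt (real m + 1) \<le> sqrt (real m + 1) - sqrt (real m)"
        using sqrt_diff_eq [of "real m + 1" 1] sqrt_diff_eq [of "real m" 1] m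
        by (auto intro!: divide_left_mono add_mono mult_pos_pos add_pos_pos)
      then show ?thesis by (simp add: d_def add.commute)
    qed
    have isM: "1 / sqrt (real (M1 L)) \<le> s" unfolding s_def using M(4) L by (intro divide_left_mono mult_pos_pos) (auto simp: M1p)
    have "\<bar>\<Sum>m = M1 L..<M2 L. adj_mean m (test1 L al \<theta>) (lpath c m)\<bar>
      \<le> (\<bar>adj_mean (M2 L) (test0 L al \<theta>) (lpath c (M2 L))\<bar> + \<bar>adj_mean (M1 L) (test0 L al \<theta>) (lpath c (M1 L))\<bar>) / bt
       + 1 * (1 / (d (M2 L) - 1 / 2) - 1 / (d (M1 L) - 1 / 2))
       + 3 * (1 + 1 / bt\<^sup>2) * (E * s) + real (M2 L - M1 L) * (5 / bt + 5 * (1 + 1 / bt\<^sup>2)) * (E * s ^ 3)"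
    proof (rule adj_mean_derivative_sum [OF DERIV_test [OF L0] tb(1) [OF al0] tb(2) [OF al0] tb(4) [OF al0]])
      show "lpath c (Suc m) = lpath c m + d m" for m by (simp add: lpath_def d_def algebra_simps)
      show "1 / 2 + bt \<le> d m \<and> d m \<le> 2" if "M1 L \<le> m" "m \<le> M2 L" for m
        using dm [OF that(1)] isM s lam by linarith
    qed (use M ddec bt in auto)
    also have "\<dots> \<le> 2 * (4096 * 9 / bt\<^sup>2) / bt * s + 1 / bt\<^sup>2 * s + G * E * s + 3 / bt * G' * E * s"
    proof (intro add_mono)
      have B: "x\<^sup>2 / (L / 8) ^ 4 \<le> 4096 * 9 / bt\<^sup>2 * s" if "0 \<le> x" "x \<le> 3 * L / bt" for x
      proof -
        have "x\<^sup>2 \<le> (3 * L / bt)\<^sup>2" using that by (intro power_mono) auto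
        then have "x\<^sup>2 / (L / 8) ^ 4 \<le> (3 * L / bt)\<^sup>2 / (L / 8) ^ 4" using L0 by (intro divide_right_mono) auto
        also have "\<dots> = 4096 * 9 / bt\<^sup>2 * (1 / L * (1 / L))"
          using L0 bt by (simp add: field_simps power2_eq_square power4_eq_xxxx)
        also have "\<dots> \<le> 4096 * 9 / bt\<^sup>2 * s"
        proof (rule mult_left_mono)
          have "1 / L = s * s" using L0 by (simp add: s_def)
          moreover have "s * s \<le> 1" using s mult_mono [of s 1 s 1] by simp
          moreover have "s * s * (s * s) = s * (s * (s * s))" by simp
          moreover have "s * (s * s) \<le> 1" using s \<open>s * s \<le> 1\<close> mult_mono [of s 1 "s * s" 1] by simp
          ultimately show "1 / L * (1 / L) \<le> s" using s mult_left_mono [of "s * (s * s)" 1 s] by simp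
        qed simp
        finally show ?thesis .
      qed
      have A2: "\<bar>adj_mean (M2 L) (test0 L al \<theta>) (lpath c (M2 L))\<bar> \<le> 1 * (real (M2 L))\<^sup>2 / (L / 8) ^ 4"
      proof (rule adj_mean_tail_high [where L = L])
        show "\<bar>test0 L al \<theta> b\<bar> \<le> 1" for b by (rule tb(1) [OF al0])
        show "test0 L al \<theta> b = 0" if "2 * L \<le> b" for b using test_eq_0 [OF L0] that by blast
        have "lpath c (M2 L) - real (M2 L) / 2 = bt * real (M2 L) + 2 * sqrt (real (M2 L)) - c"
          by (simp add: lpath_def bt_def algebra_simps)
        moreover have "0 \<le> sqrt (real (M2 L))" by simp
        moreover have "0 \<le> 32 / bt" using bt by simp
        ultimately show "2 * L + L / 8 \<le> lpath c (M2 L) - real (M2 L) / 2" using M(8) c L by linarith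
      qed (use L0 in simp)
      have A1: "\<bar>adj_mean (M1 L) (test0 L al \<theta>) (lpath c (M1 L))\<bar> \<le> 1 * (real (M1 L))\<^sup>2 / (L / 8) ^ 4"
      proof (rule adj_mean_tail_low)
        show "\<bar>test0 L al \<theta> b\<bar> \<le> 1" for b by (rule tb(1) [OF al0])
        show "test0 L al \<theta> b = 0" if "b \<le> L" for b using test_eq_0 [OF L0] that by blast
        have "lpath c (M1 L) - real (M1 L) / 2 = bt * real (M1 L) + 2 * sqrt (real (M1 L)) - c"
          by (simp add: lpath_def bt_def algebra_simps)
        then show "lpath c (M1 L) - real (M1 L) / 2 \<le> 7 / 8 * L" using drift_M1 [OF LL] c by linarith
      qed (use L0 in simp)
      have "real (M1 L) \<le> real (M2 L)" using M(7) by simp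
      then have "\<bar>adj_mean (M2 L) (test0 L al \<theta>) (lpath c (M2 L))\<bar> + \<bar>adj_mean (M1 L) (test0 L al \<theta>) (lpath c (M1 L))\<bar>
          \<le> 2 * (4096 * 9 / bt\<^sup>2) * s"
        using A1 A2 B [of "real (M1 L)"] B [of "real (M2 L)"] M(6) by simp
      then have "(\<bar>adj_mean (M2 L) (test0 L al \<theta>) (lpath c (M2 L))\<bar> + \<bar>adj_mean (M1 L) (test0 L al \<theta>) (lpath c (M1 L))\<bar>) / bt
          \<le> 2 * (4096 * 9 / bt\<^sup>2) * s / bt" using bt by (intro divide_right_mono) auto
      then show "(\<bar>adj_mean (M2 L) (test0 L al \<theta>) (lpath c (M2 L))\<bar> + \<bar>adj_mean (M1 L) (test0 L al \<theta>) (lpath c (M1 L))\<bar>) / bt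
          \<le> 2 * (4096 * 9 / bt\<^sup>2) / bt * s" by simp
      show "1 * (1 / (d (M2 L) - 1 / 2) - 1 / (d (M1 L) - 1 / 2)) \<le> 1 / bt\<^sup>2 * s"
      proof -
        have "1 / (d (M2 L) - 1 / 2) \<le> 1 / bt" using dm [OF M(7)] bt by (intro divide_left_mono) auto
        moreover have "1 / (bt + s) \<le> 1 / (d (M1 L) - 1 / 2)"
          using dm [of "M1 L"] isM bt by (intro divide_left_mono mult_pos_pos) (auto simp: bt_def)
        moreover have "1 / bt - 1 / (bt + s) = s / (bt * (bt + s))" using bt s by (simp add: field_simps)
        moreover have "s / (bt * (bt + s)) \<le> s / (bt * bt)" using bt s by (intro divide_left_mono mult_left_mono mult_pos_pos) auto
        ultimately show ?thesis by (simp add: power2_eq_square)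
      qed
      show "3 * (1 + 1 / bt\<^sup>2) * (E * s) \<le> G * E * s" by (simp add: G_def)
      have "real (M2 L - M1 L) * G' * (E * s ^ 3) \<le> (3 * L / bt) * G' * (E * s ^ 3)"
        using M(6) G0 E0 s bt L0 by (intro mult_right_mono) auto
      also have "\<dots> = 3 / bt * G' * E * (s\<^sup>2 * L * s)" by (simp add: power3_eq_cube power2_eq_square)
      finally show "real (M2 L - M1 L) * (5 / bt + 5 * (1 + 1 / bt\<^sup>2)) * (E * s ^ 3) \<le> 3 / bt * G' * E * s"
        unfolding sL by (simp add: G'_def)
    qed
    also have "\<dots> = C * s" by (simp add: C_def algebra_simps)
    finally show "\<bar>\<Sum>m = M1 L..<M2 L. adj_mean m (test1 L al \<theta>) (lpath c m)\<bar> \<le> C / sqrt L" by (simp add: s_def)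
  qed
qed

lemma lpath_eq: "lpath c m = of_int p / real q * real m + 2 * sqrt (real m) - c"
  unfolding lpath_def by (subst lam(1)) (rule refl)

lemma lam0_q: "lam0 * real q = of_int p"
  by (subst lam(1)) (use q in simp)

lemma amp_bounds:
  assumes L: "1 \<le> L"
  shows "0 \<le> amp L m" "\<bar>amp L m\<bar> \<le> 50 * al\<^sup>2 / L" "\<bar>amp L (Suc m) - amp L m\<bar> \<le> 50 * al\<^sup>2 / L\<^sup>2"
proof -
  define K where "K = exp (- (al\<^sup>2 / (32 * bt)))"
  have K: "0 < K" "K \<le> 1" using bt by (auto simp: K_def)
  define A where "A = al\<^sup>2 / 4 * K"
  have A: "0 \<le> A" "A \<le> al\<^sup>2 / 4" using K mult_left_mono [of K 1 "al\<^sup>2 / 4"] by (auto simp: A_def)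
  have e: "amp L m = A * envelope L (bt * real m)" for m by (simp add: amp_def A_def K_def)
  have s2: "(1 / sqrt L)\<^sup>2 = 1 / L" using L by (simp add: power_divide)
  have "(1 / sqrt L) ^ 4 = ((1 / sqrt L)\<^sup>2)\<^sup>2" by (simp add: power_mult [symmetric])
  then have s4: "(1 / sqrt L) ^ 4 = 1 / L\<^sup>2" unfolding s2 by (simp add: power_divide)
  note env = envelope_bounds [OF L, unfolded s2 s4]
  show "0 \<le> amp L m" unfolding e using A env(3) by simp
  have "\<bar>amp L m\<bar> = A * \<bar>envelope L (bt * real m)\<bar>" unfolding e abs_mult using A by simp
  also have "\<dots> \<le> al\<^sup>2 / 4 * (1 / L)" using A env(1) by (intro mult_mono) auto
  also have "\<dots> \<le> 50 * al\<^sup>2 / L" using L by (simp add: field_simps)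
  finally show "\<bar>amp L m\<bar> \<le> 50 * al\<^sup>2 / L" .
  have "\<bar>amp L (Suc m) - amp L m\<bar> = A * \<bar>envelope L (bt * real (Suc m)) - envelope L (bt * real m)\<bar>"
    unfolding e right_diff_distrib [symmetric] abs_mult using A by simp
  also have "\<dots> \<le> al\<^sup>2 / 4 * (200 * (1 / L\<^sup>2) * 1)"
  proof (rule mult_mono)
    have "\<bar>envelope L (bt * real (Suc m)) - envelope L (bt * real m)\<bar> \<le> 200 * (1 / L\<^sup>2) * \<bar>bt * real (Suc m) - bt * real m\<bar>"
      by (rule env(2))
    also have "\<dots> \<le> 200 * (1 / L\<^sup>2) * 1" using bt by (intro mult_left_mono) (auto simp: algebra_simps)
    finally show "\<bar>envelope L (bt * real (Suc m)) - envelope L (bt * real m)\<bar> \<le> 200 * (1 / L\<^sup>2) * 1" .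
  qed (use A in auto)
  finally show "\<bar>amp L (Suc m) - amp L m\<bar> \<le> 50 * al\<^sup>2 / L\<^sup>2" by simp
qed

text \<open>Since lam0 * q = p, the linear part of \<open>lpath\<close> contributes k * p * m full
  turns. The slow phase of the averaged test function is therefore the phase of the lattice position
  at frequency k * q.\<close>

lemma second_derivative_asymptotics:
  "\<exists>D\<ge>0. \<forall>L\<ge>L1. \<forall>\<theta> c m. \<bar>c\<bar> \<le> Cc \<and> M1 L \<le> m \<and> m < M2 L \<longrightarrow>
     \<bar>adj_mean m (test2 L al \<theta>) (lpath c m) + amp L m * cos (2 * pi * real (k * q) * (lpath c m + c) + (\<theta> + al / sqrt bt))\<bar>
       \<le> D * (1 / sqrt L) ^ 3"
proof -
  have c12: "0 < (1::real)" "1 \<le> 3 / bt" using bt by auto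
  have al0: "0 \<le> al" using al by simp
  obtain D where D: "D \<ge> 0" "\<And>L m c \<theta>. \<lbrakk>L \<ge> 1; 1 * L \<le> real m; real m \<le> 3 / bt * L; \<bar>c\<bar> \<le> Cc\<rbrakk> \<Longrightarrow>
    \<bar>walk_mean m (test2 L al \<theta>) (bt * real m + 2 * sqrt (real m) - c)
     + al\<^sup>2 / 4 * exp (- (al\<^sup>2 / (32 * bt))) * envelope L (bt * real m)
       * cos (al * sqrt (bt * real m) + al / sqrt bt + \<theta>)\<bar> \<le> D * (1 / sqrt L) ^ 3"
    using test2_mean_asymptotics [OF al0 bt(1) c12 Cc] by metis
  show ?thesis
  proof (intro exI [of _ D] conjI D(1) allI impI)
    fix L \<theta> c :: real and m :: nat
    assume LL: "L1 \<le> L" and H: "\<bar>c\<bar> \<le> Cc \<and> M1 L \<le> m \<and> m < M2 L"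
    note L = L1 [OF LL]
    note M = M_bounds [OF L(1)]
    have m: "real (M1 L) \<le> real m" "real m \<le> real (M2 L)" using H by auto
    have m': "1 * L \<le> real m" "real m \<le> 3 / bt * L" using m M(4,6) by auto
    have x: "lpath c m - real m / 2 = bt * real m + 2 * sqrt (real m) - c"
      by (simp add: lpath_def bt_def algebra_simps)
    have "cos (al * sqrt (bt * real m) + al / sqrt bt + \<theta>) = cos (2 * pi * real (k * q) * (lpath c m + c) + (\<theta> + al / sqrt bt))"
    proof -
      have "al * sqrt (bt * real m) = 4 * pi * real (k * q) * sqrt (real m)"
        using bt by (simp add: al_def real_sqrt_mult)
      moreover have "2 * pi * real (k * q) * (lpath c m + c) = 4 * pi * real (k * q) * sqrt (real m) + 2 * pi * of_int (int k * p * int m)"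
      proof -
        have "2 * pi * real (k * q) * (lpath c m + c) = 4 * pi * real (k * q) * sqrt (real m) + 2 * pi * (real k * (lam0 * real q) * real m)"
          by (simp add: lpath_def algebra_simps)
        then show ?thesis unfolding lam0_q by simp
      qed
      ultimately have "2 * pi * real (k * q) * (lpath c m + c) + (\<theta> + al / sqrt bt)
          = (al * sqrt (bt * real m) + al / sqrt bt + \<theta>) + 2 * pi * of_int (int k * p * int m)" by simp
      moreover have "cos (y + 2 * pi * of_int i) = cos y" for y and i :: int
        by (simp add: cos_add sin_int_2pin cos_int_2pin)
      ultimately show ?thesis by presburger
    qed
    with D(2) [OF L(1) m', of c \<theta>] H
    show "\<bar>adj_mean m (test2 L al \<theta>) (lpath c m) + amp L m * cos (2 * pi * real (k * q) * (lpath c m + c) + (\<theta> + al / sqrt bt))\<bar>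
       \<le> D * (1 / sqrt L) ^ 3"
      unfolding adj_mean_def x amp_def by simp
  qed
qed

text \<open>What the source at time - m contributes when a level curve lies at - y: by duality, the
  increment of the averaged test function across the lattice cell containing y.\<close>

definition unit_jump :: "real \<Rightarrow> real \<Rightarrow> nat \<Rightarrow> real \<Rightarrow> real" where
  "unit_jump L \<theta> m y = adj_mean m (test0 L al \<theta>) (of_int \<lfloor>y\<rfloor> + 1) - adj_mean m (test0 L al \<theta>) (of_int \<lfloor>y\<rfloor>)"

text \<open>Taylor expansion about y with displacements 1 - f and - f, where f = frac y: the
  first-order weights add up to 1, and the second-order ones to ((1 - f)^2 - f^2) / 2 = 1 / 2 - f,
  the sawtooth. Only the derivatives are moved to the model path, because the sawtooth, being
  discontinuous, has to keep the true position.\<close>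

lemma unit_jump_good:
  "\<exists>C\<ge>0. \<forall>L\<ge>L1. \<forall>\<theta> c m y \<delta>. \<bar>c\<bar> \<le> Cc \<and> M1 L \<le> m \<and> m < M2 L \<and> \<bar>y - lpath c m\<bar> \<le> \<delta> \<and> \<delta> \<le> 1 / 4 \<longrightarrow>
     \<bar>unit_jump L \<theta> m y - adj_mean m (test1 L al \<theta>) (lpath c m)
        + amp L m * ((1 / 2 - frac y) * cos (2 * pi * real (k * q) * (lpath c m + c) + (\<theta> + al / sqrt bt)))\<bar>
       \<le> C * (\<delta> * (1 / sqrt L)\<^sup>2 + (1 / sqrt L) ^ 3)"
proof -
  obtain D where D: "D \<ge> 0" "\<And>L \<theta> c m. L1 \<le> L \<Longrightarrow> \<bar>c\<bar> \<le> Cc \<Longrightarrow> M1 L \<le> m \<Longrightarrow> m < M2 L \<Longrightarrow>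
     \<bar>adj_mean m (test2 L al \<theta>) (lpath c m) + amp L m * cos (2 * pi * real (k * q) * (lpath c m + c) + (\<theta> + al / sqrt bt))\<bar>
       \<le> D * (1 / sqrt L) ^ 3" using second_derivative_asymptotics by metis
  define E where "E = test_bound al"
  have E0: "E \<ge> 0" using al by (simp add: E_def test_bound_def)
  show ?thesis
  proof (intro exI [of _ "3 * E + D"] conjI allI impI)
    show "0 \<le> 3 * E + D" using E0 D(1) by simp
    fix L \<theta> c y \<delta> :: real and m :: nat
    assume LL: "L1 \<le> L" and H: "\<bar>c\<bar> \<le> Cc \<and> M1 L \<le> m \<and> m < M2 L \<and> \<bar>y - lpath c m\<bar> \<le> \<delta> \<and> \<delta> \<le> 1 / 4"
    note L = L1 [OF LL]
    have L0: "L > 0" using L by simp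
    have al0: "al \<ge> 0" using al by simp
    define s where "s = 1 / sqrt L"
    have s: "0 < s" using L by (auto simp: s_def)
    note tb = test_bounds [OF L(1) al0, folded s_def E_def]
    define A where "A = adj_mean m (test0 L al \<theta>)"
    define A1 where "A1 = adj_mean m (test1 L al \<theta>)"
    define A2 where "A2 = adj_mean m (test2 L al \<theta>)"
    define A3 where "A3 = adj_mean m (test3 L al \<theta>)"
    have d: "(A has_real_derivative A1 x) (at x)" "(A1 has_real_derivative A2 x) (at x)"
      "(A2 has_real_derivative A3 x) (at x)" for x
      unfolding A_def A1_def A2_def A3_def by (rule DERIV_adj_mean, rule DERIV_test [OF L0])+
    have b2: "\<bar>A2 x\<bar> \<le> E * s\<^sup>2" for x unfolding A2_def by (rule abs_adj_mean_bound) (rule tb)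
    have b3: "\<bar>A3 x\<bar> \<le> E * s ^ 3" for x unfolding A3_def by (rule abs_adj_mean_bound) (rule tb)
    define f where "f = frac y"
    have f: "0 \<le> f" "f < 1" unfolding f_def using frac_ge_0 frac_lt_1 by auto
    have fy: "of_int \<lfloor>y\<rfloor> = y + (- f)" "of_int \<lfloor>y\<rfloor> + 1 = y + (1 - f)" by (simp_all add: f_def frac_def)
    define y0 where "y0 = lpath c m"
    define W where "W = amp L m * cos (2 * pi * real (k * q) * (lpath c m + c) + (\<theta> + al / sqrt bt))"
    have t1: "\<bar>A (y + (1 - f)) - A y - (1 - f) * A1 y - (1 - f)\<^sup>2 / 2 * A2 y\<bar> \<le> E * s ^ 3"
      using order_trans [OF taylor_second [OF d b3, of y "1 - f"] mult_left_mono [of "\<bar>1 - f\<bar> ^ 3" 1 "E * s ^ 3"]]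
        f E0 s by (simp add: power_le_one)
    have t2: "\<bar>A (y + (- f)) - A y - (- f) * A1 y - (- f)\<^sup>2 / 2 * A2 y\<bar> \<le> E * s ^ 3"
      using order_trans [OF taylor_second [OF d b3, of y "- f"] mult_left_mono [of "\<bar>- f\<bar> ^ 3" 1 "E * s ^ 3"]]
        f E0 s by (simp add: power_le_one)
    have t3: "\<bar>A1 y - A1 y0\<bar> \<le> E * s\<^sup>2 * \<delta>"
    proof -
      have "norm (A1 y - A1 y0) \<le> E * s\<^sup>2 * norm (y - y0)"
        by (rule field_differentiable_bound [where S = UNIV and f' = A2]) (use d(2) b2 in auto)
      also have "\<dots> \<le> E * s\<^sup>2 * \<delta>" using H E0 by (intro mult_left_mono) (auto simp: y0_def)
      finally show ?thesis by simp
    qed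
    have t4: "\<bar>A2 y - A2 y0\<bar> \<le> E * s ^ 3 * (1 / 4)"
    proof -
      have "norm (A2 y - A2 y0) \<le> E * s ^ 3 * norm (y - y0)"
        by (rule field_differentiable_bound [where S = UNIV and f' = A3]) (use d(3) b3 in auto)
      also have "\<dots> \<le> E * s ^ 3 * (1 / 4)" using H E0 s by (intro mult_left_mono) (auto simp: y0_def)
      finally show ?thesis by simp
    qed
    have t5: "\<bar>A2 y0 + W\<bar> \<le> D * s ^ 3" unfolding A2_def y0_def W_def s_def using D(2) [OF LL] H by blast
    have t6: "\<bar>(1 / 2 - f) * (A2 y + W)\<bar> \<le> 1 * (E * s ^ 3 + D * s ^ 3)"
      unfolding abs_mult
    proof (rule mult_mono)
      have "0 \<le> E * s ^ 3" using E0 s by simp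
      then show "\<bar>A2 y + W\<bar> \<le> E * s ^ 3 + D * s ^ 3" using t4 t5 by linarith
    qed (use f in auto)
    define X where "X = A (y + (1 - f)) - A y - (1 - f) * A1 y - (1 - f)\<^sup>2 / 2 * A2 y"
    define X' where "X' = A (y + (- f)) - A y - (- f) * A1 y - (- f)\<^sup>2 / 2 * A2 y"
    \<comment> \<open>The two remainders, the move of the first derivative to the model path, and
      the error of the second derivative weighted by the sawtooth.\<close>
    have "unit_jump L \<theta> m y - A1 y0 + (1 / 2 - f) * W = X - X' + (A1 y - A1 y0) + (1 / 2 - f) * (A2 y + W)"
      unfolding unit_jump_def fy A_def [symmetric] X_def X'_def by (simp add: power2_eq_square field_simps)
    also have "\<bar>\<dots>\<bar> \<le> E * s ^ 3 + E * s ^ 3 + E * s\<^sup>2 * \<delta> + 1 * (E * s ^ 3 + D * s ^ 3)"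
      using t1 t2 t3 t6 unfolding X_def [symmetric] X'_def [symmetric] by linarith
    also have "\<dots> = E * (\<delta> * s\<^sup>2) + (3 * E + D) * s ^ 3" by (simp add: algebra_simps)
    also have "\<dots> \<le> (3 * E + D) * (\<delta> * s\<^sup>2) + (3 * E + D) * s ^ 3"
      using E0 D(1) H by (intro add_right_mono mult_right_mono) auto
    finally have "\<bar>unit_jump L \<theta> m y - A1 y0 + (1 / 2 - f) * W\<bar> \<le> (3 * E + D) * (\<delta> * s\<^sup>2 + s ^ 3)"
      by (simp add: distrib_left)
    moreover have "(1 / 2 - f) * W = amp L m * ((1 / 2 - frac y) * cos (2 * pi * real (k * q) * (lpath c m + c) + (\<theta> + al / sqrt bt)))"
      by (simp add: W_def f_def)
    ultimately show "\<bar>unit_jump L \<theta> m y - adj_mean m (test1 L al \<theta>) (lpath c m)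
        + amp L m * ((1 / 2 - frac y) * cos (2 * pi * real (k * q) * (lpath c m + c) + (\<theta> + al / sqrt bt)))\<bar>
       \<le> (3 * E + D) * (\<delta> * (1 / sqrt L)\<^sup>2 + (1 / sqrt L) ^ 3)"
      by (simp only: A1_def y0_def s_def)
  qed
qed

text \<open>First-derivative terms telescope and second-derivative terms resonate with the sawtooth.
  The order of quantifiers matters: \<open>C\<close> serves all \<delta>, whereas the second
  constant depends on \<delta>, so \<delta> has to be fixed before L is taken large.\<close>

lemma good_range_sum:
  "\<exists>C. \<forall>\<delta>. 0 < \<delta> \<and> \<delta> \<le> 1 / 4 \<longrightarrow> (\<exists>C'. \<forall>L\<ge>L1. \<forall>\<theta> c Y.
     \<bar>c\<bar> \<le> Cc \<and> (\<forall>m. M1 L \<le> m \<and> m < M2 L \<longrightarrow> \<bar>Y m - lpath c m\<bar> \<le> \<delta>) \<longrightarrow>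
     \<bar>(\<Sum>m = M1 L..<M2 L. unit_jump L \<theta> m (Y m))
       - (\<Sum>m = M1 L..<M2 L. amp L m) * sin (2 * pi * real (k * q) * c + (\<theta> + al / sqrt bt)) / (2 * pi * real (k * q))\<bar>
     \<le> C * \<delta> + C' / sqrt L)"
proof -
  obtain C1 where C1: "C1 \<ge> 0" "\<And>L \<theta> c m y \<delta>. L1 \<le> L \<Longrightarrow> \<bar>c\<bar> \<le> Cc \<and> M1 L \<le> m \<and> m < M2 L \<and> \<bar>y - lpath c m\<bar> \<le> \<delta> \<and> \<delta> \<le> 1 / 4 \<Longrightarrow>
     \<bar>unit_jump L \<theta> m y - adj_mean m (test1 L al \<theta>) (lpath c m)
        + amp L m * ((1 / 2 - frac y) * cos (2 * pi * real (k * q) * (lpath c m + c) + (\<theta> + al / sqrt bt)))\<bar>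
       \<le> C1 * (\<delta> * (1 / sqrt L)\<^sup>2 + (1 / sqrt L) ^ 3)" using unit_jump_good by metis
  obtain C2 where C2: "\<And>L \<theta> c. L1 \<le> L \<Longrightarrow> \<bar>c\<bar> \<le> Cc \<Longrightarrow>
     \<bar>\<Sum>m = M1 L..<M2 L. adj_mean m (test1 L al \<theta>) (lpath c m)\<bar> \<le> C2 / sqrt L" using test1_sum_bound by metis
  \<comment> \<open>\<open>slow_phase_average\<close> looks q + 1 times past the last one; as L >=
    1, this is absorbed in a multiple of L.\<close>
  define \<kappa> where "\<kappa> = 3 / bt + real q + 1"
  have \<kappa>: "\<kappa> > 0" using bt by (simp add: \<kappa>_def add_pos_nonneg)
  define H where "H = 50 * al\<^sup>2"
  have H: "H \<ge> 0" by (simp add: H_def)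
  have kq: "k * q > 0" using k q by simp
  show ?thesis
  proof (rule exI [of _ "3 / bt * C1 + 40 * \<kappa> * H"], intro allI impI)
    fix \<delta> :: real assume "0 < \<delta> \<and> \<delta> \<le> 1 / 4"
    then have \<delta>: "0 < \<delta>" "\<delta> \<le> 1 / 4" by auto
    show "\<exists>C'. \<forall>L\<ge>L1. \<forall>\<theta> c Y.
     \<bar>c\<bar> \<le> Cc \<and> (\<forall>m. M1 L \<le> m \<and> m < M2 L \<longrightarrow> \<bar>Y m - lpath c m\<bar> \<le> \<delta>) \<longrightarrow>
     \<bar>(\<Sum>m = M1 L..<M2 L. unit_jump L \<theta> m (Y m))
       - (\<Sum>m = M1 L..<M2 L. amp L m) * sin (2 * pi * real (k * q) * c + (\<theta> + al / sqrt bt)) / (2 * pi * real (k * q))\<bar>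
     \<le> (3 / bt * C1 + 40 * \<kappa> * H) * \<delta> + C' / sqrt L"
    proof (intro exI [of _ "3 / bt * C1 + C2 + sawtooth_const \<kappa> H 2 q (k * q) \<delta>"] allI impI)
      fix L \<theta> c :: real and Y :: "nat \<Rightarrow> real"
      assume LL: "L1 \<le> L" and a: "\<bar>c\<bar> \<le> Cc \<and> (\<forall>m. M1 L \<le> m \<and> m < M2 L \<longrightarrow> \<bar>Y m - lpath c m\<bar> \<le> \<delta>)"
      note L = L1 [OF LL]
      note M = M_bounds [OF L(1)]
      define s where "s = 1 / sqrt L"
      have s: "0 < s" using L by (auto simp: s_def)
      have sL: "s\<^sup>2 * L = 1" using L by (simp add: s_def power_divide)
      define U where "U m = unit_jump L \<theta> m (Y m)" for m
      define A where "A m = adj_mean m (test1 L al \<theta>) (lpath c m)" for m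
      define W where "W m = amp L m * ((1 / 2 - frac (Y m)) * cos (2 * pi * real (k * q) * (lpath c m + c) + (\<theta> + al / sqrt bt)))" for m
      define Sn where "Sn = (\<Sum>m = M1 L..<M2 L. amp L m) * sin (2 * pi * real (k * q) * c + (\<theta> + al / sqrt bt)) / (2 * pi * real (k * q))"
      have "\<bar>(\<Sum>m = M1 L..<M2 L. U m - A m + W m)\<bar> \<le> (\<Sum>m = M1 L..<M2 L. C1 * (\<delta> * s\<^sup>2 + s ^ 3))"
        unfolding U_def A_def W_def s_def
        by (rule order_trans [OF sum_abs], rule sum_mono, rule C1(2) [OF LL]) (use a \<delta> in auto)
      also have "\<dots> = real (M2 L - M1 L) * (C1 * (\<delta> * s\<^sup>2 + s ^ 3))" by simp
      also have "\<dots> \<le> (3 * L / bt) * (C1 * (\<delta> * s\<^sup>2 + s ^ 3))"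
        using M(6) C1(1) \<delta> s by (intro mult_right_mono) auto
      also have "\<dots> = 3 / bt * C1 * (\<delta> * (s\<^sup>2 * L) + s\<^sup>2 * L * s)"
        by (simp add: algebra_simps power3_eq_cube power2_eq_square)
      finally have 1: "\<bar>(\<Sum>m = M1 L..<M2 L. U m) - (\<Sum>m = M1 L..<M2 L. A m) + (\<Sum>m = M1 L..<M2 L. W m)\<bar> \<le> 3 / bt * C1 * (\<delta> + s)"
        unfolding sL by (simp add: sum.distrib sum_subtractf)
      have 2: "\<bar>\<Sum>m = M1 L..<M2 L. A m\<bar> \<le> C2 * s" unfolding A_def s_def using C2 [OF LL] a by simp
      have 3: "\<bar>(\<Sum>m = M1 L..<M2 L. W m) + Sn\<bar> \<le> 40 * \<kappa> * H * \<delta> + sawtooth_const \<kappa> H 2 q (k * q) \<delta> / sqrt L"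
        unfolding W_def Sn_def lpath_eq
      proof (rule sawtooth_average [OF q kq _ \<delta> \<kappa> H])
        have "real (M2 L) + (real q + 1) * 1 \<le> 3 / bt * L + (real q + 1) * L"
          using M(6) L by (intro add_mono mult_left_mono) auto
        then show "real (M2 L) + real q + 1 \<le> \<kappa> * L" by (simp add: \<kappa>_def distrib_right)
        show "\<bar>amp L m\<bar> \<le> H / L" for m using amp_bounds(2) [OF L(1)] by (simp add: H_def)
        show "\<bar>amp L (Suc m) - amp L m\<bar> \<le> H / L\<^sup>2" for m using amp_bounds(3) [OF L(1)] by (simp add: H_def)
        show "\<bar>Y m - (of_int p / real q * real m + 2 * sqrt (real m) - c)\<bar> \<le> \<delta>" if "M1 L \<le> m" "m < M2 L" for m
          using a that by (simp add: lpath_eq)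
      qed (use L M in auto)
      have "\<bar>(\<Sum>m = M1 L..<M2 L. U m) - Sn\<bar> \<le> 3 / bt * C1 * (\<delta> + s) + C2 * s + (40 * \<kappa> * H * \<delta> + sawtooth_const \<kappa> H 2 q (k * q) \<delta> / sqrt L)"
        using 1 2 3 by linarith
      also have "\<dots> = (3 / bt * C1 + 40 * \<kappa> * H) * \<delta> + (3 / bt * C1 + C2 + sawtooth_const \<kappa> H 2 q (k * q) \<delta>) / sqrt L"
        by (simp add: s_def algebra_simps add_divide_distrib)
      finally show "\<bar>(\<Sum>m = M1 L..<M2 L. unit_jump L \<theta> m (Y m))
       - (\<Sum>m = M1 L..<M2 L. amp L m) * sin (2 * pi * real (k * q) * c + (\<theta> + al / sqrt bt)) / (2 * pi * real (k * q))\<bar>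
     \<le> (3 / bt * C1 + 40 * \<kappa> * H) * \<delta> + (3 / bt * C1 + C2 + sawtooth_const \<kappa> H 2 q (k * q) \<delta>) / sqrt L"
        unfolding U_def Sn_def by simp
    qed
  qed
qed

lemma unit_jump_mvt:
  assumes L: "L > 0"
  obtains z where "y - 1 \<le> z" "z \<le> y + 1" "unit_jump L \<theta> m y = adj_mean m (test1 L al \<theta>) z"
proof -
  define A where "A = adj_mean m (test0 L al \<theta>)"
  have d: "(A has_real_derivative adj_mean m (test1 L al \<theta>) x) (at x)" for x
    unfolding A_def by (rule DERIV_adj_mean, rule DERIV_test [OF L])
  obtain z where z: "of_int \<lfloor>y\<rfloor> < z" "z < of_int \<lfloor>y\<rfloor> + 1"
     "A (of_int \<lfloor>y\<rfloor> + 1) - A (of_int \<lfloor>y\<rfloor>) = (of_int \<lfloor>y\<rfloor> + 1 - of_int \<lfloor>y\<rfloor>) * adj_mean m (test1 L al \<theta>) z"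
    using MVT2 [of "of_int \<lfloor>y\<rfloor>" "of_int \<lfloor>y\<rfloor> + 1" A "adj_mean m (test1 L al \<theta>)"] d by auto
  have "y - 1 \<le> z" "z \<le> y + 1" using z(1,2) by linarith+
  moreover have "unit_jump L \<theta> m y = adj_mean m (test1 L al \<theta>) z"
    using z(3) by (simp add: unit_jump_def A_def)
  ultimately show ?thesis by (rule that)
qed

text \<open>At early times no expansion is at hand. Following the path backwards from
  \<open>M1\<close> with speed at least lam0, which exceeds the drift of the walk, still places the
  walk at least L / 8 below the support, and the tail bound applies.\<close>

lemma low_range_sum:
  "\<exists>C. \<forall>L\<ge>L1. \<forall>\<theta> c Y. \<bar>c\<bar> \<le> Cc \<and> \<bar>Y (M1 L) - lpath c (M1 L)\<bar> \<le> 1 / 4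
     \<and> (\<forall>m\<le>M1 L. lam0 * (real (M1 L) - real m) \<le> Y (M1 L) - Y m) \<longrightarrow>
     \<bar>\<Sum>m<M1 L. unit_jump L \<theta> m (Y m)\<bar> \<le> C / sqrt L"
proof -
  define E where "E = test_bound al"
  have E0: "E \<ge> 0" using al by (simp add: E_def test_bound_def)
  define C where "C = 8 / bt ^ 3 * (E * 4096)"
  show ?thesis
  proof (rule exI [of _ C], intro allI impI)
    fix L \<theta> c :: real and Y :: "nat \<Rightarrow> real"
    assume LL: "L1 \<le> L" and H: "\<bar>c\<bar> \<le> Cc \<and> \<bar>Y (M1 L) - lpath c (M1 L)\<bar> \<le> 1 / 4
     \<and> (\<forall>m\<le>M1 L. lam0 * (real (M1 L) - real m) \<le> Y (M1 L) - Y m)"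
    note L = L1 [OF LL]
    note M = M_bounds [OF L(1)]
    have L0: "L > 0" using L by simp
    have al0: "al \<ge> 0" using al by simp
    define s where "s = 1 / sqrt L"
    have s: "0 < s" using L by (auto simp: s_def)
    note tb = test_bounds [OF L(1) al0, folded s_def E_def]
    have "\<bar>unit_jump L \<theta> m (Y m)\<bar> \<le> E * s * (2 * L / bt)\<^sup>2 / (L / 8) ^ 4" if m: "m < M1 L" for m
    proof -
      obtain z where z: "z \<le> Y m + 1" "unit_jump L \<theta> m (Y m) = adj_mean m (test1 L al \<theta>) z"
        using unit_jump_mvt [OF L0] by metis
      have mM: "real m \<le> real (M1 L)" using m by simp
      have "Y m \<le> Y (M1 L) - lam0 * (real (M1 L) - real m)" using H m by (simp add: algebra_simps)
      moreover have "Y (M1 L) \<le> lam0 * real (M1 L) + 2 * sqrt (real (M1 L)) + Cc + 1 / 4"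
        using H unfolding lpath_def by linarith
      ultimately have "Y m \<le> lam0 * real m + 2 * sqrt (real (M1 L)) + Cc + 1 / 4"
        unfolding right_diff_distrib by linarith
      moreover have "bt * real m \<le> bt * real (M1 L)" using mM bt by (intro mult_left_mono) auto
      moreover have "lam0 * real m = bt * real m + real m / 2" by (simp add: bt_def algebra_simps)
      ultimately have "z - real m / 2 \<le> 7 / 8 * L" using z(1) drift_M1 [OF LL] by linarith
      then have "\<bar>unit_jump L \<theta> m (Y m)\<bar> \<le> E * s * (real m)\<^sup>2 / (L / 8) ^ 4"
        unfolding z(2) using test_eq_0 [OF L0] by (intro adj_mean_tail_low [OF _ _ L0] tb(2)) auto
      also have "\<dots> \<le> E * s * (2 * L / bt)\<^sup>2 / (L / 8) ^ 4"
        using mM M(3) E0 s L0 by (intro divide_right_mono mult_left_mono power_mono) auto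
      finally show ?thesis .
    qed
    then have "\<bar>\<Sum>m<M1 L. unit_jump L \<theta> m (Y m)\<bar> \<le> (\<Sum>m<M1 L. E * s * (2 * L / bt)\<^sup>2 / (L / 8) ^ 4)"
      by (intro order_trans [OF sum_abs] sum_mono) auto
    also have "\<dots> = real (M1 L) * (E * s * (2 * L / bt)\<^sup>2 / (L / 8) ^ 4)" by simp
    also have "\<dots> \<le> (2 * L / bt) * (E * s * (2 * L / bt)\<^sup>2 / (L / 8) ^ 4)"
      using M(3) E0 s L0 by (intro mult_right_mono) auto
    also have "\<dots> = C * s * (1 / L)" using L0 bt by (simp add: C_def field_simps power2_eq_square power3_eq_cube power4_eq_xxxx)
    also have "\<dots> \<le> C * s * 1" using L E0 s bt by (intro mult_left_mono) (auto simp: C_def)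
    finally show "\<bar>\<Sum>m<M1 L. unit_jump L \<theta> m (Y m)\<bar> \<le> C / sqrt L" by (simp add: s_def)
  qed
qed

text \<open>Past \<open>M2\<close> the path outruns the drift, so the distance of the walk from the
  support grows like bt * m / 4. The fourth-moment tail is then of order 1 / m^2, which is summable
  uniformly in the last time \<open>N\<close>.\<close>

lemma high_range_sum:
  "\<exists>C. \<forall>L\<ge>L1. \<forall>\<theta> c Y N. \<bar>c\<bar> \<le> Cc \<and> \<bar>Y (M2 L) - lpath c (M2 L)\<bar> \<le> 1 / 4
     \<and> (\<forall>m. M2 L \<le> m \<and> m \<le> N \<longrightarrow> lam0 * (real m - real (M2 L)) \<le> Y m - Y (M2 L)) \<longrightarrow>
     \<bar>\<Sum>m = M2 L..N. unit_jump L \<theta> m (Y m)\<bar> \<le> C / sqrt L"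
proof -
  define E where "E = test_bound al"
  have E0: "E \<ge> 0" using al by (simp add: E_def test_bound_def)
  define C where "C = 2 * (256 / bt ^ 4 * E)"
  show ?thesis
  proof (rule exI [of _ C], intro allI impI)
    fix L \<theta> c :: real and Y :: "nat \<Rightarrow> real" and N :: nat
    assume LL: "L1 \<le> L" and H: "\<bar>c\<bar> \<le> Cc \<and> \<bar>Y (M2 L) - lpath c (M2 L)\<bar> \<le> 1 / 4
     \<and> (\<forall>m. M2 L \<le> m \<and> m \<le> N \<longrightarrow> lam0 * (real m - real (M2 L)) \<le> Y m - Y (M2 L))"
    note L = L1 [OF LL]
    note M = M_bounds [OF L(1)]
    have L0: "L > 0" using L by simp
    have al0: "al \<ge> 0" using al by simp
    define s where "s = 1 / sqrt L"
    have s: "0 < s" using L by (auto simp: s_def)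
    note tb = test_bounds [OF L(1) al0, folded s_def E_def]
    have M21: "1 \<le> M2 L" using M(4,7) L by linarith
    have "\<bar>unit_jump L \<theta> m (Y m)\<bar> \<le> 256 / bt ^ 4 * E * s * (1 / (real m)\<^sup>2)" if m: "M2 L \<le> m" "m \<le> N" for m
    proof -
      obtain z where z: "Y m - 1 \<le> z" "unit_jump L \<theta> m (Y m) = adj_mean m (test1 L al \<theta>) z"
        using unit_jump_mvt [OF L0] by metis
      have mM: "real (M2 L) \<le> real m" using m by simp
      have m0: "real m > 0" using mM M21 by simp
      have "lam0 * (real m - real (M2 L)) \<le> Y m - Y (M2 L)" using H m by simp
      moreover have "0 \<le> sqrt (real (M2 L))" by simp
      then have "lam0 * real (M2 L) - Cc - 1 / 4 \<le> Y (M2 L)"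
        using H unfolding lpath_def by linarith
      ultimately have "lam0 * real m - Cc - 1 / 4 \<le> Y m"
        unfolding right_diff_distrib by linarith
      moreover have b: "bt * real (M2 L) \<le> bt * real m" using mM bt by (intro mult_left_mono) auto
      moreover have "lam0 * real m = bt * real m + real m / 2" by (simp add: bt_def algebra_simps)
      moreover have "0 \<le> 32 / bt" using bt by simp
      ultimately have x: "2 * L + bt * real m / 4 \<le> z - real m / 2" using z(1) M(8) L by linarith
      have "\<bar>unit_jump L \<theta> m (Y m)\<bar> \<le> E * s * (real m)\<^sup>2 / (bt * real m / 4) ^ 4"
        unfolding z(2) using test_eq_0 [OF L0] bt m0 by (intro adj_mean_tail_high [OF _ _ _ x] tb(2)) auto
      also have "\<dots> = 256 / bt ^ 4 * E * s * (1 / (real m)\<^sup>2)"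
        using m0 bt by (simp add: field_simps power2_eq_square power4_eq_xxxx)
      finally show ?thesis .
    qed
    then have "\<bar>\<Sum>m = M2 L..N. unit_jump L \<theta> m (Y m)\<bar> \<le> (\<Sum>m = M2 L..N. 256 / bt ^ 4 * E * s * (1 / (real m)\<^sup>2))"
      by (intro order_trans [OF sum_abs] sum_mono) auto
    also have "\<dots> = 256 / bt ^ 4 * E * s * (\<Sum>m = M2 L..N. 1 / (real m)\<^sup>2)" by (simp only: sum_distrib_left)
    also have "\<dots> \<le> 256 / bt ^ 4 * E * s * 2"
      using E0 s by (intro mult_left_mono sum_inverse_squares_le M21) auto
    finally show "\<bar>\<Sum>m = M2 L..N. unit_jump L \<theta> m (Y m)\<bar> \<le> C / sqrt L" by (simp add: s_def C_def mult_ac)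
  qed
qed

definition "total_amp L = (\<Sum>m = M1 L..<M2 L. amp L m)"

text \<open>At least L / 2 consecutive times have bt * m / L between 5 / 4 and 7 / 4. There the
  parabola in \<open>hat\<close> is at least 3 / 16, and each amplitude is at least a fixed multiple
  of 1 / L.\<close>

lemma total_amp_lower: "\<exists>r>0. \<forall>L\<ge>L1. r \<le> total_amp L"
proof -
  define A0 where "A0 = al\<^sup>2 / 4 * exp (- (al\<^sup>2 / (32 * bt)))"
  have A0: "A0 > 0" using al by (simp add: A0_def)
  define r0 where "r0 = (3 / 16 :: real) ^ 4"
  show ?thesis
  proof (intro exI [of _ "A0 * r0 / 4"] conjI allI impI)
    show "0 < A0 * r0 / 4" using A0 by (simp add: r0_def)
    fix L assume LL: "L1 \<le> L"
    note L = L1 [OF LL]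
    note M = M_bounds [OF L(1)]
    define u where "u = L / bt"
    have u: "2 * L \<le> u" using L bt by (simp add: u_def field_simps)
    define a where "a = nat \<lceil>5 / 4 * u\<rceil>"
    define n where "n = nat \<lceil>L / 2\<rceil>"
    have ra: "real a = of_int \<lceil>5 / 4 * u\<rceil>" and rn: "real n = of_int \<lceil>L / 2\<rceil>" using u L by (auto simp: a_def n_def)
    have a: "5 / 4 * u \<le> real a" "real a \<le> 5 / 4 * u + 1" unfolding ra by linarith+
    have n: "L / 2 \<le> real n" "real n \<le> L / 2 + 1" unfolding rn by linarith+
    have M1u: "real (M1 L) \<le> 3 / 4 * u + 1" using M(2) by (simp add: u_def)
    have M2u: "3 * u - 1 \<le> real (M2 L)" using M(5) by (simp add: u_def)
    have "real (M1 L) \<le> real a" using a M1u u L by linarith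
    moreover have "real (a + n) \<le> real (M2 L)" using a n M2u u L by simp
    ultimately have sub: "{a..<a + n} \<subseteq> {M1 L..<M2 L}" by auto
    have lo: "A0 * r0 / (2 * L) \<le> amp L m" if m: "m \<in> {a..<a + n}" for m
    proof -
      have "real a \<le> real m" "real m \<le> real a + real n" using m by auto
      then have mu: "5 / 4 * u \<le> real m" "real m \<le> 7 / 4 * u" using a n u L by linarith+
      define t where "t = bt * real m / L"
      have ub: "bt * u = L" using bt by (simp add: u_def)
      have "bt * (5 / 4 * u) \<le> bt * real m" "bt * real m \<le> bt * (7 / 4 * u)" using mu bt by (auto intro!: mult_left_mono)
      then have t': "5 / 4 * L \<le> bt * real m" "bt * real m \<le> 7 / 4 * L" using ub by auto
      then have t: "5 / 4 \<le> t" "t \<le> 7 / 4" using L by (auto simp: t_def field_simps)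
      have "0 \<le> (t - 5 / 4) * (7 / 4 - t)" using t by simp
      then have "3 / 16 \<le> (t - 1) * (2 - t)" by (simp add: field_simps)
      then have "3 / 16 \<le> hat t" by (simp add: hat_def)
      then have "r0 \<le> rho0 t" unfolding r0_def rho0_def by (intro power_mono) auto
      moreover have "1 / (2 * L) \<le> 1 / (bt * real m)" using t' L by (intro frac_le) auto
      ultimately have "r0 * (1 / (2 * L)) \<le> rho0 t * (1 / (bt * real m))" using L rho_bounds(1) by (intro mult_mono) auto
      also have "\<dots> = envelope L (bt * real m)" using t' L by (simp add: wave_def t_def power_divide)
      finally have "A0 * (r0 * (1 / (2 * L))) \<le> A0 * envelope L (bt * real m)" using A0 by (intro mult_left_mono) auto
      then show ?thesis by (simp add: amp_def A0_def)
    qed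
    have "A0 * r0 / 4 = L / 2 * (A0 * r0 / (2 * L))" using L by simp
    also have "\<dots> \<le> real n * (A0 * r0 / (2 * L))" using n A0 L by (intro mult_right_mono) (auto simp: r0_def)
    also have "\<dots> = (\<Sum>m\<in>{a..<a + n}. A0 * r0 / (2 * L))" by simp
    also have "\<dots> \<le> (\<Sum>m\<in>{a..<a + n}. amp L m)" by (rule sum_mono [OF lo])
    also have "\<dots> \<le> total_amp L" unfolding total_amp_def
      by (rule sum_mono2) (use sub amp_bounds(1) [OF L(1)] in auto)
    finally show "A0 * r0 / 4 \<le> total_amp L" .
  qed
qed

text \<open>The hypotheses on \<open>Y\<close> are what true level curves can supply: closeness to
  the model path at intermediate times, and a lower bound on the speed at all times.\<close>

lemma block_sum:
  "\<exists>C. \<forall>\<delta>. 0 < \<delta> \<and> \<delta> \<le> 1 / 4 \<longrightarrow> (\<exists>C'. \<forall>L\<ge>L1. \<forall>\<theta> c Y N.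
     \<bar>c\<bar> \<le> Cc \<and> M2 L \<le> N \<and> (\<forall>m. M1 L \<le> m \<and> m \<le> M2 L \<longrightarrow> \<bar>Y m - lpath c m\<bar> \<le> \<delta>)
       \<and> (\<forall>m m'. m \<le> m' \<and> m' \<le> N \<longrightarrow> lam0 * (real m' - real m) \<le> Y m' - Y m) \<longrightarrow>
     \<bar>(\<Sum>m\<le>N. unit_jump L \<theta> m (Y m))
       - total_amp L * sin (2 * pi * real (k * q) * c + (\<theta> + al / sqrt bt)) / (2 * pi * real (k * q))\<bar>
     \<le> C * \<delta> + C' / sqrt L)"
proof -
  obtain C where C: "\<And>\<delta>. 0 < \<delta> \<and> \<delta> \<le> 1 / 4 \<Longrightarrow> (\<exists>C'. \<forall>L\<ge>L1. \<forall>\<theta> c Y.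
     \<bar>c\<bar> \<le> Cc \<and> (\<forall>m. M1 L \<le> m \<and> m < M2 L \<longrightarrow> \<bar>Y m - lpath c m\<bar> \<le> \<delta>) \<longrightarrow>
     \<bar>(\<Sum>m = M1 L..<M2 L. unit_jump L \<theta> m (Y m))
       - (\<Sum>m = M1 L..<M2 L. amp L m) * sin (2 * pi * real (k * q) * c + (\<theta> + al / sqrt bt)) / (2 * pi * real (k * q))\<bar>
     \<le> C * \<delta> + C' / sqrt L)" using good_range_sum by blast
  obtain Cl where Cl: "\<And>L \<theta> c Y. L1 \<le> L \<Longrightarrow> \<bar>c\<bar> \<le> Cc \<and> \<bar>Y (M1 L) - lpath c (M1 L)\<bar> \<le> 1 / 4
     \<and> (\<forall>m\<le>M1 L. lam0 * (real (M1 L) - real m) \<le> Y (M1 L) - Y m) \<Longrightarrow>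
     \<bar>\<Sum>m<M1 L. unit_jump L \<theta> m (Y m)\<bar> \<le> Cl / sqrt L" using low_range_sum by blast
  obtain Ch where Ch: "\<And>L \<theta> c Y N. L1 \<le> L \<Longrightarrow> \<bar>c\<bar> \<le> Cc \<and> \<bar>Y (M2 L) - lpath c (M2 L)\<bar> \<le> 1 / 4
     \<and> (\<forall>m. M2 L \<le> m \<and> m \<le> N \<longrightarrow> lam0 * (real m - real (M2 L)) \<le> Y m - Y (M2 L)) \<Longrightarrow>
     \<bar>\<Sum>m = M2 L..N. unit_jump L \<theta> m (Y m)\<bar> \<le> Ch / sqrt L" using high_range_sum by blast
  show ?thesis
  proof (rule exI [of _ C], intro allI impI)
    fix \<delta> :: real assume \<delta>: "0 < \<delta> \<and> \<delta> \<le> 1 / 4"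
    from C [OF \<delta>] obtain C' where C': "\<And>L \<theta> c Y. L1 \<le> L \<Longrightarrow>
     \<bar>c\<bar> \<le> Cc \<and> (\<forall>m. M1 L \<le> m \<and> m < M2 L \<longrightarrow> \<bar>Y m - lpath c m\<bar> \<le> \<delta>) \<Longrightarrow>
     \<bar>(\<Sum>m = M1 L..<M2 L. unit_jump L \<theta> m (Y m))
       - (\<Sum>m = M1 L..<M2 L. amp L m) * sin (2 * pi * real (k * q) * c + (\<theta> + al / sqrt bt)) / (2 * pi * real (k * q))\<bar>
     \<le> C * \<delta> + C' / sqrt L" by blast
    show "\<exists>C'. \<forall>L\<ge>L1. \<forall>\<theta> c Y N.
     \<bar>c\<bar> \<le> Cc \<and> M2 L \<le> N \<and> (\<forall>m. M1 L \<le> m \<and> m \<le> M2 L \<longrightarrow> \<bar>Y m - lpath c m\<bar> \<le> \<delta>)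
       \<and> (\<forall>m m'. m \<le> m' \<and> m' \<le> N \<longrightarrow> lam0 * (real m' - real m) \<le> Y m' - Y m) \<longrightarrow>
     \<bar>(\<Sum>m\<le>N. unit_jump L \<theta> m (Y m))
       - total_amp L * sin (2 * pi * real (k * q) * c + (\<theta> + al / sqrt bt)) / (2 * pi * real (k * q))\<bar>
     \<le> C * \<delta> + C' / sqrt L"
    proof (rule exI [of _ "C' + Cl + Ch"], intro allI impI)
      fix L \<theta> c :: real and Y :: "nat \<Rightarrow> real" and N :: nat
      assume LL: "L1 \<le> L" and H: "\<bar>c\<bar> \<le> Cc \<and> M2 L \<le> N \<and> (\<forall>m. M1 L \<le> m \<and> m \<le> M2 L \<longrightarrow> \<bar>Y m - lpath c m\<bar> \<le> \<delta>)
       \<and> (\<forall>m m'. m \<le> m' \<and> m' \<le> N \<longrightarrow> lam0 * (real m' - real m) \<le> Y m' - Y m)"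
      note L = L1 [OF LL]
      note M = M_bounds [OF L(1)]
      define U where "U m = unit_jump L \<theta> m (Y m)" for m
      have 1: "\<bar>(\<Sum>m = M1 L..<M2 L. U m) - total_amp L * sin (2 * pi * real (k * q) * c + (\<theta> + al / sqrt bt)) / (2 * pi * real (k * q))\<bar>
          \<le> C * \<delta> + C' / sqrt L"
        unfolding U_def total_amp_def by (rule C' [OF LL]) (use H in auto)
      have cl: "\<bar>Y m - lpath c m\<bar> \<le> 1 / 4" if "M1 L \<le> m" "m \<le> M2 L" for m using H \<delta> that by fastforce
      have 2: "\<bar>\<Sum>m<M1 L. U m\<bar> \<le> Cl / sqrt L" unfolding U_def
        by (rule Cl [OF LL, where c = c]) (use H cl [of "M1 L"] M(7) in auto)
      have 3: "\<bar>\<Sum>m = M2 L..N. U m\<bar> \<le> Ch / sqrt L" unfolding U_def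
        by (rule Ch [OF LL, where c = c]) (use H cl [of "M2 L"] M(7) in auto)
      have "{..N} = {..<M1 L} \<union> {M1 L..<M2 L} \<union> {M2 L..N}" using M(7) H by auto
      then have "(\<Sum>m\<le>N. U m) = (\<Sum>m<M1 L. U m) + (\<Sum>m = M1 L..<M2 L. U m) + (\<Sum>m = M2 L..N. U m)"
        using M(7) by (simp only:) (subst sum.union_disjoint; (subst sum.union_disjoint)?; force)
      then have "\<bar>(\<Sum>m\<le>N. U m) - total_amp L * sin (2 * pi * real (k * q) * c + (\<theta> + al / sqrt bt)) / (2 * pi * real (k * q))\<bar>
         \<le> C * \<delta> + C' / sqrt L + Cl / sqrt L + Ch / sqrt L" using 1 2 3 by linarith
      then show "\<bar>(\<Sum>m\<le>N. unit_jump L \<theta> m (Y m))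
       - total_amp L * sin (2 * pi * real (k * q) * c + (\<theta> + al / sqrt bt)) / (2 * pi * real (k * q))\<bar>
     \<le> C * \<delta> + (C' + Cl + Ch) / sqrt L" by (simp add: U_def add_divide_distrib)
    qed
  qed
qed

end

subsection \<open>Level curves of the approximate shock\<close>

lemma flux_deriv:
  assumes "0 < \<mu>" "\<mu> < 1"
  shows "(flux \<mu> has_real_derivative \<mu> * exp u / ((1 - \<mu>) + \<mu> * exp u)) (at u)"
proof -
  have "(1 - \<mu>) + \<mu> * exp u > 0" using assms by (simp add: add_pos_pos)
  moreover have "flux \<mu> = (\<lambda>u. ln ((1 - \<mu>) + \<mu> * exp u))" by (auto simp: flux_def)
  ultimately show ?thesis by (auto intro!: derivative_eq_intros simp: field_simps)
qed

lemma flux_0: "flux \<mu> 0 = 0"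
  by (simp add: flux_def)

text \<open>The flux is strictly convex and vanishes at 0, so chords from the origin become steeper;
  the mean value theorem is applied on both sides of u.\<close>

lemma flux_slope_strict_mono:
  assumes mu: "0 < \<mu>" "\<mu> < 1" and uv: "0 < u" "u < v"
  shows "flux \<mu> u / u < flux \<mu> v / v"
proof -
  define f' where "f' u = \<mu> * exp u / ((1 - \<mu>) + \<mu> * exp u)" for u
  have D: "(flux \<mu> has_real_derivative f' x) (at x)" for x unfolding f'_def by (rule flux_deriv [OF mu])
  obtain a where a: "0 < a" "a < u" "flux \<mu> u - flux \<mu> 0 = (u - 0) * f' a"
    using MVT2 [of 0 u "flux \<mu>" f'] D uv by auto
  obtain b where b: "u < b" "b < v" "flux \<mu> v - flux \<mu> u = (v - u) * f' b"
    using MVT2 [of u v "flux \<mu>" f'] D uv by auto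
  have "f' a < f' b"
  proof -
    have p: "(1 - \<mu>) + \<mu> * exp x > 0" for x using mu by (simp add: add_pos_pos)
    have e: "f' x = 1 - (1 - \<mu>) / ((1 - \<mu>) + \<mu> * exp x)" for x
      using p [of x] by (simp add: f'_def field_simps)
    have "(1 - \<mu>) + \<mu> * exp a < (1 - \<mu>) + \<mu> * exp b" using a b mu by simp
    then have "(1 - \<mu>) / ((1 - \<mu>) + \<mu> * exp b) < (1 - \<mu>) / ((1 - \<mu>) + \<mu> * exp a)"
      using p mu by (intro divide_strict_left_mono mult_pos_pos) auto
    then show ?thesis unfolding e by simp
  qed
  moreover have fu: "flux \<mu> u = u * f' a" using a(3) by (simp add: flux_0)
  ultimately have "(v - u) * f' a < flux \<mu> v - flux \<mu> u" using b uv by simp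
  then have "v * f' a < flux \<mu> v" unfolding fu by (simp add: algebra_simps)
  then have "f' a < flux \<mu> v / v" using uv by (simp add: pos_less_divide_eq mult.commute)
  moreover have "flux \<mu> u / u = f' a" using fu uv by simp
  ultimately show ?thesis by simp
qed

lemma flux_slope_inj:
  assumes mu: "0 < \<mu>" "\<mu> < 1" and uv: "0 < u" "0 < v" "flux \<mu> u / u = flux \<mu> v / v"
  shows "u = v"
  using flux_slope_strict_mono [OF mu uv(1), of v] flux_slope_strict_mono [OF mu uv(2), of u] uv(3)
  by (metis less_irrefl linorder_neqE_linordered_idom)

text \<open>Near 0 the chord slope is close to the derivative \<mu> of the flux at 0, and for large
  u it reaches \<sigma> because the flux is at least u + ln \<mu>. The intermediate value theorem
  gives existence, and injectivity of the slope gives uniqueness.\<close>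

lemma phi_works:
  assumes mu: "0 < \<mu>" "\<mu> < 1" and s: "\<mu> < \<sigma>" "\<sigma> < 1"
  shows "phi \<mu> \<sigma> > 0" "flux \<mu> (phi \<mu> \<sigma>) / phi \<mu> \<sigma> = \<sigma>"
proof -
  define f' where "f' u = \<mu> * exp u / ((1 - \<mu>) + \<mu> * exp u)" for u
  have D: "(flux \<mu> has_real_derivative f' x) (at x)" for x unfolding f'_def by (rule flux_deriv [OF mu])
  have p: "(1 - \<mu>) + \<mu> * exp x > 0" for x using mu by (simp add: add_pos_pos)
  have "isCont f' 0" unfolding f'_def using p [of 0] mu by (intro continuous_intros) auto
  then have "(f' \<longlongrightarrow> f' 0) (at_right 0)" by (simp add: isCont_def filterlim_at_split)
  moreover have "f' 0 < \<sigma>" using s by (simp add: f'_def)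
  ultimately have "\<forall>\<^sub>F x in at_right 0. f' x < \<sigma>" by (rule order_tendstoD)
  then obtain d where d: "d > 0" "\<And>x. 0 < x \<Longrightarrow> x < d \<Longrightarrow> f' x < \<sigma>" by (auto simp: eventually_at_right_field)
  define u1 where "u1 = d / 2"
  have u1: "u1 > 0" using d by (simp add: u1_def)
  obtain a where a: "0 < a" "a < u1" "flux \<mu> u1 - flux \<mu> 0 = (u1 - 0) * f' a"
    using MVT2 [of 0 u1 "flux \<mu>" f'] D u1 by auto
  have "flux \<mu> u1 / u1 = f' a" using a(3) u1 by (simp add: flux_0)
  then have lo: "flux \<mu> u1 / u1 < \<sigma>" using d(2) [of a] a d(1) by (simp add: u1_def)
  \<comment> \<open>From ln \<mu> + u <= flux \<mu> u the slope reaches \<sigma> as soon as u * (1 -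
    \<sigma>) >= - ln \<mu>.\<close>
  define u2 where "u2 = max (u1 + 1) (- ln \<mu> / (1 - \<sigma>))"
  have u2: "u2 > u1" "u2 > 0" using u1 by (auto simp: u2_def)
  have "- ln \<mu> / (1 - \<sigma>) \<le> u2" by (simp add: u2_def)
  from mult_right_mono [OF this, of "1 - \<sigma>"] have "- ln \<mu> \<le> u2 * (1 - \<sigma>)" using s by simp
  moreover have "ln \<mu> + u2 \<le> flux \<mu> u2"
  proof -
    have "ln \<mu> + u2 = ln (\<mu> * exp u2)" using mu by (simp add: ln_mult)
    also have "\<dots> \<le> flux \<mu> u2" unfolding flux_def using mu p [of u2] by (intro ln_mono) auto
    finally show ?thesis .
  qed
  ultimately have "\<sigma> * u2 \<le> flux \<mu> u2" by (simp add: algebra_simps)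
  then have hi: "\<sigma> \<le> flux \<mu> u2 / u2" using u2 by (simp add: pos_le_divide_eq)
  have "\<exists>x. u1 \<le> x \<and> x \<le> u2 \<and> flux \<mu> x / x = \<sigma>"
  proof (rule IVT')
    show "continuous_on {u1..u2} (\<lambda>x. flux \<mu> x / x)"
      using u1 D by (intro continuous_intros continuous_at_imp_continuous_on ballI DERIV_isCont) auto
  qed (use lo hi u2 in auto)
  then obtain x where "u1 \<le> x" and x2: "flux \<mu> x / x = \<sigma>" by blast
  then have x: "x > 0" "flux \<mu> x / x = \<sigma>" using u1 by linarith+
  have "phi \<mu> \<sigma> > 0 \<and> flux \<mu> (phi \<mu> \<sigma>) / phi \<mu> \<sigma> = \<sigma>"
    unfolding phi_def
    by (rule theI [where a = x]) (use x flux_slope_inj [OF mu] in auto)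
  then show "phi \<mu> \<sigma> > 0" "flux \<mu> (phi \<mu> \<sigma>) / phi \<mu> \<sigma> = \<sigma>" by auto
qed

lemma phi_less_iff:
  assumes mu: "0 < \<mu>" "\<mu> < 1" and s: "\<mu> < \<sigma>" "\<sigma> < 1" and a: "a > 0"
  shows "phi \<mu> \<sigma> < a \<longleftrightarrow> \<sigma> < flux \<mu> a / a"
  using phi_works [OF mu s] flux_slope_strict_mono [OF mu, of "phi \<mu> \<sigma>" a] flux_slope_strict_mono [OF mu a, of "phi \<mu> \<sigma>"]
  by (metis less_irrefl less_trans linorder_neqE_linordered_idom)

lemma phi_strict_mono:
  assumes mu: "0 < \<mu>" "\<mu> < 1" and s: "\<mu> < \<sigma>" "\<sigma> < \<sigma>'" "\<sigma>' < 1"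
  shows "phi \<mu> \<sigma> < phi \<mu> \<sigma>'"
  using phi_less_iff [OF mu, of \<sigma> "phi \<mu> \<sigma>'"] phi_works [OF mu, of \<sigma>'] s by auto

lemma set_integrable_neg_powr:
  fixes B r :: real
  assumes "B \<ge> 0" "-1 < r"
  shows "set_integrable lborel {-B..0} (\<lambda>\<tau>. (- \<tau>) powr r)"
proof -
  have "((\<lambda>x. x powr r) has_integral (B powr (r + 1) / (r + 1))) {0..B}"
    using assms by (intro has_integral_powr_from_0) auto
  then have "((\<lambda>x. (- x) powr r) has_integral (B powr (r + 1) / (r + 1))) {-B..0}"
    using has_integral_reflect_real [of "\<lambda>x. x powr r" _ B 0] by simp
  then have "(\<lambda>x. (- x) powr r) absolutely_integrable_on {-B..0}"
    by (intro nonnegative_absolutely_integrable_1) auto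
  then show ?thesis
    by (subst (asm) integrable_completion [symmetric] | simp add: set_integrable_def integrable_completion)+
qed

text \<open>The bound on lam0 + T powr (-1/4) keeps all slopes of the shock curve between \<mu> and
  1, where \<open>phi\<close> is meaningful; it holds for all large T.\<close>

locale level_curves =
  fixes \<mu> lam0 :: real and T :: nat
  assumes mu: "0 < \<mu>" "\<mu> < 1" and lam: "\<mu> < lam0" and T: "T > 0" "lam0 + real T powr (- 1 / 4) < 1"
begin

abbreviation "\<gamma> \<equiv> shock_curve lam0 T"
abbreviation "\<gamma>' \<equiv> deriv (shock_curve lam0 T)"
abbreviation "um \<equiv> u_minus \<mu> lam0 T"
abbreviation "kap \<equiv> kappa0 \<mu> lam0"
definition "sT = lam0 + real T powr (- 1 / 4)"
definition "umax = phi \<mu> sT"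
definition "S = {- 2 * real T..0}"
definition "w t x \<tau> = exp (- um \<tau> * (x - \<gamma> \<tau> - \<gamma>' \<tau> * (t - \<tau>))) * (- \<tau>) powr (- 3 / 4)"
definition "J t x = (LBINT \<tau>:S. w t x \<tau>)"
text \<open>Clearing denominators turns u = a into Q = exp a - 1. This is linear in the integrand,
  and for a <= kap its density exp (um) - exp a is nonnegative, so that monotonicity can be read off
  under the integral sign.\<close>

definition "Q a t x = J t (x - 1) - exp a * J t x"

lemma sT: "lam0 < sT" "sT < 1" "\<mu> < sT"
proof -
  have "real T powr (- 1 / 4) > 0" using T by simp
  then show "lam0 < sT" "sT < 1" "\<mu> < sT" using T(2) lam unfolding sT_def by linarith+
qed

lemma lam1: "lam0 < 1" using sT by simp

lemma kap_pos: "kap > 0" unfolding kappa0_def using phi_works(1) [OF mu lam lam1] .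

lemma slope_eq: "\<gamma>' \<tau> = (if \<tau> < - sqrt (real T) then lam0 + 1 / sqrt (- \<tau>) else sT)"
  using DERIV_imp_deriv [OF shock_curve_has_derivative [OF T(1), of lam0 \<tau>]] by (simp add: sT_def)

lemma slope_bounds: "lam0 < \<gamma>' \<tau>" "\<gamma>' \<tau> \<le> sT"
proof -
  have "lam0 < \<gamma>' \<tau> \<and> \<gamma>' \<tau> \<le> sT"
  proof (cases "\<tau> < - sqrt (real T)")
    case True
    have s: "sqrt (real T) > 0" using T by simp
    have t0: "\<tau> < 0" using True s by linarith
    have "1 / sqrt (- \<tau>) \<le> 1 / sqrt (sqrt (real T))" using True s t0 by (intro divide_left_mono mult_pos_pos) auto
    also have "\<dots> = real T powr (- 1 / 4)" using powr_minus_quarter [OF T(1)] by simp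
    finally show ?thesis using True t0 by (auto simp: slope_eq sT_def)
  next
    case False
    then show ?thesis using sT by (simp add: slope_eq)
  qed
  then show "lam0 < \<gamma>' \<tau>" "\<gamma>' \<tau> \<le> sT" by auto
qed

lemma slope_mono: "mono \<gamma>'"
proof (rule monoI)
  fix x y :: real assume xy: "x \<le> y"
  show "\<gamma>' x \<le> \<gamma>' y"
  proof (cases "y < - sqrt (real T)")
    case True
    have s: "sqrt (real T) > 0" using T by simp
    have "x < 0" "y < 0" using True s xy by linarith+
    then have "1 / sqrt (- x) \<le> 1 / sqrt (- y)" using xy by (intro divide_left_mono mult_pos_pos) auto
    then show ?thesis using True xy by (simp add: slope_eq)
  next
    case False
    then show ?thesis using slope_bounds(2) [of x] by (simp add: slope_eq [of y])
  qed
qed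

lemma um_bounds: "kap < um \<tau>" "um \<tau> \<le> umax"
proof -
  show "kap < um \<tau>" unfolding kappa0_def u_minus_def
    by (rule phi_strict_mono [OF mu lam]) (use slope_bounds [of \<tau>] sT in auto)
  show "um \<tau> \<le> umax" unfolding umax_def u_minus_def
    using phi_strict_mono [OF mu, of "\<gamma>' \<tau>" sT] slope_bounds [of \<tau>] sT lam by (cases "\<gamma>' \<tau> = sT") auto
qed

lemma um_mono: "mono um"
proof (rule monoI)
  fix x y :: real assume xy: "x \<le> y"
  have "\<gamma>' x \<le> \<gamma>' y" using slope_mono xy by (rule monoD)
  then show "um x \<le> um y" unfolding u_minus_def
    using phi_strict_mono [OF mu, of "\<gamma>' x" "\<gamma>' y"] slope_bounds [of x] slope_bounds [of y] sT lam
    by (cases "\<gamma>' x = \<gamma>' y") auto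
qed

lemma measurable_pieces [measurable]: "um \<in> borel_measurable borel" "\<gamma> \<in> borel_measurable borel" "\<gamma>' \<in> borel_measurable borel"
proof -
  show "um \<in> borel_measurable borel" using um_mono by (rule borel_measurable_mono)
  show "\<gamma>' \<in> borel_measurable borel" using slope_mono by (rule borel_measurable_mono)
  have "continuous_on UNIV \<gamma>"
    using shock_curve_has_derivative [OF T(1), of lam0] by (intro continuous_at_imp_continuous_on ballI) (blast intro: DERIV_isCont)
  then show "\<gamma> \<in> borel_measurable borel" by (rule borel_measurable_continuous_onI)
qed

lemma phase_bounded: "\<exists>B. \<forall>\<tau>\<in>S. \<bar>um \<tau> * (x - \<gamma> \<tau> - \<gamma>' \<tau> * (t - \<tau>))\<bar> \<le> B"
proof -
  have cont: "continuous_on S (\<lambda>\<tau>. x - \<gamma> \<tau> - \<gamma>' \<tau> * (t - \<tau>))"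
  proof (intro continuous_intros)
    show "continuous_on S \<gamma>"
      using shock_curve_has_derivative [OF T(1), of lam0] by (intro continuous_at_imp_continuous_on ballI) (blast intro: DERIV_isCont)
    show "continuous_on S \<gamma>'" by (rule continuous_on_subset [OF continuous_on_deriv_shock_curve [OF T(1)]]) simp
  qed
  have "compact S" by (simp add: S_def)
  from compact_imp_bounded [OF compact_continuous_image [OF cont this]]
  obtain B where B: "\<And>\<tau>. \<tau> \<in> S \<Longrightarrow> \<bar>x - \<gamma> \<tau> - \<gamma>' \<tau> * (t - \<tau>)\<bar> \<le> B"
    by (auto simp: bounded_iff)
  show ?thesis
  proof (intro exI [of _ "umax * B"] ballI)
    fix \<tau> assume "\<tau> \<in> S"
    then show "\<bar>um \<tau> * (x - \<gamma> \<tau> - \<gamma>' \<tau> * (t - \<tau>))\<bar> \<le> umax * B"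
      unfolding abs_mult using B [of \<tau>] um_bounds [of \<tau>] kap_pos by (intro mult_mono) auto
  qed
qed

lemma w_nonneg: "0 \<le> w t x \<tau>"
  by (simp add: w_def)

lemma w_integrable: "set_integrable lborel S (w t x)"
proof -
  obtain B where B: "\<And>\<tau>. \<tau> \<in> S \<Longrightarrow> \<bar>um \<tau> * (x - \<gamma> \<tau> - \<gamma>' \<tau> * (t - \<tau>))\<bar> \<le> B"
    using phase_bounded by blast
  have "set_integrable lborel S (\<lambda>\<tau>. exp B * (- \<tau>) powr (- 3 / 4))"
    using set_integrable_neg_powr [of "2 * real T" "- 3 / 4"] by (simp add: S_def)
  then show ?thesis
  proof (rule set_integrable_bound)
    show "set_borel_measurable lborel S (w t x)"
      unfolding set_borel_measurable_def w_def S_def by measurable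
    show "AE \<tau> in lborel. \<tau> \<in> S \<longrightarrow> norm (w t x \<tau>) \<le> norm (exp B * (- \<tau>) powr (- 3 / 4))"
    proof (intro AE_I2 impI)
      fix \<tau> assume "\<tau> \<in> S"
      then have "- um \<tau> * (x - \<gamma> \<tau> - \<gamma>' \<tau> * (t - \<tau>)) \<le> B" using B [of \<tau>] by (simp add: abs_le_iff)
      then show "norm (w t x \<tau>) \<le> norm (exp B * (- \<tau>) powr (- 3 / 4))"
        unfolding w_def by (simp add: mult_right_mono)
    qed
  qed
qed

lemma J_pos: "J t x > 0"
proof -
  obtain B where B: "\<And>\<tau>. \<tau> \<in> S \<Longrightarrow> \<bar>um \<tau> * (x - \<gamma> \<tau> - \<gamma>' \<tau> * (t - \<tau>))\<bar> \<le> B"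
    using phase_bounded by blast
  define S' where "S' = {- 2 * real T..- real T}"
  define e where "e = exp (- B) * (2 * real T) powr (- 3 / 4)"
  have e: "e > 0" using T by (simp add: e_def)
  have sub: "S' \<subseteq> S" by (auto simp: S'_def S_def)
  have i': "set_integrable lborel S' (w t x)" using w_integrable by (rule set_integrable_subset) (use sub in \<open>auto simp: S'_def\<close>)
  have "e * real T = (LBINT \<tau>:S'. e)" unfolding set_lebesgue_integral_def using T by (simp add: S'_def)
  also have "\<dots> \<le> (LBINT \<tau>:S'. w t x \<tau>)"
  proof (rule set_integral_mono [OF _ i'])
    show "set_integrable lborel S' (\<lambda>\<tau>. e)" by (simp add: S'_def set_integrable_def)
    fix \<tau> assume t: "\<tau> \<in> S'"
    have "- B \<le> - um \<tau> * (x - \<gamma> \<tau> - \<gamma>' \<tau> * (t - \<tau>))" using B [of \<tau>] t sub by (auto simp: abs_le_iff)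
    moreover have "(2 * real T) powr (- 3 / 4) \<le> (- \<tau>) powr (- 3 / 4)"
      using t T by (intro powr_mono2') (auto simp: S'_def)
    ultimately show "e \<le> w t x \<tau>" unfolding e_def w_def by (intro mult_mono) auto
  qed
  also have "\<dots> \<le> J t x" unfolding J_def
    unfolding set_lebesgue_integral_def
    by (rule integral_mono [OF i' [unfolded set_integrable_def] w_integrable [unfolded set_integrable_def]])
      (use w_nonneg sub in \<open>auto simp: indicator_def\<close>)
  finally show ?thesis using e T by (smt (verit) mult_pos_pos of_nat_0_less_iff)
qed

lemma w_shift: "w t (x - 1) \<tau> = exp (um \<tau>) * w t x \<tau>"
proof -
  have "- um \<tau> * (x - 1 - \<gamma> \<tau> - \<gamma>' \<tau> * (t - \<tau>)) = um \<tau> + (- um \<tau> * (x - \<gamma> \<tau> - \<gamma>' \<tau> * (t - \<tau>)))"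
    by (simp add: algebra_simps)
  then show ?thesis unfolding w_def by (simp only: exp_add mult.assoc)
qed

lemma J_shift_bounds: "exp kap * J t x \<le> J t (x - 1)" "J t (x - 1) \<le> exp umax * J t x"
proof -
  have i: "set_integrable lborel S (\<lambda>\<tau>. k * w t x \<tau>)" for k using w_integrable by simp
  have e: "k * J t x = (LBINT \<tau>:S. k * w t x \<tau>)" for k unfolding J_def by simp
  show "exp kap * J t x \<le> J t (x - 1)" unfolding e J_def [of t "x - 1"]
    by (rule set_integral_mono [OF i w_integrable])
      (use um_bounds w_nonneg in \<open>auto simp: w_shift less_imp_le intro!: mult_right_mono\<close>)
  show "J t (x - 1) \<le> exp umax * J t x" unfolding e J_def [of t "x - 1"]
    by (rule set_integral_mono [OF w_integrable i])
      (use um_bounds w_nonneg in \<open>auto simp: w_shift less_imp_le intro!: mult_right_mono\<close>)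
qed

lemma z_sol_eq: "z_sol \<mu> lam0 T t x = 1 + J t x"
  by (simp add: z_sol_def J_def w_def S_def)

lemma u_sol_greater_iff: "a < u_sol \<mu> lam0 T t x \<longleftrightarrow> exp a - 1 < Q a t x"
  and u_sol_eq_iff: "u_sol \<mu> lam0 T t x = a \<longleftrightarrow> Q a t x = exp a - 1"
proof -
  have p: "1 + J t x > 0" "1 + J t (x - 1) > 0" using J_pos by (simp_all add: add_pos_pos)
  then have r: "(1 + J t (x - 1)) / (1 + J t x) > 0" by simp
  have "a < ln ((1 + J t (x - 1)) / (1 + J t x)) \<longleftrightarrow> exp a < (1 + J t (x - 1)) / (1 + J t x)"
    using r by (metis exp_ln exp_less_cancel_iff)
  also have "\<dots> \<longleftrightarrow> exp a - 1 < Q a t x" using p by (simp add: pos_less_divide_eq Q_def algebra_simps)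
  finally show "a < u_sol \<mu> lam0 T t x \<longleftrightarrow> exp a - 1 < Q a t x" unfolding u_sol_def z_sol_eq .
  have "ln ((1 + J t (x - 1)) / (1 + J t x)) = a \<longleftrightarrow> (1 + J t (x - 1)) / (1 + J t x) = exp a"
    using r by (metis exp_ln ln_exp)
  also have "\<dots> \<longleftrightarrow> Q a t x = exp a - 1" using p by (auto simp: divide_eq_eq Q_def algebra_simps)
  finally show "u_sol \<mu> lam0 T t x = a \<longleftrightarrow> Q a t x = exp a - 1" unfolding u_sol_def z_sol_eq .
qed

lemma u_sol_pos: "u_sol \<mu> lam0 T t x > 0"
proof -
  have "1 * J t x < exp kap * J t x" using kap_pos J_pos by (intro mult_strict_right_mono) auto
  then show ?thesis unfolding u_sol_greater_iff Q_def using J_shift_bounds(1) [of t x] by simp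
qed

lemma u_sol_le_umax: "u_sol \<mu> lam0 T t x < a" if "umax < a"
proof -
  have "exp umax * J t x \<le> exp a * J t x" using that J_pos [of t x] by (intro mult_right_mono) auto
  then have "Q a t x \<le> 0" unfolding Q_def using J_shift_bounds(2) [of t x] by simp
  moreover have "umax > 0" using kap_pos um_bounds [of 0] by linarith
  then have "exp a > 1" using that by simp
  ultimately have "Q a t x < exp a - 1" by linarith
  then have "Q a t x \<noteq> exp a - 1" "\<not> exp a - 1 < Q a t x" by auto
  then show ?thesis using u_sol_greater_iff [of a t x] u_sol_eq_iff [of t x a] by force
qed

lemma Q_eq: "Q a t x = (LBINT \<tau>:S. (exp (um \<tau>) - exp a) * w t x \<tau>)"
  and Q_integrable: "set_integrable lborel S (\<lambda>\<tau>. (exp (um \<tau>) - exp a) * w t x \<tau>)"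
proof -
  have e: "(\<lambda>\<tau>. (exp (um \<tau>) - exp a) * w t x \<tau>) = (\<lambda>\<tau>. w t (x - 1) \<tau> - exp a * w t x \<tau>)"
    by (auto simp: w_shift algebra_simps)
  have i: "set_integrable lborel S (\<lambda>\<tau>. exp a * w t x \<tau>)" using w_integrable by simp
  show "set_integrable lborel S (\<lambda>\<tau>. (exp (um \<tau>) - exp a) * w t x \<tau>)"
    unfolding e by (rule set_integral_diff(1) [OF w_integrable i])
  show "Q a t x = (LBINT \<tau>:S. (exp (um \<tau>) - exp a) * w t x \<tau>)"
    unfolding e Q_def by (subst set_integral_diff(2) [OF w_integrable i]) (simp add: J_def)
qed

text \<open>Pointwise inequalities between the weights pass to \<open>Q\<close> because the factor
  exp (um) - exp a is nonnegative for a <= kap.\<close>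

lemma Q_comparison:
  assumes "a \<le> kap" "k \<ge> 0" "\<And>\<tau>. \<tau> \<in> S \<Longrightarrow> k * w t x \<tau> \<le> w t' x' \<tau>"
  shows "k * Q a t x \<le> Q a t' x'"
proof -
  have "k * Q a t x = (LBINT \<tau>:S. k * ((exp (um \<tau>) - exp a) * w t x \<tau>))" unfolding Q_eq by simp
  also have "\<dots> \<le> Q a t' x'" unfolding Q_eq
  proof (rule set_integral_mono)
    show "set_integrable lborel S (\<lambda>\<tau>. k * ((exp (um \<tau>) - exp a) * w t x \<tau>))"
      using Q_integrable by simp
    show "set_integrable lborel S (\<lambda>\<tau>. (exp (um \<tau>) - exp a) * w t' x' \<tau>)" by (rule Q_integrable)
    fix \<tau> assume "\<tau> \<in> S"
    have "0 \<le> exp (um \<tau>) - exp a" using um_bounds(1) [of \<tau>] assms(1) by simp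
    then have "(exp (um \<tau>) - exp a) * (k * w t x \<tau>) \<le> (exp (um \<tau>) - exp a) * w t' x' \<tau>"
      using assms(3) [OF \<open>\<tau> \<in> S\<close>] by (intro mult_left_mono)
    then show "k * ((exp (um \<tau>) - exp a) * w t x \<tau>) \<le> (exp (um \<tau>) - exp a) * w t' x' \<tau>"
      by (simp add: mult.left_commute)
  qed
  finally show ?thesis .
qed

lemma Q_space_shift:
  assumes "a \<le> kap" "0 \<le> s"
  shows "Q a t (x + s) \<le> exp (- kap * s) * Q a t x" "exp (- umax * s) * Q a t x \<le> Q a t (x + s)"
proof -
  have w: "w t (x + s) \<tau> = exp (- um \<tau> * s) * w t x \<tau>" for \<tau>
  proof -
    have "- um \<tau> * (x + s - \<gamma> \<tau> - \<gamma>' \<tau> * (t - \<tau>)) = - um \<tau> * s + (- um \<tau> * (x - \<gamma> \<tau> - \<gamma>' \<tau> * (t - \<tau>)))"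
      by (simp add: algebra_simps)
    then show ?thesis unfolding w_def by (simp only: exp_add mult.assoc)
  qed
  have m: "kap * s \<le> um \<tau> * s" "um \<tau> * s \<le> umax * s" for \<tau>
    using um_bounds [of \<tau>] assms by (auto intro!: mult_right_mono)
  have "exp (kap * s) * Q a t (x + s) \<le> Q a t x"
  proof (rule Q_comparison [OF assms(1)])
    fix \<tau>
    have "exp (kap * s) * w t (x + s) \<tau> = exp (kap * s - um \<tau> * s) * w t x \<tau>"
      unfolding w by (simp add: exp_diff exp_minus field_simps)
    also have "\<dots> \<le> 1 * w t x \<tau>" using m(1) [of \<tau>] w_nonneg by (intro mult_right_mono) auto
    finally show "exp (kap * s) * w t (x + s) \<tau> \<le> w t x \<tau>" by simp
  qed simp
  then show "Q a t (x + s) \<le> exp (- kap * s) * Q a t x" by (simp add: exp_minus field_simps)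
  show "exp (- umax * s) * Q a t x \<le> Q a t (x + s)"
    by (rule Q_comparison [OF assms(1)]) (use m w_nonneg in \<open>auto simp: w intro!: mult_right_mono\<close>)
qed

lemma Q_pos: "a < kap \<Longrightarrow> 0 < Q a t x"
proof -
  assume a: "a < kap"
  have "exp a * J t x < exp kap * J t x" using a J_pos by (intro mult_strict_right_mono) auto
  then show ?thesis unfolding Q_def using J_shift_bounds(1) [of t x] by linarith
qed

lemma Q_strict_antimono:
  assumes a: "a < kap" and xy: "x < y"
  shows "Q a t y < Q a t x"
proof -
  have "Q a t y \<le> exp (- kap * (y - x)) * Q a t x" using Q_space_shift(1) [of a "y - x" t x] a xy by simp
  also have "\<dots> < 1 * Q a t x" using kap_pos xy Q_pos [OF a] by (intro mult_strict_right_mono) auto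
  finally show ?thesis by simp
qed

text \<open>Moving x by s changes \<open>Q\<close> at most by the factor exp (umax * s), which
  yields continuity without passing to a limit under the integral.\<close>

lemma Q_continuous:
  assumes a: "a < kap"
  shows "continuous_on UNIV (Q a t)"
proof -
  have umax: "umax > 0" using kap_pos um_bounds [of 0] by linarith
  have lip: "\<bar>Q a t y - Q a t x\<bar> \<le> (exp (umax * \<bar>y - x\<bar>) - 1) * Q a t x" for x y
  proof (cases "x \<le> y")
    case True
    have "exp (- umax * (y - x)) * Q a t x \<le> Q a t y" using Q_space_shift(2) [of a "y - x" t x] a True by simp
    moreover have "Q a t y \<le> Q a t x" using Q_strict_antimono [OF a, of x y t] True by (cases "x = y") auto
    moreover have "1 - exp (- umax * (y - x)) \<le> exp (umax * (y - x)) - 1"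
      using exp_ge_add_one_self [of "- umax * (y - x)"] exp_ge_add_one_self [of "umax * (y - x)"] by linarith
    then have "(1 - exp (- umax * (y - x))) * Q a t x \<le> (exp (umax * (y - x)) - 1) * Q a t x"
      using Q_pos [OF a, of t x] by (intro mult_right_mono) auto
    ultimately show ?thesis using True by (simp add: abs_le_iff left_diff_distrib)
  next
    case False
    have "exp (- umax * (x - y)) * Q a t y \<le> Q a t x" using Q_space_shift(2) [of a "x - y" t y] a False by simp
    then have "exp (umax * (x - y)) * (exp (- umax * (x - y)) * Q a t y) \<le> exp (umax * (x - y)) * Q a t x"
      by (intro mult_left_mono) auto
    moreover have "exp (umax * (x - y)) * exp (- umax * (x - y)) = 1" by (simp add: exp_add [symmetric])
    ultimately have "Q a t y \<le> exp (umax * (x - y)) * Q a t x" by (simp only: mult.assoc [symmetric] mult_1)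
    moreover have "Q a t x \<le> Q a t y" using Q_strict_antimono [OF a, of y x t] False by auto
    ultimately show ?thesis using False by (simp add: left_diff_distrib)
  qed
  have "isCont (Q a t) x" for x
  proof -
    have "((\<lambda>y. (exp (umax * \<bar>y - x\<bar>) - 1) * Q a t x) \<longlongrightarrow> (exp (umax * \<bar>x - x\<bar>) - 1) * Q a t x) (at x)"
      by (intro tendsto_intros)
    then have "((\<lambda>y. (exp (umax * \<bar>y - x\<bar>) - 1) * Q a t x) \<longlongrightarrow> 0) (at x)" by simp
    then have "((\<lambda>y. Q a t y - Q a t x) \<longlongrightarrow> 0) (at x)"
      by (rule Lim_null_comparison [rotated]) (use lip in simp)
    then show ?thesis by (simp add: isCont_def LIM_zero_iff)
  qed
  then show ?thesis by (simp add: continuous_at_imp_continuous_on)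
qed

lemma level_ex1:
  assumes a: "0 < a" "a < kap"
  shows "\<exists>!x. u_sol \<mu> lam0 T t x = a"
proof -
  have e: "exp a - 1 > 0" using a by simp
  define q0 where "q0 = Q a t 0"
  have q0: "q0 > 0" unfolding q0_def using Q_pos [OF a(2)] .
  \<comment> \<open>At distance \<open>r\<close>, the exponential rate kap makes up for the ratio of
    \<open>Q\<close> at 0 to the target exp a - 1, in whichever direction is needed.\<close>
  define r where "r = \<bar>ln (q0 / (exp a - 1))\<bar> / kap"
  have r: "r \<ge> 0" using kap_pos by (simp add: r_def)
  have kr: "kap * r = \<bar>ln (q0 / (exp a - 1))\<bar>" using kap_pos by (simp add: r_def)
  have "Q a t r \<le> exp (- kap * r) * q0" using Q_space_shift(1) [of a r t 0] a r by (simp add: q0_def)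
  also have "exp (- kap * r) \<le> exp (- ln (q0 / (exp a - 1)))" using kr by simp
  then have "exp (- kap * r) * q0 \<le> exp (- ln (q0 / (exp a - 1))) * q0" using q0 by (intro mult_right_mono) auto
  also have "\<dots> = exp a - 1" using q0 e by (simp add: exp_minus)
  finally have hi: "Q a t r \<le> exp a - 1" .
  have "q0 \<le> exp (- kap * r) * Q a t (- r)" using Q_space_shift(1) [of a r t "- r"] a r by (simp add: q0_def)
  also have "exp (- kap * r) \<le> exp (ln (q0 / (exp a - 1)))" using kr by simp
  then have "exp (- kap * r) * Q a t (- r) \<le> exp (ln (q0 / (exp a - 1))) * Q a t (- r)"
    using Q_pos [OF a(2), of t "- r"] by (intro mult_right_mono) auto
  also have "\<dots> = q0 / (exp a - 1) * Q a t (- r)" using q0 e by simp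
  finally have "1 * q0 \<le> (Q a t (- r) / (exp a - 1)) * q0" by (simp add: mult.commute)
  then have "1 \<le> Q a t (- r) / (exp a - 1)" using q0 by (rule mult_right_le_imp_le)
  then have lo: "exp a - 1 \<le> Q a t (- r)" using e by (simp add: pos_le_divide_eq)
  have "\<exists>x. - r \<le> x \<and> x \<le> r \<and> Q a t x = exp a - 1"
    by (rule IVT2' [where f = "Q a t", OF hi lo]) (use r continuous_on_subset [OF Q_continuous [OF a(2)]] in auto)
  then obtain x where "Q a t x = exp a - 1" by blast
  moreover have "x = y" if "Q a t x = exp a - 1" "Q a t y = exp a - 1" for x y
    using Q_strict_antimono [OF a(2), of x y t] Q_strict_antimono [OF a(2), of y x t] that
    by (metis less_irrefl linorder_neqE_linordered_idom)
  ultimately show ?thesis unfolding u_sol_eq_iff by blast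
qed

abbreviation "X \<equiv> level_curve \<mu> lam0 T"

lemma level_curve_Q: "0 < a \<Longrightarrow> a < kap \<Longrightarrow> Q a t (X t a) = exp a - 1"
  using theI' [OF level_ex1, of a t] by (simp add: level_curve_def u_sol_eq_iff)

lemma u_sol_greater_level:
  assumes a: "0 < a" "a < kap"
  shows "a < u_sol \<mu> lam0 T t x \<longleftrightarrow> x < X t a"
proof -
  note q = level_curve_Q [OF a, of t]
  show ?thesis unfolding u_sol_greater_iff q [symmetric]
    using Q_strict_antimono [OF a(2), of x "X t a" t] Q_strict_antimono [OF a(2), of "X t a" x t]
    by (metis less_irrefl less_trans linorder_neqE_linordered_idom)
qed

text \<open>In a frame moving with speed lam0 every elementary wave still moves to the right, as all
  slopes of the shock curve exceed lam0. Hence all weights grow along such a ray, and the level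
  cannot fall behind it.\<close>

lemma level_curve_advance:
  assumes a: "0 < a" "a < kap" and s: "0 \<le> s"
  shows "X t a + lam0 * s \<le> X (t + s) a"
proof -
  have "1 * Q a t (X t a) \<le> Q a (t + s) (X t a + lam0 * s)"
  proof (rule Q_comparison)
    fix \<tau>
    have "0 \<le> um \<tau> * ((\<gamma>' \<tau> - lam0) * s)"
      using um_bounds(1) [of \<tau>] kap_pos slope_bounds(1) [of \<tau>] s by (intro mult_nonneg_nonneg) auto
    then have "- um \<tau> * (X t a - \<gamma> \<tau> - \<gamma>' \<tau> * (t - \<tau>)) \<le> - um \<tau> * (X t a + lam0 * s - \<gamma> \<tau> - \<gamma>' \<tau> * (t + s - \<tau>))"
      by (simp add: algebra_simps)
    then show "1 * w t (X t a) \<tau> \<le> w (t + s) (X t a + lam0 * s) \<tau>"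
      unfolding w_def mult_1 by (intro mult_right_mono) auto
  qed (use a in auto)
  then have "Q a (t + s) (X (t + s) a) \<le> Q a (t + s) (X t a + lam0 * s)"
    using level_curve_Q [OF a] by simp
  then show ?thesis using Q_strict_antimono [OF a(2), of "X (t + s) a" "X t a + lam0 * s" "t + s"] by force
qed

end

text \<open>Outside \<open>(0, kappa0)\<close> the level is not attained for large \<open>T\<close>, so that \<^const>\<open>level_curve\<close> has a
  constant junk value, which is incompatible with the expansion.\<close>

lemma level_expansion_range:
  assumes mu: "0 < \<mu>" "\<mu> < 1" and lam: "\<mu> < lam0" "lam0 < 1" and I: "open I" and ex: "level_expansion \<mu> lam0 I c"
  shows "I \<subseteq> {0<..<kappa0 \<mu> lam0}"
proof -
  have powr: "((\<lambda>T::nat. real T powr (- 1 / 4)) \<longlongrightarrow> 0) sequentially" by real_asymp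
  have good: "\<forall>\<^sub>F T in sequentially. level_curves \<mu> lam0 T"
  proof -
    have "\<forall>\<^sub>F T::nat in sequentially. real T powr (- 1 / 4) < 1 - lam0" using order_tendstoD(2) [OF powr, of "1 - lam0"] lam by simp
    then show ?thesis using eventually_gt_at_top [of 0]
      by eventually_elim (use mu lam in \<open>auto simp: level_curves_def\<close>)
  qed
  define K0 where "K0 = kappa0 \<mu> lam0"
  have key: False if a: "a \<in> I" and na: "\<forall>\<^sub>F T in sequentially. \<forall>t x. u_sol \<mu> lam0 T t x \<noteq> a" for a
  proof -
    \<comment> \<open>If no x satisfies the equation, the predicate in the definite description is
      identically false. Its value is then one unspecified constant, the same for all
      \<open>t\<close> and \<open>T\<close>.\<close>
    define D :: real where "D = (THE x. False)"
    have lc: "level_curve \<mu> lam0 T t a = D" if "\<forall>t x. u_sol \<mu> lam0 T t x \<noteq> a" for T t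
      using that by (simp add: level_curve_def D_def)
    have "0 < (1/2::real) \<and> (1/2::real) < 1 \<and> 0 < (1/4::real) \<and> (1/4::real) < 1 / 2" by simp
    with ex obtain K N where KN: "\<And>T t. T \<ge> N \<Longrightarrow> - (2 - 1 / 2) * real T \<le> t \<Longrightarrow> t \<le> - (1 + 1 / 2) * sqrt (real T) \<Longrightarrow>
          \<bar>level_curve \<mu> lam0 T t a - (c a + shock_curve lam0 T t)\<bar> \<le> K * (- t) powr (- 1 / 2 + 1 / 4)"
      unfolding level_expansion_def using a by metis
    have "filterlim (\<lambda>T::nat. lam0 * (3 / 2 * sqrt (real T))) at_top sequentially" using mu lam by real_asymp
    then have "\<forall>\<^sub>F T::nat in sequentially. lam0 * (3 / 2 * sqrt (real T)) > \<bar>K\<bar> + \<bar>D\<bar> + \<bar>c a\<bar>"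
      unfolding filterlim_at_top_dense by blast
    with na have "\<forall>\<^sub>F T in sequentially. False"
      using eventually_ge_at_top [of N] eventually_ge_at_top [of 1]
    proof eventually_elim
      case (elim T)
      \<comment> \<open>The latest time covered by the expansion for \<delta> = 1 / 2. The shock
        curve there is at most - lam0 * 3 / 2 * sqrt T and tends to minus infinity, while the
        expansion would keep it bounded.\<close>
      define t where "t = - (1 + 1 / 2) * sqrt (real T)"
      have sT: "sqrt (real T) \<ge> 1" using elim by simp
      have "sqrt (real T) * 1 \<le> sqrt (real T) * sqrt (real T)" using sT by (intro mult_left_mono) auto
      then have "sqrt (real T) \<le> real T" by simp
      then have "\<bar>D - (c a + shock_curve lam0 T t)\<bar> \<le> K * (- t) powr (- 1 / 2 + 1 / 4)"
        using KN [of T t] lc elim by (simp add: t_def)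
      also have "\<dots> \<le> \<bar>K\<bar> * 1"
      proof (intro mult_mono)
        show "(- t) powr (- 1 / 2 + 1 / 4) \<le> 1" proof -
          have "- t = 3 / 2 * sqrt (real T)" by (simp add: t_def)
          then have t1: "1 \<le> - t" using sT by linarith
          have "(- t) powr (- 1 / 2 + 1 / 4) \<le> (- t) powr 0" by (rule powr_mono) (use t1 in auto)
          then show ?thesis using t1 by simp
        qed
      qed auto
      finally have "- shock_curve lam0 T t \<le> \<bar>K\<bar> + \<bar>D\<bar> + \<bar>c a\<bar>" by linarith
      moreover have "shock_curve lam0 T t = lam0 * t - 2 * sqrt (- t)" using sT by (simp add: shock_curve_def t_def)
      moreover have "sqrt (- t) \<ge> 0" using sT by (simp add: t_def)
      moreover have "lam0 * t = - (lam0 * (3 / 2 * sqrt (real T)))" by (simp add: t_def)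
      ultimately show False using elim by linarith
    qed
    then show False by simp
  qed
  have pos: "0 < a" if "a \<in> I" for a
  proof (rule ccontr)
    assume "\<not> 0 < a"
    have "\<forall>\<^sub>F T in sequentially. \<forall>t x. u_sol \<mu> lam0 T t x \<noteq> a"
      using good
    proof eventually_elim
      case (elim T)
      then show ?case using level_curves.u_sol_pos [OF elim] \<open>\<not> 0 < a\<close> by force
    qed
    with key [OF that] show False by blast
  qed
  have le: "a \<le> K0" if "a \<in> I" for a
  proof (rule ccontr)
    assume "\<not> a \<le> K0"
    then have a: "phi \<mu> lam0 < a" by (simp add: K0_def kappa0_def)
    have a0: "a > 0" using pos [OF that] .
    \<comment> \<open>Restating a > kappa0 through the slope of the flux leaves room for the
      perturbation T powr (-1/4), so that eventually even the largest value of
      \<open>u_minus\<close> is below a.\<close>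
    have "lam0 < flux \<mu> a / a" using phi_less_iff [OF mu lam a0] a by simp
    then have "\<forall>\<^sub>F T::nat in sequentially. real T powr (- 1 / 4) < flux \<mu> a / a - lam0"
      using order_tendstoD(2) [OF powr, of "flux \<mu> a / a - lam0"] by simp
    then have "\<forall>\<^sub>F T in sequentially. \<forall>t x. u_sol \<mu> lam0 T t x \<noteq> a"
      using good
    proof eventually_elim
      case (elim T)
      interpret level_curves \<mu> lam0 T by fact
      have "umax < a" unfolding umax_def
        by (subst phi_less_iff [OF mu sT(3,2) a0]) (use elim(1) in \<open>simp add: sT_def\<close>)
      then show ?case using u_sol_le_umax by force
    qed
    with key [OF that] show False by blast
  qed
  show ?thesis
  proof
    fix a assume a: "a \<in> I"
    \<comment> \<open>Openness excludes the end point kappa0: a slightly larger level in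
      \<open>I\<close> also satisfies the weak inequality.\<close>
    obtain e where e: "e > 0" "cball a e \<subseteq> I" using I a open_contains_cball by blast
    then have "a + e \<in> I" by (auto simp: dist_real_def)
    then show "a \<in> {0<..<kappa0 \<mu> lam0}" using le [of "a + e"] pos [OF a] e by (simp add: K0_def)
  qed
qed

subsection \<open>Duality\<close>

text \<open>Duhamel's formula in weak form. Transposing one step moves the shift from v to
  \<open>F\<close>, where it becomes one more averaging step, and leaves a source term; so the
  source at step k is tested after N - 1 - k further averagings. The induction generalises over
  \<open>m\<close> for this reason.\<close>

lemma upwind_duality:
  fixes f :: "real \<Rightarrow> real" and U :: "nat \<Rightarrow> int \<Rightarrow> real"
  defines "F \<equiv> \<lambda>m (j::int). adj_mean m f (1 - of_int j) - adj_mean m f (- of_int j)"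
  assumes z: "\<And>j m. j < a - int m \<or> b < j \<Longrightarrow> F m j = 0"
  shows "l \<le> a - int (m + N) \<Longrightarrow> b \<le> h \<Longrightarrow>
    (\<Sum>j\<in>{l..h}. F m j * upwind_v g U N j)
      = - (\<Sum>k<N. \<Sum>j\<in>{l..h}. (g (U k j) - g (U k (j - 1))) * F (m + N - 1 - k) j)"
proof (induction N arbitrary: m)
  case (Suc N)
  have FS: "F (Suc m) j = (F m j + F m (j + 1)) / 2" for m j
  proof -
    have e: "1 - of_int j - 1 = - real_of_int j" "1 - real_of_int (j + 1) = - of_int j"
      "- real_of_int (j + 1) = - of_int j - 1" by simp_all
    show ?thesis unfolding F_def adj_mean_Suc e by argo
  qed
  \<comment> \<open>After reindexing, the range is shifted by one; the terms gained and lost lie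
    outside the support of \<open>F\<close>.\<close>
  have sh: "(\<Sum>j\<in>{l..h}. F m j * upwind_v g U N (j - 1)) = (\<Sum>j\<in>{l..h}. F m (j + 1) * upwind_v g U N j)"
  proof -
    have "(\<Sum>j\<in>{l..h}. F m j * upwind_v g U N (j - 1)) = (\<Sum>j\<in>{l - 1..h - 1}. F m (j + 1) * upwind_v g U N j)"
      by (rule sum.reindex_bij_witness [where i = "\<lambda>j. j + 1" and j = "\<lambda>j. j - 1"]) auto
    also have "\<dots> = (\<Sum>j\<in>{l - 1..h}. F m (j + 1) * upwind_v g U N j)"
      by (rule sum.mono_neutral_left) (use z [of _ m] Suc.prems in \<open>auto\<close>)
    also have "\<dots> = (\<Sum>j\<in>{l..h}. F m (j + 1) * upwind_v g U N j)"
      by (rule sum.mono_neutral_right) (use z [of _ m] Suc.prems in \<open>auto\<close>)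
    finally show ?thesis .
  qed
  have "(\<Sum>j\<in>{l..h}. F m j * upwind_v g U (Suc N) j)
     = ((\<Sum>j\<in>{l..h}. F m j * upwind_v g U N (j - 1)) + (\<Sum>j\<in>{l..h}. F m j * upwind_v g U N j)) / 2
       - (\<Sum>j\<in>{l..h}. (g (U N j) - g (U N (j - 1))) * F m j)"
    by (simp add: sum.distrib [symmetric] sum_subtractf [symmetric] sum_divide_distrib algebra_simps add_divide_distrib)
  also have "\<dots> = (\<Sum>j\<in>{l..h}. F (Suc m) j * upwind_v g U N j)
       - (\<Sum>j\<in>{l..h}. (g (U N j) - g (U N (j - 1))) * F m j)"
    unfolding sh FS by (simp add: sum.distrib [symmetric] sum_divide_distrib algebra_simps add_divide_distrib)
  also have "(\<Sum>j\<in>{l..h}. F (Suc m) j * upwind_v g U N j)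
      = - (\<Sum>k<N. \<Sum>j\<in>{l..h}. (g (U k j) - g (U k (j - 1))) * F (Suc m + N - 1 - k) j)"
    by (rule Suc.IH) (use Suc.prems in auto)
  finally show ?case by simp
qed simp

lemma duality_increments:
  fixes \<Phi> :: "real \<Rightarrow> real" and v :: "int \<Rightarrow> real"
  assumes z: "\<And>j. j \<le> l \<or> h < j \<Longrightarrow> \<Phi> (- of_int j) = 0"
  shows "(\<Sum>j\<in>{l..h}. \<Phi> (- of_int j) * (v (j + 1) - v j)) = (\<Sum>j\<in>{l..h + 1}. (\<Phi> (1 - of_int j) - \<Phi> (- of_int j)) * v j)"
proof -
  have "(\<Sum>j\<in>{l..h}. \<Phi> (- of_int j) * v (j + 1)) = (\<Sum>j\<in>{l + 1..h + 1}. \<Phi> (1 - of_int j) * v j)"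
    by (rule sum.reindex_bij_witness [where i = "\<lambda>j. j - 1" and j = "\<lambda>j. j + 1"]) auto
  also have "\<dots> = (\<Sum>j\<in>{l..h + 1}. \<Phi> (1 - of_int j) * v j)"
  proof (rule sum.mono_neutral_left)
    show "\<forall>i\<in>{l..h + 1} - {l + 1..h + 1}. \<Phi> (1 - of_int i) * v i = 0"
    proof
      fix i assume "i \<in> {l..h + 1} - {l + 1..h + 1}"
      then have "i = l" by auto
      then show "\<Phi> (1 - of_int i) * v i = 0" using z [of "l - 1"] by simp
    qed
  qed auto
  finally have 1: "(\<Sum>j\<in>{l..h}. \<Phi> (- of_int j) * v (j + 1)) = (\<Sum>j\<in>{l..h + 1}. \<Phi> (1 - of_int j) * v j)" .
  have 2: "(\<Sum>j\<in>{l..h}. \<Phi> (- of_int j) * v j) = (\<Sum>j\<in>{l..h + 1}. \<Phi> (- of_int j) * v j)"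
    by (rule sum.mono_neutral_left) (use z in auto)
  show ?thesis using 1 2 by (simp add: right_diff_distrib left_diff_distrib sum_subtractf)
qed

text \<open>The fundamental theorem written as an integral over levels, so that the dependence on u
  sits in an indicator only.\<close>

lemma set_integral_deriv_below:
  fixes g g' :: "real \<Rightarrow> real"
  assumes g: "\<And>x. (g has_real_derivative g' x) (at x)" "continuous_on UNIV g'" and u: "0 < u"
  shows "set_integrable lborel {0..} (\<lambda>\<xi>. g' \<xi> * indicator {..<u} \<xi>)"
    "(LBINT \<xi>:{0..}. g' \<xi> * indicator {..<u} \<xi>) = g u - g 0"
proof -
  have ae: "AE \<xi> in lborel. indicator {0..} \<xi> *\<^sub>R (g' \<xi> * indicator {..<u} \<xi>) = g' \<xi> * indicator {0..u} \<xi>"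
    using AE_lborel_singleton [of u] by eventually_elim (auto simp: indicator_def)
  have [measurable]: "g' \<in> borel_measurable borel" using g(2) by (rule borel_measurable_continuous_onI)
  have i: "integrable lborel (\<lambda>\<xi>. g' \<xi> * indicator {0..u} \<xi>)"
    using borel_integrable_compact [of "{0..u}" g'] continuous_on_subset [OF g(2)]
    by (simp add: set_integrable_def mult.commute)
  show "set_integrable lborel {0..} (\<lambda>\<xi>. g' \<xi> * indicator {..<u} \<xi>)"
    unfolding set_integrable_def by (subst integrable_cong_AE [OF _ _ ae]) (use i in auto)
  have "(LBINT \<xi>:{0..}. g' \<xi> * indicator {..<u} \<xi>) = (\<integral>\<xi>. g' \<xi> * indicator {0..u} \<xi> \<partial>lborel)"
    unfolding set_lebesgue_integral_def by (rule integral_cong_AE [OF _ _ ae]) auto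
  also have "\<dots> = g u - g 0"
    by (rule integral_FTC_Icc_real) (use u g in \<open>auto simp: continuous_on_eq_continuous_at\<close>)
  finally show "(LBINT \<xi>:{0..}. g' \<xi> * indicator {..<u} \<xi>) = g u - g 0" .
qed

lemma set_integral_finite_sum:
  fixes f :: "'i \<Rightarrow> 'a \<Rightarrow> real"
  assumes "\<And>i. i \<in> A \<Longrightarrow> set_integrable M S (f i)"
  shows "set_integrable M S (\<lambda>x. \<Sum>i\<in>A. f i x)"
    "set_lebesgue_integral M S (\<lambda>x. \<Sum>i\<in>A. f i x) = (\<Sum>i\<in>A. set_lebesgue_integral M S (f i))"
  using assms unfolding set_integrable_def set_lebesgue_integral_def scaleR_sum_right
  by (auto intro!: Bochner_Integration.integrable_sum Bochner_Integration.integral_sum)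

section \<open>Reduction of the source to the lattice steps of the level curves\<close>

context level_curves
begin

text \<open>At fixed time u decreases through each level \<xi> exactly once. An increment of g (u)
  thus collects the density of the levels crossed in that cell, and summing over cells leaves one
  value of \<open>F\<close> per level.\<close>

lemma layer_cake:
  fixes g g' :: "real \<Rightarrow> real" and F :: "int \<Rightarrow> real"
  assumes g: "\<And>x. (g has_real_derivative g' x) (at x)" "continuous_on UNIV g'"
    and supp: "\<And>\<xi>. 0 \<le> \<xi> \<Longrightarrow> g' \<xi> \<noteq> 0 \<Longrightarrow> 0 < \<xi> \<and> \<xi> < kap"
    and F: "\<And>j. j < l \<or> h < j \<Longrightarrow> F j = 0"
  shows "set_integrable lborel {0..} (\<lambda>\<xi>. g' \<xi> * F \<lceil>X t \<xi>\<rceil>)"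
    "(\<Sum>j\<in>{l..h}. (g (u_sol \<mu> lam0 T t (of_int j)) - g (u_sol \<mu> lam0 T t (of_int j - 1))) * F j)
       = - (LBINT \<xi>:{0..}. g' \<xi> * F \<lceil>X t \<xi>\<rceil>)"
proof -
  let ?u = "u_sol \<mu> lam0 T t"
  have eq: "g' \<xi> * F \<lceil>X t \<xi>\<rceil> = (\<Sum>j\<in>{l..h}. (g' \<xi> * indicator {..<?u (of_int j - 1)} \<xi> - g' \<xi> * indicator {..<?u (of_int j)} \<xi>) * F j)"
    if "\<xi> \<in> {0..}" for \<xi>
  proof (cases "g' \<xi> = 0")
    case False
    then have \<xi>: "0 < \<xi>" "\<xi> < kap" using supp that by auto
    \<comment> \<open>u exceeds \<xi> at j - 1 but not at j exactly if j - 1 < X <= j, which says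
      that j is the ceiling of the level-curve position.\<close>
    have "g' \<xi> * indicator {..<?u (of_int j - 1)} \<xi> - g' \<xi> * indicator {..<?u (of_int j)} \<xi> = (if j = \<lceil>X t \<xi>\<rceil> then g' \<xi> else 0)" for j
      using u_sol_greater_level [OF \<xi>, of t "of_int j"] u_sol_greater_level [OF \<xi>, of t "of_int j - 1"]
      by (auto simp: indicator_def ceiling_eq_iff) linarith+
    then have "(\<Sum>j\<in>{l..h}. (g' \<xi> * indicator {..<?u (of_int j - 1)} \<xi> - g' \<xi> * indicator {..<?u (of_int j)} \<xi>) * F j)
        = (\<Sum>j\<in>{l..h}. if j = \<lceil>X t \<xi>\<rceil> then g' \<xi> * F j else 0)" by (intro sum.cong) auto
    also have "\<dots> = g' \<xi> * F \<lceil>X t \<xi>\<rceil>" using F [of "\<lceil>X t \<xi>\<rceil>"] by (auto simp: sum.delta)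
    finally show ?thesis by simp
  qed simp
  note d = set_integral_deriv_below [OF g u_sol_pos]
  have i: "set_integrable lborel {0..} (\<lambda>\<xi>. (g' \<xi> * indicator {..<?u (of_int j - 1)} \<xi> - g' \<xi> * indicator {..<?u (of_int j)} \<xi>) * F j)" for j
    by (intro set_integrable_mult_left set_integral_diff(1) d)
  have i': "set_integrable lborel {0..} (\<lambda>\<xi>. \<Sum>j\<in>{l..h}. (g' \<xi> * indicator {..<?u (of_int j - 1)} \<xi> - g' \<xi> * indicator {..<?u (of_int j)} \<xi>) * F j)"
    by (rule set_integral_finite_sum(1)) (rule i)
  show "set_integrable lborel {0..} (\<lambda>\<xi>. g' \<xi> * F \<lceil>X t \<xi>\<rceil>)"
    using i' by (subst set_integrable_cong [OF refl refl eq])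
  have "(LBINT \<xi>:{0..}. g' \<xi> * F \<lceil>X t \<xi>\<rceil>)
     = (LBINT \<xi>:{0..}. \<Sum>j\<in>{l..h}. (g' \<xi> * indicator {..<?u (of_int j - 1)} \<xi> - g' \<xi> * indicator {..<?u (of_int j)} \<xi>) * F j)"
    by (rule set_lebesgue_integral_cong) (use eq in auto)
  also have "\<dots> = (\<Sum>j\<in>{l..h}. LBINT \<xi>:{0..}. (g' \<xi> * indicator {..<?u (of_int j - 1)} \<xi> - g' \<xi> * indicator {..<?u (of_int j)} \<xi>) * F j)"
    by (rule set_integral_finite_sum(2)) (rule i)
  also have "\<dots> = (\<Sum>j\<in>{l..h}. (g (?u (of_int j - 1)) - g (?u (of_int j))) * F j)"
  proof (rule sum.cong [OF refl])
    fix j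
    have "(LBINT \<xi>:{0..}. (g' \<xi> * indicator {..<?u (of_int j - 1)} \<xi> - g' \<xi> * indicator {..<?u (of_int j)} \<xi>) * F j)
       = (LBINT \<xi>:{0..}. g' \<xi> * indicator {..<?u (of_int j - 1)} \<xi> - g' \<xi> * indicator {..<?u (of_int j)} \<xi>) * F j"
      by (rule set_integral_mult_left)
    also have "(LBINT \<xi>:{0..}. g' \<xi> * indicator {..<?u (of_int j - 1)} \<xi> - g' \<xi> * indicator {..<?u (of_int j)} \<xi>)
       = (g (?u (of_int j - 1)) - g 0) - (g (?u (of_int j)) - g 0)"
      by (subst set_integral_diff(2)) (simp_all add: d)
    finally show "(LBINT \<xi>:{0..}. (g' \<xi> * indicator {..<?u (of_int j - 1)} \<xi> - g' \<xi> * indicator {..<?u (of_int j)} \<xi>) * F j)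
       = (g (?u (of_int j - 1)) - g (?u (of_int j))) * F j" by simp
  qed
  finally show "(\<Sum>j\<in>{l..h}. (g (?u (of_int j)) - g (?u (of_int j - 1))) * F j) = - (LBINT \<xi>:{0..}. g' \<xi> * F \<lceil>X t \<xi>\<rceil>)"
    by (simp add: sum_negf [symmetric] left_diff_distrib)
qed

text \<open>Testing the increments of the profile with \<open>f\<close>: in space-time only the lattice steps of the
  level curves contribute.\<close>

lemma tested_increments:
  fixes g g' f :: "real \<Rightarrow> real"
  assumes g: "\<And>x. (g has_real_derivative g' x) (at x)" "continuous_on UNIV g'"
    and supp: "\<And>\<xi>. 0 \<le> \<xi> \<Longrightarrow> g' \<xi> \<noteq> 0 \<Longrightarrow> 0 < \<xi> \<and> \<xi> < kap"
    and f: "\<And>b. b \<le> 0 \<or> R \<le> b \<Longrightarrow> f b = 0" and R: "R \<ge> 1"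
  defines "Jm \<equiv> \<lambda>\<xi>. \<Sum>m\<le>2 * T. adj_mean m f (of_int \<lfloor>- X (- real m) \<xi>\<rfloor> + 1) - adj_mean m f (of_int \<lfloor>- X (- real m) \<xi>\<rfloor>)"
  shows "set_integrable lborel {0..} (\<lambda>\<xi>. g' \<xi> * Jm \<xi>)"
    "(\<Sum>j\<in>{- \<lceil>R\<rceil>..0}. f (- of_int j) * (V_profile \<mu> lam0 T g j - V_profile \<mu> lam0 T g (j - 1))) = (LBINT \<xi>:{0..}. g' \<xi> * Jm \<xi>)"
proof -
  define F where "F = (\<lambda>m (j::int). adj_mean m f (1 - of_int j) - adj_mean m f (- of_int j))"
  define U where "U = (\<lambda>k i. u_sol \<mu> lam0 T (real k - 2 * real T) (of_int i))"
  \<comment> \<open>From time - 2 * T to time 1 there are 2 * T + 1 steps. The sources act at the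
    times - m with m <= 2 * T, and the one at - m undergoes exactly m further averagings.\<close>
  define N where "N = 2 * T + 1"
  define l where "l = - \<lceil>R\<rceil> - int N - 2"
  have adj0: "adj_mean m f y = 0" if "y \<le> 0 \<or> R + real m \<le> y" for m y
    using that
  proof (induction m arbitrary: y)
    case (Suc m)
    then show ?case by (auto simp: adj_mean_Suc)
  qed (use f in auto)
  have F0: "F m j = 0" if "j < - \<lceil>R\<rceil> - int m \<or> 1 < j" for m j
  proof -
    have "R \<le> of_int \<lceil>R\<rceil>" by simp
    have c: "of_int j < - of_int \<lceil>R\<rceil> - real m \<or> (1::real) < of_int j"
    proof -
      have "of_int j < (of_int (- \<lceil>R\<rceil> - int m) :: real) \<or> of_int 1 < (of_int j :: real)"
        using that unfolding of_int_less_iff .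
      then show ?thesis by simp
    qed
    have "adj_mean m f (1 - of_int j) = 0" by (rule adj0) (use c \<open>R \<le> of_int \<lceil>R\<rceil>\<close> in argo)
    moreover have "adj_mean m f (- of_int j) = 0" by (rule adj0) (use c \<open>R \<le> of_int \<lceil>R\<rceil>\<close> in argo)
    ultimately show ?thesis by (simp add: F_def)
  qed
  \<comment> \<open>Reflection turns the ceiling of the level-curve position into a floor, which
    produces the cell increments of \<open>unit_jump\<close>.\<close>
  have FX: "F m \<lceil>x\<rceil> = adj_mean m f (of_int \<lfloor>- x\<rfloor> + 1) - adj_mean m f (of_int \<lfloor>- x\<rfloor>)" for m x
    by (simp add: F_def floor_minus)
  have Jm: "Jm \<xi> = (\<Sum>m\<le>2 * T. F m \<lceil>X (- real m) \<xi>\<rceil>)" for \<xi> by (simp only: Jm_def FX)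
  have FlN: "F m j = 0" if "m \<le> 2 * T" "j < l \<or> 1 < j" for m j using F0 [of j m] that by (auto simp: l_def N_def)
  note lc = layer_cake [OF g supp, of l 1 "F m" "- real m" for m]
  have i: "set_integrable lborel {0..} (\<lambda>\<xi>. g' \<xi> * F m \<lceil>X (- real m) \<xi>\<rceil>)" if "m \<le> 2 * T" for m
    by (rule lc) (use FlN that in auto)
  have gJ: "g' \<xi> * Jm \<xi> = (\<Sum>m\<le>2 * T. g' \<xi> * F m \<lceil>X (- real m) \<xi>\<rceil>)" for \<xi> by (simp add: Jm sum_distrib_left)
  show "set_integrable lborel {0..} (\<lambda>\<xi>. g' \<xi> * Jm \<xi>)"
    unfolding gJ by (rule set_integral_finite_sum(1)) (use i in auto)
  have IJ: "(LBINT \<xi>:{0..}. g' \<xi> * Jm \<xi>) = (\<Sum>m\<le>2 * T. LBINT \<xi>:{0..}. g' \<xi> * F m \<lceil>X (- real m) \<xi>\<rceil>)"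
    unfolding gJ by (rule set_integral_finite_sum(2)) (use i in auto)
  have V: "V_profile \<mu> lam0 T g j = upwind_v g U N (j + 1)" for j
  proof -
    have "nat (1 + 2 * int T) = N" by (simp add: N_def nat_eq_iff)
    then show ?thesis unfolding V_profile_def v_sol_def U_def by simp
  qed
  have "(\<Sum>j\<in>{- \<lceil>R\<rceil>..0}. f (- of_int j) * (V_profile \<mu> lam0 T g j - V_profile \<mu> lam0 T g (j - 1)))
     = (\<Sum>j\<in>{- \<lceil>R\<rceil>..0}. f (- of_int j) * (upwind_v g U N (j + 1) - upwind_v g U N j))" by (simp add: V)
  also have "\<dots> = (\<Sum>j\<in>{- \<lceil>R\<rceil>..0 + 1}. (f (1 - of_int j) - f (- of_int j)) * upwind_v g U N j)"
  proof (rule duality_increments)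
    fix j assume "j \<le> - \<lceil>R\<rceil> \<or> 0 < j"
    then have "of_int j \<le> (of_int (- \<lceil>R\<rceil>) :: real) \<or> of_int 0 < (of_int j :: real)"
      unfolding of_int_less_iff of_int_le_iff .
    moreover have "R \<le> of_int \<lceil>R\<rceil>" by simp
    ultimately have "of_int j \<le> - R \<or> (0::real) < of_int j"
      unfolding of_int_minus of_int_0 by argo
    then show "f (- of_int j) = 0" by (intro f) auto
  qed
  also have "\<dots> = (\<Sum>j\<in>{- \<lceil>R\<rceil>..1}. F 0 j * upwind_v g U N j)" by (simp add: F_def)
  also have "\<dots> = (\<Sum>j\<in>{l..1}. F 0 j * upwind_v g U N j)"
    by (rule sum.mono_neutral_left) (use F0 [of _ 0] in \<open>auto simp: l_def\<close>)
  also have "\<dots> = - (\<Sum>k<N. \<Sum>j\<in>{l..1}. (g (U k j) - g (U k (j - 1))) * F (0 + N - 1 - k) j)"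
    unfolding F_def
    by (rule upwind_duality [where a = "- \<lceil>R\<rceil>" and b = 1]) (use F0 in \<open>auto simp: F_def l_def\<close>)
  also have "\<dots> = - (\<Sum>k<N. \<Sum>j\<in>{l..1}. (g (U k j) - g (U k (j - 1))) * F (2 * T - k) j)" by (simp add: N_def)
  also have "(\<Sum>k<N. \<Sum>j\<in>{l..1}. (g (U k j) - g (U k (j - 1))) * F (2 * T - k) j)
     = (\<Sum>m\<le>2 * T. \<Sum>j\<in>{l..1}. (g (U (2 * T - m) j) - g (U (2 * T - m) (j - 1))) * F m j)"
    by (rule sum.reindex_bij_witness [where i = "\<lambda>m. 2 * T - m" and j = "\<lambda>k. 2 * T - k"]) (auto simp: N_def)
  also have "\<dots> = (\<Sum>m\<le>2 * T. - (LBINT \<xi>:{0..}. g' \<xi> * F m \<lceil>X (- real m) \<xi>\<rceil>))"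
  proof (rule sum.cong [OF refl])
    fix m assume "m \<in> {..2 * T}"
    then have m: "m \<le> 2 * T" by simp
    have U: "U (2 * T - m) j = u_sol \<mu> lam0 T (- real m) (of_int j)" for j using m by (simp add: U_def of_nat_diff)
    have "(\<Sum>j\<in>{l..1}. (g (u_sol \<mu> lam0 T (- real m) (of_int j)) - g (u_sol \<mu> lam0 T (- real m) (of_int j - 1))) * F m j)
       = - (LBINT \<xi>:{0..}. g' \<xi> * F m \<lceil>X (- real m) \<xi>\<rceil>)"
      by (rule lc) (use FlN m in auto)
    then show "(\<Sum>j\<in>{l..1}. (g (U (2 * T - m) j) - g (U (2 * T - m) (j - 1))) * F m j) = - (LBINT \<xi>:{0..}. g' \<xi> * F m \<lceil>X (- real m) \<xi>\<rceil>)"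
      by (simp add: U)
  qed
  also have "- \<dots> = (LBINT \<xi>:{0..}. g' \<xi> * Jm \<xi>)" unfolding IJ by (simp add: sum_negf)
  finally show "(\<Sum>j\<in>{- \<lceil>R\<rceil>..0}. f (- of_int j) * (V_profile \<mu> lam0 T g j - V_profile \<mu> lam0 T g (j - 1))) = (LBINT \<xi>:{0..}. g' \<xi> * Jm \<xi>)" .
qed

end

subsection \<open>Trigonometric approximation\<close>

text \<open>Free phases make separate sines unnecessary, and allowing every integer frequency,
  including 0 and negative ones, lets the product formula for cosines stay within the class.\<close>

inductive trig_poly :: "(real \<Rightarrow> real) \<Rightarrow> bool" where
  cos: "trig_poly (\<lambda>t. a * cos (2 * pi * of_int k * t + \<theta>))"
| add: "trig_poly f \<Longrightarrow> trig_poly g \<Longrightarrow> trig_poly (\<lambda>t. f t + g t)"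

lemma trig_poly_mult:
  assumes "trig_poly f" "trig_poly g"
  shows "trig_poly (\<lambda>t. f t * g t)"
  using assms(1)
proof induction
  case (cos a k \<theta>)
  note c = this
  from assms(2) show ?case
  proof induction
    case (cos b l \<eta>)
    have "(\<lambda>t. a * cos (2 * pi * of_int k * t + \<theta>) * (b * cos (2 * pi * of_int l * t + \<eta>)))
        = (\<lambda>t. (a * b / 2) * cos (2 * pi * of_int (k - l) * t + (\<theta> - \<eta>)) + (a * b / 2) * cos (2 * pi * of_int (k + l) * t + (\<theta> + \<eta>)))"
    proof
      fix t
      have e: "2 * pi * of_int (k - l) * t + (\<theta> - \<eta>) = (2 * pi * of_int k * t + \<theta>) - (2 * pi * of_int l * t + \<eta>)"
        "2 * pi * of_int (k + l) * t + (\<theta> + \<eta>) = (2 * pi * of_int k * t + \<theta>) + (2 * pi * of_int l * t + \<eta>)"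
        by (simp_all add: algebra_simps)
      show "a * cos (2 * pi * of_int k * t + \<theta>) * (b * cos (2 * pi * of_int l * t + \<eta>))
        = (a * b / 2) * cos (2 * pi * of_int (k - l) * t + (\<theta> - \<eta>)) + (a * b / 2) * cos (2 * pi * of_int (k + l) * t + (\<theta> + \<eta>))"
        unfolding e cos_add cos_diff by (simp add: algebra_simps)
    qed
    then show ?case by (simp only: trig_poly.intros)
  next
    case (add f g)
    then show ?case by (simp only: distrib_left trig_poly.intros)
  qed
next
  case (add f g)
  then show ?case by (simp only: distrib_right trig_poly.intros)
qed

lemma trig_poly_const: "trig_poly (\<lambda>t. a)"
  using trig_poly.cos [of a 0 0] by simp

text \<open>The circle is the image of the compact interval {0..1}. Preimages of closed sets under
  the induced function are images of compact sets, hence closed.\<close>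

lemma continuous_periodic_on_circle:
  fixes f :: "real \<Rightarrow> real"
  assumes cont: "continuous_on UNIV f" and per: "\<And>x. f (x + 1) = f x"
  obtains F :: "complex \<Rightarrow> real" where "continuous_on (sphere 0 1) F" "\<And>t. F (cis (2 * pi * t)) = f t"
proof -
  define F where "F z = f (SOME t. cis (2 * pi * t) = z)" for z
  have F: "F (cis (2 * pi * t)) = f t" for t
  proof -
    define t' where "t' = (SOME t'. cis (2 * pi * t') = cis (2 * pi * t))"
    have "cis (2 * pi * t') = cis (2 * pi * t)" unfolding t'_def by (rule someI) simp
    then have "cos (2 * pi * t') = cos (2 * pi * t)" "sin (2 * pi * t') = sin (2 * pi * t)"
      by (simp_all add: complex_eq_iff)
    then obtain n :: int where "2 * pi * t' = 2 * pi * t + 2 * pi * of_int n"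
      using sin_cos_eq_iff [of "2 * pi * t'" "2 * pi * t"] by auto
    then have "2 * pi * t' = 2 * pi * (t + of_int n)" by (simp add: distrib_left)
    then have "t' = t + of_int n" by simp
    then show ?thesis unfolding F_def t'_def [symmetric] using periodic_add_int [of f, OF per] by simp
  qed
  have surj: "\<exists>t\<in>{0..1}. z = cis (2 * pi * t)" if "z \<in> sphere 0 1" for z
  proof -
    have "cmod z = 1" using that by simp
    then have "z = cis (Arg2pi z)" using Arg2pi [of z] by (simp add: cis_conv_exp is_Arg_def)
    moreover have "0 \<le> Arg2pi z" "Arg2pi z < 2 * pi" using Arg2pi [of z] by auto
    ultimately show ?thesis by (intro bexI [of _ "Arg2pi z / (2 * pi)"]) auto
  qed
  have "continuous_on (sphere 0 1) F"
  proof (subst continuous_on_closed_vimage)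
    show "\<forall>B. closed B \<longrightarrow> closed (F -` B \<inter> sphere 0 1)"
    proof (intro allI impI)
      fix B :: "real set" assume B: "closed B"
      have "F -` B \<inter> sphere 0 1 = (\<lambda>t. cis (2 * pi * t)) ` (f -` B \<inter> {0..1})"
        using surj by (fastforce simp: F)
      moreover have "closed (f -` B \<inter> {0..1})"
        using B continuous_on_subset [OF cont, of "{0..1}"] continuous_on_closed_vimage [of "{0..1}" f] by auto
      then have "compact (f -` B \<inter> {0..1})" by (simp add: compact_eq_bounded_closed bounded_Int)
      then have "compact ((\<lambda>t. cis (2 * pi * t)) ` (f -` B \<inter> {0..1}))"
        by (intro compact_continuous_image) (auto intro!: continuous_intros simp: cis_conv_exp)
      ultimately show "closed (F -` B \<inter> sphere 0 1)" by (simp add: compact_imp_closed)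
    qed
  qed simp
  then show ?thesis using F by (rule that)
qed

text \<open>Stone-Weierstrass on the circle: real linear functionals of cis (2 * pi * t) are
  combinations of a cosine and a sine, and polynomials in them remain trigonometric.\<close>

lemma trig_poly_approximation:
  fixes f :: "real \<Rightarrow> real"
  assumes cont: "continuous_on UNIV f" and per: "\<And>x. f (x + 1) = f x" and e: "e > 0"
  obtains p where "trig_poly p" "\<And>t. \<bar>f t - p t\<bar> < e"
proof -
  obtain F :: "complex \<Rightarrow> real" where F: "continuous_on (sphere 0 1) F" "\<And>t. F (cis (2 * pi * t)) = f t"
    using continuous_periodic_on_circle [OF cont per] by blast
  obtain g where g: "real_polynomial_function g" "\<And>z. z \<in> sphere 0 1 \<Longrightarrow> \<bar>F z - g z\<bar> < e"
    using Stone_Weierstrass_real_polynomial_function [OF compact_sphere F(1) e] by blast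
  from g(1) have "trig_poly (\<lambda>t. g (cis (2 * pi * t)))"
  proof induction
    case (linear h)
    have "h (cis (2 * pi * t)) = h 1 * cos (2 * pi * of_int 1 * t + 0) + (- h \<i>) * cos (2 * pi * of_int 1 * t + pi / 2)" for t
    proof -
      interpret bounded_linear h by fact
      have "cis (2 * pi * t) = cos (2 * pi * t) *\<^sub>R 1 + sin (2 * pi * t) *\<^sub>R \<i>"
        by (simp add: complex_eq_iff)
      then have "h (cis (2 * pi * t)) = cos (2 * pi * t) *\<^sub>R h 1 + sin (2 * pi * t) *\<^sub>R h \<i>"
        by (simp only: add scaleR)
      then show ?thesis by (simp add: cos_add)
    qed
    then show ?case by (simp only: trig_poly.intros)
  qed (auto intro: trig_poly_const trig_poly.add trig_poly_mult)
  moreover have "\<bar>f t - g (cis (2 * pi * t))\<bar> < e" for t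
    using g(2) [of "cis (2 * pi * t)"] by (simp add: F(2))
  ultimately show ?thesis by (rule that)
qed

lemma integral_cos_period:
  assumes "k \<noteq> 0"
  shows "((\<lambda>t. cos (2 * pi * of_int k * t + \<theta>)) has_integral 0) {0..1::real}"
proof -
  define w where "w = 2 * pi * of_int k"
  have w: "w \<noteq> 0" using assms by (simp add: w_def)
  have "((\<lambda>t. cos (w * t + \<theta>)) has_integral (sin (w * 1 + \<theta>) / w - sin (w * 0 + \<theta>) / w)) {0..1::real}"
  proof (rule fundamental_theorem_of_calculus)
    fix t :: real
    have "((\<lambda>t. sin (w * t + \<theta>) / w) has_real_derivative cos (w * t + \<theta>)) (at t within {0..1})"
      using w by (auto intro!: derivative_eq_intros)
    then show "((\<lambda>t. sin (w * t + \<theta>) / w) has_vector_derivative cos (w * t + \<theta>)) (at t within {0..1})"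
      by (simp add: has_real_derivative_iff_has_vector_derivative)
  qed simp
  moreover have "sin (w * 1 + \<theta>) = sin (w * 0 + \<theta>)"
    by (simp add: w_def sin_add sin_int_2pin cos_int_2pin)
  ultimately show ?thesis by (simp add: w_def)
qed

lemma trig_poly_continuous: "trig_poly p \<Longrightarrow> continuous_on A p"
  by (induction rule: trig_poly.induct) (auto intro!: continuous_intros)

text \<open>A signed density is determined, modulo constants, by its nonzero frequencies.\<close>

lemma integral_periodic_eq_mean:
  fixes f G C :: "real \<Rightarrow> real"
  assumes G: "integrable lborel G" and C [measurable]: "C \<in> borel_measurable borel"
    and Fc: "\<And>k \<theta>. k > 0 \<Longrightarrow> (\<integral>\<xi>. G \<xi> * cos (2 * pi * real k * C \<xi> + \<theta>) \<partial>lborel) = 0"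
    and cont: "continuous_on UNIV f" and per: "\<And>x. f (x + 1) = f x" and mean: "integral {0..1} f = 0"
  shows "(\<integral>\<xi>. G \<xi> * f (C \<xi>) \<partial>lborel) = 0"
proof -
  have [measurable]: "f \<in> borel_measurable borel" "G \<in> borel_measurable borel"
    using cont G by (auto intro: borel_measurable_continuous_onI)
  have GI: "integrable lborel (\<lambda>\<xi>. G \<xi> * h (C \<xi>))" if h: "continuous_on UNIV h" "\<And>t. \<bar>h t\<bar> \<le> B" for h B
  proof -
    have [measurable]: "h \<in> borel_measurable borel" using h(1) by (rule borel_measurable_continuous_onI)
    show ?thesis
    proof (rule Bochner_Integration.integrable_bound)
      show "integrable lborel (\<lambda>\<xi>. B * G \<xi>)" using G by simp
      show "AE \<xi> in lborel. norm (G \<xi> * h (C \<xi>)) \<le> norm (B * G \<xi>)"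
      proof (rule AE_I2)
        fix \<xi>
        have "\<bar>G \<xi>\<bar> * \<bar>h (C \<xi>)\<bar> \<le> \<bar>G \<xi>\<bar> * \<bar>B\<bar>" using h(2) [of "C \<xi>"] by (intro mult_left_mono) auto
        then show "norm (G \<xi> * h (C \<xi>)) \<le> norm (B * G \<xi>)" by (simp add: abs_mult mult.commute)
      qed
    qed simp
  qed
  have Fc': "(\<integral>\<xi>. G \<xi> * cos (2 * pi * of_int k * C \<xi> + \<theta>) \<partial>lborel) = 0" if "k \<noteq> 0" for k :: int and \<theta>
  proof (cases "k > 0")
    case True
    then show ?thesis using Fc [of "nat k" \<theta>] by simp
  next
    case False
    have "cos (2 * pi * of_int k * C \<xi> + \<theta>) = cos (2 * pi * real (nat (- k)) * C \<xi> + (- \<theta>))" for \<xi>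
    proof -
      have "2 * pi * real (nat (- k)) * C \<xi> + (- \<theta>) = - (2 * pi * of_int k * C \<xi> + \<theta>)" using False by simp
      then show ?thesis by (simp only: cos_minus)
    qed
    then show ?thesis using Fc [of "nat (- k)" "- \<theta>"] that False by simp
  qed
  \<comment> \<open>For trigonometric polynomials the hypothesis removes all frequencies but zero,
    and what is left is the mean over a period.\<close>
  have P: "(\<exists>B. \<forall>t. \<bar>p t\<bar> \<le> B) \<and> (\<integral>\<xi>. G \<xi> * p (C \<xi>) \<partial>lborel) = integral {0..1} p * (\<integral>\<xi>. G \<xi> \<partial>lborel)" if "trig_poly p" for p
    using that
  proof induction
    case (cos a k \<theta>)
    have "\<bar>a * cos (2 * pi * of_int k * t + \<theta>)\<bar> \<le> \<bar>a\<bar>" for t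
      using mult_left_mono [OF abs_cos_le_one [of "2 * pi * of_int k * t + \<theta>"], of "\<bar>a\<bar>"] by (simp add: abs_mult)
    moreover have "(\<integral>\<xi>. G \<xi> * (a * cos (2 * pi * of_int k * C \<xi> + \<theta>)) \<partial>lborel)
        = integral {0..1} (\<lambda>t. a * cos (2 * pi * of_int k * t + \<theta>)) * (\<integral>\<xi>. G \<xi> \<partial>lborel)"
    proof (cases "k = 0")
      case False
      have "(\<integral>\<xi>. G \<xi> * (a * cos (2 * pi * of_int k * C \<xi> + \<theta>)) \<partial>lborel) = 0"
        using Fc' [OF False, of \<theta>] by (simp add: mult.left_commute)
      moreover have "integral {0..1} (\<lambda>t. a * cos (2 * pi * of_int k * t + \<theta>)) = 0"
        by (rule integral_unique) (use has_integral_mult_right [OF integral_cos_period [OF False, of \<theta>], of a] in simp)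
      ultimately show ?thesis by simp
    qed (simp add: mult.commute)
    ultimately show ?case by blast
  next
    case (add p p')
    then obtain B B' where B: "\<And>t. \<bar>p t\<bar> \<le> B" "\<And>t. \<bar>p' t\<bar> \<le> B'" by blast
    have "\<bar>p t + p' t\<bar> \<le> B + B'" for t using B(1) [of t] B(2) [of t] by linarith
    moreover have "(\<integral>\<xi>. G \<xi> * (p (C \<xi>) + p' (C \<xi>)) \<partial>lborel) = (\<integral>\<xi>. G \<xi> * p (C \<xi>) \<partial>lborel) + (\<integral>\<xi>. G \<xi> * p' (C \<xi>) \<partial>lborel)"
      unfolding distrib_left
      by (intro Bochner_Integration.integral_add GI [OF trig_poly_continuous B(1)] GI [OF trig_poly_continuous B(2)] add)
    moreover have "integral {0..1} (\<lambda>t. p t + p' t) = integral {0..1} p + integral {0..1} p'"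
      by (intro Henstock_Kurzweil_Integration.integral_add integrable_continuous_real trig_poly_continuous add)
    ultimately show ?case using add.IH by (auto simp: distrib_right)
  qed
  define N where "N = (\<integral>\<xi>. \<bar>G \<xi>\<bar> \<partial>lborel)"
  have N: "N \<ge> 0" unfolding N_def by simp
  have bnd: "\<bar>\<integral>\<xi>. G \<xi> * f (C \<xi>) \<partial>lborel\<bar> \<le> 2 * N * e" if e: "e > 0" for e
  proof -
    obtain p where p: "trig_poly p" "\<And>t. \<bar>f t - p t\<bar> < e" using trig_poly_approximation [OF cont per e] by blast
    obtain B where B: "\<And>t. \<bar>p t\<bar> \<le> B" using P [OF p(1)] by blast
    have fB: "\<bar>f t\<bar> \<le> B + e" for t using B [of t] p(2) [of t] by linarith
    have "\<bar>integral {0..1} p\<bar> = norm (integral {0..1} (\<lambda>t. p t - f t))"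
      using mean by (subst Henstock_Kurzweil_Integration.integral_diff)
        (auto intro!: integrable_continuous_real trig_poly_continuous p continuous_on_subset [OF cont])
    also have "\<dots> \<le> integral {0..1} (\<lambda>t::real. e)"
    proof (rule Henstock_Kurzweil_Integration.integral_norm_bound_integral)
      show "(\<lambda>t. p t - f t) integrable_on {0..1}"
        by (intro integrable_continuous_real continuous_intros trig_poly_continuous p continuous_on_subset [OF cont]) auto
      show "norm (p t - f t) \<le> e" for t using p(2) [of t] by (simp add: abs_minus_commute)
    qed auto
    finally have ip: "\<bar>integral {0..1} p\<bar> \<le> e" by simp
    have "(\<integral>\<xi>. G \<xi> * f (C \<xi>) \<partial>lborel) = (\<integral>\<xi>. G \<xi> * (f (C \<xi>) - p (C \<xi>)) \<partial>lborel) + (\<integral>\<xi>. G \<xi> * p (C \<xi>) \<partial>lborel)"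
      unfolding right_diff_distrib
      by (subst Bochner_Integration.integral_diff) (auto intro!: GI [OF trig_poly_continuous [OF p(1)] B] GI [OF cont fB])
    also have "(\<integral>\<xi>. G \<xi> * p (C \<xi>) \<partial>lborel) = integral {0..1} p * (\<integral>\<xi>. G \<xi> \<partial>lborel)" using P [OF p(1)] by blast
    finally have s: "(\<integral>\<xi>. G \<xi> * f (C \<xi>) \<partial>lborel) = (\<integral>\<xi>. G \<xi> * (f (C \<xi>) - p (C \<xi>)) \<partial>lborel) + integral {0..1} p * (\<integral>\<xi>. G \<xi> \<partial>lborel)" .
    have 1: "\<bar>\<integral>\<xi>. G \<xi> * (f (C \<xi>) - p (C \<xi>)) \<partial>lborel\<bar> \<le> (\<integral>\<xi>. e * \<bar>G \<xi>\<bar> \<partial>lborel)"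
    proof (rule order_trans [OF integral_abs_bound], rule integral_mono)
      show "integrable lborel (\<lambda>\<xi>. \<bar>G \<xi> * (f (C \<xi>) - p (C \<xi>))\<bar>)"
        unfolding right_diff_distrib
        by (intro integrable_abs Bochner_Integration.integrable_diff GI [OF trig_poly_continuous [OF p(1)] B] GI [OF cont fB])
      show "integrable lborel (\<lambda>\<xi>. e * \<bar>G \<xi>\<bar>)" using G by simp
      fix \<xi>
      have "\<bar>G \<xi>\<bar> * \<bar>f (C \<xi>) - p (C \<xi>)\<bar> \<le> \<bar>G \<xi>\<bar> * e" using p(2) [of "C \<xi>"] by (intro mult_left_mono) auto
      then show "\<bar>G \<xi> * (f (C \<xi>) - p (C \<xi>))\<bar> \<le> e * \<bar>G \<xi>\<bar>" by (simp add: abs_mult mult.commute)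
    qed
    have "\<bar>\<integral>\<xi>. G \<xi> \<partial>lborel\<bar> \<le> N" unfolding N_def by (rule integral_abs_bound)
    then have 2: "\<bar>integral {0..1} p * (\<integral>\<xi>. G \<xi> \<partial>lborel)\<bar> \<le> e * N" unfolding abs_mult using ip e by (intro mult_mono) auto
    have ie: "(\<integral>\<xi>. e * \<bar>G \<xi>\<bar> \<partial>lborel) = e * N" by (simp add: N_def)
    have "2 * N * e = e * N + e * N" by simp
    then show ?thesis unfolding s using 1 [unfolded ie] 2 by linarith
  qed
  show ?thesis
  proof (rule ccontr)
    assume ne: "(\<integral>\<xi>. G \<xi> * f (C \<xi>) \<partial>lborel) \<noteq> 0"
    define v where "v = \<bar>\<integral>\<xi>. G \<xi> * f (C \<xi>) \<partial>lborel\<bar>"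
    have v: "v > 0" using ne by (simp add: v_def)
    \<comment> \<open>The accuracy v / (4 * N + 4) makes the bound smaller than v, also in the case
      N = 0.\<close>
    have "v \<le> 2 * N * (v / (4 * N + 4))" unfolding v_def [symmetric] using bnd [of "v / (4 * N + 4)"] v N unfolding v_def by simp
    also have "\<dots> = v * (2 * N / (4 * N + 4))" by simp
    also have "\<dots> < v * 1" using v N by (intro mult_strict_left_mono) (auto simp: divide_less_eq)
    finally show False by simp
  qed
qed

subsection \<open>The smoothed fractional part\<close>

text \<open>Half the second derivative of the Gaussian. It therefore has mean zero, while its
  Fourier transform vanishes at 0 only.\<close>

definition gauss2 :: "real \<Rightarrow> real" where
  "gauss2 \<sigma> = (2 * \<sigma>\<^sup>2 - 1) * exp (- \<sigma>\<^sup>2)"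

text \<open>Exchanging the integrations writes \<open>Pi_fun\<close> as the integral of the
  derivative of g against this one periodic function, evaluated along q * c. Unlike
  \<open>frac\<close> it is continuous, if A > 0.\<close>

definition smoothed_frac :: "real \<Rightarrow> real \<Rightarrow> real" where
  "smoothed_frac A w = (LBINT \<sigma>. gauss2 \<sigma> * frac (w + A * \<sigma>))"

lemma gauss_integrals:
  "integrable lborel (\<lambda>x::real. exp (- x\<^sup>2))" "(LBINT x. exp (- x\<^sup>2)) = sqrt pi"
  "integrable lborel gauss2" "(LBINT x. gauss2 x) = 0"
proof -
  have h: "has_bochner_integral lborel (\<lambda>x::real. exp (- x\<^sup>2) * x ^ (2 * k)) (2 *\<^sub>R ((sqrt pi / 2) * (fact (2 * k) / (2 ^ (2 * k) * fact k))))" for k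
    by (rule has_bochner_integral_even_function [OF gaussian_moment_even_pos]) simp
  have h0: "has_bochner_integral lborel (\<lambda>x::real. exp (- x\<^sup>2)) (sqrt pi)" using h [of 0] by simp
  have h1: "has_bochner_integral lborel (\<lambda>x::real. exp (- x\<^sup>2) * x\<^sup>2) (sqrt pi / 2)" using h [of 1] by simp
  have "has_bochner_integral lborel (\<lambda>x::real. (exp (- x\<^sup>2) * x\<^sup>2) * 2 - exp (- x\<^sup>2)) (sqrt pi / 2 * 2 - sqrt pi)"
    by (intro has_bochner_integral_diff has_bochner_integral_mult_left h0 h1)
  moreover have "(\<lambda>x. (exp (- x\<^sup>2) * x\<^sup>2) * 2 - exp (- x\<^sup>2)) = gauss2"
    by (auto simp: gauss2_def algebra_simps)
  ultimately have h2: "has_bochner_integral lborel gauss2 0" by simp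
  show "integrable lborel (\<lambda>x::real. exp (- x\<^sup>2))" "(LBINT x. exp (- x\<^sup>2)) = sqrt pi"
    "integrable lborel gauss2" "(LBINT x. gauss2 x) = 0"
    using h0 h2 by (auto simp: has_bochner_integral_iff)
qed

text \<open>The characteristic function of the standard normal law, rescaled by sqrt 2.\<close>

lemma gauss_cos_integral: "(LBINT x. exp (- x\<^sup>2) * cos (s * x)) = sqrt pi * exp (- (s\<^sup>2 / 4))"
proof -
  interpret real_distribution std_normal_distribution by (rule real_dist_normal_dist)
  define t where "t = s / sqrt 2"
  have "(LINT x|std_normal_distribution. iexp (t * x)) = complex_of_real (exp (- (t\<^sup>2) / 2))"
    using char_std_normal_distribution by (simp add: char_def fun_eq_iff)
  moreover have "Re (LINT x|std_normal_distribution. iexp (t * x)) = (LINT x|std_normal_distribution. Re (iexp (t * x)))"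
    by (rule integral_Re [symmetric]) (auto intro!: integrable_const_bound [where B = 1])
  ultimately have "(LINT x|std_normal_distribution. cos (t * x)) = exp (- (t\<^sup>2) / 2)"
    by (simp add: Re_exp)
  also have "(LINT x|std_normal_distribution. cos (t * x)) = (LBINT x. std_normal_density x * cos (t * x))"
    by (subst integral_density) (auto simp: normal_density_nonneg)
  also have "\<dots> = \<bar>sqrt 2\<bar> *\<^sub>R (LBINT x. std_normal_density (0 + sqrt 2 * x) * cos (t * (0 + sqrt 2 * x)))"
    by (rule lborel_integral_real_affine) simp
  also have "(\<lambda>x. std_normal_density (0 + sqrt 2 * x) * cos (t * (0 + sqrt 2 * x))) = (\<lambda>x. (1 / sqrt (2 * pi)) * (exp (- x\<^sup>2) * cos (s * x)))"
    by (auto simp: std_normal_density_def t_def power_mult_distrib)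
  also have "\<bar>sqrt 2\<bar> *\<^sub>R (LBINT x. (1 / sqrt (2 * pi)) * (exp (- x\<^sup>2) * cos (s * x))) = (LBINT x. exp (- x\<^sup>2) * cos (s * x)) / sqrt pi"
    by (simp add: real_sqrt_mult)
  finally have "(LBINT x. exp (- x\<^sup>2) * cos (s * x)) = sqrt pi * exp (- (t\<^sup>2) / 2)" by (simp add: field_simps)
  then show ?thesis by (simp add: t_def power_divide)
qed

text \<open>Two integrations by parts in one: \<open>P\<close> vanishes at both infinities, and its
  derivative is the integrand plus s^2 / 2 times the Gaussian cosine integrand.\<close>

lemma gauss2_cos_integral: "(LBINT x. gauss2 x * cos (s * x)) = - (s\<^sup>2 / 2) * (sqrt pi * exp (- (s\<^sup>2 / 4)))"
proof -
  define P where "P x = - x * exp (- x\<^sup>2) * cos (s * x) + s / 2 * (exp (- x\<^sup>2) * sin (s * x))" for x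
  define P' where "P' x = gauss2 x * cos (s * x) + s\<^sup>2 / 2 * (exp (- x\<^sup>2) * cos (s * x))" for x
  have i1: "integrable lborel (\<lambda>x. gauss2 x * cos (s * x))"
    by (rule Bochner_Integration.integrable_bound [OF gauss_integrals(3)])
      (use borel_measurable_integrable [OF gauss_integrals(3)] in \<open>auto simp: abs_mult mult_left_le\<close>)
  have i2: "integrable lborel (\<lambda>x. exp (- x\<^sup>2) * cos (s * x))"
    by (rule Bochner_Integration.integrable_bound [OF gauss_integrals(1)]) (auto simp: abs_mult mult_left_le)
  have P'i: "integrable lborel P'" unfolding P'_def using i1 i2 by simp
  have b: "norm (P x) \<le> (\<bar>x\<bar> + \<bar>s\<bar>) * exp (- x\<^sup>2)" for x
  proof -
    have "norm (P x) \<le> \<bar>x\<bar> * exp (- x\<^sup>2) * \<bar>cos (s * x)\<bar> + \<bar>s\<bar> / 2 * (exp (- x\<^sup>2) * \<bar>sin (s * x)\<bar>)"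
      unfolding P_def real_norm_def by (rule order_trans [OF abs_triangle_ineq]) (simp add: abs_mult)
    also have "\<dots> \<le> \<bar>x\<bar> * exp (- x\<^sup>2) * 1 + \<bar>s\<bar> * (exp (- x\<^sup>2) * 1)"
      by (intro add_mono mult_mono) auto
    finally show ?thesis by (simp add: algebra_simps)
  qed
  have lim: "(P \<longlongrightarrow> 0) at_top" "(P \<longlongrightarrow> 0) at_bot"
  proof -
    have "((\<lambda>x::real. (\<bar>x\<bar> + \<bar>s\<bar>) * exp (- x\<^sup>2)) \<longlongrightarrow> 0) at_top" by real_asymp
    then show "(P \<longlongrightarrow> 0) at_top" by (rule Lim_null_comparison [rotated]) (use b in simp)
    have "((\<lambda>x::real. (\<bar>x\<bar> + \<bar>s\<bar>) * exp (- x\<^sup>2)) \<longlongrightarrow> 0) at_bot" by real_asymp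
    then show "(P \<longlongrightarrow> 0) at_bot" by (rule Lim_null_comparison [rotated]) (use b in simp)
  qed
  have "(LBINT x=-\<infinity>..\<infinity>. P' x) = 0 - 0"
  proof (rule interval_integral_FTC_integrable [where F = P])
    fix x
    have "(P has_real_derivative P' x) (at x)"
      unfolding P_def P'_def gauss2_def
      by (auto intro!: derivative_eq_intros simp: field_simps power2_eq_square)
    then show "(P has_vector_derivative P' x) (at x)" by (simp add: has_real_derivative_iff_has_vector_derivative)
    show "isCont P' x" unfolding P'_def gauss2_def by (intro continuous_intros)
  next
    show "set_integrable lborel (einterval (- \<infinity>) \<infinity>) P'" using P'i by (simp add: set_integrable_def)
    show "((P \<circ> real_of_ereal) \<longlongrightarrow> 0) (at_right (- \<infinity>))" using lim(2) by (simp add: ereal_tendsto_simps)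
    show "((P \<circ> real_of_ereal) \<longlongrightarrow> 0) (at_left \<infinity>)" using lim(1) by (simp add: ereal_tendsto_simps)
  qed simp
  then have "(LBINT x. P' x) = 0"
    by (simp add: interval_lebesgue_integral_def set_lebesgue_integral_def)
  moreover have "(LBINT x. P' x) = (LBINT x. gauss2 x * cos (s * x)) + s\<^sup>2 / 2 * (LBINT x. exp (- x\<^sup>2) * cos (s * x))"
    unfolding P'_def using i1 i2 by simp
  ultimately show ?thesis unfolding gauss_cos_integral by simp
qed

lemma measurable_frac [measurable]: "frac \<in> borel_measurable (borel :: real measure)"
proof -
  have "(\<lambda>x::real. x - of_int \<lfloor>x\<rfloor>) \<in> borel_measurable borel" by measurable
  moreover have "frac = (\<lambda>x::real. x - of_int \<lfloor>x\<rfloor>)" by (auto simp: frac_def)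
  ultimately show ?thesis by simp
qed

lemma frac_abs_le: "\<bar>frac x\<bar> \<le> 1" for x :: real
  using frac_ge_0 [of x] frac_lt_1 [of x] by simp

lemma smoothed_frac_Fubini:
  assumes G: "integrable lborel G" and C [measurable]: "C \<in> borel_measurable borel"
  shows "(LBINT \<sigma>. gauss2 \<sigma> * (LBINT \<xi>. G \<xi> * frac (C \<xi> + A * \<sigma>))) = (LBINT \<xi>. G \<xi> * smoothed_frac A (C \<xi>))"
proof -
  have [measurable]: "G \<in> borel_measurable borel" "gauss2 \<in> borel_measurable borel"
    using G gauss_integrals(3) by auto
  have b: "\<bar>a * f\<bar> \<le> \<bar>a\<bar>" if "\<bar>f\<bar> \<le> 1" for a f :: real
    using mult_left_mono [OF that, of "\<bar>a\<bar>"] by (simp add: abs_mult)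
  have Gi: "integrable lborel (\<lambda>\<xi>. G \<xi> * frac (C \<xi> + A * \<sigma>))" for \<sigma>
    by (rule Bochner_Integration.integrable_bound [OF G]) (auto intro!: b frac_abs_le)
  have "integrable (lborel \<Otimes>\<^sub>M lborel) (\<lambda>(\<sigma>, \<xi>). gauss2 \<sigma> * (G \<xi> * frac (C \<xi> + A * \<sigma>)))"
  proof (rule lborel_pair.Fubini_integrable)
    show "integrable lborel (\<lambda>x. LBINT y. norm (case (x, y) of (\<sigma>, \<xi>) \<Rightarrow> gauss2 \<sigma> * (G \<xi> * frac (C \<xi> + A * \<sigma>))))"
    proof (rule Bochner_Integration.integrable_bound)
      show "integrable lborel (\<lambda>x. gauss2 x * (LBINT y. \<bar>G y\<bar>))" using gauss_integrals(3) by simp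
      show "AE x in lborel. norm (LBINT y. norm (case (x, y) of (\<sigma>, \<xi>) \<Rightarrow> gauss2 \<sigma> * (G \<xi> * frac (C \<xi> + A * \<sigma>))))
          \<le> norm (gauss2 x * (LBINT y. \<bar>G y\<bar>))"
      proof (rule AE_I2)
        fix x
        have "(LBINT y. \<bar>G y * frac (C y + A * x)\<bar>) \<le> (LBINT y. \<bar>G y\<bar>)"
          by (rule integral_mono) (use G Gi b frac_abs_le in auto)
        then have "\<bar>gauss2 x\<bar> * (LBINT y. \<bar>G y * frac (C y + A * x)\<bar>) \<le> \<bar>gauss2 x\<bar> * (LBINT y. \<bar>G y\<bar>)"
          by (intro mult_left_mono) auto
        moreover have "0 \<le> (LBINT y. \<bar>G y\<bar>)" "0 \<le> (LBINT y. \<bar>G y * frac (C y + A * x)\<bar>)" by auto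
        ultimately show "norm (LBINT y. norm (case (x, y) of (\<sigma>, \<xi>) \<Rightarrow> gauss2 \<sigma> * (G \<xi> * frac (C \<xi> + A * \<sigma>))))
          \<le> norm (gauss2 x * (LBINT y. \<bar>G y\<bar>))" by (simp add: abs_mult)
      qed
    qed (measurable)
    show "AE x in lborel. integrable lborel (\<lambda>y. case (x, y) of (\<sigma>, \<xi>) \<Rightarrow> gauss2 \<sigma> * (G \<xi> * frac (C \<xi> + A * \<sigma>)))"
      using Gi by simp
  qed measurable
  then have "(LBINT \<xi>. LBINT \<sigma>. gauss2 \<sigma> * (G \<xi> * frac (C \<xi> + A * \<sigma>))) = (LBINT \<sigma>. LBINT \<xi>. gauss2 \<sigma> * (G \<xi> * frac (C \<xi> + A * \<sigma>)))"
    by (rule lborel_pair.Fubini_integral)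
  moreover have "(LBINT \<sigma>. gauss2 \<sigma> * (G \<xi> * frac (C \<xi> + A * \<sigma>))) = G \<xi> * smoothed_frac A (C \<xi>)" for \<xi>
    unfolding smoothed_frac_def by (subst integral_mult_right_zero [symmetric]) (simp add: mult_ac)
  ultimately show ?thesis by simp
qed

lemma smoothed_frac_periodic: "smoothed_frac A (w + 1) = smoothed_frac A w"
proof -
  have "frac (w + 1 + A * \<sigma>) = frac (w + A * \<sigma>)" for \<sigma>
    using frac_add_one [of "w + A * \<sigma>"] by (simp add: algebra_simps)
  then show ?thesis by (simp add: smoothed_frac_def)
qed

text \<open>Dominated convergence: for given w the integrand jumps only where w + A * \<sigma> is an
  integer, a countable set because A is nonzero.\<close>

lemma smoothed_frac_continuous:
  assumes A: "A > 0"
  shows "continuous_on UNIV (smoothed_frac A)"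
proof (intro continuous_at_imp_continuous_on ballI continuous_at_sequentiallyI)
  fix w :: real and u assume u: "u \<longlonglongrightarrow> w"
  have [measurable]: "gauss2 \<in> borel_measurable borel" using gauss_integrals(3) by auto
  have "countable {\<sigma>. w + A * \<sigma> \<in> \<int>}"
  proof -
    have "{\<sigma>. w + A * \<sigma> \<in> \<int>} \<subseteq> (\<lambda>x. (x - w) / A) ` \<int>"
    proof
      fix \<sigma> assume "\<sigma> \<in> {\<sigma>. w + A * \<sigma> \<in> \<int>}"
      then have "\<sigma> = (\<lambda>x. (x - w) / A) (w + A * \<sigma>)" "w + A * \<sigma> \<in> \<int>" using A by auto
      then show "\<sigma> \<in> (\<lambda>x. (x - w) / A) ` \<int>" by blast
    qed
    moreover have "countable (\<int> :: real set)" by (simp add: Ints_def)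
    ultimately show ?thesis by (meson countable_image countable_subset)
  qed
  then have ae: "AE \<sigma> in lborel. \<sigma> \<notin> {\<sigma>. w + A * \<sigma> \<in> \<int>}" by (intro AE_not_in countable_imp_null_set_lborel)
  show "(\<lambda>n. smoothed_frac A (u n)) \<longlonglongrightarrow> smoothed_frac A w"
    unfolding smoothed_frac_def
  proof (rule integral_dominated_convergence [where w = "\<lambda>\<sigma>. \<bar>gauss2 \<sigma>\<bar>"])
    show "AE \<sigma> in lborel. (\<lambda>n. gauss2 \<sigma> * frac (u n + A * \<sigma>)) \<longlonglongrightarrow> gauss2 \<sigma> * frac (w + A * \<sigma>)"
      using ae
    proof eventually_elim
      case (elim \<sigma>)
      then have "isCont frac (w + A * \<sigma>)" using continuous_frac by auto
      moreover have "(\<lambda>n. u n + A * \<sigma>) \<longlonglongrightarrow> w + A * \<sigma>" by (intro tendsto_intros u)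
      ultimately have "(\<lambda>n. frac (u n + A * \<sigma>)) \<longlonglongrightarrow> frac (w + A * \<sigma>)" by (rule isCont_tendsto_compose)
      then show ?case by (rule tendsto_mult_left)
    qed
    show "AE \<sigma> in lborel. norm (gauss2 \<sigma> * frac (u n + A * \<sigma>)) \<le> \<bar>gauss2 \<sigma>\<bar>" for n
      by (auto simp: abs_mult less_imp_le [OF frac_lt_1] intro!: AE_I2 mult_right_le_one_le)
  qed (use gauss_integrals(3) in auto)
qed

lemma frac_cos_integral:
  "((\<lambda>w. frac (w + y) * cos (2 * pi * w + \<theta>)) has_integral (sin (\<theta> - 2 * pi * y) / (2 * pi))) {0..1::real}"
  "((\<lambda>w. frac (w + y)) has_integral (1 / 2)) {0..1::real}"
proof -
  define f where "f = frac y"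
  have f: "0 \<le> f" "f < 1" unfolding f_def using frac_ge_0 frac_lt_1 by auto
  have fr1: "frac (w + y) = w + f" if "0 \<le> w" "w < 1 - f" for w
  proof -
    have "\<lfloor>w + y\<rfloor> = \<lfloor>y\<rfloor>" using that f unfolding f_def frac_def by (intro floor_unique) linarith+
    then show ?thesis by (simp add: frac_def f_def)
  qed
  have fr2: "frac (w + y) = w + f - 1" if "1 - f \<le> w" "w \<le> 1" for w
  proof -
    have "real_of_int (\<lfloor>y\<rfloor> + 1) = of_int \<lfloor>y\<rfloor> + 1" by simp
    then have "\<lfloor>w + y\<rfloor> = \<lfloor>y\<rfloor> + 1" using that f unfolding f_def frac_def
      by (intro floor_unique) linarith+
    then show ?thesis by (simp add: frac_def f_def)
  qed
  \<comment> \<open>On {0..1} the only jump is at 1 - f. The functions \<open>P\<close> and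
    \<open>R\<close> are primitives on the two pieces, and both claims follow from this one
    splitting.\<close>
  have gen: "((\<lambda>w. frac (w + y) * \<omega> w) has_integral ((P (1 - f) - P 0) + (R 1 - R (1 - f)))) {0..1}"
    if P: "\<And>w. (P has_real_derivative (w + f) * \<omega> w) (at w)" and R: "\<And>w. (R has_real_derivative (w + f - 1) * \<omega> w) (at w)" for P R \<omega>
  proof (rule Henstock_Kurzweil_Integration.has_integral_combine [where c = "1 - f"])
    have "((\<lambda>w. (w + f) * \<omega> w) has_integral (P (1 - f) - P 0)) {0..1 - f}"
      by (rule fundamental_theorem_of_calculus) (use f P in \<open>auto simp: has_real_derivative_iff_has_vector_derivative [symmetric] intro: has_field_derivative_at_within\<close>)
    then show "((\<lambda>w. frac (w + y) * \<omega> w) has_integral (P (1 - f) - P 0)) {0..1 - f}"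
      by (rule has_integral_spike_finite [of "{1 - f}", rotated 2]) (use fr1 in auto)
    have "((\<lambda>w. (w + f - 1) * \<omega> w) has_integral (R 1 - R (1 - f))) {1 - f..1}"
      by (rule fundamental_theorem_of_calculus) (use f R in \<open>auto simp: has_real_derivative_iff_has_vector_derivative [symmetric] intro: has_field_derivative_at_within\<close>)
    then show "((\<lambda>w. frac (w + y) * \<omega> w) has_integral (R 1 - R (1 - f))) {1 - f..1}"
      by (rule has_integral_eq [rotated]) (use fr2 in auto)
  qed (use f in auto)
  define P where "P e w = (w + e) * sin (2 * pi * w + \<theta>) / (2 * pi) + cos (2 * pi * w + \<theta>) / (2 * pi)\<^sup>2" for e w
  have dP: "(P e has_real_derivative (w + e) * cos (2 * pi * w + \<theta>)) (at w)" for e w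
    unfolding P_def by (auto intro!: derivative_eq_intros simp: field_simps power2_eq_square)
  have e1: "2 * pi * 1 + \<theta> = \<theta> + 2 * pi" by simp
  have e2: "2 * pi * (1 - f) + \<theta> = (\<theta> - 2 * pi * f) + 2 * pi" by (simp add: algebra_simps)
  have "sin (\<theta> - 2 * pi * y) = sin (\<theta> - 2 * pi * f)"
  proof -
    have e: "\<theta> - 2 * pi * f = (\<theta> - 2 * pi * y) + 2 * pi * of_int \<lfloor>y\<rfloor>" by (simp add: f_def frac_def algebra_simps)
    have "sin (x + 2 * pi * of_int i) = sin x" for x and i :: int
      by (simp add: sin_add sin_int_2pin cos_int_2pin)
    then show ?thesis unfolding e by simp
  qed
  then have "(P f (1 - f) - P f 0) + (P (f - 1) 1 - P (f - 1) (1 - f)) = sin (\<theta> - 2 * pi * y) / (2 * pi)"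
    unfolding P_def e1 e2 sin_periodic cos_periodic by (simp add: field_simps)
  then show "((\<lambda>w. frac (w + y) * cos (2 * pi * w + \<theta>)) has_integral (sin (\<theta> - 2 * pi * y) / (2 * pi))) {0..1}"
    using gen [of "P f" "\<lambda>w. cos (2 * pi * w + \<theta>)" "P (f - 1)"] dP [of f] dP [of "f - 1"] by (simp add: add_diff_eq)
  define N where "N e w = (w + e)\<^sup>2 / 2" for e w :: real
  have dN: "(N e has_real_derivative (w + e) * 1) (at w)" for e w
    unfolding N_def by (auto intro!: derivative_eq_intros)
  have v: "(N f (1 - f) - N f 0) + (N (f - 1) 1 - N (f - 1) (1 - f)) = 1 / 2"
    by (simp add: N_def power2_eq_square field_simps)
  have "((\<lambda>w. frac (w + y) * 1) has_integral ((N f (1 - f) - N f 0) + (N (f - 1) 1 - N (f - 1) (1 - f)))) {0..1}"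
    by (rule gen) (use dN [of f] dN [of "f - 1"] in \<open>simp_all add: add_diff_eq\<close>)
  then show "((\<lambda>w. frac (w + y)) has_integral (1 / 2)) {0..1}" unfolding v by simp
qed

text \<open>Fubini with the weight on one period as density: means of the smoothed function reduce
  to means of translates of \<open>frac\<close>, which are elementary.\<close>

lemma smoothed_frac_weighted_mean:
  fixes \<omega> :: "real \<Rightarrow> real"
  assumes A: "A > 0" and \<omega>: "continuous_on UNIV \<omega>" "\<And>w. \<bar>\<omega> w\<bar> \<le> 1"
    and I: "\<And>y. ((\<lambda>w. frac (w + y) * \<omega> w) has_integral I y) {0..1}"
  shows "integral {0..1} (\<lambda>w. smoothed_frac A w * \<omega> w) = (LBINT \<sigma>. gauss2 \<sigma> * I (A * \<sigma>))"
proof -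
  have [measurable]: "\<omega> \<in> borel_measurable borel" using \<omega>(1) by (rule borel_measurable_continuous_onI)
  have Gi: "integrable lborel (\<lambda>w. indicator {0..1} w * \<omega> w)"
    using borel_integrable_compact [of "{0..1}" \<omega>] continuous_on_subset [OF \<omega>(1)] by simp
  have b: "\<bar>a * f\<bar> \<le> \<bar>a\<bar>" if "\<bar>f\<bar> \<le> 1" for a f :: real
    using mult_left_mono [OF that, of "\<bar>a\<bar>"] by (simp add: abs_mult)
  have e: "(LBINT w. indicator {0..1} w * \<omega> w * frac (w + A * \<sigma>)) = I (A * \<sigma>)" for \<sigma>
  proof -
    have "set_integrable lborel {0..1} (\<lambda>w. frac (w + A * \<sigma>) * \<omega> w)"
      unfolding set_integrable_def
      by (rule Bochner_Integration.integrable_bound [OF Gi]) (auto simp: indicator_def abs_mult less_imp_le [OF frac_lt_1] intro!: AE_I2 mult_left_le_one_le)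
    then have "(LBINT w:{0..1}. frac (w + A * \<sigma>) * \<omega> w) = integral {0..1} (\<lambda>w. frac (w + A * \<sigma>) * \<omega> w)"
      by (rule set_borel_integral_eq_integral(2))
    also have "\<dots> = I (A * \<sigma>)" using I by (rule integral_unique)
    finally show ?thesis by (simp add: set_lebesgue_integral_def mult_ac)
  qed
  have "set_integrable lborel {0..1} (\<lambda>w. smoothed_frac A w * \<omega> w)"
    unfolding set_integrable_def
    by (rule borel_integrable_compact)
      (auto intro!: continuous_intros continuous_on_subset [OF smoothed_frac_continuous [OF A]] continuous_on_subset [OF \<omega>(1)])
  then have "integral {0..1} (\<lambda>w. smoothed_frac A w * \<omega> w) = (LBINT w:{0..1}. smoothed_frac A w * \<omega> w)"
    by (rule set_borel_integral_eq_integral(2) [symmetric])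
  also have "\<dots> = (LBINT w. indicator {0..1} w * \<omega> w * smoothed_frac A w)"
    by (simp add: set_lebesgue_integral_def mult_ac)
  also have "\<dots> = (LBINT \<sigma>. gauss2 \<sigma> * I (A * \<sigma>))"
    using smoothed_frac_Fubini [OF Gi, of "\<lambda>w. w" A] by (simp add: e)
  finally show ?thesis .
qed

lemma smoothed_frac_mean: "A > 0 \<Longrightarrow> integral {0..1} (smoothed_frac A) = 0"
  using smoothed_frac_weighted_mean [of A "\<lambda>_. 1" "\<lambda>_. 1 / 2"] frac_cos_integral(2) gauss_integrals(4)
  by simp

text \<open>The first Fourier coefficient is that of \<open>frac\<close> times the transform of
  \<open>gauss2\<close> at 2 * pi * A, and both factors are nonzero.\<close>

lemma smoothed_frac_nonzero:
  assumes A: "A > 0"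
  obtains w where "smoothed_frac A w \<noteq> 0"
proof (rule ccontr)
  assume "\<not> thesis"
  then have z: "smoothed_frac A w = 0" for w using that by blast
  have "integral {0..1} (\<lambda>w. smoothed_frac A w * cos (2 * pi * w + pi / 2))
      = (LBINT \<sigma>. gauss2 \<sigma> * (sin (pi / 2 - 2 * pi * (A * \<sigma>)) / (2 * pi)))"
    by (rule smoothed_frac_weighted_mean [OF A]) (auto intro!: continuous_intros frac_cos_integral(1))
  moreover have "sin (pi / 2 - 2 * pi * (A * \<sigma>)) = cos ((2 * pi * A) * \<sigma>)" for \<sigma>
    by (simp add: sin_diff mult.assoc)
  ultimately have "(LBINT \<sigma>. gauss2 \<sigma> * (cos ((2 * pi * A) * \<sigma>) / (2 * pi))) = 0" by (simp add: z)
  then have "(LBINT \<sigma>. gauss2 \<sigma> * cos ((2 * pi * A) * \<sigma>)) = 0" by simp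
  then show False unfolding gauss2_cos_integral using A by simp
qed

subsection \<open>Smooth steps\<close>

text \<open>Membership in a class closed under differentiation is inherited by all iterated
  derivatives, so smoothness needs no formula for them.\<close>

lemma smooth_on_closed_class:
  assumes C: "\<And>f. f \<in> C \<Longrightarrow> \<exists>f'\<in>C. \<forall>x. (f has_real_derivative f' x) (at x)" and f: "f \<in> C"
  shows "smooth_on UNIV f"
proof -
  have "(deriv ^^ n) f \<in> C" for n
  proof (induction n)
    case (Suc n)
    then obtain f' where f': "f' \<in> C" "\<And>x. ((deriv ^^ n) f has_real_derivative f' x) (at x)" using C by blast
    then have "deriv ((deriv ^^ n) f) = f'" using DERIV_imp_deriv by blast
    with f' show ?case by simp
  qed (use f in simp)
  moreover have "h differentiable_on UNIV" if "h \<in> C" for h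
    using C [OF that] by (auto simp: differentiable_on_def real_differentiable_def)
  ultimately show ?thesis by (simp add: smooth_on_def)
qed

text \<open>The classical bump on the unit interval, with rational prefactors that serve to close
  the family under differentiation.\<close>

definition bump :: "real poly \<Rightarrow> nat \<Rightarrow> real \<Rightarrow> real" where
  "bump p k x = (if 0 < x \<and> x < 1 then poly p x / (x * (1 - x)) ^ k * exp (- (1 / (x * (1 - x)))) else 0)"

lemma exp_minus_inverse_le:
  fixes r :: real
  assumes "r > 0"
  shows "exp (- (1 / r)) \<le> fact n * r ^ n"
proof -
  have "(1 / r) ^ n / fact n \<le> exp (1 / r)"
  proof -
    have "(\<lambda>m. (1 / r) ^ m /\<^sub>R fact m) sums exp (1 / r)" by (rule exp_converges)
    then have "sum (\<lambda>m. (1 / r) ^ m /\<^sub>R fact m) {n} \<le> exp (1 / r)"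
      by (metis (no_types, lifting) assms sums_unique sums_summable sum_le_suminf finite.emptyI finite.insertI
          divide_nonneg_nonneg fact_ge_zero less_imp_le scaleR_nonneg_nonneg zero_le_one zero_le_power
          inverse_nonnegative_iff_nonnegative)
    then show ?thesis by (simp add: divide_inverse mult.commute)
  qed
  then have "1 / exp (1 / r) \<le> 1 / ((1 / r) ^ n / fact n)"
    using assms by (intro divide_left_mono mult_pos_pos divide_pos_pos) auto
  then show ?thesis using assms by (simp add: exp_minus power_one_over field_simps)
qed

text \<open>The exponential beats any power of x * (1 - x), which in turn is at most the distance to
  any point outside the open interval. Vanishing to second order gives derivative 0 there, the end
  points included.\<close>

lemma bump_quadratic:
  "\<exists>C. \<forall>x x0. \<not> (0 < x0 \<and> x0 < 1) \<longrightarrow> \<bar>bump p k x\<bar> \<le> C * (x - x0)\<^sup>2"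
proof -
  have "compact (poly p ` {0..1})" by (intro compact_continuous_image continuous_on_poly continuous_on_id) auto
  then obtain B where B: "\<And>x. x \<in> {0..1} \<Longrightarrow> \<bar>poly p x\<bar> \<le> B" by (force simp: bounded_iff dest!: compact_imp_bounded)
  have B0: "B \<ge> 0" using B [of 0] by force
  show ?thesis
  proof (intro exI [of _ "B * fact (k + 2)"] allI impI)
    fix x x0 :: real assume x0: "\<not> (0 < x0 \<and> x0 < 1)"
    show "\<bar>bump p k x\<bar> \<le> B * fact (k + 2) * (x - x0)\<^sup>2"
    proof (cases "0 < x \<and> x < 1")
      case True
      define r where "r = x * (1 - x)"
      have r: "r > 0" using True by (simp add: r_def)
      have "r \<le> x * 1" "r \<le> 1 * (1 - x)" unfolding r_def using True by (intro mult_left_mono mult_right_mono; simp)+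
      then have "r \<le> \<bar>x - x0\<bar>" using x0 True by auto
      then have "r ^ 2 \<le> \<bar>x - x0\<bar> ^ 2" using r by (intro power_mono) auto
      then have r2: "r\<^sup>2 \<le> (x - x0)\<^sup>2" by simp
      have "\<bar>bump p k x\<bar> = \<bar>poly p x\<bar> * (exp (- (1 / r)) / r ^ k)" using True r by (simp add: bump_def r_def abs_mult)
      also have "\<dots> \<le> B * (fact (k + 2) * r ^ (k + 2) / r ^ k)"
        using B [of x] True r exp_minus_inverse_le [OF r, of "k + 2"] by (intro mult_mono divide_right_mono) auto
      also have "\<dots> = B * fact (k + 2) * r\<^sup>2" using r by (simp add: power_add power2_eq_square)
      also have "\<dots> \<le> B * fact (k + 2) * (x - x0)\<^sup>2" using r2 B0 by (intro mult_left_mono) auto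
      finally show ?thesis .
    next
      case False
      then have "bump p k x = 0" by (auto simp: bump_def)
      moreover have "0 \<le> B * fact (k + 2) * (x - x0)\<^sup>2" using B0 by (intro mult_nonneg_nonneg) auto
      ultimately show ?thesis by simp
    qed
  qed
qed

lemma DERIV_bump: "\<exists>p' k'. \<forall>x. (bump p k has_real_derivative bump p' k' x) (at x)"
proof -
  define R where "R = [:0, 1, -1 :: real:]"
  have R: "poly R x = x * (1 - x)" for x by (simp add: R_def algebra_simps)
  \<comment> \<open>The numerator of the derivative of p * R^(-k) * exp (- 1 / R) over the common
    denominator R^(k + 2).\<close>
  define p' where "p' = pderiv p * R * R - of_nat k * p * pderiv R * R + p * pderiv R"
  have "(bump p k has_real_derivative bump p' (k + 2) x) (at x)" for x
  proof (cases "0 < x \<and> x < 1")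
    case True
    then have r: "poly R x > 0" by (simp add: R)
    have d1: "((\<lambda>x. 1 / poly R x ^ k) has_real_derivative - (real k * poly (pderiv R) x / poly R x ^ (k + 1))) (at x)"
    proof (cases k)
      case (Suc j)
      show ?thesis
        by (rule derivative_eq_intros poly_DERIV refl | use r Suc in \<open>simp add: field_simps power2_eq_square power_add\<close>)+
    qed simp
    have d2: "((\<lambda>x. exp (- (1 / poly R x))) has_real_derivative exp (- (1 / poly R x)) * (poly (pderiv R) x / (poly R x)\<^sup>2)) (at x)"
      by (rule derivative_eq_intros poly_DERIV refl | use r in \<open>simp add: field_simps power2_eq_square\<close>)+
    have "((\<lambda>x. poly p x * ((1 / poly R x ^ k) * exp (- (1 / poly R x)))) has_real_derivative
        poly (pderiv p) x * ((1 / poly R x ^ k) * exp (- (1 / poly R x))) +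
        (- (real k * poly (pderiv R) x / poly R x ^ (k + 1)) * exp (- (1 / poly R x))
          + exp (- (1 / poly R x)) * (poly (pderiv R) x / (poly R x)\<^sup>2) * (1 / poly R x ^ k)) * poly p x) (at x)"
      by (intro DERIV_mult poly_DERIV d1 d2)
    moreover have "\<dots> = \<dots>" by simp
    moreover have "poly (pderiv p) x * ((1 / poly R x ^ k) * exp (- (1 / poly R x))) +
        (- (real k * poly (pderiv R) x / poly R x ^ (k + 1)) * exp (- (1 / poly R x))
          + exp (- (1 / poly R x)) * (poly (pderiv R) x / (poly R x)\<^sup>2) * (1 / poly R x ^ k)) * poly p x = bump p' (k + 2) x"
      using True r by (simp add: bump_def p'_def R [symmetric] field_simps power_add power2_eq_square)
    ultimately have "((\<lambda>x. poly p x * ((1 / poly R x ^ k) * exp (- (1 / poly R x)))) has_real_derivative bump p' (k + 2) x) (at x)" by simp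
    then show ?thesis
      by (rule has_field_derivative_transform_within_open [where S = "{0<..<1}"]) (use True in \<open>auto simp: bump_def R\<close>)
  next
    case False
    obtain C where C: "\<And>y x0. \<not> (0 < x0 \<and> x0 < 1) \<Longrightarrow> \<bar>bump p k y\<bar> \<le> C * (y - x0)\<^sup>2" using bump_quadratic by blast
    have "((\<lambda>h. C * \<bar>h\<bar>) \<longlongrightarrow> C * \<bar>0\<bar>) (at (0::real))" by (intro tendsto_intros)
    then have "((\<lambda>h. C * \<bar>h\<bar>) \<longlongrightarrow> 0) (at (0::real))" by simp
    then have "((\<lambda>h. (bump p k (x + h) - bump p k x) / h) \<longlongrightarrow> 0) (at 0)"
    proof (rule Lim_null_comparison [rotated])
      show "\<forall>\<^sub>F h in at 0. norm ((bump p k (x + h) - bump p k x) / h) \<le> C * \<bar>h\<bar>"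
      proof (rule eventually_at_filter [THEN iffD2], rule always_eventually, intro allI impI)
        fix h :: real assume h: "h \<noteq> 0"
        have "\<bar>bump p k (x + h)\<bar> \<le> C * h\<^sup>2" using C [OF False, of "x + h"] by simp
        then have "\<bar>bump p k (x + h)\<bar> / \<bar>h\<bar> \<le> C * h\<^sup>2 / \<bar>h\<bar>" by (intro divide_right_mono) auto
        also have "\<dots> = C * \<bar>h\<bar>" using h by (simp add: power2_eq_square abs_if)
        moreover have "bump p k x = 0" using False by (auto simp: bump_def)
        ultimately show "norm ((bump p k (x + h) - bump p k x) / h) \<le> C * \<bar>h\<bar>" by (simp add: abs_divide)
      qed
    qed
    moreover have "bump p' (k + 2) x = 0" using False by (auto simp: bump_def)
    ultimately show ?thesis by (simp add: DERIV_def)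
  qed
  then show ?thesis by blast
qed

text \<open>The difference of two normalised primitives of a bump: one rises across the
  \<delta>-neighbourhood of u0, the other on {-2..-1}. The second restores compact support and is
  constant on {0..}, so it does not affect the derivative there.\<close>

lemma smooth_step_exists:
  fixes u0 \<delta> :: real
  assumes d: "0 < \<delta>" "\<delta> < u0"
  shows "\<exists>g. smooth_compact_support g \<and> deriv_approx_delta u0 \<delta> g"
proof -
  define b where "b = bump 1 0"
  have b0: "b x = 0" if "x \<le> 0 \<or> 1 \<le> x" for x using that by (auto simp: b_def bump_def)
  have bnn: "b x \<ge> 0" for x by (auto simp: b_def bump_def)
  have bp: "b x > 0" if "0 < x" "x < 1" for x using that by (simp add: b_def bump_def)
  have "continuous_on UNIV b"
    using DERIV_bump [of 1 0] unfolding b_def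
    by (intro continuous_at_imp_continuous_on ballI) (blast intro: DERIV_isCont)
  then obtain W0 where W0: "\<And>x. (W0 has_real_derivative b x) (at x)" using antiderivative_exists by blast
  define W where "W x = W0 x - W0 0" for x
  have W: "(W has_real_derivative b x) (at x)" for x
    unfolding W_def using W0 by (auto intro!: derivative_eq_intros)
  have Wc: "W x = W y" if b: "\<And>z. min x y \<le> z \<Longrightarrow> z \<le> max x y \<Longrightarrow> b z = 0" for x y
  proof -
    have lt: "W x = W y" if xy: "x < y" and z0: "\<And>z. x \<le> z \<Longrightarrow> z \<le> y \<Longrightarrow> b z = 0" for x y
    proof -
      obtain z where "x < z" "z < y" "W y - W x = (y - x) * b z" using MVT2 [OF xy, of W b] W by auto
      then show ?thesis using z0 [of z] by simp
    qed
    show ?thesis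
    proof (cases x y rule: linorder_cases)
      case less
      then show ?thesis using lt [OF less] b by simp
    next
      case greater
      then show ?thesis using lt [OF greater] b by simp
    qed simp
  qed
  have Wl: "W x = 0" if "x \<le> 0" for x using Wc [of x 0] b0 that by (simp add: W_def)
  define N where "N = W 1"
  have Wr: "W x = N" if "1 \<le> x" for x unfolding N_def using that by (intro Wc) (auto intro: b0)
  have N: "N > 0"
  proof -
    obtain z where "0 < z" "z < 1" "W 1 - W 0 = (1 - 0) * b z" using MVT2 [of 0 1 W b] W by auto
    then show ?thesis using bp [of z] by (simp add: N_def W_def)
  qed
  \<comment> \<open>The affine map with slope \<open>a\<close> and offset \<open>e\<close> carries
    {u0 - \<delta>..u0 + \<delta>} onto {0..1}.\<close>
  define a where "a = 1 / (2 * \<delta>)"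
  define e where "e = (\<delta> - u0) * a"
  have a: "a > 0" using d by (simp add: a_def)
  have e: "e < 0" using d a by (simp add: e_def mult_neg_pos)
  define g where "g \<xi> = (W (a * \<xi> + e) - W (\<xi> + 2)) / N" for \<xi>
  define g' where "g' \<xi> = a / N * b (a * \<xi> + e) + (- (1 / N)) * b (1 * \<xi> + 2)" for \<xi>
  have aff: "((\<lambda>x. h (s * x + t)) has_real_derivative s * h' (s * x + t)) (at x)"
    if "\<And>x. (h has_real_derivative h' x) (at x)" for h h' s t x
  proof -
    have "((\<lambda>x. s * x + t) has_real_derivative s) (at x)" by (auto intro!: derivative_eq_intros)
    from DERIV_chain2 [OF that this] show ?thesis by (simp add: mult.commute)
  qed
  have gD: "(g has_real_derivative g' x) (at x)" for x
    unfolding g_def g'_def using aff [OF W, of a e x] aff [OF W, of 1 2 x] N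
    by (auto intro!: derivative_eq_intros simp: field_simps)
  define Cl where "Cl = {\<lambda>x. k1 * bump p1 n1 (a * x + e) + k2 * bump p2 n2 (1 * x + 2) | k1 p1 n1 k2 p2 n2. True}"
  have "smooth_on UNIV g"
  proof (rule smooth_on_closed_class [where C = "insert g Cl"])
    fix f assume "f \<in> insert g Cl"
    then show "\<exists>f'\<in>insert g Cl. \<forall>x. (f has_real_derivative f' x) (at x)"
    proof
      assume "f = g"
      moreover have "g' \<in> Cl" unfolding Cl_def g'_def [abs_def] b_def by blast
      ultimately show ?thesis using gD by blast
    next
      assume "f \<in> Cl"
      then obtain k1 p1 n1 k2 p2 n2 where f: "f = (\<lambda>x. k1 * bump p1 n1 (a * x + e) + k2 * bump p2 n2 (1 * x + 2))"
        unfolding Cl_def by blast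
      obtain p1' n1' where 1: "\<And>x. (bump p1 n1 has_real_derivative bump p1' n1' x) (at x)" using DERIV_bump by blast
      obtain p2' n2' where 2: "\<And>x. (bump p2 n2 has_real_derivative bump p2' n2' x) (at x)" using DERIV_bump by blast
      have "(f has_real_derivative (k1 * a) * bump p1' n1' (a * x + e) + k2 * bump p2' n2' (1 * x + 2)) (at x)" for x
        unfolding f by (rule DERIV_cong [OF DERIV_add [OF DERIV_cmult [OF aff [OF 1]] DERIV_cmult [OF aff [OF 2]]]]) simp
      moreover have "(\<lambda>x. (k1 * a) * bump p1' n1' (a * x + e) + k2 * bump p2' n2' (1 * x + 2)) \<in> Cl"
        unfolding Cl_def by blast
      ultimately show ?thesis
        by (intro bexI [of _ "\<lambda>x. (k1 * a) * bump p1' n1' (a * x + e) + k2 * bump p2' n2' (1 * x + 2)"]) auto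
    qed
  qed simp
  have dg: "deriv g \<xi> = g' \<xi>" for \<xi> using gD by (rule DERIV_imp_deriv)
  have ax: "a * \<xi> + e = (\<xi> - (u0 - \<delta>)) * a" for \<xi> by (simp add: e_def algebra_simps)
  have hi: "1 \<le> a * \<xi> + e" if "u0 + \<delta> \<le> \<xi>" for \<xi>
  proof -
    have "2 * \<delta> * a \<le> (\<xi> - (u0 - \<delta>)) * a" using that a by (intro mult_right_mono) auto
    then show ?thesis unfolding ax using d by (simp add: a_def)
  qed
  have lo: "a * \<xi> + e \<le> 0" if "\<xi> \<le> u0 - \<delta>" for \<xi>
    unfolding ax using that a by (intro mult_nonpos_nonneg) auto
  have "{x. g x \<noteq> 0} \<subseteq> {-2..u0 + \<delta>}"
  proof
    fix x assume "x \<in> {x. g x \<noteq> 0}"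
    then have x: "g x \<noteq> 0" by simp
    have "\<not> x < -2" using x d Wl [of "a * x + e"] lo [of x] Wl [of "x + 2"] by (auto simp: g_def)
    moreover have "\<not> x > u0 + \<delta>" using x d Wr [of "a * x + e"] hi [of x] Wr [of "x + 2"] by (auto simp: g_def)
    ultimately show "x \<in> {-2..u0 + \<delta>}" by auto
  qed
  then have "bounded {x. g x \<noteq> 0}" by (rule bounded_subset [rotated]) simp
  then have "compact (closure {x. g x \<noteq> 0})" by (simp add: compact_closure)
  with \<open>smooth_on UNIV g\<close> have 1: "smooth_compact_support g" by (simp add: smooth_compact_support_def)
  have g'nn: "g' \<xi> \<ge> 0" if "\<xi> \<ge> 0" for \<xi> using that b0 [of "1 * \<xi> + 2"] a N bnn by (simp add: g'_def)
  have g'0: "g' \<xi> = 0" if "\<xi> \<ge> 0" "\<bar>\<xi> - u0\<bar> \<ge> \<delta>" for \<xi>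
  proof -
    have "b (a * \<xi> + e) = 0" using that hi [of \<xi>] lo [of \<xi>] by (intro b0) linarith
    then show ?thesis using that b0 [of "1 * \<xi> + 2"] by (simp add: g'_def)
  qed
  have cb: "continuous_on UNIV g'"
    unfolding g'_def [abs_def]
    by (intro continuous_intros continuous_on_compose2 [OF \<open>continuous_on UNIV b\<close>]) auto
  have "(LBINT \<xi>:{0..}. g' \<xi>) = (LBINT \<xi>:{0..}. g' \<xi> * indicator {..<u0 + \<delta>} \<xi>)"
    by (rule set_lebesgue_integral_cong) (use g'0 in \<open>auto simp: indicator_def\<close>)
  also have "\<dots> = g (u0 + \<delta>) - g 0" by (rule set_integral_deriv_below(2) [OF gD cb]) (use d in simp)
  also have "\<dots> = 1"
    using Wr [of "a * (u0 + \<delta>) + e"] hi [of "u0 + \<delta>"] Wr [of "u0 + \<delta> + 2"] Wl [of e] e Wr [of 2] N d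
    by (simp add: g_def)
  finally have "deriv_approx_delta u0 \<delta> g"
    unfolding deriv_approx_delta_def dg using g'nn g'0 by auto
  with 1 show ?thesis by blast
qed

lemma smoothed_frac_bounded: "\<exists>B\<ge>0. \<forall>w. \<bar>smoothed_frac A w\<bar> \<le> B"
proof (intro exI [of _ "LBINT \<sigma>. \<bar>gauss2 \<sigma>\<bar>"] conjI allI)
  have [measurable]: "gauss2 \<in> borel_measurable borel" using gauss_integrals(3) by auto
  show "0 \<le> (LBINT \<sigma>. \<bar>gauss2 \<sigma>\<bar>)" by simp
  fix w
  have "integrable lborel (\<lambda>\<sigma>. \<bar>gauss2 \<sigma> * frac (w + A * \<sigma>)\<bar>)"
    by (intro integrable_abs Bochner_Integration.integrable_bound [OF gauss_integrals(3)])
      (auto simp: abs_mult less_imp_le [OF frac_lt_1] intro!: AE_I2 mult_right_le_one_le)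
  then have "(LBINT \<sigma>. \<bar>gauss2 \<sigma> * frac (w + A * \<sigma>)\<bar>) \<le> (LBINT \<sigma>. \<bar>gauss2 \<sigma>\<bar>)"
    by (rule integral_mono) (use gauss_integrals(3) in \<open>auto simp: abs_mult less_imp_le [OF frac_lt_1] intro!: mult_right_le_one_le\<close>)
  then show "\<bar>smoothed_frac A w\<bar> \<le> (LBINT \<sigma>. \<bar>gauss2 \<sigma>\<bar>)"
    unfolding smoothed_frac_def by (rule order_trans [OF integral_abs_bound])
qed

lemma smooth_on_DERIV:
  assumes "smooth_on UNIV g"
  shows "(g has_real_derivative deriv g x) (at x)" "continuous_on UNIV (deriv g)"
proof -
  have d: "(deriv ^^ n) g differentiable_on UNIV" for n using assms by (simp add: smooth_on_def)
  have "g differentiable at x" using d [of 0] by (simp add: differentiable_on_def)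
  then show "(g has_real_derivative deriv g x) (at x)" by (simp add: DERIV_deriv_iff_real_differentiable)
  show "continuous_on UNIV (deriv g)" using d [of 1] by (simp add: differentiable_imp_continuous_on)
qed

section \<open>The periodic function attached to a profile, and its Fourier content\<close>

locale profile_data =
  fixes lam0 :: real and q :: nat and c g :: "real \<Rightarrow> real" and I :: "real set"
  assumes lam: "1 / 2 < lam0" and q: "q > 0" and c: "continuous_on I c"
    and g: "smooth_compact_support g" and sup: "deriv_supported_in I g"
begin

definition "K = closure {\<xi>. 0 \<le> \<xi> \<and> deriv g \<xi> \<noteq> 0}"
text \<open>The offset function means something on \<open>I\<close> only. Cut off outside the
  compact support of the derivative of g, it becomes bounded and measurable on the whole
  line.\<close>

definition "ct \<xi> = indicator K \<xi> * c \<xi>"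
definition "G \<xi> = indicator {0..} \<xi> * deriv g \<xi>"
definition "A = real q / (sqrt 2 * beta lam0)"
definition "off = - A * sqrt 8"
abbreviation "PI \<equiv> Pi_fun lam0 q c g"

lemma A: "A > 0" using q lam by (simp add: A_def beta_def)

lemma gD: "(g has_real_derivative deriv g x) (at x)" "continuous_on UNIV (deriv g)"
  using smooth_on_DERIV [of g] g by (auto simp: smooth_compact_support_def)

lemma K: "compact K" "K \<subseteq> I" "K \<subseteq> {0..}"
proof -
  have "{\<xi>. 0 \<le> \<xi> \<and> deriv g \<xi> \<noteq> 0} \<subseteq> closure {x. g x \<noteq> 0}"
  proof
    fix \<xi> assume "\<xi> \<in> {\<xi>. 0 \<le> \<xi> \<and> deriv g \<xi> \<noteq> 0}"
    then have nz: "deriv g \<xi> \<noteq> 0" by simp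
    show "\<xi> \<in> closure {x. g x \<noteq> 0}"
    proof (rule ccontr)
      assume n: "\<xi> \<notin> closure {x. g x \<noteq> 0}"
      have "(g has_real_derivative 0) (at \<xi>)"
        by (rule has_field_derivative_transform_within_open [where f = "\<lambda>_. 0" and S = "- closure {x. g x \<noteq> 0}"])
          (use n closure_subset [of "{x. g x \<noteq> 0}"] in auto)
      then show False using nz DERIV_imp_deriv by blast
    qed
  qed
  then have "K \<subseteq> closure {x. g x \<noteq> 0}" unfolding K_def by (simp add: closure_minimal)
  moreover have "compact (closure {x. g x \<noteq> 0})" using g by (simp add: smooth_compact_support_def)
  moreover have "closed K" by (simp add: K_def)
  ultimately show "compact K" by (metis compact_Int_closed inf.absorb_iff2)
  show "K \<subseteq> I" using sup by (simp add: K_def deriv_supported_in_def)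
  have "closed {0::real..}" by simp
  then show "K \<subseteq> {0..}" unfolding K_def by (intro closure_minimal) auto
qed

lemma G_nonzero: "G \<xi> \<noteq> 0 \<Longrightarrow> \<xi> \<in> K \<and> 0 \<le> \<xi>"
  using closure_subset [of "{\<xi>. 0 \<le> \<xi> \<and> deriv g \<xi> \<noteq> 0}"] by (auto simp: G_def K_def indicator_def split: if_splits)

lemma G_integrable: "integrable lborel G"
proof -
  obtain B where B: "\<And>x. x \<in> K \<Longrightarrow> \<bar>x\<bar> \<le> B" using compact_imp_bounded [OF K(1)] by (auto simp: bounded_iff)
  have "integrable lborel (\<lambda>\<xi>. indicator {0..B} \<xi> *\<^sub>R deriv g \<xi>)"
    by (rule borel_integrable_compact) (use continuous_on_subset [OF gD(2)] in auto)
  moreover have "(\<lambda>\<xi>. indicator {0..B} \<xi> *\<^sub>R deriv g \<xi>) = G"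
  proof
    fix \<xi>
    show "indicator {0..B} \<xi> *\<^sub>R deriv g \<xi> = G \<xi>"
    proof (cases "G \<xi> = 0")
      case True
      then show ?thesis by (auto simp: G_def indicator_def split: if_splits)
    next
      case False
      then have "0 \<le> \<xi>" "\<xi> \<le> B" using G_nonzero [OF False] B [of \<xi>] by auto
      then show ?thesis by (simp add: G_def)
    qed
  qed
  ultimately show ?thesis by simp
qed

lemma G_measurable [measurable]: "G \<in> borel_measurable borel"
  using G_integrable by auto

lemma ct_measurable [measurable]: "ct \<in> borel_measurable borel"
proof -
  have "(\<lambda>x. indicator K x *\<^sub>R c x) \<in> borel_measurable borel"
    by (rule borel_measurable_continuous_on_indicator)
      (use borel_closed [OF compact_imp_closed [OF K(1)]] continuous_on_subset [OF c K(2)] in auto)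
  then show ?thesis by (simp add: ct_def [abs_def])
qed

lemma ct_bounded: "\<exists>B\<ge>0. \<forall>\<xi>. \<bar>ct \<xi>\<bar> \<le> B"
proof -
  have "compact (c ` K)" by (intro compact_continuous_image K continuous_on_subset [OF c])
  then obtain B where B: "\<And>x. x \<in> K \<Longrightarrow> \<bar>c x\<bar> \<le> B" using compact_imp_bounded by (force simp: bounded_iff)
  have "\<bar>ct \<xi>\<bar> \<le> \<bar>B\<bar>" for \<xi> using B [of \<xi>] by (auto simp: ct_def indicator_def)
  then show ?thesis by (intro exI [of _ "\<bar>B\<bar>"]) auto
qed

text \<open>Where the density vanishes the value of c does not matter, so \<open>ct\<close> may
  replace it; Fubini then moves the Gaussian weight onto the fractional part.\<close>

lemma PI_eq: "PI z = (LBINT \<xi>. G \<xi> * smoothed_frac A (real q * ct \<xi> + (z + off)))"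
proof -
  have "pi_fun lam0 q c g \<sigma> z = (LBINT \<xi>. G \<xi> * frac ((real q * ct \<xi> + (z + off)) + A * \<sigma>))" for \<sigma>
    unfolding pi_fun_def set_lebesgue_integral_def
  proof (rule Bochner_Integration.integral_cong [OF refl])
    fix \<xi>
    show "indicator {0..} \<xi> *\<^sub>R (deriv g \<xi> * frac (real q * c \<xi> + z + real q * (\<sigma> - sqrt 8) / (sqrt 2 * beta lam0)))
       = G \<xi> * frac ((real q * ct \<xi> + (z + off)) + A * \<sigma>)"
    proof (cases "G \<xi> = 0")
      case True
      then show ?thesis by (auto simp: G_def indicator_def split: if_splits)
    next
      case False
      then have "ct \<xi> = c \<xi>" using G_nonzero [OF False] by (simp add: ct_def)
      moreover have "real q * (\<sigma> - sqrt 8) / (sqrt 2 * beta lam0) = off + A * \<sigma>"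
        by (simp add: off_def A_def right_diff_distrib diff_divide_distrib)
      ultimately show ?thesis by (simp add: G_def add.assoc)
    qed
  qed
  then have "PI z = (LBINT \<sigma>. gauss2 \<sigma> * (LBINT \<xi>. G \<xi> * frac ((real q * ct \<xi> + (z + off)) + A * \<sigma>)))"
    by (simp add: Pi_fun_def gauss2_def)
  also have "\<dots> = (LBINT \<xi>. G \<xi> * smoothed_frac A (real q * ct \<xi> + (z + off)))"
    by (rule smoothed_frac_Fubini [OF G_integrable]) measurable
  finally show ?thesis .
qed

lemma smoothed_measurable [measurable]: "smoothed_frac A \<in> borel_measurable borel"
  using smoothed_frac_continuous [OF A] by (rule borel_measurable_continuous_onI)

lemma PI_integrable: "integrable lborel (\<lambda>\<xi>. G \<xi> * smoothed_frac A (real q * ct \<xi> + z))"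
proof -
  obtain B where B: "B \<ge> 0" "\<And>w. \<bar>smoothed_frac A w\<bar> \<le> B" using smoothed_frac_bounded by blast
  have "integrable lborel (\<lambda>\<xi>. B * G \<xi>)" using G_integrable by simp
  then show ?thesis
  proof (rule Bochner_Integration.integrable_bound)
    show "AE \<xi> in lborel. norm (G \<xi> * smoothed_frac A (real q * ct \<xi> + z)) \<le> norm (B * G \<xi>)"
    proof (rule AE_I2)
      fix \<xi>
      show "norm (G \<xi> * smoothed_frac A (real q * ct \<xi> + z)) \<le> norm (B * G \<xi>)"
        using mult_left_mono [OF B(2) [of "real q * ct \<xi> + z"], of "\<bar>G \<xi>\<bar>"] B(1) by (simp add: abs_mult mult.commute)
    qed
  qed measurable
qed

lemma PI_bounded: "\<exists>B\<ge>0. \<forall>z. \<bar>PI z\<bar> \<le> B"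
proof -
  obtain B where B: "B \<ge> 0" "\<And>w. \<bar>smoothed_frac A w\<bar> \<le> B" using smoothed_frac_bounded by blast
  have "\<bar>PI z\<bar> \<le> (LBINT \<xi>. \<bar>G \<xi>\<bar> * B)" for z
    unfolding PI_eq
  proof (rule order_trans [OF integral_abs_bound], rule integral_mono)
    show "integrable lborel (\<lambda>\<xi>. \<bar>G \<xi> * smoothed_frac A (real q * ct \<xi> + (z + off))\<bar>)" using PI_integrable by (rule integrable_abs)
    show "integrable lborel (\<lambda>\<xi>. \<bar>G \<xi>\<bar> * B)" using G_integrable by simp
    show "\<bar>G \<xi> * smoothed_frac A (real q * ct \<xi> + (z + off))\<bar> \<le> \<bar>G \<xi>\<bar> * B" for \<xi>
      unfolding abs_mult by (intro mult_left_mono B) auto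
  qed
  then show ?thesis using B(1) by (intro exI [of _ "LBINT \<xi>. \<bar>G \<xi>\<bar> * B"]) auto
qed

lemma PI_periodic: "PI (z + 1) = PI z"
proof -
  have "smoothed_frac A (x + (z + 1 + off)) = smoothed_frac A (x + (z + off))" for x
    using smoothed_frac_periodic [of A "x + (z + off)"] by (simp add: algebra_simps)
  then show ?thesis by (simp only: PI_eq)
qed

lemma PI_continuous: "continuous_on UNIV PI"
proof (intro continuous_at_imp_continuous_on ballI continuous_at_sequentiallyI)
  fix z :: real and u assume u: "u \<longlonglongrightarrow> z"
  obtain B where B: "B \<ge> 0" "\<And>w. \<bar>smoothed_frac A w\<bar> \<le> B" using smoothed_frac_bounded by blast
  show "(\<lambda>n. PI (u n)) \<longlonglongrightarrow> PI z"
    unfolding PI_eq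
  proof (rule integral_dominated_convergence [where w = "\<lambda>\<xi>. \<bar>G \<xi>\<bar> * B"])
    show "AE \<xi> in lborel. (\<lambda>n. G \<xi> * smoothed_frac A (real q * ct \<xi> + (u n + off))) \<longlonglongrightarrow> G \<xi> * smoothed_frac A (real q * ct \<xi> + (z + off))"
    proof (rule AE_I2, rule tendsto_mult_left)
      fix \<xi>
      have "isCont (smoothed_frac A) (real q * ct \<xi> + (z + off))"
        using smoothed_frac_continuous [OF A] by (simp add: continuous_on_eq_continuous_at)
      moreover have "(\<lambda>n. real q * ct \<xi> + (u n + off)) \<longlonglongrightarrow> real q * ct \<xi> + (z + off)" by (intro tendsto_intros u)
      ultimately show "(\<lambda>n. smoothed_frac A (real q * ct \<xi> + (u n + off))) \<longlonglongrightarrow> smoothed_frac A (real q * ct \<xi> + (z + off))"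
        by (rule isCont_tendsto_compose)
    qed
    show "AE \<xi> in lborel. norm (G \<xi> * smoothed_frac A (real q * ct \<xi> + (u n + off))) \<le> \<bar>G \<xi>\<bar> * B" for n
      by (rule AE_I2) (simp add: abs_mult mult_left_mono B)
    show "integrable lborel (\<lambda>\<xi>. \<bar>G \<xi>\<bar> * B)" using G_integrable by simp
  qed measurable
qed

text \<open>By \<open>PI_eq\<close>, \<open>Pi_fun\<close> integrates \<open>G\<close> against a
  continuous periodic function of mean zero along q * ct. If all nonzero frequencies of that density
  vanished, so would every such integral; the shift by z only enters the phase.\<close>

lemma nonzero_frequency:
  assumes "PI z \<noteq> 0"
  shows "\<exists>k>0. \<exists>\<theta>. (LBINT \<xi>. G \<xi> * sin (2 * pi * real (k * q) * ct \<xi> + \<theta>)) \<noteq> 0"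
proof (rule ccontr)
  assume n: "\<not> ?thesis"
  have n0: "(LBINT \<xi>. G \<xi> * sin (2 * pi * real (k * q) * ct \<xi> + \<theta>)) = 0" if "k > 0" for k \<theta>
    using n that by blast
  have "PI z = 0" unfolding PI_eq
  proof (rule integral_periodic_eq_mean [where f = "smoothed_frac A" and C = "\<lambda>\<xi>. real q * ct \<xi> + (z + off)", OF G_integrable])
    fix k :: nat and \<theta> :: real assume k: "k > 0"
    have "cos (2 * pi * real k * (real q * ct \<xi> + (z + off)) + \<theta>)
       = sin (2 * pi * real (k * q) * ct \<xi> + (2 * pi * real k * (z + off) + \<theta> + pi / 2))" (is "?l \<xi> = ?r \<xi>") for \<xi>
    proof -
      have e: "2 * pi * real (k * q) * ct \<xi> + (2 * pi * real k * (z + off) + \<theta> + pi / 2)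
         = (2 * pi * real k * (real q * ct \<xi> + (z + off)) + \<theta>) + pi / 2" by (simp add: algebra_simps)
      show ?thesis unfolding e by (simp add: sin_add)
    qed
    then show "(LBINT \<xi>. G \<xi> * cos (2 * pi * real k * (real q * ct \<xi> + (z + off)) + \<theta>)) = 0" by (simp only: n0 [OF k])
  qed (use smoothed_frac_continuous [OF A] smoothed_frac_periodic smoothed_frac_mean [OF A] in \<open>auto\<close>)
  with assms show False by simp
qed

text \<open>The density has unit mass near u0, where the smoothed function changes by at most half
  of its value at w; its average cannot vanish.\<close>

lemma nonzero_of_approx_delta:
  assumes d: "deriv_approx_delta u0 \<delta> g"
    and close: "\<And>\<xi>. \<bar>\<xi> - u0\<bar> < \<delta> \<Longrightarrow> \<bar>smoothed_frac A (real q * c \<xi> - real q * c u0 + w) - smoothed_frac A w\<bar> \<le> \<bar>smoothed_frac A w\<bar> / 2"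
    and w: "smoothed_frac A w \<noteq> 0"
  shows "\<exists>z. PI z \<noteq> 0"
proof -
  \<comment> \<open>Chosen so that the argument of \<open>smoothed_frac\<close> equals w at \<xi> =
    u0.\<close>
  define z where "z = w - real q * c u0 - off"
  have G1: "(LBINT \<xi>. G \<xi>) = 1"
    using d by (simp add: deriv_approx_delta_def set_lebesgue_integral_def G_def)
  have G0: "0 \<le> G \<xi>" for \<xi> using d by (auto simp: deriv_approx_delta_def G_def indicator_def)
  have "\<bar>PI z - smoothed_frac A w\<bar> = \<bar>(LBINT \<xi>. G \<xi> * smoothed_frac A (real q * ct \<xi> + (z + off))) - (LBINT \<xi>. G \<xi> * smoothed_frac A w)\<bar>"
    using G1 by (simp add: PI_eq)
  also have "\<dots> = \<bar>LBINT \<xi>. G \<xi> * smoothed_frac A (real q * ct \<xi> + (z + off)) - G \<xi> * smoothed_frac A w\<bar>"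
    by (subst Bochner_Integration.integral_diff [OF PI_integrable]) (use G_integrable in auto)
  also have "\<dots> \<le> (LBINT \<xi>. G \<xi> * (\<bar>smoothed_frac A w\<bar> / 2))"
  proof (rule order_trans [OF integral_abs_bound], rule integral_mono)
    show "integrable lborel (\<lambda>\<xi>. \<bar>G \<xi> * smoothed_frac A (real q * ct \<xi> + (z + off)) - G \<xi> * smoothed_frac A w\<bar>)"
      by (intro integrable_abs Bochner_Integration.integrable_diff PI_integrable) (use G_integrable in auto)
    show "integrable lborel (\<lambda>\<xi>. G \<xi> * (\<bar>smoothed_frac A w\<bar> / 2))" using G_integrable by simp
    fix \<xi>
    show "\<bar>G \<xi> * smoothed_frac A (real q * ct \<xi> + (z + off)) - G \<xi> * smoothed_frac A w\<bar> \<le> G \<xi> * (\<bar>smoothed_frac A w\<bar> / 2)"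
    proof (cases "G \<xi> = 0")
      case False
      have k: "\<xi> \<in> K" "0 \<le> \<xi>" using G_nonzero [OF False] by auto
      have "deriv g \<xi> \<noteq> 0" using False by (auto simp: G_def)
      then have "\<bar>\<xi> - u0\<bar> < \<delta>" using d k by (force simp: deriv_approx_delta_def)
      from close [OF this] have "\<bar>smoothed_frac A (real q * ct \<xi> + (z + off)) - smoothed_frac A w\<bar> \<le> \<bar>smoothed_frac A w\<bar> / 2"
        using k by (simp add: ct_def z_def algebra_simps)
      from mult_left_mono [OF this G0 [of \<xi>]] show ?thesis
        using G0 [of \<xi>] by (simp add: right_diff_distrib [symmetric] abs_mult)
    qed simp
  qed
  also have "\<dots> = \<bar>smoothed_frac A w\<bar> / 2" using G1 by simp
  finally have "PI z \<noteq> 0" using w by auto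
  then show ?thesis by blast
qed

end

subsection \<open>Dyadic blocks\<close>

definition block :: "real \<Rightarrow> int set" where
  "block L = {j. L < of_int j \<and> of_int j \<le> 2 * L}"

lemma finite_right_range: "finite (right_range T)"
proof -
  have "right_range T \<subseteq> {0..int T}"
  proof
    fix j assume "j \<in> right_range T"
    then have j: "sqrt (real T) \<le> of_int j" "of_int j \<le> real T" by (auto simp: right_range_def)
    have "0 \<le> sqrt (real T)" by simp
    then have "0 \<le> real_of_int j" using j by linarith
    moreover have "real_of_int j \<le> of_int (int T)" using j by simp
    ultimately show "j \<in> {0..int T}" unfolding of_int_le_iff by simp
  qed
  then show ?thesis by (rule finite_subset) simp
qed

text \<open>The disjoint blocks starting at 2 ^ i * sqrt T up to \<kappa> * T number about log 2
  (\<kappa> * sqrt T), a positive multiple of ln T for large T, and each carries at least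
  c2.\<close>

lemma dyadic_sum_lower:
  fixes w :: "nat \<Rightarrow> int \<Rightarrow> real"
  assumes w: "\<And>T j. j \<in> right_range T \<Longrightarrow> 0 \<le> w T j" and c2: "c2 > 0" and \<kappa>: "0 < \<kappa>" "\<kappa> \<le> 1 / 2"
    and blk: "\<And>T L. T \<ge> T0 \<Longrightarrow> L \<ge> L0 \<Longrightarrow> sqrt (real T) \<le> L \<Longrightarrow> L \<le> \<kappa> * real T \<Longrightarrow> c2 \<le> (\<Sum>j\<in>block L. w T j)"
  shows "\<exists>C>0. \<exists>T1. \<forall>T\<ge>T1. C * ln (real T) \<le> (\<Sum>j\<in>right_range T. w T j)"
proof -
  have "\<forall>\<^sub>F T::nat in sequentially. sqrt (real T) \<ge> L0" "\<forall>\<^sub>F T::nat in sequentially. \<kappa> * sqrt (real T) \<ge> 1"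
    "\<forall>\<^sub>F T::nat in sequentially. ln (real T) \<ge> - 4 * ln \<kappa>"
  proof -
    have "filterlim (\<lambda>T::nat. sqrt (real T)) at_top sequentially" by real_asymp
    then show "\<forall>\<^sub>F T::nat in sequentially. sqrt (real T) \<ge> L0" unfolding filterlim_at_top by blast
    have "filterlim (\<lambda>T::nat. \<kappa> * sqrt (real T)) at_top sequentially" using \<kappa> by real_asymp
    then show "\<forall>\<^sub>F T::nat in sequentially. \<kappa> * sqrt (real T) \<ge> 1" unfolding filterlim_at_top by blast
    have "filterlim (\<lambda>T::nat. ln (real T)) at_top sequentially" by real_asymp
    then show "\<forall>\<^sub>F T::nat in sequentially. ln (real T) \<ge> - 4 * ln \<kappa>" unfolding filterlim_at_top by blast
  qed
  then have "\<forall>\<^sub>F T in sequentially. T \<ge> T0 \<and> T \<ge> 1 \<and> sqrt (real T) \<ge> L0 \<and> \<kappa> * sqrt (real T) \<ge> 1 \<and> ln (real T) \<ge> - 4 * ln \<kappa>"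
    using eventually_ge_at_top [of T0] eventually_ge_at_top [of 1] by eventually_elim auto
  then obtain T1 where T1: "\<And>T. T \<ge> T1 \<Longrightarrow> T \<ge> T0 \<and> T \<ge> 1 \<and> sqrt (real T) \<ge> L0 \<and> \<kappa> * sqrt (real T) \<ge> 1 \<and> ln (real T) \<ge> - 4 * ln \<kappa>"
    unfolding eventually_sequentially by blast
  show ?thesis
  proof (intro exI [of _ "c2 / (4 * ln 2)"] conjI exI [of _ T1] allI impI)
    show "0 < c2 / (4 * ln 2)" using c2 by simp
    fix T assume "T1 \<le> T"
    note t = T1 [OF this]
    define s where "s = sqrt (real T)"
    have s: "s > 0" "s * s = real T" "\<kappa> * s \<ge> 1" "s \<ge> L0" using t by (auto simp: s_def)
    \<comment> \<open>The \<open>n\<close> >= x blocks used have 2 ^ i <= \<kappa> * sqrt T, so they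
      start no later than \<kappa> * T <= T / 2 and end before T.\<close>
    define x where "x = log 2 (\<kappa> * s)"
    have x0: "0 \<le> x" unfolding x_def using s by simp
    define n where "n = nat \<lfloor>x\<rfloor> + 1"
    define B where "B i = block (2 ^ i * s)" for i :: nat
    have pw: "2 ^ i \<le> \<kappa> * s" if "i < n" for i
    proof -
      have "real i \<le> x" using that x0 unfolding n_def by linarith
      then have "2 powr real i \<le> 2 powr x" by simp
      also have "2 powr x = \<kappa> * s" unfolding x_def using s by (simp add: powr_log_cancel)
      finally show ?thesis by (simp add: powr_realpow)
    qed
    have Bs: "B i \<subseteq> right_range T" if "i < n" for i
    proof
      fix j assume "j \<in> B i"
      then have j: "2 ^ i * s < of_int j" "of_int j \<le> 2 * (2 ^ i * s)" by (auto simp: B_def block_def)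
      have "1 * s \<le> 2 ^ i * s" using s by (intro mult_right_mono) auto
      moreover have "2 * (2 ^ i * s) \<le> 2 * (\<kappa> * s * s)" using pw [OF that] s by simp
      moreover have "2 * (\<kappa> * s * s) \<le> 1 * real T"
        unfolding s(2) [symmetric] mult.assoc [symmetric] using \<kappa> s by (intro mult_right_mono) auto
      ultimately have "s \<le> of_int j" "of_int j \<le> real T" using j by linarith+
      then show "j \<in> right_range T" by (simp add: right_range_def s_def)
    qed
    have "pairwise (\<lambda>i k. disjnt (B i) (B k)) {..<n}"
    proof -
      have dj: "disjnt (B i) (B k)" if "i < k" for i k
      proof -
        have "2 * 2 ^ i \<le> (2::real) ^ k" using that power_increasing [of "Suc i" k "2::real"] by simp
        then have "2 * (2 ^ i * s) \<le> 2 ^ k * s" using s by (simp add: mult.assoc [symmetric] mult_right_mono)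
        then show ?thesis by (auto simp: disjnt_def B_def block_def)
      qed
      show ?thesis unfolding pairwise_def using dj by (metis disjnt_sym linorder_neqE_nat)
    qed
    then have dj: "\<forall>i\<in>{..<n}. \<forall>k\<in>{..<n}. i \<noteq> k \<longrightarrow> B i \<inter> B k = {}" by (auto simp: pairwise_def disjnt_def)
    have fB: "finite (B i)" if "i < n" for i using finite_subset [OF Bs [OF that] finite_right_range] .
    have "x \<le> real n" using x0 unfolding n_def by linarith
    then have "c2 * x \<le> real n * c2" using c2 by (simp add: mult.commute)
    also have "\<dots> = (\<Sum>i<n. c2)" by simp
    also have "\<dots> \<le> (\<Sum>i<n. \<Sum>j\<in>B i. w T j)"
    proof (rule sum_mono)
      fix i assume "i \<in> {..<n}"
      then have i: "i < n" by simp
      have "1 * s \<le> 2 ^ i * s" using s by (intro mult_right_mono) auto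
      then have "L0 \<le> 2 ^ i * s" "sqrt (real T) \<le> 2 ^ i * s" using s(4) unfolding s_def [symmetric] by linarith+
      moreover have "2 ^ i * s \<le> \<kappa> * s * s" using pw [OF i] s by (intro mult_right_mono) auto
      then have "2 ^ i * s \<le> \<kappa> * real T" by (simp only: s(2) mult.assoc)
      ultimately
      show "c2 \<le> (\<Sum>j\<in>B i. w T j)" unfolding B_def using t by (intro blk) auto
    qed
    also have "\<dots> = (\<Sum>j\<in>(\<Union>i<n. B i). w T j)"
      by (rule sum.UNION_disjoint [symmetric]) (use fB dj in auto)
    also have "\<dots> \<le> (\<Sum>j\<in>right_range T. w T j)"
      by (rule sum_mono2) (use finite_right_range Bs w in auto)
    finally have 1: "c2 * x \<le> (\<Sum>j\<in>right_range T. w T j)" .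
    \<comment> \<open>Since ln T >= - 4 * ln \<kappa>, the loss ln \<kappa> uses up at most half of
      ln (sqrt T).\<close>
    have "ln s = ln (real T) / 2" using t by (simp add: s_def ln_sqrt)
    then have "ln (\<kappa> * s) \<ge> ln (real T) / 4" using \<kappa> s t by (simp add: ln_mult)
    then have "ln (real T) / 4 / ln 2 \<le> x" unfolding x_def log_def by (intro divide_right_mono) auto
    then have "c2 * (ln (real T) / 4 / ln 2) \<le> c2 * x" using c2 by (intro mult_left_mono) auto
    with 1 show "c2 / (4 * ln 2) * ln (real T) \<le> (\<Sum>j\<in>right_range T. w T j)" by simp
  qed
qed

lemma integral_tent_ge:
  assumes r: "0 < r" "r \<le> 1 / 2"
  shows "r / 4 \<le> integral {0..1} (tent r)"
proof -
  note i = integrable_Lipschitz [OF tent_Lipschitz [OF r(1)]]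
  have "r / 4 = integral {0..r / 2} (\<lambda>_::real. 1 / 2)" using r by simp
  also have "\<dots> \<le> integral {0..r / 2} (tent r)"
  proof (rule integral_le [OF integrable_const_ivl i])
    fix x assume x: "x \<in> {0..r / 2}"
    then have "frac x = x" using r by (simp add: frac_eq)
    then have "dist_int x \<le> x" by (simp add: dist_int_def)
    then have "dist_int x / r \<le> 1 / 2" using x r by (simp add: divide_le_eq)
    then have "1 / 2 \<le> 1 - dist_int x / r" by linarith
    then show "1 / 2 \<le> tent r x" unfolding tent_def by (rule max.coboundedI2)
  qed
  also have "\<dots> \<le> integral {0..1} (tent r)"
    by (rule integral_subset_le) (use r i tent_bounds in auto)
  finally show ?thesis .
qed

lemma sum_block_nat:
  fixes f :: "int \<Rightarrow> real"
  assumes "L \<ge> 0"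
  shows "(\<Sum>j\<in>block L. f j) = (\<Sum>m = nat \<lfloor>L\<rfloor> + 1..<nat \<lfloor>2 * L\<rfloor> + 1. f (int m))"
proof -
  have "block L = int ` {nat \<lfloor>L\<rfloor> + 1..<nat \<lfloor>2 * L\<rfloor> + 1}"
  proof (intro equalityI subsetI)
    fix j assume "j \<in> block L"
    then have j: "L < of_int j" "of_int j \<le> 2 * L" by (auto simp: block_def)
    have "\<lfloor>L\<rfloor> < j" using j(1) by (simp add: floor_less_iff)
    moreover have "j \<le> \<lfloor>2 * L\<rfloor>" using j(2) by (simp add: le_floor_iff)
    moreover have "0 \<le> \<lfloor>L\<rfloor>" using assms by simp
    ultimately have "nat \<lfloor>L\<rfloor> < nat j" "nat j \<le> nat \<lfloor>2 * L\<rfloor>" "j = int (nat j)" by linarith+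
    then have "nat j \<in> {nat \<lfloor>L\<rfloor> + 1..<nat \<lfloor>2 * L\<rfloor> + 1}" "j = int (nat j)" by auto
    then show "j \<in> int ` {nat \<lfloor>L\<rfloor> + 1..<nat \<lfloor>2 * L\<rfloor> + 1}" by blast
  next
    fix j assume "j \<in> int ` {nat \<lfloor>L\<rfloor> + 1..<nat \<lfloor>2 * L\<rfloor> + 1}"
    then have "\<lfloor>L\<rfloor> < j" "j \<le> \<lfloor>2 * L\<rfloor>" using assms by auto
    then show "j \<in> block L" by (simp add: block_def floor_less_iff le_floor_iff)
  qed
  then show ?thesis by (simp add: sum.reindex)
qed

context profile_data
begin

text \<open>Continuity keeps the absolute value above half of its value at z0 near z0, and
  periodicity near all integer translates. The tent makes this lower bound Lipschitz, as averaging
  requires.\<close>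

lemma PI_tent_minorant:
  assumes "PI z0 \<noteq> 0"
  obtains r where "0 < r" "r \<le> 1 / 2" "\<And>z. \<bar>PI z0\<bar> / 2 * tent r (z - z0) \<le> \<bar>PI z\<bar>"
proof -
  have "isCont PI z0" using PI_continuous by (simp add: continuous_on_eq_continuous_at)
  moreover have "0 < \<bar>PI z0\<bar> / 2" using assms by simp
  ultimately obtain d where d: "d > 0" "\<And>z. \<bar>z - z0\<bar> < d \<Longrightarrow> \<bar>PI z - PI z0\<bar> < \<bar>PI z0\<bar> / 2"
    unfolding continuous_at_eps_delta dist_real_def by blast
  define r where "r = min d (1 / 2)"
  show thesis
  proof (rule that [of r])
    show r: "0 < r" "r \<le> 1 / 2" using d by (auto simp: r_def)
    fix z
    show "\<bar>PI z0\<bar> / 2 * tent r (z - z0) \<le> \<bar>PI z\<bar>"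
    proof (cases "dist_int (z - z0) < r")
      case True
      obtain n where n: "dist_int (z - z0) = \<bar>z - z0 - of_int n\<bar>" using dist_int_attained by blast
      have "PI (z - of_int n) = PI z" using periodic_add_int [of PI "z" "- n", OF PI_periodic] by simp
      moreover have "\<bar>PI (z - of_int n) - PI z0\<bar> < \<bar>PI z0\<bar> / 2"
        by (rule d) (use True n in \<open>simp add: r_def algebra_simps\<close>)
      ultimately have "\<bar>PI z0\<bar> / 2 \<le> \<bar>PI z\<bar>" by linarith
      moreover have "\<bar>PI z0\<bar> / 2 * tent r (z - z0) \<le> \<bar>PI z0\<bar> / 2 * 1" using tent_bounds(2) [OF r(1)] by (intro mult_left_mono) auto
      ultimately show ?thesis by linarith
    next
      case False
      then have "tent r (z - z0) = 0" using r by (simp add: tent_def)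
      then show ?thesis by simp
    qed
  qed
qed

text \<open>The points \<open>z_pt\<close> are a slow phase a * sqrt j with no rational part, so the
  tent below the function is averaged by \<open>slow_phase_average\<close> with modulus 1. Its mean
  is positive, and the weights 1 / j of a block add up to at least 1 / 4.\<close>

lemma PI_block_lower:
  assumes "PI z0 \<noteq> 0"
  shows "\<exists>c2>0. \<exists>L0. \<forall>L\<ge>L0. c2 \<le> (\<Sum>j\<in>block L. \<bar>PI (z_pt lam0 q j)\<bar> / of_int j)"
proof -
  obtain r where r: "0 < r" "r \<le> 1 / 2" "\<And>z. \<bar>PI z0\<bar> / 2 * tent r (z - z0) \<le> \<bar>PI z\<bar>"
    using PI_tent_minorant [OF assms] by blast
  have bt: "beta lam0 > 0" using lam by (simp add: beta_def)
  define a where "a = 2 * real q / sqrt (beta lam0)"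
  have a: "a > 0" using q bt by (simp add: a_def)
  define I0 where "I0 = integral {0..1} (tent r)"
  have I0: "r / 4 \<le> I0" "I0 \<le> 1" using integral_tent_ge [OF r(1,2)] integral_tent_le [OF r(1,2)] r by (auto simp: I0_def)
  note lip = tent_Lipschitz [OF r(1)]
  \<comment> \<open>The constant of \<open>slow_phase_average\<close> for B = H = 1, Lipschitz
    constant 1 / r, modulus 1 and \<kappa> = 5.\<close>
  define C where "C = 1 * 1 / a * (4 * sqrt 5 + 2 * 5 * sqrt 5 + 5) + 5 * 1 * (1 / r) * a * real (1::nat) / 2"
  have C: "C \<ge> 0" using a r by (simp add: C_def)
  define c2 where "c2 = \<bar>PI z0\<bar> / 2 * (I0 / 8)"
  have "0 < c2" using assms I0 r by (simp add: c2_def)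
  \<comment> \<open>The threshold makes the averaging error C / sqrt L at most I0 / 8, half of the
    guaranteed main term I0 / 4.\<close>
  moreover have "c2 \<le> (\<Sum>j\<in>block L. \<bar>PI (z_pt lam0 q j)\<bar> / of_int j)" if "2 + (8 * C / I0)\<^sup>2 \<le> L" for L
  proof -
    from that have L: "L \<ge> 2" "(8 * C / I0)\<^sup>2 \<le> L" using zero_le_power2 [of "8 * C / I0"] by linarith+
    define M1 where "M1 = nat \<lfloor>L\<rfloor> + 1"
    define M2 where "M2 = nat \<lfloor>2 * L\<rfloor> + 1"
    have rM1: "real M1 = of_int \<lfloor>L\<rfloor> + 1" and rM2: "real M2 = of_int \<lfloor>2 * L\<rfloor> + 1" using L by (auto simp: M1_def M2_def)
    have M: "L \<le> real M1" "real M1 \<le> L + 1" "2 * L \<le> real M2" "real M2 \<le> 2 * L + 1" unfolding rM1 rM2 by linarith+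
    have M12: "M1 \<le> M2" unfolding M1_def M2_def using L by (intro add_right_mono nat_mono floor_mono) simp
    have avg: "\<bar>\<Sum>m = M1..<M2. 1 / real m * (tent r (of_int 0 / real 1 * real m + a * sqrt (real m) - z0) - I0)\<bar> \<le> C / sqrt L"
      unfolding C_def
    proof (rule slow_phase_average [where F = "\<lambda>x. tent r x - I0" and h = "\<lambda>m. 1 / real m"])
      show "(1 / r)-lipschitz_on UNIV (\<lambda>x. tent r x - I0)" using lip by (simp add: lipschitz_on_def dist_real_def)
      show "tent r (x + 1) - I0 = tent r x - I0" for x by (simp add: tent_periodic)
      show "integral {0..1} (\<lambda>x. tent r x - I0) = 0"
        by (subst Henstock_Kurzweil_Integration.integral_diff) (use integrable_Lipschitz [OF lip] in \<open>auto simp: I0_def\<close>)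
      show "\<bar>tent r x - I0\<bar> \<le> 1" for x using tent_bounds [OF r(1), of x] I0 r by auto
      show "\<bar>1 / real m\<bar> \<le> 1 / L" if "M1 \<le> m" "m \<le> M2" for m
      proof -
        have "L \<le> real m" by (rule order_trans [OF M(1)]) (use that(1) in simp)
        then show ?thesis using L by (simp add: frac_le)
      qed
      show "\<bar>1 / real (Suc m) - 1 / real m\<bar> \<le> 1 / L\<^sup>2" if "M1 \<le> m" "m < M2" for m
      proof -
        have m: "L \<le> real m" by (rule order_trans [OF M(1)]) (use that(1) in simp)
        have "1 / real (Suc m) - 1 / real m = - (1 / (real m * real (Suc m)))" using m L by (simp add: field_simps)
        moreover have "1 / (real m * real (Suc m)) \<le> 1 / L\<^sup>2"
          unfolding power2_eq_square using m L by (intro divide_left_mono mult_mono mult_pos_pos) auto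
        ultimately show ?thesis by simp
      qed
    qed (use a L M M12 in auto)
    have cnt: "1 / 4 \<le> (\<Sum>m = M1..<M2. 1 / real m)"
    proof -
      have "1 / 4 \<le> (L - 1) * (1 / (2 * L))" using L by (simp add: field_simps)
      also have "\<dots> \<le> real (M2 - M1) * (1 / (2 * L))" using M M12 L by (intro mult_right_mono) (auto simp: of_nat_diff)
      also have "\<dots> = (\<Sum>m = M1..<M2. 1 / (2 * L))" by simp
      also have "\<dots> \<le> (\<Sum>m = M1..<M2. 1 / real m)"
      proof (rule sum_mono)
        fix m assume "m \<in> {M1..<M2}"
        then have "real m + 1 \<le> real M2" "real M1 \<le> real m" by auto
        then have "real m \<le> 2 * L" "0 < real m" using M L by linarith+
        then show "1 / (2 * L) \<le> 1 / real m" by (intro divide_left_mono mult_pos_pos) auto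
      qed
      finally show ?thesis .
    qed
    have CL: "C / sqrt L \<le> I0 / 8"
    proof -
      have "8 * C / I0 \<le> sqrt L" using L(2) by (rule real_le_rsqrt)
      then have "8 * C \<le> sqrt L * I0" using I0 r by (simp add: pos_divide_le_eq)
      then show ?thesis using L by (simp add: pos_divide_le_eq mult.commute)
    qed
    have "(\<Sum>m = M1..<M2. 1 / real m * (tent r (of_int 0 / real 1 * real m + a * sqrt (real m) - z0) - I0))
      = (\<Sum>m = M1..<M2. 1 / real m * tent r (a * sqrt (real m) - z0)) - (\<Sum>m = M1..<M2. 1 / real m) * I0"
      by (simp add: right_diff_distrib sum_subtractf sum_distrib_right)
    moreover have "1 / 4 * I0 \<le> (\<Sum>m = M1..<M2. 1 / real m) * I0" using cnt I0 r by (intro mult_right_mono) auto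
    ultimately have tl: "I0 / 8 \<le> (\<Sum>m = M1..<M2. 1 / real m * tent r (a * sqrt (real m) - z0))"
      using avg CL by linarith
    have "c2 \<le> \<bar>PI z0\<bar> / 2 * (\<Sum>m = M1..<M2. 1 / real m * tent r (a * sqrt (real m) - z0))"
      unfolding c2_def using tl by (intro mult_left_mono) auto
    also have "\<dots> = (\<Sum>m = M1..<M2. 1 / real m * (\<bar>PI z0\<bar> / 2 * tent r (a * sqrt (real m) - z0)))"
      by (simp add: sum_distrib_left mult_ac)
    also have "\<dots> \<le> (\<Sum>m = M1..<M2. 1 / real m * \<bar>PI (a * sqrt (real m))\<bar>)"
      by (intro sum_mono mult_left_mono r) auto
    also have "\<dots> = (\<Sum>m = M1..<M2. \<bar>PI (z_pt lam0 q (int m))\<bar> / of_int (int m))"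
      by (simp add: z_pt_def a_def real_sqrt_divide)
    also have "\<dots> = (\<Sum>j\<in>block L. \<bar>PI (z_pt lam0 q j)\<bar> / of_int j)"
      unfolding M1_def M2_def by (rule sum_block_nat [symmetric]) (use L in simp)
    finally show ?thesis .
  qed
  ultimately show ?thesis by blast
qed

text \<open>The test function is bounded by 1 and lives on the block, so the variation there
  dominates the tested increments. These equal the integral of \<open>G\<close> times sums of unit
  jumps along level curves, which \<open>block_sum\<close> replaces by a multiple of the nonzero
  Fourier integral. The limits on L put the times of the block inside the range of the level
  expansion.\<close>

lemma tv_block_lower:
  fixes \<mu> :: real and p :: nat
  assumes mu: "0 < \<mu>" "\<mu> < 1" "\<mu> < lam0" and lam1: "lam0 < 1" "lam0 = real p / real q"
    and I: "open I" and ex: "level_expansion \<mu> lam0 I c"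
    and k: "k > 0" and nz: "(LBINT \<xi>. G \<xi> * sin (2 * pi * real (k * q) * ct \<xi> + \<theta>1)) \<noteq> 0"
  shows "\<exists>c3>0. \<exists>L0 T0. \<forall>T\<ge>T0. \<forall>L\<ge>L0. sqrt (real T) \<le> L \<and> L \<le> (lam0 - 1 / 2) / 4 * real T \<longrightarrow>
     c3 \<le> (\<Sum>j\<in>block L. \<bar>V_profile \<mu> lam0 T g (- j) - V_profile \<mu> lam0 T g (- j - 1)\<bar>)"
proof -
  obtain Cc where Cc: "Cc \<ge> 0" "\<And>\<xi>. \<bar>ct \<xi>\<bar> \<le> Cc" using ct_bounded by blast
  interpret bs: block_setup lam0 "int p" q k Cc
    by unfold_locales (use q k lam lam1 Cc in auto)
  \<comment> \<open>The walk advances the phase by al / sqrt bt; starting earlier by this amount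
    makes the block see \<theta>1.\<close>
  define \<theta> where "\<theta> = \<theta>1 - bs.al / sqrt bs.bt"
  have \<theta>: "\<theta> + bs.al / sqrt bs.bt = \<theta>1" by (simp add: \<theta>_def)
  define kq where "kq = 2 * pi * real (k * q)"
  have kq: "kq > 0" using k q by (simp add: kq_def)
  define D where "D = (LBINT \<xi>. G \<xi> * sin (kq * ct \<xi> + \<theta>1))"
  have D: "\<bar>D\<bar> > 0" using nz by (simp add: D_def kq_def)
  define NG where "NG = (LBINT \<xi>. \<bar>G \<xi>\<bar>)"
  have NG: "NG \<ge> 0" by (simp add: NG_def)
  obtain r0 where r0: "r0 > 0" "\<And>L. bs.L1 \<le> L \<Longrightarrow> r0 \<le> bs.total_amp L" using bs.total_amp_lower by blast
  define E where "E = r0 * \<bar>D\<bar> / kq"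
  have E: "E > 0" using r0 D kq by (simp add: E_def)
  obtain C where C: "\<And>\<delta>. 0 < \<delta> \<and> \<delta> \<le> 1 / 4 \<Longrightarrow> (\<exists>C'. \<forall>L\<ge>bs.L1. \<forall>\<theta> c Y N.
     \<bar>c\<bar> \<le> Cc \<and> bs.M2 L \<le> N \<and> (\<forall>m. bs.M1 L \<le> m \<and> m \<le> bs.M2 L \<longrightarrow> \<bar>Y m - bs.lpath c m\<bar> \<le> \<delta>)
       \<and> (\<forall>m m'. m \<le> m' \<and> m' \<le> N \<longrightarrow> lam0 * (real m' - real m) \<le> Y m' - Y m) \<longrightarrow>
     \<bar>(\<Sum>m\<le>N. bs.unit_jump L \<theta> m (Y m))
       - bs.total_amp L * sin (2 * pi * real (k * q) * c + (\<theta> + bs.al / sqrt bs.bt)) / (2 * pi * real (k * q))\<bar>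
     \<le> C * \<delta> + C' / sqrt L)" using bs.block_sum by blast
  \<comment> \<open>Small enough, in terms of \<open>C\<close> alone, that its error uses up at most
    E / 4; the constant \<open>C'\<close>, which depends on \<delta>, is beaten afterwards by large
    L.\<close>
  define \<delta> where "\<delta> = min (1 / 4) (E / (4 * ((\<bar>C\<bar> + 1) * (NG + 1))))"
  have "0 < (\<bar>C\<bar> + 1) * (NG + 1)" using NG by (intro mult_pos_pos) auto
  then have "0 < E / (4 * ((\<bar>C\<bar> + 1) * (NG + 1)))" using E by (intro divide_pos_pos) linarith+
  then have \<delta>: "0 < \<delta> \<and> \<delta> \<le> 1 / 4" unfolding \<delta>_def by (intro conjI min.cobounded1) simp
  have \<delta>E: "C * \<delta> * NG \<le> E / 4"
  proof -
    have "C * \<delta> * NG \<le> (\<bar>C\<bar> + 1) * \<delta> * (NG + 1)" using \<delta> NG by (intro mult_mono) auto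
    also have "\<dots> = ((\<bar>C\<bar> + 1) * (NG + 1)) * \<delta>" by simp
    also have "\<dots> \<le> ((\<bar>C\<bar> + 1) * (NG + 1)) * (E / (4 * ((\<bar>C\<bar> + 1) * (NG + 1))))"
      using NG by (intro mult_left_mono) (auto simp: \<delta>_def)
    also have "\<dots> = E / 4"
    proof -
      have "(\<bar>C\<bar> + 1) * (NG + 1) > 0" using NG by (intro mult_pos_pos) auto
      then have "(\<bar>C\<bar> + 1) * (NG + 1) \<noteq> 0" by linarith
      then show ?thesis by (metis nonzero_mult_div_cancel_left mult.commute times_divide_eq_right times_divide_eq_left divide_divide_eq_left)
    qed
    finally show ?thesis .
  qed
  obtain C' where C': "\<And>L \<theta> c Y N. bs.L1 \<le> L \<Longrightarrow>
     \<bar>c\<bar> \<le> Cc \<and> bs.M2 L \<le> N \<and> (\<forall>m. bs.M1 L \<le> m \<and> m \<le> bs.M2 L \<longrightarrow> \<bar>Y m - bs.lpath c m\<bar> \<le> \<delta>)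
       \<and> (\<forall>m m'. m \<le> m' \<and> m' \<le> N \<longrightarrow> lam0 * (real m' - real m) \<le> Y m' - Y m) \<Longrightarrow>
     \<bar>(\<Sum>m\<le>N. bs.unit_jump L \<theta> m (Y m))
       - bs.total_amp L * sin (2 * pi * real (k * q) * c + (\<theta> + bs.al / sqrt bs.bt)) / (2 * pi * real (k * q))\<bar>
     \<le> C * \<delta> + C' / sqrt L" using C [OF \<delta>] by blast
  \<comment> \<open>The parameters 1 / 2 and 1 / 4 allow times - t between 3 / 2 * sqrt T and 3 / 2
    * T, with an error decaying like (- t) powr (-1/4).\<close>
  have "\<exists>K T0. \<forall>T\<ge>T0. \<forall>a\<in>I. \<forall>t. - (2 - 1 / 2) * real T \<le> t \<and> t \<le> - (1 + 1 / 2) * sqrt (real T) \<longrightarrow>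
        \<bar>level_curve \<mu> lam0 T t a - (c a + shock_curve lam0 T t)\<bar> \<le> K * (- t) powr (- 1 / 2 + 1 / 4)"
    by (rule ex [unfolded level_expansion_def, rule_format, of "1 / 2" "1 / 4"]) simp
  then obtain K0 N0 where KN: "\<And>T a t. T \<ge> N0 \<Longrightarrow> a \<in> I \<Longrightarrow> - (2 - 1 / 2) * real T \<le> t \<Longrightarrow> t \<le> - (1 + 1 / 2) * sqrt (real T) \<Longrightarrow>
        \<bar>level_curve \<mu> lam0 T t a - (c a + shock_curve lam0 T t)\<bar> \<le> K0 * (- t) powr (- 1 / 2 + 1 / 4)"
    by blast
  have "((\<lambda>L::real. \<bar>K0\<bar> * L powr (- 1 / 4)) \<longlongrightarrow> 0) at_top" by real_asymp
  then have "\<forall>\<^sub>F L in at_top. \<bar>K0\<bar> * L powr (- 1 / 4) < \<delta>" using \<delta> by (intro order_tendstoD) auto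
  moreover have "((\<lambda>L::real. \<bar>C'\<bar> / sqrt L * NG) \<longlongrightarrow> 0) at_top" by real_asymp
  then have "\<forall>\<^sub>F L in at_top. \<bar>C'\<bar> / sqrt L * NG < E / 4" using E by (intro order_tendstoD) auto
  ultimately have "\<forall>\<^sub>F L in at_top. \<bar>K0\<bar> * L powr (- 1 / 4) < \<delta> \<and> \<bar>C'\<bar> / sqrt L * NG < E / 4 \<and> bs.L1 \<le> L"
    using eventually_ge_at_top [of bs.L1] by eventually_elim auto
  then obtain L0 where L0: "\<And>L. L \<ge> L0 \<Longrightarrow> \<bar>K0\<bar> * L powr (- 1 / 4) < \<delta> \<and> \<bar>C'\<bar> / sqrt L * NG < E / 4 \<and> bs.L1 \<le> L"
    unfolding eventually_at_top_linorder by blast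
  have "((\<lambda>T::nat. real T powr (- 1 / 4)) \<longlongrightarrow> 0) sequentially" by real_asymp
  then have "\<forall>\<^sub>F T::nat in sequentially. real T powr (- 1 / 4) < 1 - lam0" using lam1 by (intro order_tendstoD) auto
  then have "\<forall>\<^sub>F T in sequentially. T > 0 \<and> lam0 + real T powr (- 1 / 4) < 1 \<and> T \<ge> N0"
    using eventually_gt_at_top [of 0] eventually_ge_at_top [of N0] by eventually_elim auto
  then obtain T0 where T0: "\<And>T. T \<ge> T0 \<Longrightarrow> T > 0 \<and> lam0 + real T powr (- 1 / 4) < 1 \<and> T \<ge> N0"
    unfolding eventually_sequentially by blast
  have "E / 2 \<le> (\<Sum>j\<in>block L. \<bar>V_profile \<mu> lam0 T g (- j) - V_profile \<mu> lam0 T g (- j - 1)\<bar>)"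
    if "T0 \<le> T" "L0 \<le> L" and LT: "sqrt (real T) \<le> L \<and> L \<le> (lam0 - 1 / 2) / 4 * real T" for T L
  proof -
    note t = T0 [OF \<open>T0 \<le> T\<close>] and l = L0 [OF \<open>L0 \<le> L\<close>]
    note L = bs.L1 [OF conjunct2 [OF conjunct2 [OF l]]]
    note M = bs.M_bounds [OF L(1)]
    interpret lc: level_curves \<mu> lam0 T by unfold_locales (use mu t in auto)
    have IK: "I \<subseteq> {0<..<lc.kap}" by (rule level_expansion_range [OF mu(1,2) mu(3) lam1(1) I ex])
    have supp: "0 < \<xi> \<and> \<xi> < lc.kap" if "0 \<le> \<xi>" "deriv g \<xi> \<noteq> 0" for \<xi>
    proof -
      have "G \<xi> \<noteq> 0" using that by (simp add: G_def)
      from G_nonzero [OF this] show ?thesis using K(2) IK by auto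
    qed
    define f where "f = test0 L bs.al \<theta>"
    have f0: "f b = 0" if "b \<le> 0 \<or> 2 * L \<le> b" for b
      unfolding f_def using L that by (intro test_eq_0) auto
    define J where "J \<xi> = (\<Sum>m\<le>2 * T. adj_mean m f (of_int \<lfloor>- lc.X (- real m) \<xi>\<rfloor> + 1) - adj_mean m f (of_int \<lfloor>- lc.X (- real m) \<xi>\<rfloor>))" for \<xi>
    have J: "J \<xi> = (\<Sum>m\<le>2 * T. bs.unit_jump L \<theta> m (- lc.X (- real m) \<xi>))" for \<xi>
      by (simp add: J_def bs.unit_jump_def f_def)
    have R1: "2 * L \<ge> 1" using L by simp
    note ti = lc.tested_increments [where f = f and g = g and g' = "deriv g" and R = "2 * L", OF gD supp f0 R1, folded J_def]
    have GJ: "indicator {0..} \<xi> *\<^sub>R (deriv g \<xi> * J \<xi>) = G \<xi> * J \<xi>" for \<xi> by (simp add: G_def)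
    have GJi: "integrable lborel (\<lambda>\<xi>. G \<xi> * J \<xi>)" using ti(1) unfolding set_integrable_def GJ .
    have IJ: "(\<Sum>j\<in>{- \<lceil>2 * L\<rceil>..0}. f (- of_int j) * (V_profile \<mu> lam0 T g j - V_profile \<mu> lam0 T g (j - 1))) = (LBINT \<xi>. G \<xi> * J \<xi>)"
      using ti(2) unfolding set_lebesgue_integral_def GJ .
    define S where "S \<xi> = bs.total_amp L * sin (kq * ct \<xi> + \<theta>1) / kq" for \<xi>
    have Si: "integrable lborel (\<lambda>\<xi>. G \<xi> * sin (kq * ct \<xi> + \<theta>1))"
      by (rule Bochner_Integration.integrable_bound [OF G_integrable]) (auto simp: abs_mult mult_left_le)
    have GS: "G \<xi> * S \<xi> = (bs.total_amp L / kq) * (G \<xi> * sin (kq * ct \<xi> + \<theta>1))" for \<xi> by (simp add: S_def)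
    have GSi: "integrable lborel (\<lambda>\<xi>. G \<xi> * S \<xi>)" unfolding GS using Si by simp
    have IS: "(LBINT \<xi>. G \<xi> * S \<xi>) = bs.total_amp L / kq * D" unfolding GS D_def by simp
    have close: "\<bar>J \<xi> - S \<xi>\<bar> \<le> C * \<delta> + C' / sqrt L" if G0: "G \<xi> \<noteq> 0" for \<xi>
    proof -
      have xK: "\<xi> \<in> K" using G_nonzero [OF G0] by simp
      then have xI: "\<xi> \<in> I" and xp: "0 < \<xi>" "\<xi> < lc.kap" and cc: "ct \<xi> = c \<xi>" using K(2) IK by (auto simp: ct_def)
      have "\<bar>(\<Sum>m\<le>2 * T. bs.unit_jump L \<theta> m (- lc.X (- real m) \<xi>))
       - bs.total_amp L * sin (2 * pi * real (k * q) * ct \<xi> + (\<theta> + bs.al / sqrt bs.bt)) / (2 * pi * real (k * q))\<bar>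
         \<le> C * \<delta> + C' / sqrt L"
      proof (rule C')
        \<comment> \<open>The upper limit on L enters: the block ends before 3 / 4 * T, well inside
          the range of the expansion.\<close>
        have M2T: "real (bs.M2 L) \<le> 3 / 4 * real T"
        proof -
          have "3 * L / bs.bt \<le> 3 * (bs.bt / 4 * real T) / bs.bt"
            using LT bs.bt by (intro divide_right_mono mult_left_mono) (auto simp: bs.bt_def)
          then show ?thesis using M(6) bs.bt by simp
        qed
        have near: "\<bar>- lc.X (- real m) \<xi> - bs.lpath (ct \<xi>) m\<bar> \<le> \<delta>" if m: "bs.M1 L \<le> m" "m \<le> bs.M2 L" for m
        proof -
          have rm: "real (bs.M1 L) \<le> real m" "real m \<le> real (bs.M2 L)" using m by auto
          \<comment> \<open>As bt < 1 / 2, the block starts no earlier than 3 / 2 * L >= 3 / 2 *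
            sqrt T, where the range of the expansion begins.\<close>
          have "3 / 2 * L \<le> 3 * L / (4 * bs.bt)" using bs.bt L by (simp add: field_simps)
          then have m15: "3 / 2 * L \<le> real m" using M(1) rm by linarith
          have sT: "sqrt (real T) > 0" using t by simp
          have mT: "3 / 2 * sqrt (real T) \<le> real m" using m15 LT by linarith
          have "- (2 - 1 / 2) * real T \<le> - real m" using M2T rm by simp
          moreover have "- real m \<le> - (1 + 1 / 2) * sqrt (real T)" using mT by simp
          ultimately have "\<bar>lc.X (- real m) \<xi> - (c \<xi> + shock_curve lam0 T (- real m))\<bar> \<le> K0 * (- (- real m)) powr (- 1 / 2 + 1 / 4)"
            using t by (intro KN xI) auto
          also have "\<dots> \<le> \<bar>K0\<bar> * L powr (- 1 / 4)"
          proof (rule mult_mono)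
            have "real m powr (- 1 / 4) \<le> L powr (- 1 / 4)" using m15 L by (intro powr_mono2') auto
            then show "(- (- real m)) powr (- 1 / 2 + 1 / 4) \<le> L powr (- 1 / 4)" by simp
          qed auto
          also have "\<dots> \<le> \<delta>" using l by simp
          finally have e: "\<bar>lc.X (- real m) \<xi> - (c \<xi> + shock_curve lam0 T (- real m))\<bar> \<le> \<delta>" .
          have "- real m < - sqrt (real T)" using mT sT by linarith
          then have "shock_curve lam0 T (- real m) = - lam0 * real m - 2 * sqrt (real m)" by (simp add: shock_curve_def)
          then show ?thesis using e by (simp add: bs.lpath_def cc abs_minus_commute algebra_simps)
        qed
        \<comment> \<open>Advancing the level curve from time - m' to - m; reflecting the positions
          turns this into forward motion in m.\<close>
        have adv: "lam0 * (real m' - real m) \<le> - lc.X (- real m') \<xi> - - lc.X (- real m) \<xi>" if "m \<le> m'" for m m'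
          using lc.level_curve_advance [OF xp, of "real m' - real m" "- real m'"] that by (simp add: algebra_simps)
        have "bs.M2 L \<le> 2 * T"
        proof -
          have "real (bs.M2 L) \<le> real (2 * T)" using M2T by simp
          then show ?thesis unfolding of_nat_le_iff .
        qed
        then show "\<bar>ct \<xi>\<bar> \<le> Cc \<and> bs.M2 L \<le> 2 * T \<and> (\<forall>m. bs.M1 L \<le> m \<and> m \<le> bs.M2 L \<longrightarrow> \<bar>- lc.X (- real m) \<xi> - bs.lpath (ct \<xi>) m\<bar> \<le> \<delta>)
          \<and> (\<forall>m m'. m \<le> m' \<and> m' \<le> 2 * T \<longrightarrow> lam0 * (real m' - real m) \<le> - lc.X (- real m') \<xi> - - lc.X (- real m) \<xi>)"
          using Cc(2) near adv by blast
      qed (use l in simp)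
      then show ?thesis by (simp only: J S_def kq_def \<theta>)
    qed
    have "\<bar>(LBINT \<xi>. G \<xi> * J \<xi>) - (LBINT \<xi>. G \<xi> * S \<xi>)\<bar> = \<bar>LBINT \<xi>. G \<xi> * J \<xi> - G \<xi> * S \<xi>\<bar>"
      by (subst Bochner_Integration.integral_diff [OF GJi GSi]) simp
    also have "\<dots> \<le> (LBINT \<xi>. \<bar>G \<xi>\<bar> * (C * \<delta> + C' / sqrt L))"
    proof (rule order_trans [OF integral_abs_bound], rule integral_mono)
      show "integrable lborel (\<lambda>\<xi>. \<bar>G \<xi> * J \<xi> - G \<xi> * S \<xi>\<bar>)" using GJi GSi by simp
      show "integrable lborel (\<lambda>\<xi>. \<bar>G \<xi>\<bar> * (C * \<delta> + C' / sqrt L))" using G_integrable by simp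
      fix \<xi>
      show "\<bar>G \<xi> * J \<xi> - G \<xi> * S \<xi>\<bar> \<le> \<bar>G \<xi>\<bar> * (C * \<delta> + C' / sqrt L)"
      proof (cases "G \<xi> = 0")
        case False
        from mult_left_mono [OF close [OF False], of "\<bar>G \<xi>\<bar>"] show ?thesis
          by (simp add: right_diff_distrib [symmetric] abs_mult)
      qed simp
    qed
    also have "\<dots> = NG * (C * \<delta> + C' / sqrt L)" by (simp add: NG_def)
    also have "\<dots> \<le> E / 2"
    proof -
      have "C' / sqrt L * NG \<le> \<bar>C'\<bar> / sqrt L * NG" using NG L by (intro mult_right_mono divide_right_mono) auto
      then have "C' / sqrt L * NG \<le> E / 4" using l by linarith
      moreover have "NG * (C * \<delta> + C' / sqrt L) = C * \<delta> * NG + C' / sqrt L * NG" by (simp add: distrib_left mult_ac)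
      ultimately show ?thesis using \<delta>E by linarith
    qed
    finally have d: "\<bar>(LBINT \<xi>. G \<xi> * J \<xi>) - (LBINT \<xi>. G \<xi> * S \<xi>)\<bar> \<le> E / 2" .
    have "E \<le> \<bar>LBINT \<xi>. G \<xi> * S \<xi>\<bar>"
    proof -
      have "r0 * (\<bar>D\<bar> / kq) \<le> \<bar>bs.total_amp L\<bar> * (\<bar>D\<bar> / kq)" using r0(2) [of L] l kq by (intro mult_right_mono) auto
      then show ?thesis unfolding IS E_def using kq by (simp add: abs_mult)
    qed
    with d have "E / 2 \<le> \<bar>LBINT \<xi>. G \<xi> * J \<xi>\<bar>" by linarith
    also have "\<dots> \<le> (\<Sum>j\<in>{- \<lceil>2 * L\<rceil>..0}. \<bar>f (- of_int j) * (V_profile \<mu> lam0 T g j - V_profile \<mu> lam0 T g (j - 1))\<bar>)"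
      unfolding IJ [symmetric] by (rule sum_abs)
    also have "\<dots> \<le> (\<Sum>j\<in>{- \<lceil>2 * L\<rceil>..0}. if - j \<in> block L then \<bar>V_profile \<mu> lam0 T g j - V_profile \<mu> lam0 T g (j - 1)\<bar> else 0)"
    proof (rule sum_mono)
      fix j
      show "\<bar>f (- of_int j) * (V_profile \<mu> lam0 T g j - V_profile \<mu> lam0 T g (j - 1))\<bar>
          \<le> (if - j \<in> block L then \<bar>V_profile \<mu> lam0 T g j - V_profile \<mu> lam0 T g (j - 1)\<bar> else 0)"
      proof (cases "- j \<in> block L")
        case True
        have "\<bar>f (- of_int j)\<bar> \<le> 1" unfolding f_def using test_bounds(1) [OF L(1)] bs.al by simp
        then show ?thesis using True by (simp add: abs_mult mult_left_le_one_le)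
      next
        case False
        then have "- of_int j \<le> L \<or> 2 * L \<le> - of_int j" by (auto simp: block_def)
        then have "f (- of_int j) = 0" unfolding f_def using L by (intro test_eq_0) auto
        then show ?thesis using False by simp
      qed
    qed
    also have "\<dots> = (\<Sum>j\<in>{j \<in> {- \<lceil>2 * L\<rceil>..0}. - j \<in> block L}. \<bar>V_profile \<mu> lam0 T g j - V_profile \<mu> lam0 T g (j - 1)\<bar>)"
      by (rule sum.inter_filter [symmetric]) simp
    also have "\<dots> = (\<Sum>j\<in>block L. \<bar>V_profile \<mu> lam0 T g (- j) - V_profile \<mu> lam0 T g (- j - 1)\<bar>)"
    proof (rule sum.reindex_bij_witness [where i = uminus and j = uminus])
      fix j assume "j \<in> block L"
      then have j: "L < of_int j" "of_int j \<le> 2 * L" by (auto simp: block_def)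
      have "0 < real_of_int j" using j L by linarith
      moreover have "j \<le> \<lceil>2 * L\<rceil>" using j by (simp add: le_ceiling_iff)
      ultimately show "- j \<in> {j \<in> {- \<lceil>2 * L\<rceil>..0}. - j \<in> block L}" using \<open>j \<in> block L\<close> by simp
    qed auto
    finally show ?thesis .
  qed
  moreover have "0 < E / 2" using E by simp
  ultimately show ?thesis by blast
qed

end

section \<open>From dyadic blocks to the whole range, and the conclusions\<close>

lemma tot_var_left_range:
  "tot_var (left_range T) W = (\<Sum>j\<in>right_range T. \<bar>W (- j) - W (- j - 1)\<bar>)"
  unfolding tot_var_def
  by (rule sum.reindex_bij_witness [where i = uminus and j = uminus]) (auto simp: left_range_def right_range_def)

lemma harmonic_sum_le_ln: "n \<ge> 1 \<Longrightarrow> (\<Sum>j = 1..n. 1 / real j) \<le> 1 + ln (real n)"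
proof (induction n rule: nat_induct_at_least)
  case base
  show ?case by simp
next
  case (Suc n)
  have "ln (real n / real (Suc n)) \<le> real n / real (Suc n) - 1"
    using Suc.hyps by (intro ln_le_minus_one) auto
  moreover have "real n / real (Suc n) - 1 = - (1 / real (Suc n))" by (simp add: field_simps)
  moreover have "ln (real n / real (Suc n)) = ln (real n) - ln (real (Suc n))" using Suc.hyps by (simp add: ln_div)
  ultimately have "1 / real (Suc n) \<le> ln (real (Suc n)) - ln (real n)" by linarith
  then show ?case using Suc.IH by simp
qed

lemma sum_right_range_inverse:
  assumes "T \<ge> 1"
  shows "(\<Sum>j\<in>right_range T. 1 / real_of_int j) \<le> 1 + ln (real T)"
proof -
  have "right_range T \<subseteq> int ` {1..T}"
  proof
    fix j assume "j \<in> right_range T"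
    then have j: "sqrt (real T) \<le> of_int j" "of_int j \<le> real T" by (auto simp: right_range_def)
    have "1 \<le> sqrt (real T)" using assms by simp
    then have "1 \<le> j" "j \<le> int T" using j by linarith+
    then show "j \<in> int ` {1..T}" by (intro image_eqI [of _ _ "nat j"]) auto
  qed
  then have "(\<Sum>j\<in>right_range T. 1 / real_of_int j) \<le> (\<Sum>j\<in>int ` {1..T}. 1 / real_of_int j)"
    by (intro sum_mono2) auto
  also have "\<dots> = (\<Sum>j = 1..T. 1 / real j)" by (simp add: sum.reindex)
  also have "\<dots> \<le> 1 + ln (real T)" by (rule harmonic_sum_le_ln [OF assms])
  finally show ?thesis .
qed

context profile_data
begin

lemma PI_sum_lower:
  assumes "PI z0 \<noteq> 0"
  shows "\<exists>C>0. \<exists>T0. \<forall>T\<ge>T0. (\<Sum>j\<in>right_range T. \<bar>PI (z_pt lam0 q j)\<bar> / of_int j) \<ge> C * ln (real T)"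
proof -
  obtain c2 L0 where c2: "c2 > 0" "\<And>L. L \<ge> L0 \<Longrightarrow> c2 \<le> (\<Sum>j\<in>block L. \<bar>PI (z_pt lam0 q j)\<bar> / of_int j)"
    using PI_block_lower [OF assms] by blast
  show ?thesis
  proof (rule dyadic_sum_lower [where \<kappa> = "1 / 2" and ?T0.0 = 0 and ?L0.0 = L0 and ?c2.0 = c2])
    fix T j assume "j \<in> right_range T"
    then have "sqrt (real T) \<le> of_int j" by (simp add: right_range_def)
    moreover have "0 \<le> sqrt (real T)" by simp
    ultimately have "0 \<le> real_of_int j" by linarith
    then show "0 \<le> \<bar>PI (z_pt lam0 q j)\<bar> / real_of_int j" by (intro divide_nonneg_nonneg) auto
  qed (use c2 in auto)
qed

lemma tot_var_lower:
  fixes \<mu> :: real and p :: nat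
  assumes mu: "0 < \<mu>" "\<mu> < 1" "\<mu> < lam0" and lam1: "lam0 < 1" "lam0 = real p / real q"
    and I: "open I" and ex: "level_expansion \<mu> lam0 I c" and z0: "PI z0 \<noteq> 0"
  shows "\<exists>C>0. \<exists>T0. \<forall>T\<ge>T0. tot_var (left_range T) (V_profile \<mu> lam0 T g) \<ge> C * ln (real T)"
proof -
  obtain k \<theta> where k: "k > 0" "(LBINT \<xi>. G \<xi> * sin (2 * pi * real (k * q) * ct \<xi> + \<theta>)) \<noteq> 0"
    using nonzero_frequency [OF z0] by blast
  obtain c3 L0 T0 where c3: "c3 > 0" "\<And>T L. T \<ge> T0 \<Longrightarrow> L \<ge> L0 \<Longrightarrow> sqrt (real T) \<le> L \<and> L \<le> (lam0 - 1 / 2) / 4 * real T \<Longrightarrow>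
     c3 \<le> (\<Sum>j\<in>block L. \<bar>V_profile \<mu> lam0 T g (- j) - V_profile \<mu> lam0 T g (- j - 1)\<bar>)"
    using tv_block_lower [OF mu lam1 I ex k] by blast
  show ?thesis
    unfolding tot_var_left_range
    by (rule dyadic_sum_lower [where \<kappa> = "(lam0 - 1 / 2) / 4" and ?T0.0 = T0 and ?L0.0 = L0 and ?c2.0 = c3])
      (use c3 lam lam1(1) in auto)
qed

text \<open>Since \<open>Pi_fun\<close> is bounded, the sum in the comparison is \<open>O(ln T)\<close>, so that a lower
  bound by a multiple of \<open>ln T\<close> already gives the comparison.\<close>

lemma tot_var_comparison:
  assumes "\<exists>C>0. \<exists>T0. \<forall>T\<ge>T0. TV T \<ge> C * ln (real T)"
  shows "\<exists>C>0. \<exists>C0::real. \<exists>T0::nat. \<forall>T\<ge>T0. TV T \<ge> (\<Sum>j\<in>right_range T. C * \<bar>PI (z_pt lam0 q j)\<bar> / of_int j) - C0"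
proof -
  obtain C3 T0 where C3: "C3 > 0" "\<And>T. T \<ge> T0 \<Longrightarrow> TV T \<ge> C3 * ln (real T)" using assms by blast
  obtain B where B: "B \<ge> 0" "\<And>z. \<bar>PI z\<bar> \<le> B" using PI_bounded by blast
  define C where "C = C3 / (B + 1)"
  have C: "C > 0" using C3 B by (simp add: C_def)
  have "TV T \<ge> (\<Sum>j\<in>right_range T. C * \<bar>PI (z_pt lam0 q j)\<bar> / of_int j) - C3" if T: "T \<ge> max T0 1" for T
  proof -
    have CB: "C * \<bar>PI z\<bar> \<le> C3" for z
    proof -
      have "C * \<bar>PI z\<bar> \<le> C * (B + 1)" using B(2) [of z] C by (intro mult_left_mono) auto
      then show ?thesis using B by (simp add: C_def)
    qed
    have "(\<Sum>j\<in>right_range T. C * \<bar>PI (z_pt lam0 q j)\<bar> / of_int j) \<le> (\<Sum>j\<in>right_range T. C3 * (1 / of_int j))"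
    proof (rule sum_mono)
      fix j assume "j \<in> right_range T"
      then have "sqrt (real T) \<le> of_int j" by (simp add: right_range_def)
      moreover have "0 \<le> sqrt (real T)" by simp
      ultimately have "0 \<le> real_of_int j" by linarith
      then show "C * \<bar>PI (z_pt lam0 q j)\<bar> / of_int j \<le> C3 * (1 / of_int j)"
        using divide_right_mono [OF CB [of "z_pt lam0 q j"]] by simp
    qed
    also have "\<dots> = C3 * (\<Sum>j\<in>right_range T. 1 / of_int j)" by (simp add: sum_distrib_left)
    also have "\<dots> \<le> C3 * (1 + ln (real T))" using sum_right_range_inverse [of T] T C3 by (intro mult_left_mono) auto
    finally show ?thesis using C3(2) [of T] T by (simp add: distrib_left)
  qed
  then show ?thesis using C by blast
qed

end

lemma tot_var_unbounded:
  assumes "\<exists>C>0. \<exists>T0. \<forall>T\<ge>T0. tot_var (left_range T) (V_profile \<mu> lam0 T g) \<ge> C * ln (real T)"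
  shows "\<exists>T>0. (\<forall>j. v_sol \<mu> lam0 T g (- 2 * int T) j = 0) \<and> tot_var (left_range T) (V_profile \<mu> lam0 T g) > B"
proof -
  obtain C T0 where C: "C > 0" "\<And>T. T \<ge> T0 \<Longrightarrow> tot_var (left_range T) (V_profile \<mu> lam0 T g) \<ge> C * ln (real T)"
    using assms by blast
  have "filterlim (\<lambda>T::nat. C * ln (real T)) at_top sequentially" using C(1) by real_asymp
  then have "\<forall>\<^sub>F T in sequentially. B < C * ln (real T)" unfolding filterlim_at_top_dense by blast
  then have "\<forall>\<^sub>F T in sequentially. B < C * ln (real T) \<and> T \<ge> T0 \<and> T > 0"
    using eventually_ge_at_top [of T0] eventually_gt_at_top [of 0] by eventually_elim auto
  then obtain T where "B < C * ln (real T)" "T \<ge> T0" "T > 0"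
    unfolding eventually_sequentially by blast
  with C(2) [of T] show ?thesis by (intro exI [of _ T]) (auto simp: v_sol_def)
qed

lemma smooth_on_imp_continuous_on: "smooth_on S h \<Longrightarrow> continuous_on S h"
  unfolding smooth_on_def by (metis differentiable_imp_continuous_on funpow_0)

text \<open>Any level u0 in \<open>I\<close> works: w is chosen with a nonzero value of the smoothed
  function, and \<delta>0 keeps the mass inside \<open>I\<close> and the oscillation along q * c
  below half of that value.\<close>

lemma condition_A_of_approx_delta:
  fixes \<mu> lam0 :: real
  assumes mu: "1 / 2 < \<mu>" "\<mu> < 1" and lam: "\<mu> < lam0" "lam0 < 1" and q: "q > 0"
    and I: "open I" "u0 \<in> I" and c: "continuous_on I c" "level_expansion \<mu> lam0 I c"
  shows "\<exists>\<delta>0>0. \<forall>\<delta>. 0 < \<delta> \<and> \<delta> \<le> \<delta>0 \<longrightarrow>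
     (\<exists>g. smooth_compact_support g \<and> deriv_approx_delta u0 \<delta> g)
   \<and> (\<forall>g. smooth_compact_support g \<and> deriv_approx_delta u0 \<delta> g \<longrightarrow>
         condition_A lam0 q c g \<and> deriv_supported_in I g)"
proof -
  define r where "r = real q / (sqrt 2 * beta lam0)"
  have "beta lam0 > 0" using mu lam by (simp add: beta_def)
  then have r: "r > 0" using q by (simp add: r_def)
  obtain w where w: "smoothed_frac r w \<noteq> 0" using smoothed_frac_nonzero [OF r] by blast
  have Ipos: "I \<subseteq> {0<..<kappa0 \<mu> lam0}" using level_expansion_range [OF _ mu(2) lam I(1) c(2)] mu by simp
  define h where "h = (\<lambda>\<xi>. smoothed_frac r (real q * c \<xi> - real q * c u0 + w))"
  have "continuous_on I h"
    unfolding h_def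
    by (intro continuous_on_compose2 [OF smoothed_frac_continuous [OF r]] continuous_intros c) auto
  then have "isCont h u0" using I by (simp add: continuous_on_eq_continuous_at)
  moreover have "0 < \<bar>smoothed_frac r w\<bar> / 2" using w by simp
  ultimately obtain d1 where d1: "d1 > 0" "\<And>\<xi>. \<bar>\<xi> - u0\<bar> < d1 \<Longrightarrow> \<bar>h \<xi> - h u0\<bar> < \<bar>smoothed_frac r w\<bar> / 2"
    unfolding continuous_at_eps_delta dist_real_def by blast
  obtain d2 where d2: "d2 > 0" "cball u0 d2 \<subseteq> I" using I open_contains_cball by blast
  define \<delta>0 where "\<delta>0 = min d1 d2"
  have "(\<exists>g. smooth_compact_support g \<and> deriv_approx_delta u0 \<delta> g)
   \<and> (\<forall>g. smooth_compact_support g \<and> deriv_approx_delta u0 \<delta> g \<longrightarrow>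
         condition_A lam0 q c g \<and> deriv_supported_in I g)" if \<delta>: "0 < \<delta>" "\<delta> \<le> \<delta>0" for \<delta>
  proof (intro conjI allI impI)
    \<comment> \<open>The expansion forces \<open>I\<close> to consist of positive levels, so the
      step lies on the positive axis, as its construction requires.\<close>
    have "u0 - \<delta> \<in> cball u0 d2" using \<delta> by (simp add: \<delta>0_def dist_real_def)
    then have "u0 - \<delta> \<in> {0<..<kappa0 \<mu> lam0}" using d2(2) Ipos by (meson subsetD)
    then have "0 < u0 - \<delta>" by simp
    then show "\<exists>g. smooth_compact_support g \<and> deriv_approx_delta u0 \<delta> g"
      by (intro smooth_step_exists) (use \<delta> in auto)
    fix g assume g: "smooth_compact_support g \<and> deriv_approx_delta u0 \<delta> g"
    have "{\<xi>. 0 \<le> \<xi> \<and> deriv g \<xi> \<noteq> 0} \<subseteq> cball u0 \<delta>"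
      using g by (force simp: deriv_approx_delta_def dist_real_def)
    then have "closure {\<xi>. 0 \<le> \<xi> \<and> deriv g \<xi> \<noteq> 0} \<subseteq> cball u0 \<delta>" by (intro closure_minimal) auto
    also have "\<dots> \<subseteq> I" using d2 \<delta> by (auto simp: \<delta>0_def)
    finally show sup: "deriv_supported_in I g" by (simp add: deriv_supported_in_def)
    have gd: "deriv_approx_delta u0 \<delta> g" using g by simp
    interpret profile_data lam0 q c g I
      by unfold_locales (use mu lam q c g sup in auto)
    have AA: "A = r" by (simp add: A_def r_def)
    have "\<exists>z. PI z \<noteq> 0"
    proof (rule nonzero_of_approx_delta [where w = w], unfold AA)
      show "deriv_approx_delta u0 \<delta> g" by (rule gd)
      show "smoothed_frac r w \<noteq> 0" by (rule w)
      fix \<xi> assume "\<bar>\<xi> - u0\<bar> < \<delta>"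
      then have "\<bar>h \<xi> - h u0\<bar> < \<bar>smoothed_frac r w\<bar> / 2" using \<delta> by (intro d1) (simp add: \<delta>0_def)
      then show "\<bar>smoothed_frac r (real q * c \<xi> - real q * c u0 + w) - smoothed_frac r w\<bar> \<le> \<bar>smoothed_frac r w\<bar> / 2"
        by (simp add: h_def)
    qed
    then show "condition_A lam0 q c g" using g by (simp add: condition_A_def)
  qed
  moreover have "\<delta>0 > 0" using d1 d2 by (simp add: \<delta>0_def)
  ultimately show ?thesis by blast
qed

theorem mainTheorem1:
  fixes \<mu> lam0 :: real and p q :: nat and c :: "real \<Rightarrow> real" and I :: "real set"
  assumes mu: "1 / 2 < \<mu>" "\<mu> < 1"
    and lam0: "q > 0" "coprime p q" "lam0 = real p / real q" "\<mu> < lam0" "lam0 < 1"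
    and I: "open I" "is_interval I" "a0 \<mu> lam0 \<in> I"
    and c: "smooth_on I c" "level_expansion \<mu> lam0 I c"
  shows "(\<forall>g. condition_A lam0 q c g \<and> deriv_supported_in I g \<longrightarrow>
            (\<exists>C>0. \<exists>C0::real. \<exists>T0. \<forall>T\<ge>T0.
               tot_var (left_range T) (V_profile \<mu> lam0 T g)
                 \<ge> (\<Sum>j\<in>right_range T. C * \<bar>Pi_fun lam0 q c g (z_pt lam0 q j)\<bar> / of_int j) - C0)
          \<and> (\<exists>C>0. \<exists>T0. \<forall>T\<ge>T0.
               (\<Sum>j\<in>right_range T. \<bar>Pi_fun lam0 q c g (z_pt lam0 q j)\<bar> / of_int j)
                 \<ge> C * ln (real T))
          \<and> (\<exists>C>0. \<exists>T0. \<forall>T\<ge>T0.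
               tot_var (left_range T) (V_profile \<mu> lam0 T g) \<ge> C * ln (real T))
          \<and> (\<forall>B. \<exists>T>0. (\<forall>j. v_sol \<mu> lam0 T g (- 2 * int T) j = 0)
               \<and> tot_var (left_range T) (V_profile \<mu> lam0 T g) > B))
       \<and> (\<exists>\<eta>>0. \<forall>u0. \<bar>u0 - a0 \<mu> lam0\<bar> < \<eta> \<longrightarrow>
            (\<exists>\<delta>0>0. \<forall>\<delta>. 0 < \<delta> \<and> \<delta> \<le> \<delta>0 \<longrightarrow>
               (\<exists>g. smooth_compact_support g \<and> deriv_approx_delta u0 \<delta> g)
             \<and> (\<forall>g. smooth_compact_support g \<and> deriv_approx_delta u0 \<delta> g \<longrightarrow>
                   condition_A lam0 q c g \<and> deriv_supported_in I g)))"
proof (intro conjI allI impI)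
  note cont = smooth_on_imp_continuous_on [OF c(1)]
  fix g assume g: "condition_A lam0 q c g \<and> deriv_supported_in I g"
  then obtain z0 where z0: "Pi_fun lam0 q c g z0 \<noteq> 0" by (auto simp: condition_A_def)
  note expansion = c(2)
  have "1 / 2 < lam0" using mu lam0 by linarith
  then interpret profile_data lam0 q c g I
    by unfold_locales (use lam0(1) g cont in \<open>auto simp: condition_A_def\<close>)
  have TV: "\<exists>C>0. \<exists>T0. \<forall>T\<ge>T0. tot_var (left_range T) (V_profile \<mu> lam0 T g) \<ge> C * ln (real T)"
    by (rule tot_var_lower [OF _ mu(2) lam0(4,5,3) I(1) expansion z0]) (use mu in simp)
  then show "\<exists>C>0. \<exists>T0. \<forall>T\<ge>T0. tot_var (left_range T) (V_profile \<mu> lam0 T g) \<ge> C * ln (real T)" .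
  show "\<exists>C>0. \<exists>C0::real. \<exists>T0. \<forall>T\<ge>T0. tot_var (left_range T) (V_profile \<mu> lam0 T g)
      \<ge> (\<Sum>j\<in>right_range T. C * \<bar>Pi_fun lam0 q c g (z_pt lam0 q j)\<bar> / of_int j) - C0"
    by (rule tot_var_comparison [OF TV])
  show "\<exists>C>0. \<exists>T0. \<forall>T\<ge>T0. (\<Sum>j\<in>right_range T. \<bar>Pi_fun lam0 q c g (z_pt lam0 q j)\<bar> / of_int j) \<ge> C * ln (real T)"
    by (rule PI_sum_lower [OF z0])
  show "\<exists>T>0. (\<forall>j. v_sol \<mu> lam0 T g (- 2 * int T) j = 0) \<and> tot_var (left_range T) (V_profile \<mu> lam0 T g) > B" for B
    by (rule tot_var_unbounded [OF TV])
next
  obtain \<eta> where \<eta>: "\<eta> > 0" "ball (a0 \<mu> lam0) \<eta> \<subseteq> I" using I open_contains_ball by blast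
  show "\<exists>\<eta>>0. \<forall>u0. \<bar>u0 - a0 \<mu> lam0\<bar> < \<eta> \<longrightarrow>
            (\<exists>\<delta>0>0. \<forall>\<delta>. 0 < \<delta> \<and> \<delta> \<le> \<delta>0 \<longrightarrow>
               (\<exists>g. smooth_compact_support g \<and> deriv_approx_delta u0 \<delta> g)
             \<and> (\<forall>g. smooth_compact_support g \<and> deriv_approx_delta u0 \<delta> g \<longrightarrow>
                   condition_A lam0 q c g \<and> deriv_supported_in I g))"
  proof (rule exI [of _ \<eta>], intro conjI allI impI \<eta>(1))
    fix u0 assume "\<bar>u0 - a0 \<mu> lam0\<bar> < \<eta>"
    then have "u0 \<in> I" using \<eta>(2) by (auto simp: dist_real_def abs_minus_commute)
    then show "\<exists>\<delta>0>0. \<forall>\<delta>. 0 < \<delta> \<and> \<delta> \<le> \<delta>0 \<longrightarrow>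
               (\<exists>g. smooth_compact_support g \<and> deriv_approx_delta u0 \<delta> g)
             \<and> (\<forall>g. smooth_compact_support g \<and> deriv_approx_delta u0 \<delta> g \<longrightarrow>
                   condition_A lam0 q c g \<and> deriv_supported_in I g)"
      by (rule condition_A_of_approx_delta [OF mu lam0(4,5,1) I(1) _ smooth_on_imp_continuous_on [OF c(1)] c(2)])
  qed
qed

end
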